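(* Assume the Young tower setting described in the context. Let $q>0$. If $\varphi\in L^{q+1}(Y)$, then $\sum_{n=1}^\infty n^{q-1}|\rho_{v,w}(n)|<\infty$ for all $v\in\mathcal{B}(X)$, $w\in L^\infty(X)$.
   Context: Setting. $T:X\to X$ is a measurable transformation, $Y\subset X$ is measurable, $\varphi:Y\to\mathbb{Z}^+$ is a measurable return time (not necessarily the first return) with $F(y)=T^{\varphi(y)}(y)\in Y$ for $y\in Y$, and $\mu$ is an ergodic $F$-invariant probability measure on $Y$. It is assumed that $\varphi\in L^1(Y)=L^1(Y,\mu)$; put $\bar\varphi=\int_Y\varphi\,d\mu$. The tower is $\Delta=\{(y,\ell)\in Y\times\mathbb{Z}:0\le\ell\le\varphi(y)-1\}$ with map $f(y,\ell)=(y,\ell+1)$ for $\ell\le\varphi(y)-2$ and $f(y,\varphi(y)-1)=(Fy,0)$, and $f$-invariant probability measure $\mu_\Delta=(\mu\times\text{counting})/\bar\varphi$. The map $\pi:\Delta\to X$, $\pi(y,\ell)=T^\ell y$, is a semiconjugacy and $\mu_X=\pi_*\mu_\Delta$ is a $T$-invariant probability measure; $L^\infty(X)=L^\infty(X,\mu_X)$. The correlation function is $\rho_{v,w}(n)=\int_X v\,w\circ T^n\,d\mu_X-\int_X v\,d\mu_X\int_X w\,d\mu_X$. Young tower assumptions. There is an at most countable measurable partition $\alpha$ of $Y$ (mod null sets, elements of positive measure) such that $\varphi$ is constant on each $a\in\alpha$ and $F$ is Gibbs-Markov: (1) for each $a\in\alpha$, $F|_a$ is a bijection (mod null sets, bimeasurable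 and nonsingular) onto a union of elements of $\alpha$, and $\inf_{a\in\alpha}\mu(Fa)>0$; (2) the separation time $s(y,y')$, the least $n\ge0$ such that $F^ny,F^ny'$ lie in distinct elements of $\alpha$, is finite for $y\ne y'$; (3) for some $\theta\in(0,1)$, with $d_\theta(y,y')=\theta^{s(y,y')}$, the function $g=d\mu/d(\mu\circ F)$ satisfies $|\log g(y)-\log g(y')|\le C_0\,d_\theta(Fy,Fy')$ for all $y,y'\in a$, $a\in\alpha$. Function spaces. $\mathcal{B}(Y)$ is the space of (piecewise Hölder) functions $v:Y\to\mathbb{R}$ (complexified when needed) which are bounded and Lipschitz with respect to $d_\theta$, with norm the sum of sup norm and Lipschitz constant. $\mathcal{B}(X)$ is the space of piecewise Hölder observables $v:X\to\mathbb{R}$ with $$\|v\|=\sup_{a\in\alpha}\ \sup_{0\le\ell<\varphi(a)}\Bigl\{\sup_{y\in a}|v(T^\ell y)|+\sup_{y\neq y'\in a}\frac{|v(T^\ell y)-v(T^\ell y')|}{d_\theta(y,y')}\Bigr\}<\infty.$$ Aperiodicity. Let $R:L^1(Y)\to L^1(Y)$ be the transfer operator of $F$ ($\int_Y Rv\,w\,d\mu=\int_Y v\,w\circ F\,d\mu$), $R_nv=R(1_{\{\varphi=n\}}v)$, and $R(z)=\sum_{n\ge1}R_nz^n$ on $\mathcal{B}(Y)$ for $z\in\mathbb{C}$, $|z|\le1$. It is assumed that for every $z$ with $|z|\le 1$, $z\ne1$, the spectrum of $R(z):\mathcal{B}(Y)\to\mathcal{B}(Y)$ does not contain $1$. *)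

theory Defs
  imports "HOL-Probability.Probability"
begin

definition Linf :: "'a measure \<Rightarrow> ('a \<Rightarrow> 'b::{banach, second_countable_topology}) set" where
  "Linf N = {w \<in> borel_measurable N. \<exists>C::real. AE x in N. norm (w x) \<le> C}"

text \<open>
  \<open>X\<close> is used only as a measurable space (its measure plays no role). The set \<open>Y\<close> is
  \<open>space M\<close>, and \<open>M\<close> carries the measure \<open>\<mu>\<close> on it.
\<close>

locale tower_data =
  fixes X :: "'x measure" and T :: "'x \<Rightarrow> 'x"
    and M :: "'x measure" and \<phi> :: "'x \<Rightarrow> nat"
    and \<alpha> :: "'x set set" and \<theta> :: real
begin

definition F :: "'x \<Rightarrow> 'x" where
  "F y = (T ^^ \<phi> y) y"

definition tower :: "('x \<times> nat) set" where
  "tower = {(y, l). y \<in> space M \<and> l < \<phi> y}"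

definition mu_tower :: "('x \<times> nat) measure" where
  "mu_tower = scale_measure (ennreal (1 / (\<integral>y. real (\<phi> y) \<partial>M)))
     (restrict_space (M \<Otimes>\<^sub>M count_space UNIV) tower)"

definition proj :: "'x \<times> nat \<Rightarrow> 'x" where
  "proj p = (T ^^ snd p) (fst p)"

definition mu_X :: "'x measure" where
  "mu_X = distr mu_tower X proj"

definition correlation :: "('x \<Rightarrow> real) \<Rightarrow> ('x \<Rightarrow> real) \<Rightarrow> nat \<Rightarrow> real" where
  "correlation v w n =
     (\<integral>x. v x * w ((T ^^ n) x) \<partial>mu_X) - (\<integral>x. v x \<partial>mu_X) * (\<integral>x. w x \<partial>mu_X)"

text \<open>
  Since \<open>\<alpha>\<close> is a partition only modulo null sets, the itinerary of a point, and with it the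
  separation time, is meaningful only on the following set of full measure (which is all of
  \<open>Y\<close> if \<open>\<alpha>\<close> is a genuine partition). Pointwise conditions are imposed on this set.
\<close>

definition core :: "'x set" where
  "core = {y \<in> space M. \<forall>n. \<exists>!a. a \<in> \<alpha> \<and> (F ^^ n) y \<in> a}"

definition sep :: "'x \<Rightarrow> 'x \<Rightarrow> enat" where
  "sep y y' = (INF n \<in> {n. \<exists>a\<in>\<alpha>. \<exists>b\<in>\<alpha>. a \<noteq> b \<and> (F ^^ n) y \<in> a \<and> (F ^^ n) y' \<in> b}. enat n)"

definition dtheta :: "'x \<Rightarrow> 'x \<Rightarrow> real" where
  "dtheta y y' = (case sep y y' of enat n \<Rightarrow> \<theta> ^ n | \<infinity> \<Rightarrow> 0)"

definition lip_norm :: "'x set \<Rightarrow> ('x \<Rightarrow> 'b::real_normed_vector) \<Rightarrow> ennreal" where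
  "lip_norm A v = (SUP y\<in>A. ennreal (norm (v y))) +
     (SUP (y, y') \<in> {(y, y'). y \<in> A \<and> y' \<in> A \<and> y \<noteq> y'}. ennreal (norm (v y - v y') / dtheta y y'))"

definition BY :: "('x \<Rightarrow> complex) set" where
  "BY = {v \<in> borel_measurable M. lip_norm core v < \<infinity>}"

text \<open>The range of \<open>l\<close> below is \<open>0 \<le> l < \<phi>(a)\<close>, as \<open>\<phi>\<close> is constant on the nonempty set \<open>a\<close>.\<close>

definition norm_BX :: "('x \<Rightarrow> real) \<Rightarrow> ennreal" where
  "norm_BX v = (SUP a\<in>\<alpha>. SUP l\<in>{l. \<forall>y\<in>a. l < \<phi> y}. lip_norm (a \<inter> core) (\<lambda>y. v ((T ^^ l) y)))"

definition BX :: "('x \<Rightarrow> real) set" where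
  "BX = {v \<in> borel_measurable X. norm_BX v < \<infinity>}"

text \<open>
  \<open>R v\<close> is a representative of a class in \<open>L\<^sup>1\<close>; it is determined up to null sets. The series
  defining \<open>R(z) v\<close> converges absolutely almost everywhere for integrable \<open>v\<close> and
  \<open>|z| \<le> 1\<close>, so \<open>R(z) v\<close> too is determined up to null sets.
\<close>

definition R :: "('x \<Rightarrow> complex) \<Rightarrow> 'x \<Rightarrow> complex" where
  "R v = (SOME u. integrable M u \<and>
     (\<forall>w\<in>Linf M. (\<integral>y. u y * w y \<partial>M) = (\<integral>y. v y * w (F y) \<partial>M)))"

definition Rn :: "nat \<Rightarrow> ('x \<Rightarrow> complex) \<Rightarrow> 'x \<Rightarrow> complex" where
  "Rn n v = R (\<lambda>y. indicator {y. \<phi> y = n} y * v y)"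

definition Rz :: "complex \<Rightarrow> ('x \<Rightarrow> complex) \<Rightarrow> 'x \<Rightarrow> complex" where
  "Rz z v y = (\<Sum>n. z ^ Suc n * Rn (Suc n) v y)"

text \<open>
  Spectrum of an operator on \<open>BY\<close>, whose elements are identified when equal almost everywhere
  (with the quotient norm): the complement of the set of \<open>c\<close> such that \<open>c - A\<close> is
  injective, and surjective with bounded inverse.
\<close>

definition spectrum_BY :: "(('x \<Rightarrow> complex) \<Rightarrow> 'x \<Rightarrow> complex) \<Rightarrow> complex set" where
  "spectrum_BY A = - {c.
     (\<forall>v\<in>BY. (AE y in M. c * v y - A v y = 0) \<longrightarrow> (AE y in M. v y = 0)) \<and>
     (\<exists>K::real. \<forall>u\<in>BY. \<exists>v\<in>BY. (AE y in M. c * v y - A v y = u y) \<and>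
        lip_norm core v \<le> ennreal K * lip_norm core u)}"

definition partition_mod_null :: bool where
  "partition_mod_null \<longleftrightarrow>
     countable \<alpha> \<and> \<alpha> \<subseteq> sets M \<and> (\<forall>a\<in>\<alpha>. 0 < emeasure M a) \<and>
     (\<forall>a\<in>\<alpha>. \<forall>b\<in>\<alpha>. a \<noteq> b \<longrightarrow> a \<inter> b \<in> null_sets M) \<and>
     space M - \<Union>\<alpha> \<in> null_sets M"

text \<open>
  In the next three definitions \<open>N\<close> is the null set off which \<open>F\<close> is injective and bimeasurable
  on every \<open>a \<in> \<alpha>\<close>. The measure \<open>\<mu> \<circ> F\<close> is \<open>A \<mapsto> \<Sum>\<^sub>a \<mu>(F(A \<inter> a))\<close>.
\<close>

definition markov :: "'x set \<Rightarrow> bool" where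
  "markov N \<longleftrightarrow>
     (\<forall>a\<in>\<alpha>. inj_on F (a - N) \<and>
        (\<forall>A\<in>sets M. A \<subseteq> a - N \<longrightarrow>
           F ` A \<in> sets M \<and> (emeasure M (F ` A) = 0 \<longleftrightarrow> emeasure M A = 0)) \<and>
        (\<exists>\<beta>\<subseteq>\<alpha>. (F ` (a - N) - \<Union>\<beta>) \<union> (\<Union>\<beta> - F ` (a - N)) \<in> null_sets M)) \<and>
     0 < (INF a\<in>\<alpha>. emeasure M (F ` (a - N)))"

definition mu_F :: "'x set \<Rightarrow> 'x measure" where
  "mu_F N = measure_of (space M) (sets M)
     (\<lambda>A. \<integral>\<^sup>+a. emeasure M (F ` (A \<inter> a - N)) \<partial>count_space \<alpha>)"

definition bounded_distortion :: "'x set \<Rightarrow> bool" where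
  "bounded_distortion N \<longleftrightarrow>
     (\<exists>(g :: 'x \<Rightarrow> real) (C\<^sub>0 :: real).
        g \<in> borel_measurable M \<and> (\<forall>y\<in>space M. 0 < g y) \<and>
        density (mu_F N) (\<lambda>y. ennreal (g y)) = M \<and>
        (\<forall>a\<in>\<alpha>. \<forall>y\<in>a \<inter> core. \<forall>y'\<in>a \<inter> core.
           \<bar>ln (g y) - ln (g y')\<bar> \<le> C\<^sub>0 * dtheta (F y) (F y')))"

definition gibbs_markov :: bool where
  "gibbs_markov \<longleftrightarrow>
     partition_mod_null \<and>
     (\<forall>y\<in>core. \<forall>y'\<in>core. y \<noteq> y' \<longrightarrow> sep y y' < \<infinity>) \<and>
     (\<exists>N\<in>null_sets M. markov N \<and> bounded_distortion N)"

end

locale young_tower = tower_data X T M \<phi> \<alpha> \<theta>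
  for X :: "'x measure" and T M \<phi> \<alpha> \<theta> +
  assumes T_measurable: "T \<in> measurable X X"
    and Y_measurable: "space M \<in> sets X"
    and sets_M: "sets M = sets (restrict_space X (space M))"
    and prob_M: "prob_space M"
    and phi_measurable: "\<phi> \<in> measurable M (count_space UNIV)"
    and phi_pos: "\<And>y. y \<in> space M \<Longrightarrow> 0 < \<phi> y"
    and F_maps_to: "\<And>y. y \<in> space M \<Longrightarrow> F y \<in> space M"
    and F_invariant: "distr M M F = M"
    and F_ergodic: "\<And>A. A \<in> sets M \<Longrightarrow> F -` A \<inter> space M = A \<Longrightarrow>
      emeasure M A = 0 \<or> emeasure M A = 1"
    and phi_integrable: "integrable M (\<lambda>y. real (\<phi> y))"
    and theta: "0 < \<theta>" "\<theta> < 1"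
    and phi_constant: "\<And>a y y'. a \<in> \<alpha> \<Longrightarrow> y \<in> a \<Longrightarrow> y' \<in> a \<Longrightarrow> \<phi> y = \<phi> y'"
    and gibbs_markov: gibbs_markov
    and aperiodic: "\<And>z. norm z \<le> 1 \<Longrightarrow> z \<noteq> 1 \<Longrightarrow> 1 \<notin> spectrum_BY (Rz z)"

end

theory Submission
  imports Defs "HOL-Computational_Algebra.Formal_Power_Series" "HOL-Complex_Analysis.Great_Picard"
begin

text \<open>
The correlations of a tower are governed by the renewal operators of the induced map. On the base,
let \<open>R\<close> be the transfer operator of \<open>F\<close>, let \<open>R\<^sub>n\<close> be its restriction to \<open>{\<phi> = n}\<close>, and define
\<open>T\<^sub>n\<close> by the formal identity \<open>\<Sum> T\<^sub>n z\<^sup>n = (1 - \<Sum> R\<^sub>n z\<^sup>n)\<^sup>-\<^sup>1\<close>; thus \<open>T\<^sub>n\<close> transports densities along orbits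
that are back in the base at time \<open>n\<close>. Splitting an orbit segment of length \<open>n\<close> on the tower at its first
and last visit to the base expresses \<open>\<integral> v w \<circ> T\<^sup>n\<close> as a convolution of three sequences: \<open>v\<close> seen \<open>k\<close> steps
before the first visit, the operators \<open>T\<^sub>n\<close>, and \<open>w\<close> seen \<open>i\<close> steps after the last visit. Orbit segments
that do not return to the base contribute at most a tail sum of \<open>\<phi>\<close>. As \<open>\<phi> \<in> L\<^sup>q\<^sup>+\<^sup>1\<close>, the outer sequences are summable with weight \<open>n\<^sup>q\<close>, and the theorem follows
once \<open>T\<^sub>n - P / \<phi>bar\<close> is summable with weight \<open>n\<^sup>q\<^sup>-\<^sup>1\<close>, where \<open>P\<close> is integration against
\<open>\<mu>\<close> (\<open>wfin_SS\<close>, \<open>return_correlation_decay\<close>, \<open>correlation_decay\<close>).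

For this last fact the pole of \<open>\<Sum> T\<^sub>n z\<^sup>n\<close> at \<open>z = 1\<close> is divided out: with
\<open>E(z) = (1 - P) + P / (1 - z)\<close> the series \<open>A(z) = (1 - R(z)) E(z)\<close> has coefficients summable with
weight \<open>n\<^sup>q\<close>, because \<open>(1 - R(z)) P / (1 - z)\<close> has the tails \<open>\<Sum>\<^bsub>k > n\<^esub> R\<^sub>k P\<close> as coefficients. It is invertible on the whole closed disc:
away from \<open>1\<close> by aperiodicity, at \<open>1\<close> because \<open>F\<close> is ergodic and \<open>P A(1) = \<phi>bar P\<close>. A Wiener lemma for
power series with operator coefficients and weight \<open>n\<^sup>q\<close> (\<open>weighted_wiener\<close>) then makes \<open>A\<^sup>-\<^sup>1\<close>
summable with the same weight (\<open>wfin_BB\<close>), and \<open>T = E A\<^sup>-\<^sup>1\<close>, so that the \<open>n\<close>-th coefficient of \<open>P T\<close> is the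
\<open>n\<close>-th partial sum of \<open>P A\<^sup>-\<^sup>1\<close>. Passing from a sequence to its tails costs one power of \<open>n\<close>.

The Wiener lemma only needs bounds and no spectral theory: a Neumann-type series for \<open>A\<^sup>-\<^sup>1\<close> around
the contracted series \<open>A\<^sup>-\<^sup>1(r z)\<close> has an error term that is small on the unit circle, and a high power of
such a series is small in the weighted norm. Accordingly all information about the operators is used in
the form of a bound from below, \<open>\<parallel>u\<parallel> \<le> C \<parallel>A(z) u\<parallel>\<close>, uniform in \<open>\<bar>z\<bar> \<le> 1\<close> by compactness.

The dynamical part is carried out for maps whose Markov, distortion and metric properties hold at every
point of an invariant set \<open>D\<close> of full measure (\<open>gibbs_markov_map\<close>). A Young tower provides such a set
after removal of a saturated null set. Transfer operators are then defined pointwise, and two Lipschitz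
functions that agree almost everywhere agree on \<open>D\<close>.
\<close>

section \<open>Power series with weighted coefficients\<close>

definition wt :: "real \<Rightarrow> nat \<Rightarrow> real" where
  "wt s n = real (Suc n) powr s"

lemma wt_pos [simp]: "0 < wt s n" and wt_nonneg [simp]: "0 \<le> wt s n"
  by (auto simp: wt_def)

lemma wt_zero_left [simp]: "wt 0 n = 1"
  by (simp add: wt_def)

lemma wt_ge_1: "0 \<le> s \<Longrightarrow> 1 \<le> wt s n"
  by (simp add: wt_def ge_one_powr_ge_zero)

lemma wt_mono: "0 \<le> s \<Longrightarrow> m \<le> n \<Longrightarrow> wt s m \<le> wt s n"
  by (simp add: wt_def powr_mono2)

lemma wt_mono_exponent: "s \<le> t \<Longrightarrow> wt s n \<le> wt t n"
  by (simp add: wt_def powr_mono)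

lemma wt_submult: "0 \<le> s \<Longrightarrow> wt s (i + j) \<le> wt s i * wt s j"
proof -
  assume s: "0 \<le> s"
  have "real (Suc (i + j)) \<le> real (Suc i) * real (Suc j)"
    by (simp add: algebra_simps)
  then show ?thesis
    unfolding wt_def using s by (subst powr_mult [symmetric]) (auto intro!: powr_mono2)
qed

text \<open>
This bound, which is additive in the weights where \<open>wt_submult\<close> is multiplicative, is what makes large
powers manageable: it leads to an estimate of a weighted norm of a product in which one factor is only
measured without weight.
\<close>

lemma wt_subadd:
  assumes s: "0 \<le> s"
  shows "wt s (i + j) \<le> 2 powr s * (wt s i + wt s j)"
proof -
  have "wt s (i + j) \<le> (2 * real (Suc (max i j))) powr s"
    unfolding wt_def using s by (intro powr_mono2) auto
  also have "\<dots> = 2 powr s * wt s (max i j)"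
    unfolding wt_def by (subst powr_mult) auto
  also have "\<dots> \<le> 2 powr s * (wt s i + wt s j)"
    by (intro mult_left_mono) (auto simp: max_def)
  finally show ?thesis .
qed

text \<open>
The triangle \<open>i + j < N\<close> is contained in the square \<open>i, j < N\<close>. Working with partial sums throughout
avoids any summability hypothesis in the product estimates below.
\<close>

lemma sum_convolution_le:
  fixes x y :: "nat \<Rightarrow> real"
  assumes "\<And>i. 0 \<le> x i" "\<And>i. 0 \<le> y i"
  shows "(\<Sum>n<N. \<Sum>i\<le>n. x i * y (n - i)) \<le> (\<Sum>i<N. x i) * (\<Sum>j<N. y j)"
proof -
  have "(\<Sum>n<N. \<Sum>i\<le>n. x i * y (n - i)) = (\<Sum>(n,i)\<in>Sigma {..<N} (\<lambda>n. {..n}). x i * y (n - i))"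
    by (subst sum.Sigma) auto
  also have "\<dots> = (\<Sum>(i,j)\<in>{(i,j). i + j < N}. x i * y j)"
    by (rule sum.reindex_bij_witness[of _ "\<lambda>(i,j). (i + j, i)" "\<lambda>(n,i). (i, n - i)"]) auto
  also have "\<dots> \<le> (\<Sum>(i,j)\<in>{..<N} \<times> {..<N}. x i * y j)"
    using assms by (intro sum_mono2) (auto intro!: mult_nonneg_nonneg)
  also have "\<dots> = (\<Sum>i<N. x i) * (\<Sum>j<N. y j)"
    by (simp add: sum_product sum.cartesian_product)
  finally show ?thesis .
qed

definition wsum :: "real \<Rightarrow> 'b::{real_normed_algebra_1} fps \<Rightarrow> nat \<Rightarrow> real" where
  "wsum s f N = (\<Sum>n<N. wt s n * norm (fps_nth f n))"

definition wfin :: "real \<Rightarrow> 'b::{real_normed_algebra_1} fps \<Rightarrow> bool" where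
  "wfin s f \<longleftrightarrow> summable (\<lambda>n. wt s n * norm (fps_nth f n))"

definition wnorm :: "real \<Rightarrow> 'b::{real_normed_algebra_1} fps \<Rightarrow> real" where
  "wnorm s f = (\<Sum>n. wt s n * norm (fps_nth f n))"

lemma wsum_nonneg: "0 \<le> wsum s f N"
  by (auto simp: wsum_def intro!: sum_nonneg mult_nonneg_nonneg)

lemma wsum_le_wnorm: "wfin s f \<Longrightarrow> wsum s f N \<le> wnorm s f"
  unfolding wfin_def wsum_def wnorm_def by (intro sum_le_suminf) (auto intro!: mult_nonneg_nonneg)

lemma wnorm_nonneg: "wfin s f \<Longrightarrow> 0 \<le> wnorm s f"
  using wsum_le_wnorm wsum_nonneg order_trans by metis

lemma wfinI: "(\<And>N. wsum s f N \<le> C) \<Longrightarrow> wfin s f"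
  unfolding wfin_def wsum_def
  by (rule bounded_imp_summable[where B = C])
    (auto intro!: mult_nonneg_nonneg simp flip: lessThan_Suc_atMost simp del: sum.lessThan_Suc)

lemma wnorm_le: "(\<And>N. wsum s f N \<le> C) \<Longrightarrow> wnorm s f \<le> C"
  using wfinI[of s f C] unfolding wfin_def wsum_def wnorm_def by (intro suminf_le_const) auto

lemma wsum_mono_exponent: "s \<le> t \<Longrightarrow> wsum s f N \<le> wsum t f N"
  unfolding wsum_def by (intro sum_mono mult_right_mono wt_mono_exponent) auto

lemma wfin_mono_exponent: "wfin t f \<Longrightarrow> s \<le> t \<Longrightarrow> wfin s f"
  by (rule wfinI[where C = "wnorm t f"]) (meson order_trans wsum_le_wnorm wsum_mono_exponent)

lemma norm_fps_nth_mult_le: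
  fixes f g :: "'b::real_normed_algebra_1 fps"
  shows "norm (fps_nth (f * g) n) \<le> (\<Sum>i\<le>n. norm (fps_nth f i) * norm (fps_nth g (n - i)))"
  unfolding fps_mult_nth atMost_atLeast0
  by (rule order_trans[OF norm_sum sum_mono]) (rule norm_mult_ineq)

lemma wsum_mult_le:
  assumes "0 \<le> s"
  shows "wsum s (f * g) N \<le> wsum s f N * wsum s g N"
proof -
  have "wsum s (f * g) N \<le> (\<Sum>n<N. \<Sum>i\<le>n. (wt s i * norm (fps_nth f i)) * (wt s (n-i) * norm (fps_nth g (n - i))))"
    unfolding wsum_def
  proof (intro sum_mono)
    fix n
    have "wt s n * norm (fps_nth (f * g) n) \<le> wt s n * (\<Sum>i\<le>n. norm (fps_nth f i) * norm (fps_nth g (n - i)))"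
      by (intro mult_left_mono norm_fps_nth_mult_le) auto
    also have "\<dots> = (\<Sum>i\<le>n. wt s n * (norm (fps_nth f i) * norm (fps_nth g (n - i))))"
      by (simp add: sum_distrib_left)
    also have "\<dots> \<le> (\<Sum>i\<le>n. (wt s i * wt s (n-i)) * (norm (fps_nth f i) * norm (fps_nth g (n - i))))"
    proof (intro sum_mono mult_right_mono)
      fix i assume "i \<in> {..n}"
      then show "wt s n \<le> wt s i * wt s (n - i)"
        using wt_submult[OF assms, of i "n - i"] by simp
    qed auto
    finally show "wt s n * norm (fps_nth (f * g) n) \<le> (\<Sum>i\<le>n. (wt s i * norm (fps_nth f i)) * (wt s (n-i) * norm (fps_nth g (n - i))))"
      by (simp add: algebra_simps)
  qed
  also have "\<dots> \<le> wsum s f N * wsum s g N"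
    unfolding wsum_def by (rule sum_convolution_le) auto
  finally show ?thesis .
qed

lemma wsum_mult_le':
  assumes "0 \<le> s"
  shows "wsum s (f * g) N \<le> 2 powr s * (wsum s f N * wsum 0 g N + wsum 0 f N * wsum s g N)"
proof -
  have "wsum s (f * g) N \<le> (\<Sum>n<N. 2 powr s * ((\<Sum>i\<le>n. (wt s i * norm (fps_nth f i)) * norm (fps_nth g (n - i)))
      + (\<Sum>i\<le>n. norm (fps_nth f i) * (wt s (n-i) * norm (fps_nth g (n - i))))))"
    unfolding wsum_def
  proof (intro sum_mono)
    fix n
    have "wt s n * norm (fps_nth (f * g) n) \<le> wt s n * (\<Sum>i\<le>n. norm (fps_nth f i) * norm (fps_nth g (n - i)))"
      by (intro mult_left_mono norm_fps_nth_mult_le) auto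
    also have "\<dots> = (\<Sum>i\<le>n. wt s n * (norm (fps_nth f i) * norm (fps_nth g (n - i))))"
      by (simp add: sum_distrib_left)
    also have "\<dots> \<le> (\<Sum>i\<le>n. (2 powr s * (wt s i + wt s (n-i))) * (norm (fps_nth f i) * norm (fps_nth g (n - i))))"
    proof (intro sum_mono mult_right_mono)
      fix i assume "i \<in> {..n}"
      then show "wt s n \<le> 2 powr s * (wt s i + wt s (n-i))"
        using wt_subadd[OF assms, of i "n - i"] by simp
    qed auto
    finally show "wt s n * norm (fps_nth (f * g) n) \<le> 2 powr s * ((\<Sum>i\<le>n. (wt s i * norm (fps_nth f i)) * norm (fps_nth g (n - i)))
      + (\<Sum>i\<le>n. norm (fps_nth f i) * (wt s (n-i) * norm (fps_nth g (n - i)))))"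
      by (simp add: algebra_simps sum.distrib sum_distrib_left)
  qed
  also have "\<dots> \<le> 2 powr s * (wsum s f N * wsum 0 g N + wsum 0 f N * wsum s g N)"
    unfolding wsum_def sum_distrib_left[symmetric] sum.distrib
    by (intro mult_left_mono add_mono order_trans[OF sum_convolution_le]) (auto intro!: sum_nonneg)
  finally show ?thesis .
qed

lemma wsum_add_le: "wsum s (f + g) N \<le> wsum s f N + wsum s g N"
  unfolding wsum_def sum.distrib[symmetric]
  by (intro sum_mono) (metis distrib_left fps_add_nth mult_left_mono norm_triangle_ineq wt_nonneg)

lemma wfin_add: "wfin s f \<Longrightarrow> wfin s g \<Longrightarrow> wfin s (f + g)"
  by (rule wfinI[where C = "wnorm s f + wnorm s g"])
    (meson add_mono order_trans wsum_add_le wsum_le_wnorm)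

lemma wfin_diff: "wfin s f \<Longrightarrow> wfin s g \<Longrightarrow> wfin s (f - g)"
  using wfin_add[of s f "- g"] by (simp add: wfin_def)

lemma wfin_mult: "0 \<le> s \<Longrightarrow> wfin s f \<Longrightarrow> wfin s g \<Longrightarrow> wfin s (f * g)"
  by (rule wfinI[where C = "wnorm s f * wnorm s g"])
    (meson mult_mono order_trans wsum_mult_le wsum_le_wnorm wsum_nonneg wnorm_nonneg)

lemma wfin_const [simp]: "wfin s (fps_const c)"
proof -
  have "(\<lambda>n. wt s n * norm (fps_nth (fps_const c) n)) = (\<lambda>n. if n = 0 then wt s n * norm c else 0)"
    by (rule ext) simp
  moreover have "summable (\<lambda>n. if n = 0 then wt s n * norm c else 0)"
    by (rule summable_finite[of "{0}"]) auto
  ultimately show ?thesis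
    unfolding wfin_def by simp
qed

lemma wfin_1 [simp]: "wfin s 1"
  using wfin_const[of s 1] by simp

lemma wfin_power: "0 \<le> s \<Longrightarrow> wfin s f \<Longrightarrow> wfin s (f ^ k)"
  by (induction k) (auto intro: wfin_mult)

lemma wfin_sum: "finite I \<Longrightarrow> (\<And>i. i \<in> I \<Longrightarrow> wfin s (f i)) \<Longrightarrow> wfin s (\<Sum>i\<in>I. f i)"
  by (induction I rule: finite_induct) (auto intro: wfin_add simp: wfin_def[of _ 0])

lemma wfin_norm_summable: "wfin 0 f \<Longrightarrow> summable (\<lambda>n. norm (fps_nth f n))"
  by (simp add: wfin_def)

text \<open>
Coefficients of index below \<open>m\<close> are estimated by their supremum, the others by the weight, which is
at least \<open>m\<^sup>s\<close> there. The free cut-off \<open>m\<close> interpolates between the two norms.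
\<close>

lemma wsum_0_interpolation:
  assumes "0 \<le> s" "wfin s f" "\<And>n. norm (fps_nth f n) \<le> S" "0 < m"
  shows "wsum 0 f N \<le> real m * S + real m powr (- s) * wnorm s f"
proof -
  have S: "0 \<le> S" using assms(3)[of 0] norm_ge_zero order_trans by blast
  have split: "norm (fps_nth f n) \<le> (if n < m then S else 0) + real m powr (-s) * (wt s n * norm (fps_nth f n))" for n
  proof (cases "n < m")
    case True
    then show ?thesis using assms(3)[of n] by (auto intro: add_increasing2)
  next
    case False
    then have "real m powr s \<le> wt s n"
      unfolding wt_def using assms by (intro powr_mono2) auto
    then have "1 \<le> real m powr (-s) * wt s n"
      using assms by (simp add: powr_minus field_simps)
    then have "1 * norm (fps_nth f n) \<le> (real m powr (-s) * wt s n) * norm (fps_nth f n)"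
      by (intro mult_right_mono) auto
    then show ?thesis using False by (simp add: mult.assoc)
  qed
  have "wsum 0 f N \<le> (\<Sum>n<N. (if n < m then S else 0) + real m powr (-s) * (wt s n * norm (fps_nth f n)))"
    unfolding wsum_def using split by (intro sum_mono) auto
  also have "\<dots> = (\<Sum>n\<in>{..<N} \<inter> {..<m}. S) + real m powr (-s) * wsum s f N"
    by (simp only: sum.distrib sum_distrib_left wsum_def sum.inter_restrict[OF finite_lessThan] lessThan_iff)
  also have "(\<Sum>n\<in>{..<N} \<inter> {..<m}. S) \<le> real m * S"
    using S card_mono[of "{..<m}" "{..<N} \<inter> {..<m}"] by (simp add: mult_right_mono)
  also have "real m powr (-s) * wsum s f N \<le> real m powr (-s) * wnorm s f"
    using assms by (intro mult_left_mono wsum_le_wnorm) auto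
  finally show ?thesis by simp
qed

text \<open>
The supremum of the coefficients of \<open>a\<^sup>k\<close> decays exponentially, but the weighted norm does not see this
directly. Let \<open>x\<^sub>j\<close> be the weighted norm of \<open>a\<close> to the power \<open>2\<^sup>j\<close>. Squaring costs only one weighted factor
(\<open>wsum_mult_le'\<close>), and the unweighted factor is exponentially smaller than \<open>x\<^sub>j\<close> by interpolation with a cut-off
growing like a small power. Hence \<open>x\<^bsub>j+1\<^esub> \<le> c \<lambda>\<^bsup>K\<^esup> x\<^sub>j\<^sup>2\<close> with \<open>K = 2\<^sup>j\<close> and \<open>\<lambda> < 1\<close>, so that
\<open>ln x\<^sub>j / 2\<^sup>j\<close> tends to \<open>-\<infinity>\<close>, unless some \<open>x\<^sub>j\<close> is small.
\<close>

lemma wnorm_power_small: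
  fixes a :: "'b::real_normed_algebra_1 fps"
  assumes s: "0 < s" and fin: "wfin s a" and \<delta>: "\<delta> < 1"
    and coeff: "\<And>k n. norm (fps_nth (a ^ k) n) \<le> \<delta> ^ k"
  shows "\<exists>k. wnorm s (a ^ k) \<le> 1/2"
proof (rule ccontr)
  assume "\<not> ?thesis"
  then have big: "wnorm s (a ^ k) > 1/2" for k by (auto simp: not_le)
  define x where "x j = wnorm s (a ^ (2 ^ j))" for j :: nat
  have d0: "0 \<le> \<delta>" using order_trans[OF norm_ge_zero coeff[of 1 0]] by simp
  \<comment> \<open>a positive rate, also if \<open>\<delta>\<close> is zero\<close>
  define d where "d = max \<delta> (1/2)"
  have d: "0 < d" "d < 1" "\<delta> \<le> d" using \<delta> by (auto simp: d_def)
  \<comment> \<open>With a cut-off of size \<open>b\<^sup>K\<close> the head is of size \<open>(b d)\<^sup>K = sqrt d\<^sup>K\<close> and the tail of size \<open>b\<^sup>-\<^sup>s\<^sup>K\<close>.\<close>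
  define b where "b = 1 / sqrt d"
  have b: "b > 1" using d by (simp add: b_def)
  have bd: "b * d = sqrt d" using d real_div_sqrt[of d] unfolding b_def by simp
  define lam where "lam = max (sqrt d) (b powr (-s))"
  have "b powr (-s) < 1" using b s by (simp add: powr_less_one)
  then have lam: "0 < lam" "lam < 1" using d b by (auto simp: lam_def less_max_iff_disj)
  define c where "c = 2 powr s * 2 * (4 + 1)"
  have fink: "wfin s (a ^ k)" for k using fin s by (intro wfin_power) auto
  have step: "x (Suc j) \<le> c * (lam ^ (2 ^ j) * (x j)\<^sup>2)" for j
  proof -
    define K where "K = (2::nat) ^ j"
    define m where "m = nat \<lceil>b ^ K\<rceil>"
    have bK: "b ^ K \<ge> 1" using b by (simp add: one_le_power)
    have m: "b ^ K \<le> real m" "real m \<le> 2 * b ^ K" "0 < m" using bK unfolding m_def by linarith+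
    have xj: "x j > 1/2" using big by (simp add: x_def)
    have cd: "norm (fps_nth (a ^ K) n) \<le> d ^ K" for n
      using coeff[of K n] power_mono[OF d(3) d0, of K] by linarith
    have "wsum 0 (a ^ K) N \<le> real m * d ^ K + real m powr (- s) * x j" for N
      using wsum_0_interpolation[OF less_imp_le[OF s] fink cd m(3), of N] by (simp add: x_def K_def)
    moreover have "real m * d ^ K \<le> 2 * lam ^ K"
    proof -
      have "real m * d ^ K \<le> (2 * b ^ K) * d ^ K" using m d by (intro mult_right_mono) auto
      also have "\<dots> = 2 * (sqrt d) ^ K" by (simp add: power_mult_distrib [symmetric] bd)
      also have "\<dots> \<le> 2 * lam ^ K" using d by (auto simp: lam_def intro!: power_mono)
      finally show ?thesis .
    qed
    moreover have "real m powr (-s) \<le> lam ^ K"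
    proof -
      have "real m powr (-s) \<le> (b ^ K) powr (-s)"
        using m s bK by (intro powr_mono2') auto
      also have "\<dots> = (b powr (-s)) ^ K"
        using b by (simp add: powr_powr powr_realpow [symmetric] mult.commute)
      also have "\<dots> \<le> lam ^ K" by (auto simp: lam_def intro!: power_mono)
      finally show ?thesis .
    qed
    ultimately have W0: "wsum 0 (a ^ K) N \<le> lam ^ K * (5 * x j)" for N
    proof -
      assume h1: "\<And>N. wsum 0 (a ^ K) N \<le> real m * d ^ K + real m powr (- s) * x j"
        and h2: "real m * d ^ K \<le> 2 * lam ^ K" and h3: "real m powr (-s) \<le> lam ^ K"
      have "wsum 0 (a ^ K) N \<le> 2 * lam ^ K + lam ^ K * x j"
        using h1[of N] h2 mult_right_mono[OF h3, of "x j"] xj by linarith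
      also have "\<dots> \<le> lam ^ K * (4 * x j) + lam ^ K * x j"
        using xj lam by (simp add: mult.commute)
      finally show ?thesis by (simp add: algebra_simps)
    qed
    have "wsum s (a ^ (2 ^ Suc j)) N \<le> c * (lam ^ K * (x j)\<^sup>2)" for N
    proof -
      have W: "wsum s (a ^ K) N \<le> x j" unfolding x_def K_def using fink by (rule wsum_le_wnorm)
      have "wsum s (a ^ K * a ^ K) N \<le> 2 powr s * (wsum s (a ^ K) N * wsum 0 (a ^ K) N + wsum 0 (a ^ K) N * wsum s (a ^ K) N)"
        using s by (intro wsum_mult_le') auto
      also have "\<dots> = 2 powr s * 2 * (wsum s (a ^ K) N * wsum 0 (a ^ K) N)" by simp
      also have "\<dots> \<le> 2 powr s * 2 * (x j * (lam ^ K * (5 * x j)))"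
        using W W0 xj by (intro mult_left_mono mult_mono) (auto simp: wsum_nonneg)
      finally show ?thesis
        by (simp add: K_def c_def power_add [symmetric] mult_2 [symmetric] power2_eq_square algebra_simps)
    qed
    then show ?thesis unfolding x_def[of "Suc j"] K_def by (rule wnorm_le)
  qed
  define u where "u j = ln (x j) / 2 ^ j" for j
  have xpos: "x j > 0" for j using big[of "2 ^ j"] by (simp add: x_def)
  have c1: "c > 0" by (simp add: c_def)
  have ustep: "u (Suc j) \<le> u j + \<bar>ln c\<bar> / 2 ^ Suc j + ln lam / 2" for j
  proof -
    have "ln (x (Suc j)) \<le> ln (c * (lam ^ (2 ^ j) * (x j)\<^sup>2))"
    proof (subst ln_le_cancel_iff)
      show "0 < c * (lam ^ (2 ^ j) * (x j)\<^sup>2)"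
        using c1 lam xpos[of j] by (intro mult_pos_pos zero_less_power) auto
    qed (use step[of j] xpos in auto)
    also have "\<dots> = ln c + (2 ^ j * ln lam + 2 * ln (x j))"
      using xpos[of j] lam c1 by (simp add: ln_mult_pos ln_realpow)
    finally have "ln (x (Suc j)) / 2 ^ Suc j \<le> (\<bar>ln c\<bar> + (2 ^ j * ln lam + 2 * ln (x j))) / 2 ^ Suc j"
      by (intro divide_right_mono) auto
    then show ?thesis by (simp add: u_def add_divide_distrib)
  qed
  have ubound: "u j \<le> u 0 + \<bar>ln c\<bar> * (1 - 1 / 2 ^ j) + real j * (ln lam / 2)" for j
  proof (induction j)
    case (Suc j)
    show ?case using ustep[of j] Suc by (simp add: field_simps)
  qed simp
  have "ln lam < 0" using lam by simp
  obtain j :: nat where j: "real j > (u 0 + \<bar>ln c\<bar> + 1) / (- ln lam / 2)"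
    using reals_Archimedean2 by blast
  have "real j * (ln lam / 2) < - (u 0 + \<bar>ln c\<bar> + 1)"
    using j \<open>ln lam < 0\<close> by (simp add: field_simps)
  moreover have "\<bar>ln c\<bar> * (1 - 1 / 2 ^ j) \<le> \<bar>ln c\<bar>" by (rule mult_left_le) auto
  ultimately have "u j < - 1" using ubound[of j] by linarith
  moreover have "u j \<ge> -1"
  proof -
    have "ln (1/2) < ln (x j)" using big[of "2 ^ j"] by (subst ln_less_cancel_iff) (auto simp: x_def)
    moreover have "ln (1/2::real) \<ge> -1" using ln_2_less_1 by (simp add: ln_div)
    ultimately have "-1 \<le> ln (x j)" by linarith
    then have "-1 / 2 ^ j \<le> u j" unfolding u_def by (intro divide_right_mono) auto
    moreover have "(1::real) / 2 ^ j \<le> 1" by simp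
    ultimately show ?thesis unfolding minus_divide_left[symmetric] by linarith
  qed
  ultimately show False by simp
qed

section \<open>Evaluation and the weighted Wiener lemma\<close>

definition dilate :: "real \<Rightarrow> 'b::real_normed_algebra_1 fps \<Rightarrow> 'b fps" where
  "dilate r f = Abs_fps (\<lambda>n. r ^ n *\<^sub>R fps_nth f n)"

lemma dilate_nth [simp]: "fps_nth (dilate r f) n = r ^ n *\<^sub>R fps_nth f n"
  by (simp add: dilate_def)

lemma dilate_mult: "dilate r (f * g) = dilate r f * dilate r g"
proof (rule fps_ext)
  fix n
  have "(\<Sum>i=0..n. r ^ n *\<^sub>R (fps_nth f i * fps_nth g (n - i)))
      = (\<Sum>i=0..n. (r ^ i *\<^sub>R fps_nth f i) * (r ^ (n - i) *\<^sub>R fps_nth g (n - i)))"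
    by (intro sum.cong) (auto simp: power_add [symmetric])
  then show "fps_nth (dilate r (f * g)) n = fps_nth (dilate r f * dilate r g) n"
    by (simp add: fps_mult_nth scaleR_right.sum)
qed

lemma dilate_1 [simp]: "dilate r 1 = 1"
  by (rule fps_ext) simp

lemma wfin_dilate_bounded:
  assumes r: "0 \<le> r" "r < 1" and C: "\<And>n. norm (fps_nth f n) \<le> C"
  shows "wfin s (dilate r f)"
proof -
  have C0: "0 \<le> C" using order_trans[OF norm_ge_zero C[of 0]] .
  show ?thesis
  proof (cases "r = 0")
    case True
    show ?thesis unfolding wfin_def using True by (intro summable_finite[of "{0}"]) auto
  next
    case False
    define c where "c = (1 + r) / 2"
    have c: "c < 1" "r < c" using r by (auto simp: c_def)
    have "((\<lambda>n. (1 + 1 / real (Suc n)) powr s * r) \<longlongrightarrow> (1 + 0) powr s * r) sequentially"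
      by (intro tendsto_intros LIMSEQ_Suc lim_1_over_n) auto
    then have "\<forall>\<^sub>F n in sequentially. (1 + 1 / real (Suc n)) powr s * r < c"
      by (rule order_tendstoD) (use c in simp)
    then obtain N where N: "\<And>n. n \<ge> N \<Longrightarrow> (1 + 1 / real (Suc n)) powr s * r < c"
      by (auto simp: eventually_sequentially)
    have "summable (\<lambda>n. wt s n * r ^ n)"
    proof (rule summable_ratio_test[OF c(1)])
      fix n assume n: "N \<le> n"
      have "real (Suc (Suc n)) = (1 + 1 / real (Suc n)) * real (Suc n)" by (simp add: field_simps)
      then have "wt s (Suc n) = (1 + 1 / real (Suc n)) powr s * wt s n"
        unfolding wt_def by (simp only: powr_mult)
      then have "wt s (Suc n) * r ^ Suc n = ((1 + 1 / real (Suc n)) powr s * r) * (wt s n * r ^ n)"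
        by simp
      also have "\<dots> \<le> c * (wt s n * r ^ n)" using N[OF n] r by (intro mult_right_mono) auto
      finally show "norm (wt s (Suc n) * r ^ Suc n) \<le> c * norm (wt s n * r ^ n)" using r by simp
    qed
    then have "summable (\<lambda>n. (wt s n * r ^ n) * C)" by (rule summable_mult2)
    then show ?thesis unfolding wfin_def
      by (rule summable_comparison_test') (use r C in \<open>auto intro!: mult_left_mono simp: mult.assoc\<close>)
  qed
qed

lemma sum_lessThan_add_split:
  fixes f :: "nat \<Rightarrow> 'a::comm_monoid_add"
  shows "(\<Sum>n<M + N. f n) = (\<Sum>n<M. f n) + (\<Sum>n<N. f (n + M))"
  by (induction N) (auto simp: add_ac)

lemma wfin_dilate:
  assumes "0 \<le> r" "r \<le> 1" "wfin s f"
  shows "wfin s (dilate r f)"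
  unfolding wfin_def
  by (rule summable_comparison_test'[OF assms(3)[unfolded wfin_def]])
    (use assms in \<open>auto intro!: mult_left_mono mult_left_le_one_le power_le_one\<close>)

text \<open>
Finitely many coefficients carry almost all of the norm, and these depend continuously on \<open>r\<close>.
\<close>

lemma dilate_close:
  assumes A: "wfin 0 A" and \<epsilon>: "0 < \<epsilon>"
  obtains r where "0 < r" "r < 1" "wnorm 0 (dilate r A - A) \<le> \<epsilon>"
proof -
  obtain M where M: "(\<Sum>i. norm (fps_nth A (i + M))) < \<epsilon> / 2"
    using order_tendstoD(2)[OF suminf_exist_split2[OF wfin_norm_summable[OF A]], of "\<epsilon> / 2"] \<epsilon>
    by (auto simp: eventually_sequentially)
  define \<eta> where "\<eta> = min (1/2) (\<epsilon> / (2 * (wnorm 0 A + 1)))"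
  have A0: "0 \<le> wnorm 0 A" using wnorm_nonneg[OF A] .
  have \<eta>: "0 < \<eta>" "\<eta> \<le> 1/2" using \<epsilon> A0 by (simp_all add: \<eta>_def del: min_less_iff_conj) (simp_all add: min_def)
  have "\<eta> * wnorm 0 A \<le> (\<epsilon> / (2 * (wnorm 0 A + 1))) * (wnorm 0 A + 1)"
    using \<epsilon> A0 by (intro mult_mono) (auto simp: \<eta>_def)
  also have "\<dots> = \<epsilon> / 2" using A0 by (simp add: divide_simps)
  finally have \<eta>A: "\<eta> * wnorm 0 A \<le> \<epsilon> / 2" .
  define r where "r = 1 - \<eta> / real (Suc M)"
  have "\<eta> / real (Suc M) \<le> \<eta>" using \<eta> by (simp add: field_simps)
  then have r: "0 < r" "r < 1" using \<eta> by (auto simp: r_def)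
  have rn: "1 - r ^ n \<le> \<eta>" if "n \<le> M" for n
  proof -
    have "1 + real n * (- (\<eta> / real (Suc M))) \<le> (1 + (- (\<eta> / real (Suc M)))) ^ n"
      using r by (intro Bernoulli_inequality) (simp add: r_def)
    moreover have "real n * (\<eta> / real (Suc M)) \<le> real (Suc M) * (\<eta> / real (Suc M))"
      using that \<eta> by (intro mult_right_mono) auto
    ultimately show ?thesis by (simp add: r_def)
  qed
  have "wsum 0 (dilate r A - A) N \<le> \<epsilon>" for N
  proof -
    have nr: "norm (fps_nth (dilate r A - A) n) = (1 - r ^ n) * norm (fps_nth A n)" for n
    proof -
      have "fps_nth (dilate r A - A) n = (r ^ n - 1) *\<^sub>R fps_nth A n" by (simp add: scaleR_left_diff_distrib)
      then show ?thesis using r power_le_one[of r n] by simp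
    qed
    have "wsum 0 (dilate r A - A) N \<le> wsum 0 (dilate r A - A) (N + M)"
      unfolding wsum_def by (intro sum_mono2) auto
    also have "\<dots> = (\<Sum>n<M. (1 - r ^ n) * norm (fps_nth A n)) + (\<Sum>n<N. (1 - r ^ (n + M)) * norm (fps_nth A (n + M)))"
      unfolding wsum_def nr wt_zero_left mult_1_left add.commute[of N M]
      by (simp add: sum_lessThan_add_split)
    also have "\<dots> \<le> (\<Sum>n<M. \<eta> * norm (fps_nth A n)) + (\<Sum>n<N. 1 * norm (fps_nth A (n + M)))"
      using r rn by (intro add_mono sum_mono mult_right_mono) auto
    also have "\<dots> \<le> \<eta> * wnorm 0 A + (\<Sum>i. norm (fps_nth A (i + M)))"
    proof (intro add_mono)
      show "(\<Sum>n<M. \<eta> * norm (fps_nth A n)) \<le> \<eta> * wnorm 0 A"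
        using wsum_le_wnorm[OF A, of M] \<eta> by (simp add: sum_distrib_left [symmetric] wsum_def)
      show "(\<Sum>n<N. 1 * norm (fps_nth A (n + M))) \<le> (\<Sum>i. norm (fps_nth A (i + M)))"
        using wfin_norm_summable[OF A] summable_iff_shift[of "\<lambda>n. norm (fps_nth A n)" M] by (auto intro!: sum_le_suminf)
    qed
    finally show ?thesis using M \<eta>A by linarith
  qed
  then show ?thesis using that r wnorm_le by blast
qed

text \<open>
The Banach algebras at hand are algebras over the reals as types. The map \<open>cs\<close> records a central
action of the complex numbers, which is needed to evaluate a power series at complex arguments.
\<close>

locale complex_scalars =
  fixes cs :: "complex \<Rightarrow> 'b::{real_normed_algebra_1,banach}"
  assumes cs_add: "cs (x + y) = cs x + cs y"
    and cs_mult: "cs (x * y) = cs x * cs y"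
    and cs_1 [simp]: "cs 1 = 1"
    and cs_commute: "cs x * a = a * cs x"
    and norm_cs_mult: "norm (cs x * a) \<le> cmod x * norm a"
    and cs_of_real: "cs (of_real t) = of_real t"
begin

lemma cs_0 [simp]: "cs 0 = 0"
  using cs_of_real[of 0] by simp

lemma cs_sum: "finite I \<Longrightarrow> cs (\<Sum>i\<in>I. f i) = (\<Sum>i\<in>I. cs (f i))"
  by (induction I rule: finite_induct) (auto simp: cs_add)

definition ev :: "'b fps \<Rightarrow> complex \<Rightarrow> 'b" where
  "ev f z = (\<Sum>n. cs (z ^ n) * fps_nth f n)"

lemma norm_ev_term:
  assumes "cmod z \<le> 1"
  shows "norm (cs (z ^ n) * fps_nth f n) \<le> norm (fps_nth f n)"
proof -
  have "norm (cs (z ^ n) * fps_nth f n) \<le> cmod z ^ n * norm (fps_nth f n)"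
    using norm_cs_mult[of "z ^ n"] by (simp add: norm_power)
  also have "\<dots> \<le> 1 * norm (fps_nth f n)"
    using assms by (intro mult_right_mono power_le_one) auto
  finally show ?thesis by simp
qed

lemma summable_norm_ev:
  "wfin 0 f \<Longrightarrow> cmod z \<le> 1 \<Longrightarrow> summable (\<lambda>n. norm (cs (z ^ n) * fps_nth f n))"
  by (rule summable_comparison_test'[OF wfin_norm_summable]) (auto simp: norm_ev_term)

lemma summable_ev: "wfin 0 f \<Longrightarrow> cmod z \<le> 1 \<Longrightarrow> summable (\<lambda>n. cs (z ^ n) * fps_nth f n)"
  by (rule summable_norm_cancel[OF summable_norm_ev])

lemma norm_ev_le: "wfin 0 f \<Longrightarrow> cmod z \<le> 1 \<Longrightarrow> norm (ev f z) \<le> wnorm 0 f"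
  unfolding ev_def wnorm_def
  by (rule order_trans[OF summable_norm[OF summable_norm_ev] suminf_le])
    (auto intro: summable_norm_ev norm_ev_term wfin_norm_summable)

lemma ev_mult:
  assumes "wfin 0 f" "wfin 0 g" "cmod z \<le> 1"
  shows "ev (f * g) z = ev f z * ev g z"
proof -
  have "ev f z * ev g z = (\<Sum>k. \<Sum>i\<le>k. (cs (z ^ i) * fps_nth f i) * (cs (z ^ (k - i)) * fps_nth g (k - i)))"
    unfolding ev_def using assms by (intro Cauchy_product summable_norm_ev)
  also have "\<dots> = ev (f * g) z"
    unfolding ev_def
  proof (intro suminf_cong)
    fix k
    have "(cs (z ^ i) * fps_nth f i) * (cs (z ^ (k - i)) * fps_nth g (k - i)) = cs (z ^ k) * (fps_nth f i * fps_nth g (k - i))"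
      if "i \<le> k" for i
    proof -
      have "(cs (z ^ i) * fps_nth f i) * (cs (z ^ (k - i)) * fps_nth g (k - i))
          = cs (z ^ i) * (cs (z ^ (k - i)) * fps_nth f i) * fps_nth g (k - i)"
        by (simp add: cs_commute[of "z ^ (k - i)" "fps_nth f i"] mult.assoc)
      also have "\<dots> = cs (z ^ i * z ^ (k - i)) * (fps_nth f i * fps_nth g (k - i))"
        by (simp only: cs_mult mult.assoc)
      finally show ?thesis using that by (simp add: power_add [symmetric])
    qed
    then show "(\<Sum>i\<le>k. (cs (z ^ i) * fps_nth f i) * (cs (z ^ (k - i)) * fps_nth g (k - i))) = cs (z ^ k) * fps_nth (f * g) k"
      by (simp add: fps_mult_nth atMost_atLeast0 sum_distrib_left)
  qed
  finally show ?thesis by simp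
qed

lemma ev_const [simp]: "ev (fps_const c) z = c"
proof -
  have "ev (fps_const c) z = (\<Sum>n. if n = 0 then c else 0)"
    unfolding ev_def by (intro suminf_cong) auto
  then show ?thesis using suminf_finite[of "{0}" "\<lambda>n. if n = 0 then c else (0::'b)"] by simp
qed

lemma ev_1 [simp]: "ev 1 z = 1"
  using ev_const[of 1 z] by simp

lemma ev_power: "wfin 0 f \<Longrightarrow> cmod z \<le> 1 \<Longrightarrow> ev (f ^ k) z = ev f z ^ k"
  by (induction k) (auto simp: ev_mult wfin_power)

lemma ev_diff: "wfin 0 f \<Longrightarrow> wfin 0 g \<Longrightarrow> cmod z \<le> 1 \<Longrightarrow> ev (f - g) z = ev f z - ev g z"
  unfolding ev_def by (subst suminf_diff) (auto simp: summable_ev algebra_simps)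

lemma ev_add: "wfin 0 f \<Longrightarrow> wfin 0 g \<Longrightarrow> cmod z \<le> 1 \<Longrightarrow> ev (f + g) z = ev f z + ev g z"
  unfolding ev_def by (subst suminf_add) (auto simp: summable_ev algebra_simps)

lemma ev_dilate: "ev (dilate r f) z = ev f (of_real r * z)"
proof -
  have "cs (z ^ n) * (r ^ n *\<^sub>R fps_nth f n) = cs ((of_real r * z) ^ n) * fps_nth f n" for n
  proof -
    have "cs ((of_real r * z) ^ n) = of_real (r ^ n) * cs (z ^ n)"
      by (simp only: power_mult_distrib cs_mult of_real_power [symmetric] cs_of_real)
    moreover have "cs (z ^ n) * (r ^ n *\<^sub>R fps_nth f n) = r ^ n *\<^sub>R (cs (z ^ n) * fps_nth f n)"
      by (rule mult_scaleR_right)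
    ultimately show ?thesis
      by (simp only: scaleR_conv_of_real mult.assoc)
  qed
  then show ?thesis by (simp add: ev_def)
qed

text \<open>
A Cauchy estimate obtained without integrals: averaging over the \<open>m\<close>-th roots of unity isolates the
\<open>n\<close>-th coefficient up to coefficients of index at least \<open>m\<close>, which are negligible as \<open>m\<close> grows.
\<close>

lemma norm_coeff_le_sup:
  assumes f: "wfin 0 f" and S: "\<And>z. cmod z = 1 \<Longrightarrow> norm (ev f z) \<le> S"
  shows "norm (fps_nth f n) \<le> S"
proof -
  have tail: "norm (fps_nth f n) \<le> S + (\<Sum>k. norm (fps_nth f (k + m)))" if m: "n < m" for m
  proof -
    define w where "w = cis (2 * pi / real m)"
    have w1: "cmod w = 1" by (simp add: w_def)
    define c where "c k = (\<Sum>j<m. w ^ (j * k) * inverse (w ^ (j * n))) / of_nat m" for k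
    have cn: "c n = 1" using m by (simp add: c_def w_def)
    have c0: "c k = 0" if "k < m" "k \<noteq> n" for k
    proof -
      define \<zeta> where "\<zeta> = w ^ k * inverse (w ^ n)"
      have cis: "w ^ i = cis (2 * pi * real i / real m)" for i
        unfolding w_def Complex.DeMoivre by (rule arg_cong[where f = cis]) (simp add: field_simps)
      have wm: "w ^ m = 1" using m by (simp add: cis)
      have "w ^ k \<noteq> w ^ n"
        using Complex.bij_betw_roots_unity[of m] that m by (auto simp: bij_betw_def inj_on_def cis)
      then have "\<zeta> \<noteq> 1" using w1 by (auto simp: \<zeta>_def field_simps)
      moreover have "\<zeta> ^ m = 1"
        using wm by (simp add: \<zeta>_def power_mult_distrib power_inverse flip: power_mult)
          (simp add: mult.commute[of _ m] power_mult)
      ultimately have "(\<Sum>j<m. \<zeta> ^ j) = 0" by (simp add: geometric_sum)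
      moreover have "w ^ (j * k) * inverse (w ^ (j * n)) = \<zeta> ^ j" for j
        by (simp add: \<zeta>_def power_mult_distrib power_inverse mult.commute[of j] power_mult)
      ultimately show ?thesis by (simp add: c_def)
    qed
    have c1: "cmod (c k) \<le> 1" for k
    proof -
      have "cmod (\<Sum>j<m. w ^ (j * k) * inverse (w ^ (j * n))) \<le> (\<Sum>j<m. 1)"
        by (rule order_trans[OF norm_sum sum_mono]) (simp add: norm_mult norm_power norm_inverse w1)
      then show ?thesis using m by (simp add: c_def norm_divide divide_le_eq)
    qed
    have ev: "(\<lambda>k. cs (w ^ (j * k)) * fps_nth f k) sums ev f (w ^ j)" for j
      using summable_sums[OF summable_ev[OF f, of "w ^ j"]] w1 by (simp add: ev_def norm_power power_mult)
    have "(\<lambda>k. \<Sum>j<m. cs (inverse (w ^ (j * n)) / of_nat m) * (cs (w ^ (j * k)) * fps_nth f k)) sums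
        (\<Sum>j<m. cs (inverse (w ^ (j * n)) / of_nat m) * ev f (w ^ j))"
      by (intro sums_sum sums_mult ev)
    also have "(\<lambda>k. \<Sum>j<m. cs (inverse (w ^ (j * n)) / of_nat m) * (cs (w ^ (j * k)) * fps_nth f k)) = (\<lambda>k. cs (c k) * fps_nth f k)"
    proof (rule ext)
      fix k
      show "(\<Sum>j<m. cs (inverse (w ^ (j * n)) / of_nat m) * (cs (w ^ (j * k)) * fps_nth f k)) = cs (c k) * fps_nth f k"
        unfolding c_def sum_divide_distrib
        by (subst cs_sum) (auto simp: sum_distrib_right cs_mult [symmetric] mult.assoc [symmetric] mult_ac intro!: sum.cong)
    qed
    finally have sums: "(\<lambda>k. cs (c k) * fps_nth f k) sums (\<Sum>j<m. cs (inverse (w ^ (j * n)) / of_nat m) * ev f (w ^ j))" .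
    have "(\<Sum>k<m. cs (c k) * fps_nth f k) = (\<Sum>k<m. if k = n then fps_nth f n else 0)"
      by (intro sum.cong) (auto simp: cn c0)
    then have head: "(\<Sum>k<m. cs (c k) * fps_nth f k) = fps_nth f n" using m by simp
    have sh: "(\<lambda>k. cs (c (k + m)) * fps_nth f (k + m)) sums ((\<Sum>j<m. cs (inverse (w ^ (j * n)) / of_nat m) * ev f (w ^ j)) - fps_nth f n)"
      using sums_iff_shift[of "\<lambda>k. cs (c k) * fps_nth f k" m] sums head by simp
    have sn: "summable (\<lambda>k. norm (fps_nth f (k + m)))"
      using wfin_norm_summable[OF f] by (subst summable_iff_shift)
    have le: "norm (cs (c (k + m)) * fps_nth f (k + m)) \<le> norm (fps_nth f (k + m))" for k
      using norm_cs_mult[of "c (k+m)" "fps_nth f (k+m)"] mult_right_mono[OF c1[of "k+m"], of "norm (fps_nth f (k+m))"] by simp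
    have A: "norm ((\<Sum>j<m. cs (inverse (w ^ (j * n)) / of_nat m) * ev f (w ^ j)) - fps_nth f n) \<le> (\<Sum>k. norm (fps_nth f (k + m)))"
      unfolding sums_unique[OF sh] using le sn by (rule norm_suminf_le)
    have "norm (\<Sum>j<m. cs (inverse (w ^ (j * n)) / of_nat m) * ev f (w ^ j)) \<le> (\<Sum>j<m. S / real m)"
    proof (rule order_trans[OF norm_sum sum_mono])
      fix j
      have "norm (cs (inverse (w ^ (j * n)) / of_nat m) * ev f (w ^ j)) \<le> cmod (inverse (w ^ (j * n)) / of_nat m) * norm (ev f (w ^ j))"
        by (rule norm_cs_mult)
      also have "\<dots> = norm (ev f (w ^ j)) / real m" by (simp add: norm_divide norm_inverse norm_power w1)
      also have "\<dots> \<le> S / real m" using S[of "w ^ j"] w1 by (simp add: norm_power divide_right_mono)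
      finally show "norm (cs (inverse (w ^ (j * n)) / of_nat m) * ev f (w ^ j)) \<le> S / real m" .
    qed
    also have "\<dots> = S" using m by simp
    finally have B: "norm (\<Sum>j<m. cs (inverse (w ^ (j * n)) / of_nat m) * ev f (w ^ j)) \<le> S" .
    show ?thesis using A B norm_triangle_sub[of "fps_nth f n" "\<Sum>j<m. cs (inverse (w ^ (j * n)) / of_nat m) * ev f (w ^ j)"]
      by (simp add: norm_minus_commute)
  qed
  have "(\<lambda>m. S + (\<Sum>k. norm (fps_nth f (k + m)))) \<longlonglongrightarrow> S + 0"
    by (intro tendsto_intros suminf_exist_split2 wfin_norm_summable f)
  moreover have "\<forall>\<^sub>F m in sequentially. norm (fps_nth f n) \<le> S + (\<Sum>k. norm (fps_nth f (k + m)))"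
    using tail by (intro eventually_sequentiallyI[of "Suc n"]) auto
  ultimately show ?thesis
    using tendsto_lowerbound[OF _ _ sequentially_bot] by fastforce
qed

text \<open>
With \<open>B'(z) = B(r z)\<close> the error \<open>a = 1 - B' A\<close> equals \<open>B'(z) (A(r z) - A(z))\<close> on the unit circle, hence is
at most \<open>1/2\<close> there for \<open>r\<close> close to \<open>1\<close>; the bound \<open>K\<close> is uniform in \<open>r\<close>, which is why it is assumed on
the whole open disc. The identity \<open>B = a\<^sup>k B + (1 + a + \<dots> + a\<^bsup>k-1\<^esup>) B'\<close> holds among formal power series, so the
weighted norm of \<open>a\<^sup>k\<close> being at most \<open>1/2\<close> bounds the partial sums of \<open>B\<close> before anything is known about
their convergence.
\<close>

theorem weighted_wiener:
  assumes s: "0 < s" and A: "wfin s A" and AB: "A * B = 1" and BA: "B * A = 1"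
    and C: "\<And>n. norm (fps_nth B n) \<le> C"
    and K: "\<And>z. cmod z < 1 \<Longrightarrow> norm (ev B z) \<le> K"
  shows "wfin s B"
proof -
  have s0: "0 \<le> s" using s by simp
  have A0: "wfin 0 A" using wfin_mono_exponent[OF A] s by simp
  have K0: "0 \<le> K" using order_trans[OF norm_ge_zero K[of 0]] by simp
  define \<epsilon> where "\<epsilon> = 1 / (2 * (K + 1))"
  have \<epsilon>: "0 < \<epsilon>" "K * \<epsilon> \<le> 1/2" using K0 by (auto simp: \<epsilon>_def field_simps)
  obtain r where r: "0 < r" "r < 1" and close: "wnorm 0 (dilate r A - A) \<le> \<epsilon>"
    using dilate_close[OF A0 \<epsilon>(1)] by blast
  define B' where "B' = dilate r B"
  have B': "wfin t B'" for t unfolding B'_def using r C by (intro wfin_dilate_bounded) auto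
  have dA: "wfin 0 (dilate r A)" using r A0 by (intro wfin_dilate) auto
  define a where "a = 1 - B' * A"
  have a: "wfin s a" unfolding a_def using s0 A B' by (intro wfin_diff wfin_mult) auto
  have a0: "wfin 0 a" using wfin_mono_exponent[OF a] s by simp
  have sup: "norm (ev a z) \<le> 1/2" if z: "cmod z = 1" for z
  proof -
    have rz: "cmod (of_real r * z) < 1" using r z by (simp add: norm_mult)
    have "ev B' z * ev (dilate r A) z = ev (dilate r (B * A)) z"
      using z B'[of 0] dA by (simp add: dilate_mult B'_def ev_mult)
    then have "ev a z = ev B' z * ev (dilate r A - A) z"
      using z B'[of 0] dA A0 by (simp add: a_def BA ev_diff ev_mult wfin_mult right_diff_distrib)
    also have "norm \<dots> \<le> norm (ev B' z) * norm (ev (dilate r A - A) z)" by (rule norm_mult_ineq)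
    also have "\<dots> \<le> K * \<epsilon>"
      using K[OF rz] close norm_ev_le[of "dilate r A - A" z] dA A0 z K0
      by (intro mult_mono) (auto simp: B'_def ev_dilate wfin_diff)
    finally show ?thesis using \<epsilon> by linarith
  qed
  have "norm (fps_nth (a ^ k) n) \<le> (1/2) ^ k" for k n
  proof (rule norm_coeff_le_sup)
    show "wfin 0 (a ^ k)" using a0 by (simp add: wfin_power)
    fix z :: complex assume z: "cmod z = 1"
    have "norm (ev (a ^ k) z) \<le> norm (ev a z) ^ k" using a0 z by (simp add: ev_power norm_power_ineq)
    also have "\<dots> \<le> (1/2) ^ k" using sup[OF z] by (intro power_mono) auto
    finally show "norm (ev (a ^ k) z) \<le> (1/2) ^ k" .
  qed
  then obtain k where k: "wnorm s (a ^ k) \<le> 1/2"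
    using wnorm_power_small[OF s a, of "1/2"] by auto
  define G where "G = (\<Sum>i<k. a ^ i) * B'"
  have G: "wfin s G" unfolding G_def using s0 a B' by (intro wfin_mult wfin_sum wfin_power) auto
  have "B = a * B + B'"
    unfolding a_def using AB by (simp add: left_diff_distrib mult.assoc)
  then have fix_k: "B = a ^ k * B + (\<Sum>i<k. a ^ i) * B'" for k
  proof (induction k)
    case (Suc k)
    have "B = a ^ k * (a * B + B') + (\<Sum>i<k. a ^ i) * B'" using Suc by simp
    then show ?case by (simp add: algebra_simps power_Suc2 del: power_Suc)
  qed simp
  show ?thesis
  proof (rule wfinI[where C = "2 * wnorm s G"])
    fix N
    have "wsum s B N \<le> wsum s (a ^ k * B) N + wsum s G N"
      using wsum_add_le[of s "a ^ k * B" G N] fix_k[of k] by (simp add: G_def)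
    also have "\<dots> \<le> wsum s (a ^ k) N * wsum s B N + wnorm s G"
      using s0 G by (intro add_mono wsum_mult_le wsum_le_wnorm) auto
    also have "wsum s (a ^ k) N * wsum s B N \<le> 1/2 * wsum s B N"
      using k wsum_le_wnorm[OF wfin_power[OF s0 a], of k N] by (intro mult_right_mono wsum_nonneg) auto
    finally show "wsum s B N \<le> 2 * wnorm s G" by simp
  qed
qed

end

lemma (in complex_scalars) ev_continuous:
  assumes f: "wfin 0 f" and z: "cmod z \<le> 1" "\<And>n. cmod (Z n) \<le> 1" and lim: "Z \<longlonglongrightarrow> z"
  shows "(\<lambda>n. ev f (Z n)) \<longlonglongrightarrow> ev f z"
  unfolding ev_def
proof (rule tannerys_theorem[where M = "\<lambda>k. norm (fps_nth f k)", THEN conjunct2, THEN conjunct2])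
  show "\<forall>\<^sub>F (k, n) in at_top \<times>\<^sub>F sequentially. norm (cs (Z n ^ k) * fps_nth f k) \<le> norm (fps_nth f k)"
  proof (rule always_eventually, safe)
    fix k n show "norm (cs (Z n ^ k) * fps_nth f k) \<le> norm (fps_nth f k)"
      using z(2)[of n] by (rule norm_ev_term)
  qed
  fix k
  have "(\<lambda>n. cmod (Z n ^ k - z ^ k) * norm (fps_nth f k)) \<longlonglongrightarrow> cmod (z ^ k - z ^ k) * norm (fps_nth f k)"
    by (intro tendsto_intros lim)
  then have l0: "(\<lambda>n. cmod (Z n ^ k - z ^ k) * norm (fps_nth f k)) \<longlonglongrightarrow> 0" by simp
  have "(\<lambda>n. cs (Z n ^ k) * fps_nth f k - cs (z ^ k) * fps_nth f k) \<longlonglongrightarrow> 0"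
  proof (rule Lim_null_comparison[OF always_eventually l0], rule allI)
    fix n
    have "cs (Z n ^ k) = cs (Z n ^ k - z ^ k) + cs (z ^ k)" by (simp flip: cs_add)
    then have "cs (Z n ^ k) * fps_nth f k - cs (z ^ k) * fps_nth f k = cs (Z n ^ k - z ^ k) * fps_nth f k"
      by (simp add: distrib_right)
    then show "norm (cs (Z n ^ k) * fps_nth f k - cs (z ^ k) * fps_nth f k) \<le> cmod (Z n ^ k - z ^ k) * norm (fps_nth f k)"
      by (simp add: norm_cs_mult)
  qed
  then show "(\<lambda>n. cs (Z n ^ k) * fps_nth f k) \<longlonglongrightarrow> cs (z ^ k) * fps_nth f k"
    by (rule LIM_zero_cancel)
qed (use wfin_norm_summable[OF f] in auto)

section \<open>Lipschitz functions as a Banach space\<close>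

text \<open>
One constant serves both for the supremum and for the Lipschitz condition. The absolute value makes
this meaningful for an arbitrary function \<open>d\<close> in place of a metric.
\<close>

definition lip_bound :: "('x \<Rightarrow> 'x \<Rightarrow> real) \<Rightarrow> ('x \<Rightarrow> complex) \<Rightarrow> real \<Rightarrow> bool" where
  "lip_bound d v K \<longleftrightarrow> (\<forall>x. cmod (v x) \<le> K) \<and> (\<forall>x x'. cmod (v x - v x') \<le> K * \<bar>d x x'\<bar>)"

lemma lip_bound_nonneg: "lip_bound d v K \<Longrightarrow> 0 \<le> K"
  unfolding lip_bound_def by (meson norm_ge_zero order_trans)

lemma lip_bound_0 [simp]: "lip_bound d (\<lambda>_. 0) K \<longleftrightarrow> 0 \<le> K"
  by (auto simp: lip_bound_def)

lemma lip_bound_mono: "lip_bound d v K \<Longrightarrow> K \<le> L \<Longrightarrow> lip_bound d v L"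
  unfolding lip_bound_def by (meson mult_right_mono abs_ge_zero order_trans)

lemma lip_bound_add: "lip_bound d v K \<Longrightarrow> lip_bound d w L \<Longrightarrow> lip_bound d (\<lambda>x. v x + w x) (K + L)"
  unfolding lip_bound_def
proof safe
  fix x x'
  assume *: "\<forall>x. cmod (v x) \<le> K" "\<forall>x. cmod (w x) \<le> L"
    "\<forall>x x'. cmod (v x - v x') \<le> K * \<bar>d x x'\<bar>" "\<forall>x x'. cmod (w x - w x') \<le> L * \<bar>d x x'\<bar>"
  show "cmod (v x + w x) \<le> K + L" using * by (meson add_mono norm_triangle_ineq order_trans)
  have "cmod ((v x - v x') + (w x - w x')) \<le> K * \<bar>d x x'\<bar> + L * \<bar>d x x'\<bar>"
    using * by (meson add_mono norm_triangle_ineq order_trans)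
  then show "cmod (v x + w x - (v x' + w x')) \<le> (K + L) * \<bar>d x x'\<bar>" by (simp add: algebra_simps)
qed

lemma lip_bound_mult: "lip_bound d v K \<Longrightarrow> lip_bound d (\<lambda>x. c * v x) (cmod c * K)"
  unfolding lip_bound_def
  by (auto simp: norm_mult mult_left_mono mult.assoc simp flip: right_diff_distrib)

lemma lip_bound_uminus: "lip_bound d (\<lambda>x. - v x) K \<longleftrightarrow> lip_bound d v K"
  unfolding lip_bound_def by (simp add: norm_minus_commute)

lemma lip_bound_limit:
  assumes lim: "\<And>x. (\<lambda>n. V n x) \<longlonglongrightarrow> v x" and bound: "\<forall>\<^sub>F n in sequentially. lip_bound d (V n) K"
  shows "lip_bound d v K"
  unfolding lip_bound_def
proof safe
  fix x x'
  show "cmod (v x) \<le> K"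
    using bound by (intro tendsto_upperbound[OF tendsto_norm[OF lim]]) (auto elim: eventually_mono simp: lip_bound_def)
  show "cmod (v x - v x') \<le> K * \<bar>d x x'\<bar>"
    using bound by (intro tendsto_upperbound[OF tendsto_norm[OF tendsto_diff[OF lim lim]]])
      (auto elim: eventually_mono simp: lip_bound_def)
qed

text \<open>
The Lipschitz functions for a fixed \<open>d\<close> form a Banach space that depends on the term \<open>d\<close>, hence is not a
type. The bounded families indexed by all \<open>d\<close> at once do form a type, and a given \<open>d\<close> is studied on
its own component of the product.
\<close>

typedef 'x lipfam = "{u :: ('x \<Rightarrow> 'x \<Rightarrow> real) \<Rightarrow> 'x \<Rightarrow> complex. \<exists>K. \<forall>d. lip_bound d (u d) K}"
  morphisms component Abs_lipfam
  by (rule exI[of _ "\<lambda>_ _. 0"]) (auto intro: exI[of _ 0])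

setup_lifting type_definition_lipfam

lemma lipfam_eqI: "(\<And>d x. component u d x = component v d x) \<Longrightarrow> u = v"
  by (metis component_inject ext)

instantiation lipfam :: (type) real_normed_vector
begin

lift_definition zero_lipfam :: "'a lipfam" is "\<lambda>_ _. 0"
  by (auto intro: exI[of _ 0])

lift_definition plus_lipfam :: "'a lipfam \<Rightarrow> 'a lipfam \<Rightarrow> 'a lipfam" is "\<lambda>u v d x. u d x + v d x"
  by (blast intro: lip_bound_add)

lift_definition uminus_lipfam :: "'a lipfam \<Rightarrow> 'a lipfam" is "\<lambda>u d x. - u d x"
  by (simp add: lip_bound_uminus)

lift_definition minus_lipfam :: "'a lipfam \<Rightarrow> 'a lipfam \<Rightarrow> 'a lipfam" is "\<lambda>u v d x. u d x - v d x"
proof -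
  fix u v :: "('a \<Rightarrow> 'a \<Rightarrow> real) \<Rightarrow> 'a \<Rightarrow> complex"
  assume "\<exists>K. \<forall>d. lip_bound d (u d) K" "\<exists>K. \<forall>d. lip_bound d (v d) K"
  then obtain K L where "\<And>d. lip_bound d (u d) K" "\<And>d. lip_bound d (\<lambda>x. - v d x) L"
    by (auto simp: lip_bound_uminus)
  then have "\<forall>d. lip_bound d (\<lambda>x. u d x + - v d x) (K + L)" by (intro allI lip_bound_add)
  then show "\<exists>K. \<forall>d. lip_bound d (\<lambda>x. u d x - v d x) K" by auto
qed

lift_definition scaleR_lipfam :: "real \<Rightarrow> 'a lipfam \<Rightarrow> 'a lipfam" is "\<lambda>r u d x. of_real r * u d x"
  by (blast intro: lip_bound_mult)

definition norm_lipfam :: "'a lipfam \<Rightarrow> real" where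
  "norm_lipfam u = Inf {K. \<forall>d. lip_bound d (component u d) K}"

definition dist_lipfam :: "'a lipfam \<Rightarrow> 'a lipfam \<Rightarrow> real" where
  "dist_lipfam u v = norm (u - v)"

definition sgn_lipfam :: "'a lipfam \<Rightarrow> 'a lipfam" where
  "sgn_lipfam u = inverse (norm u) *\<^sub>R u"

definition uniformity_lipfam :: "('a lipfam \<times> 'a lipfam) filter" where
  "uniformity_lipfam = (INF e\<in>{0 <..}. principal {(x, y). dist x y < e})"

definition open_lipfam :: "'a lipfam set \<Rightarrow> bool" where
  "open_lipfam U = (\<forall>x\<in>U. eventually (\<lambda>(x', y). x' = x \<longrightarrow> y \<in> U) uniformity)"

lemma bdd_below_lip_bounds: "bdd_below {K. \<forall>d. lip_bound d (component (u :: 'a lipfam) d) K}"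
  by (auto intro!: bdd_belowI[of _ 0] dest: lip_bound_nonneg)

lemma norm_lipfam_le: "(\<And>d. lip_bound d (component (u :: 'a lipfam) d) K) \<Longrightarrow> norm u \<le> K"
  unfolding norm_lipfam_def by (rule cInf_lower) (auto simp: bdd_below_lip_bounds)

lemma lip_bound_norm: "lip_bound d (component (u :: 'a lipfam) d) (norm u)"
proof -
  define S where "S = {K. \<forall>d. lip_bound d (component u d) K}"
  have ne: "S \<noteq> {}" using component[of u] by (auto simp: S_def)
  have *: "cmod (component u d x) \<le> norm u" for x
    unfolding norm_lipfam_def S_def[symmetric] using ne
    by (intro cInf_greatest) (auto simp: S_def lip_bound_def)
  have "cmod (component u d x - component u d x') \<le> norm u * \<bar>d x x'\<bar>" for x x'
  proof (cases "d x x' = 0")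
    case True
    obtain K where "lip_bound d (component u d) K" using ne by (auto simp: S_def)
    then have "cmod (component u d x - component u d x') \<le> K * \<bar>d x x'\<bar>" by (simp add: lip_bound_def)
    then show ?thesis using True by simp
  next
    case False
    have "cmod (component u d x - component u d x') / \<bar>d x x'\<bar> \<le> norm u"
      unfolding norm_lipfam_def S_def[symmetric] using ne False
      by (intro cInf_greatest) (auto simp: S_def lip_bound_def divide_le_eq)
    then show ?thesis using False by (simp add: divide_le_eq)
  qed
  then show ?thesis using * by (simp add: lip_bound_def)
qed

lemma norm_component_le: "cmod (component (u :: 'a lipfam) d x) \<le> norm u"
  using lip_bound_norm[of d u] by (simp add: lip_bound_def)

instance
proof
  fix u v w :: "'a lipfam" and a b :: real
  show "u + v + w = u + (v + w)" "u + v = v + u" "0 + u = u" "- u + u = 0" "u - v = u + - v"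
    "a *\<^sub>R (u + v) = a *\<^sub>R u + a *\<^sub>R v" "(a + b) *\<^sub>R u = a *\<^sub>R u + b *\<^sub>R u"
    "a *\<^sub>R b *\<^sub>R u = (a * b) *\<^sub>R u" "1 *\<^sub>R u = u"
    by (transfer; auto simp: algebra_simps fun_eq_iff)+
  show "dist u v = norm (u - v)" by (rule dist_lipfam_def)
  show "sgn u = inverse (norm u) *\<^sub>R u" by (rule sgn_lipfam_def)
  show "uniformity = (INF e\<in>{0 <..}. principal {(x, y :: 'a lipfam). dist x y < e})"
    by (rule uniformity_lipfam_def)
  show "open U = (\<forall>x\<in>U. eventually (\<lambda>(x', y). x' = x \<longrightarrow> y \<in> U) uniformity)" for U :: "'a lipfam set"
    by (rule open_lipfam_def)
  have n0: "0 \<le> norm u" for u :: "'a lipfam" using lip_bound_nonneg[OF lip_bound_norm] .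
  show "norm u = 0 \<longleftrightarrow> u = 0"
  proof
    assume "norm u = 0"
    then show "u = 0" using norm_component_le[of u] by (intro lipfam_eqI) (simp add: zero_lipfam.rep_eq)
  next
    assume "u = 0"
    then have "norm u \<le> 0" by (intro norm_lipfam_le) (simp add: zero_lipfam.rep_eq)
    then show "norm u = 0" using n0[of u] by simp
  qed
  show "norm (u + v) \<le> norm u + norm v"
    by (intro norm_lipfam_le) (auto simp: plus_lipfam.rep_eq intro!: lip_bound_add lip_bound_norm)
  have le: "norm (a *\<^sub>R u) \<le> \<bar>a\<bar> * norm u" for a :: real and u :: "'a lipfam"
    using lip_bound_mult[OF lip_bound_norm[of _ u], where c = "of_real a"]
    by (intro norm_lipfam_le) (simp add: scaleR_lipfam.rep_eq)
  show "norm (a *\<^sub>R u) = \<bar>a\<bar> * norm u"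
  proof (cases "a = 0")
    case True
    then show ?thesis using le[of a u] n0[of "a *\<^sub>R u"] by simp
  next
    case False
    have "inverse a *\<^sub>R (a *\<^sub>R u) = u" using False by transfer (auto simp: fun_eq_iff)
    then have "norm u \<le> \<bar>inverse a\<bar> * norm (a *\<^sub>R u)" using le[of "inverse a" "a *\<^sub>R u"] by simp
    then show ?thesis using le[of a u] False by (auto simp: field_simps)
  qed
qed

end

instance lipfam :: (type) banach
proof
  fix X :: "nat \<Rightarrow> 'a lipfam"
  assume X: "Cauchy X"
  have conv: "convergent (\<lambda>n. component (X n) d x)" for d x
  proof (rule Cauchy_convergent, rule metric_CauchyI)
    fix e :: real assume "0 < e"
    then obtain M where M: "\<And>m n. m \<ge> M \<Longrightarrow> n \<ge> M \<Longrightarrow> dist (X m) (X n) < e"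
      using X unfolding Cauchy_def by blast
    show "\<exists>M. \<forall>m\<ge>M. \<forall>n\<ge>M. dist (component (X m) d x) (component (X n) d x) < e"
    proof (intro exI[of _ M] allI impI)
      fix m n assume "M \<le> m" "M \<le> n"
      then have "norm (X m - X n) < e" using M by (simp add: dist_norm)
      then show "dist (component (X m) d x) (component (X n) d x) < e"
        using norm_component_le[of "X m - X n" d x] by (simp add: dist_norm minus_lipfam.rep_eq)
    qed
  qed
  define L where "L d x = lim (\<lambda>n. component (X n) d x)" for d x
  have L: "(\<lambda>n. component (X n) d x) \<longlonglongrightarrow> L d x" for d x
    using conv unfolding L_def by (simp add: convergent_LIMSEQ_iff)
  have close: "lip_bound d (\<lambda>x. component (X m) d x - L d x) e"
    if M: "\<And>n. n \<ge> M \<Longrightarrow> norm (X m - X n) \<le> e" for m M e d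
  proof (rule lip_bound_limit)
    show "(\<lambda>n. component (X m) d x - component (X n) d x) \<longlonglongrightarrow> component (X m) d x - L d x" for x
      by (intro tendsto_intros L)
    show "\<forall>\<^sub>F n in sequentially. lip_bound d (\<lambda>x. component (X m) d x - component (X n) d x) e"
      using M lip_bound_mono[OF lip_bound_norm[of d "X m - X _"]]
      by (intro eventually_sequentiallyI[of M]) (simp add: minus_lipfam.rep_eq)
  qed
  obtain M0 where M0: "\<And>m n. m \<ge> M0 \<Longrightarrow> n \<ge> M0 \<Longrightarrow> norm (X m - X n) \<le> 1"
    using X unfolding Cauchy_def dist_norm by (meson less_imp_le zero_less_one)
  have "lip_bound d (L d) (norm (X M0) + 1)" for d
  proof -
    have "lip_bound d (\<lambda>x. component (X M0) d x - L d x) 1" using M0 by (intro close) auto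
    then have "lip_bound d (\<lambda>x. - (component (X M0) d x - L d x)) 1" by (simp only: lip_bound_uminus)
    from lip_bound_add[OF lip_bound_norm[of d "X M0"] this] show ?thesis by simp
  qed
  then have cL: "component (Abs_lipfam L) = L" by (intro Abs_lipfam_inverse) auto
  have "X \<longlonglongrightarrow> Abs_lipfam L"
  proof (rule metric_LIMSEQ_I)
    fix e :: real assume e: "0 < e"
    then obtain M where M: "\<And>m n. m \<ge> M \<Longrightarrow> n \<ge> M \<Longrightarrow> norm (X m - X n) \<le> e / 2"
      using X unfolding Cauchy_def dist_norm by (meson less_imp_le half_gt_zero)
    have "norm (X m - Abs_lipfam L) \<le> e / 2" if "m \<ge> M" for m
      using close[of M m "e / 2"] M that by (intro norm_lipfam_le) (simp add: minus_lipfam.rep_eq cL)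
    then show "\<exists>M. \<forall>m\<ge>M. dist (X m) (Abs_lipfam L) < e"
      using e by (intro exI[of _ M]) (force simp: dist_norm)
  qed
  then show "convergent X" by (auto simp: convergent_def)
qed

lemma component_simps [simp]:
  "component 0 d x = 0" "component (u + v) d x = component u d x + component v d x"
  "component (u - v) d x = component u d x - component v d x"
  "component (- u) d x = - component u d x"
  "component (r *\<^sub>R u) d x = of_real r * component u d x"
  by (simp_all add: zero_lipfam.rep_eq plus_lipfam.rep_eq minus_lipfam.rep_eq uminus_lipfam.rep_eq scaleR_lipfam.rep_eq)

lift_definition scaleC :: "complex \<Rightarrow> 'a lipfam \<Rightarrow> 'a lipfam" is "\<lambda>c u d x. c * u d x"
  by (blast intro: lip_bound_mult)

lemma component_scaleC [simp]: "component (scaleC c u) d x = c * component u d x"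
  by (simp add: scaleC.rep_eq)

lemma norm_scaleC_le: "norm (scaleC c u) \<le> cmod c * norm u"
  using lip_bound_mult[OF lip_bound_norm[of _ u], where c = c]
  by (intro norm_lipfam_le) (simp add: scaleC.rep_eq)

lemma bounded_linear_scaleC: "bounded_linear (scaleC c)"
  by (rule bounded_linear_intro[where K = "cmod c"])
    (auto intro!: lipfam_eqI order_trans[OF norm_scaleC_le] simp: algebra_simps)

lift_definition unit_lipfam :: "'a lipfam" is "\<lambda>_ _. 1"
  by (rule exI[of _ 1]) (simp add: lip_bound_def)

lemma norm_unit_lipfam: "norm (unit_lipfam :: 'a lipfam) \<noteq> 0"
proof -
  have "component (unit_lipfam :: 'a lipfam) d x \<noteq> component 0 d x" for d x
    by (simp add: unit_lipfam.rep_eq)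
  then show ?thesis by (metis norm_eq_zero)
qed

text \<open>
Bounded operators that are linear over the complex numbers; the type of bounded linear maps
only provides linearity over the reals, but scalars must commute with operators for evaluation to be multiplicative.
\<close>

typedef 'x lipop = "{A :: 'x lipfam \<Rightarrow>\<^sub>L 'x lipfam. \<forall>c u. blinfun_apply A (scaleC c u) = scaleC c (blinfun_apply A u)}"
  morphisms blinfun_of_lipop Abs_lipop
  by (rule exI[of _ 0]) (auto intro!: lipfam_eqI)

setup_lifting type_definition_lipop

instantiation lipop :: (type) real_normed_algebra_1
begin

lift_definition zero_lipop :: "'a lipop" is 0
  by (auto intro!: lipfam_eqI)

lift_definition one_lipop :: "'a lipop" is id_blinfun
  by simp

lift_definition plus_lipop :: "'a lipop \<Rightarrow> 'a lipop \<Rightarrow> 'a lipop" is "(+)"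
  by (auto intro!: lipfam_eqI simp: blinfun.bilinear_simps algebra_simps)

lift_definition uminus_lipop :: "'a lipop \<Rightarrow> 'a lipop" is "uminus"
  by (auto intro!: lipfam_eqI simp: blinfun.bilinear_simps)

lift_definition minus_lipop :: "'a lipop \<Rightarrow> 'a lipop \<Rightarrow> 'a lipop" is "(-)"
  by (auto intro!: lipfam_eqI simp: blinfun.bilinear_simps algebra_simps)

lift_definition times_lipop :: "'a lipop \<Rightarrow> 'a lipop \<Rightarrow> 'a lipop" is "(o\<^sub>L)"
  by simp

lift_definition scaleR_lipop :: "real \<Rightarrow> 'a lipop \<Rightarrow> 'a lipop" is "scaleR"
  by (auto intro!: lipfam_eqI simp: blinfun.bilinear_simps)

lift_definition norm_lipop :: "'a lipop \<Rightarrow> real" is norm .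

definition dist_lipop :: "'a lipop \<Rightarrow> 'a lipop \<Rightarrow> real" where
  "dist_lipop u v = norm (u - v)"

definition sgn_lipop :: "'a lipop \<Rightarrow> 'a lipop" where
  "sgn_lipop u = inverse (norm u) *\<^sub>R u"

definition uniformity_lipop :: "('a lipop \<times> 'a lipop) filter" where
  "uniformity_lipop = (INF e\<in>{0 <..}. principal {(x, y). dist x y < e})"

definition open_lipop :: "'a lipop set \<Rightarrow> bool" where
  "open_lipop U = (\<forall>x\<in>U. eventually (\<lambda>(x', y). x' = x \<longrightarrow> y \<in> U) uniformity)"

instance
proof
  fix u v w :: "'a lipop" and a b :: real
  show "u + v + w = u + (v + w)" "u + v = v + u" "0 + u = u" "- u + u = 0" "u - v = u + - v"
    "a *\<^sub>R (u + v) = a *\<^sub>R u + a *\<^sub>R v" "(a + b) *\<^sub>R u = a *\<^sub>R u + b *\<^sub>R u"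
    "a *\<^sub>R b *\<^sub>R u = (a * b) *\<^sub>R u" "1 *\<^sub>R u = u"
    by (transfer; auto simp: algebra_simps)+
  show "u * v * w = u * (v * w)" by transfer (auto intro: blinfun_eqI)
  show "1 * u = u" "u * 1 = u" by (transfer; auto intro: blinfun_eqI)+
  show "(u + v) * w = u * w + v * w" "u * (v + w) = u * v + u * w"
    "a *\<^sub>R u * v = a *\<^sub>R (u * v)" "u * a *\<^sub>R v = a *\<^sub>R (u * v)"
    by (transfer; auto intro!: blinfun_eqI simp: blinfun.bilinear_simps)+
  show "dist u v = norm (u - v)" by (rule dist_lipop_def)
  show "sgn u = inverse (norm u) *\<^sub>R u" by (rule sgn_lipop_def)
  show "uniformity = (INF e\<in>{0 <..}. principal {(x, y :: 'a lipop). dist x y < e})"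
    by (rule uniformity_lipop_def)
  show "open U = (\<forall>x\<in>U. eventually (\<lambda>(x', y). x' = x \<longrightarrow> y \<in> U) uniformity)" for U :: "'a lipop set"
    by (rule open_lipop_def)
  show "norm u = 0 \<longleftrightarrow> u = 0" by transfer simp
  show "norm (u + v) \<le> norm u + norm v" by transfer (rule norm_triangle_ineq)
  show "norm (a *\<^sub>R u) = \<bar>a\<bar> * norm u" by transfer simp
  show "norm (u * v) \<le> norm u * norm v" by transfer (rule norm_blinfun_compose)
  show n1: "norm (1 :: 'a lipop) = 1"
  proof (transfer, rule antisym)
    show "norm (id_blinfun :: 'a lipfam \<Rightarrow>\<^sub>L 'a lipfam) \<le> 1" by (rule norm_blinfun_bound) auto
    show "1 \<le> norm (id_blinfun :: 'a lipfam \<Rightarrow>\<^sub>L 'a lipfam)"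
      using norm_blinfun[of "id_blinfun :: 'a lipfam \<Rightarrow>\<^sub>L 'a lipfam" unit_lipfam] norm_unit_lipfam by (auto simp: mult_le_cancel_right1)
  qed
  show "(0 :: 'a lipop) \<noteq> 1"
  proof
    assume "(0 :: 'a lipop) = 1"
    then have "norm (0 :: 'a lipop) = 1" using n1 by simp
    then show False by transfer simp
  qed
qed

end

instance lipop :: (type) banach
proof
  fix X :: "nat \<Rightarrow> 'a lipop"
  assume X: "Cauchy X"
  have dist: "dist (blinfun_of_lipop u) (blinfun_of_lipop v) = dist u v" for u v :: "'a lipop"
    by (simp add: dist_norm norm_lipop.rep_eq minus_lipop.rep_eq)
  then have "Cauchy (\<lambda>n. blinfun_of_lipop (X n))" using X by (simp add: Cauchy_def)
  then obtain L where L: "(\<lambda>n. blinfun_of_lipop (X n)) \<longlonglongrightarrow> L"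
    using Cauchy_convergent_iff convergent_def by blast
  have app: "(\<lambda>n. blinfun_apply (blinfun_of_lipop (X n)) u) \<longlonglongrightarrow> blinfun_apply L u" for u
    by (rule blinfun.tendsto[OF L tendsto_const])
  have "blinfun_apply L (scaleC c u) = scaleC c (blinfun_apply L u)" for c u
  proof (rule LIMSEQ_unique[OF app])
    have "blinfun_apply (blinfun_of_lipop (X n)) (scaleC c u) = scaleC c (blinfun_apply (blinfun_of_lipop (X n)) u)" for n
      using blinfun_of_lipop[of "X n"] by simp
    then show "(\<lambda>n. blinfun_apply (blinfun_of_lipop (X n)) (scaleC c u)) \<longlonglongrightarrow> scaleC c (blinfun_apply L u)"
      using bounded_linear.tendsto[OF bounded_linear_scaleC app] by simp
  qed
  then have L': "blinfun_of_lipop (Abs_lipop L) = L" by (intro Abs_lipop_inverse) auto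
  have "X \<longlonglongrightarrow> Abs_lipop L"
    using L unfolding lim_sequentially dist[symmetric] L' .
  then show "convergent X" by (auto simp: convergent_def)
qed

definition app :: "'x lipop \<Rightarrow> 'x lipfam \<Rightarrow> 'x lipfam" where
  "app A = blinfun_apply (blinfun_of_lipop A)"

lemma app_simps [simp]:
  "app 0 u = 0" "app 1 u = u" "app (A + B) u = app A u + app B u" "app (A - B) u = app A u - app B u"
  "app (- A) u = - app A u" "app (A * B) u = app A (app B u)" "app (r *\<^sub>R A) u = r *\<^sub>R app A u"
  by (simp_all add: app_def zero_lipop.rep_eq one_lipop.rep_eq plus_lipop.rep_eq minus_lipop.rep_eq
      uminus_lipop.rep_eq times_lipop.rep_eq scaleR_lipop.rep_eq blinfun.bilinear_simps)

lemma app_linear [simp]: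
  "app A 0 = 0" "app A (u + v) = app A u + app A v" "app A (u - v) = app A u - app A v"
  "app A (- u) = - app A u" "app A (r *\<^sub>R u) = r *\<^sub>R app A u"
  by (simp_all add: app_def blinfun.bilinear_simps)

lemma app_scaleC [simp]: "app A (scaleC c u) = scaleC c (app A u)"
  using blinfun_of_lipop[of A] by (simp add: app_def)

lemma norm_app_le: "norm (app A u) \<le> norm A * norm u"
  unfolding app_def norm_lipop.rep_eq by (rule norm_blinfun)

lemma norm_lipop_le: "(\<And>u. norm (app A u) \<le> C * norm u) \<Longrightarrow> 0 \<le> C \<Longrightarrow> norm A \<le> C"
  unfolding app_def norm_lipop.rep_eq by (rule norm_blinfun_bound)

lemma bounded_linear_app_left: "bounded_linear (\<lambda>A. app A u)"
  by (rule bounded_linear_intro[where K = "norm u"]) (auto simp: norm_app_le)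

lemma lipop_eqI: "(\<And>u. app A u = app B u) \<Longrightarrow> A = B"
  unfolding app_def by (metis blinfun_eqI blinfun_of_lipop_inject)

lift_definition scalar_lipop :: "complex \<Rightarrow> 'x lipop" is "\<lambda>c. Blinfun (scaleC c)"
  by (auto simp: bounded_linear_Blinfun_apply[OF bounded_linear_scaleC] intro!: lipfam_eqI)

lemma app_scalar_lipop [simp]: "app (scalar_lipop c) u = scaleC c u"
  by (simp add: app_def scalar_lipop.rep_eq bounded_linear_Blinfun_apply[OF bounded_linear_scaleC])

interpretation lipop: complex_scalars "scalar_lipop :: complex \<Rightarrow> 'x lipop"
proof
  fix x y :: complex and a :: "'x lipop" and t :: real
  show "scalar_lipop (x + y) = scalar_lipop x + (scalar_lipop y :: 'x lipop)"
    "scalar_lipop (x * y) = scalar_lipop x * (scalar_lipop y :: 'x lipop)"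
    "scalar_lipop 1 = (1 :: 'x lipop)"
    by (auto intro!: lipop_eqI lipfam_eqI simp: algebra_simps)
  show "scalar_lipop x * a = a * scalar_lipop x" by (auto intro!: lipop_eqI)
  show "scalar_lipop (complex_of_real t) = (of_real t :: 'x lipop)"
    by (auto intro!: lipop_eqI lipfam_eqI simp: of_real_def)
  show "norm (scalar_lipop x * a) \<le> cmod x * norm a"
  proof (rule norm_lipop_le)
    fix u
    have "norm (scaleC x (app a u)) \<le> cmod x * (norm a * norm u)"
      by (rule order_trans[OF norm_scaleC_le mult_left_mono[OF norm_app_le]]) auto
    then show "norm (app (scalar_lipop x * a) u) \<le> cmod x * norm a * norm u" by (simp add: mult.assoc)
  qed auto
qed

section \<open>Operators acting on one component\<close>

text \<open>
Linearity is only required on Lipschitz functions, because the operators of interest are given by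
integrals and series that converge there.
\<close>

definition lip_op :: "('x \<Rightarrow> 'x \<Rightarrow> real) \<Rightarrow> (('x \<Rightarrow> complex) \<Rightarrow> 'x \<Rightarrow> complex) \<Rightarrow> real \<Rightarrow> bool" where
  "lip_op d L C \<longleftrightarrow> 0 \<le> C \<and> (\<forall>v K. lip_bound d v K \<longrightarrow> lip_bound d (L v) (C * K)) \<and>
     (\<forall>v w K. lip_bound d v K \<longrightarrow> lip_bound d w K \<longrightarrow> L (\<lambda>x. v x + w x) = (\<lambda>x. L v x + L w x)) \<and>
     (\<forall>v K c. lip_bound d v K \<longrightarrow> L (\<lambda>x. c * v x) = (\<lambda>x. c * L v x))"

definition component_op :: "('x \<Rightarrow> 'x \<Rightarrow> real) \<Rightarrow> (('x \<Rightarrow> complex) \<Rightarrow> 'x \<Rightarrow> complex) \<Rightarrow> 'x lipop" where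
  "component_op d L = Abs_lipop (Blinfun (\<lambda>u. Abs_lipfam (\<lambda>d'. if d' = d then L (component u d) else (\<lambda>_. 0))))"

definition embed :: "('x \<Rightarrow> 'x \<Rightarrow> real) \<Rightarrow> ('x \<Rightarrow> complex) \<Rightarrow> 'x lipfam" where
  "embed d v = Abs_lipfam (\<lambda>d'. if d' = d then v else (\<lambda>_. 0))"

lemma component_embed:
  assumes "lip_bound d v K"
  shows "component (embed d v) d' = (if d' = d then v else (\<lambda>_. 0))"
  unfolding embed_def using assms
  by (subst Abs_lipfam_inverse) (auto intro!: exI[of _ K] simp: lip_bound_nonneg)

lemma norm_embed_le: "lip_bound d v K \<Longrightarrow> norm (embed d v) \<le> K"
  by (rule norm_lipfam_le) (auto simp: component_embed lip_bound_nonneg)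

lemma
  assumes L: "lip_op d L C"
  shows app_component_op: "app (component_op d L) u = embed d (L (component u d))"
    and norm_component_op: "norm (component_op d L) \<le> C"
    and component_component_op: "component (app (component_op d L) u) d' = (if d' = d then L (component u d) else (\<lambda>_. 0))"
proof -
  define f where "f u = embed d (L (component u d))" for u
  have LN: "lip_bound d (L (component u d)) (C * norm u)" for u
    using L lip_bound_norm[of d u] by (auto simp: lip_op_def)
  have cf: "component (f u) d' = (if d' = d then L (component u d) else (\<lambda>_. 0))" for u d'
    unfolding f_def by (rule component_embed[OF LN])
  have add: "L (component (u + v) d) = (\<lambda>x. L (component u d) x + L (component v d) x)" for u v
  proof -
    have "component (u + v) d = (\<lambda>x. component u d x + component v d x)" by auto
    then show ?thesis
      using L lip_bound_mono[OF lip_bound_norm[of d u], of "max (norm u) (norm v)"]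
        lip_bound_mono[OF lip_bound_norm[of d v], of "max (norm u) (norm v)"]
      unfolding lip_op_def by (metis max.cobounded1 max.cobounded2)
  qed
  have scale: "L (component (scaleC c u) d) = (\<lambda>x. c * L (component u d) x)" for c u
  proof -
    have "component (scaleC c u) d = (\<lambda>x. c * component u d x)" by auto
    then show ?thesis using L lip_bound_norm[of d u] unfolding lip_op_def by metis
  qed
  have scaleR: "L (component (r *\<^sub>R u) d) = (\<lambda>x. of_real r * L (component u d) x)" for r u
  proof -
    have "component (r *\<^sub>R u) d = component (scaleC (of_real r) u) d" by auto
    then show ?thesis by (simp only: scale)
  qed
  have bl: "bounded_linear f"
  proof (rule bounded_linear_intro[where K = C])
    show "f (u + v) = f u + f v" for u v by (rule lipfam_eqI) (simp add: cf add)
    show "f (r *\<^sub>R u) = r *\<^sub>R f u" for u r by (rule lipfam_eqI) (simp add: cf scaleR)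
    show "norm (f u) \<le> norm u * C" for u
      unfolding f_def using norm_embed_le[OF LN[of u]] by (simp add: mult.commute)
  qed
  have "blinfun_of_lipop (component_op d L) = Blinfun f"
    unfolding component_op_def
  proof (subst Abs_lipop_inverse)
    show "Blinfun (\<lambda>u. Abs_lipfam (\<lambda>d'. if d' = d then L (component u d) else (\<lambda>_. 0)))
      \<in> {A. \<forall>c u. blinfun_apply A (scaleC c u) = scaleC c (blinfun_apply A u)}"
      unfolding embed_def[symmetric] f_def[symmetric]
      by (auto simp: bounded_linear_Blinfun_apply[OF bl] cf scale intro!: lipfam_eqI)
  qed (rule arg_cong[where f = Blinfun], simp add: embed_def f_def fun_eq_iff)
  then show 1: "app (component_op d L) u = embed d (L (component u d))" for u
    by (simp add: app_def bounded_linear_Blinfun_apply[OF bl] f_def)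
  show "norm (component_op d L) \<le> C"
    using L norm_embed_le[OF LN] by (intro norm_lipop_le) (auto simp: 1 lip_op_def)
  show "component (app (component_op d L) u) d' = (if d' = d then L (component u d) else (\<lambda>_. 0))"
    by (simp add: 1 f_def[symmetric] cf)
qed

section \<open>Gibbs-Markov maps\<close>

text \<open>
The function is a pointwise limit of functions that depend on finitely many symbols only, namely of its
values at a chosen point with the same first symbols.
\<close>

lemma measurable_of_itineraries:
  fixes v :: "'x \<Rightarrow> 'b::{real_normed_vector, second_countable_topology}" and it :: "nat \<Rightarrow> 'x \<Rightarrow> 'c::countable"
  assumes it: "\<And>k. it k \<in> measurable M (count_space UNIV)" and C [measurable]: "C \<in> sets M"
    and off: "\<And>x. x \<notin> C \<Longrightarrow> v x = 0"
    and close: "\<And>k x x'. x \<in> C \<Longrightarrow> x' \<in> C \<Longrightarrow> it k x = it k x' \<Longrightarrow> norm (v x - v x') \<le> \<epsilon> k"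
    and \<epsilon>: "\<epsilon> \<longlonglongrightarrow> (0::real)"
  shows "v \<in> borel_measurable M"
proof (rule borel_measurable_LIMSEQ_metric)
  define rep where "rep k w = (SOME y. y \<in> C \<and> it k y = w)" for k w
  have rep: "rep k (it k x) \<in> C" "it k (rep k (it k x)) = it k x" if "x \<in> C" for k x
    using someI[of "\<lambda>y. y \<in> C \<and> it k y = it k x" x] that unfolding rep_def by auto
  let ?v = "\<lambda>k x. if x \<in> C then v (rep k (it k x)) else 0"
  have "(\<lambda>x. v (rep k (it k x))) \<in> borel_measurable M" for k
    by (rule measurable_compose[OF it]) simp
  then show "?v k \<in> borel_measurable M" for k by simp
  fix x
  show "(\<lambda>k. ?v k x) \<longlonglongrightarrow> v x"
  proof (cases "x \<in> C")
    case True
    have "norm (?v k x - v x) \<le> \<epsilon> k" for k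
      using close[OF rep(1)[OF True] True rep(2)[OF True], of k] True by simp
    then have "(\<lambda>k. ?v k x - v x) \<longlonglongrightarrow> 0"
      by (intro Lim_null_comparison[OF always_eventually \<epsilon>] allI)
    then show ?thesis by (rule LIM_zero_cancel)
  qed (simp add: off)
qed

text \<open>
A Gibbs-Markov map whose properties hold at every point of an invariant set \<open>D\<close> of full measure. The symbol
\<open>\<kappa> x\<close> names the partition element of \<open>x\<close>. The assumption \<open>image_cell\<close> is the Markov property: the image of
a cell is a union of cells. The assumption \<open>jacobian\<close> says that \<open>g\<close> is the density of the measure with respect to
its image, read in the range of a branch.

Points outside \<open>D\<close> have distance \<open>2\<close> from everything, so that the Lipschitz condition there follows from the
bound on the supremum. The assumption \<open>support\<close> says that every cylinder meeting \<open>D\<close> has positive measure; by it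
almost everywhere identities between Lipschitz functions hold on all of \<open>D\<close>.
\<close>

locale gibbs_markov_map = prob_space M for M :: "'x measure" +
  fixes F :: "'x \<Rightarrow> 'x" and D :: "'x set" and \<kappa> :: "'x \<Rightarrow> nat" and g :: "'x \<Rightarrow> real"
    and d :: "'x \<Rightarrow> 'x \<Rightarrow> real" and \<theta> C\<^sub>0 c\<^sub>0 :: real
  assumes D_sets [measurable]: "D \<in> sets M" and D_full: "AE x in M. x \<in> D"
    and F_measurable [measurable]: "F \<in> measurable M M" and F_invariant: "distr M M F = M"
    and F_D: "x \<in> D \<Longrightarrow> F x \<in> D"
    and F_ergodic: "A \<in> sets M \<Longrightarrow> F -` A \<inter> space M = A \<Longrightarrow> emeasure M A = 0 \<or> emeasure M A = 1"
    and kappa_measurable [measurable]: "\<kappa> \<in> measurable M (count_space UNIV)"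
    and inj_cell: "inj_on F {x \<in> D. \<kappa> x = i}"
    and image_sets: "A \<in> sets M \<Longrightarrow> A \<subseteq> {x \<in> D. \<kappa> x = i} \<Longrightarrow> F ` A \<in> sets M"
    and image_cell: "x \<in> F ` {y \<in> D. \<kappa> y = i} \<Longrightarrow> x' \<in> D \<Longrightarrow> \<kappa> x' = \<kappa> x \<Longrightarrow> x' \<in> F ` {y \<in> D. \<kappa> y = i}"
    and g_measurable [measurable]: "g \<in> borel_measurable M"
    and g_pos: "x \<in> D \<Longrightarrow> 0 < g x"
    and jacobian: "A \<in> sets M \<Longrightarrow> A \<subseteq> {x \<in> D. \<kappa> x = i} \<Longrightarrow>
      emeasure M A = (\<integral>\<^sup>+x. ennreal (g (inv_into {x \<in> D. \<kappa> x = i} F x)) * indicator (F ` A) x \<partial>M)"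
    and distortion: "x \<in> D \<Longrightarrow> x' \<in> D \<Longrightarrow> \<kappa> x' = \<kappa> x \<Longrightarrow> \<bar>ln (g x) - ln (g x')\<bar> \<le> C\<^sub>0 * d (F x) (F x')"
    and C0: "0 \<le> C\<^sub>0" and c0: "0 < c\<^sub>0"
    and big_images: "x \<in> D \<Longrightarrow> c\<^sub>0 \<le> measure M (F ` {y \<in> D. \<kappa> y = \<kappa> x})"
    and theta: "0 < \<theta>" "\<theta> < 1"
    and d_nonneg: "0 \<le> d x x'"
    and d_le_1: "x \<in> D \<Longrightarrow> x' \<in> D \<Longrightarrow> d x x' \<le> 1"
    and d_distinct: "x \<in> D \<Longrightarrow> x' \<in> D \<Longrightarrow> \<kappa> x' \<noteq> \<kappa> x \<Longrightarrow> d x x' = 1"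
    and d_shift: "x \<in> D \<Longrightarrow> x' \<in> D \<Longrightarrow> \<kappa> x' = \<kappa> x \<Longrightarrow> d x x' = \<theta> * d (F x) (F x')"
    and d_off: "x \<notin> D \<or> x' \<notin> D \<Longrightarrow> d x x' = 2"
    and support: "x \<in> D \<Longrightarrow> AE y in M. P y \<Longrightarrow> \<exists>y\<in>D. P y \<and> (\<forall>i<k. \<kappa> ((F ^^ i) y) = \<kappa> ((F ^^ i) x))"
begin

definition cell :: "nat \<Rightarrow> 'x set" where
  "cell i = {x \<in> D. \<kappa> x = i}"

definition branch :: "nat \<Rightarrow> 'x \<Rightarrow> 'x" where
  "branch i = inv_into (cell i) F"

text \<open>
The weight of the \<open>i\<close>-th inverse branch.
\<close>

definition G :: "nat \<Rightarrow> 'x \<Rightarrow> real" where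
  "G i x = (if x \<in> F ` cell i then g (branch i x) else 0)"

definition m :: "nat \<Rightarrow> real" where
  "m i = measure M (cell i)"

definition C\<^sub>G :: real where
  "C\<^sub>G = exp C\<^sub>0 / c\<^sub>0"

definition C\<^sub>L :: real where
  "C\<^sub>L = C\<^sub>0 * exp C\<^sub>0"

lemma D_subset: "D \<subseteq> space M"
  by (rule sets.sets_into_space[OF D_sets])

lemma cell_sets [measurable]: "cell i \<in> sets M"
proof -
  have "cell i = D \<inter> (\<kappa> -` {i} \<inter> space M)" using D_subset by (auto simp: cell_def)
  then show ?thesis by simp
qed

lemma cell_subset: "cell i \<subseteq> D" and cell_kappa: "x \<in> D \<Longrightarrow> x \<in> cell (\<kappa> x)"
  by (auto simp: cell_def)

lemma branch_in_cell: "x \<in> F ` cell i \<Longrightarrow> branch i x \<in> cell i"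
  and F_branch: "x \<in> F ` cell i \<Longrightarrow> F (branch i x) = x"
  unfolding branch_def by (simp_all add: inv_into_into f_inv_into_f)

lemma branch_F: "x \<in> cell i \<Longrightarrow> branch i (F x) = x"
  unfolding branch_def using inj_cell[of i] by (simp add: cell_def inv_into_f_f)

lemma image_subset: "F ` cell i \<subseteq> D"
  using F_D cell_subset by auto

lemma image_cell_sets: "A \<in> sets M \<Longrightarrow> A \<subseteq> cell i \<Longrightarrow> F ` A \<in> sets M"
  using image_sets[of A i] by (simp add: cell_def)

lemma image_sets' [measurable]: "F ` cell i \<in> sets M"
  by (rule image_cell_sets) auto

lemma image_iff_kappa: "x \<in> D \<Longrightarrow> x' \<in> D \<Longrightarrow> \<kappa> x' = \<kappa> x \<Longrightarrow> x' \<in> F ` cell i \<longleftrightarrow> x \<in> F ` cell i"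
  using image_cell[of x i x'] image_cell[of x' i x] by (auto simp: cell_def)

lemma d_branch:
  assumes "x \<in> F ` cell i" "x' \<in> F ` cell i"
  shows "d (branch i x) (branch i x') = \<theta> * d x x'"
proof -
  have "branch i x \<in> cell i" "branch i x' \<in> cell i" using assms by (auto intro: branch_in_cell)
  then show ?thesis
    using d_shift[of "branch i x" "branch i x'"] assms by (auto simp: cell_def F_branch)
qed

lemma G_nonneg: "0 \<le> G i x"
  using branch_in_cell[of x i] cell_subset[of i] g_pos[of "branch i x"] by (auto simp: G_def less_imp_le)

lemma G_off: "x \<notin> D \<Longrightarrow> G i x = 0"
  using image_subset by (auto simp: G_def)

lemma C\<^sub>G_nonneg: "0 \<le> C\<^sub>G"
  using c0 by (simp add: C\<^sub>G_def)

lemma C\<^sub>L_nonneg: "0 \<le> C\<^sub>L"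
  using C0 by (simp add: C\<^sub>L_def)

lemma G_distortion:
  assumes "x \<in> D" "x' \<in> D" "\<kappa> x' = \<kappa> x"
  shows "G i x \<le> exp (C\<^sub>0 * d x x') * G i x'" and "G i x' \<le> exp (C\<^sub>0 * d x x') * G i x"
proof -
  have "G i x \<le> exp (C\<^sub>0 * d x x') * G i x' \<and> G i x' \<le> exp (C\<^sub>0 * d x x') * G i x"
  proof (cases "x \<in> F ` cell i")
    case True
    then have x': "x' \<in> F ` cell i" using image_iff_kappa[OF assms, of i] by simp
    define y y' where "y = branch i x" and "y' = branch i x'"
    have y: "y \<in> cell i" "y' \<in> cell i" "F y = x" "F y' = x'"
      using True x' by (auto simp: y_def y'_def branch_in_cell F_branch)
    then have "y \<in> D" "y' \<in> D" "\<kappa> y' = \<kappa> y" by (auto simp: cell_def)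
    from distortion[OF this] g_pos[OF this(1)] g_pos[OF this(2)] y
    have "ln (g y) \<le> C\<^sub>0 * d x x' + ln (g y')" "ln (g y') \<le> C\<^sub>0 * d x x' + ln (g y)" "0 < g y" "0 < g y'"
      by auto
    then have "g y \<le> exp (C\<^sub>0 * d x x' + ln (g y'))" "g y' \<le> exp (C\<^sub>0 * d x x' + ln (g y))"
      by (metis exp_le_cancel_iff exp_ln)+
    then show ?thesis
      using True x' \<open>0 < g y\<close> \<open>0 < g y'\<close> by (simp add: G_def y_def y'_def exp_add)
  next
    case False
    then show ?thesis using image_iff_kappa[OF assms, of i] by (simp add: G_def)
  qed
  then show "G i x \<le> exp (C\<^sub>0 * d x x') * G i x'" and "G i x' \<le> exp (C\<^sub>0 * d x x') * G i x" by auto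
qed

lemma G_diff:
  assumes x: "x \<in> D" "x' \<in> D" "\<kappa> x' = \<kappa> x"
  shows "\<bar>G i x - G i x'\<bar> \<le> C\<^sub>L * d x x' * G i x"
proof -
  define t where "t = C\<^sub>0 * d x x'"
  have t: "0 \<le> t" "t \<le> C\<^sub>0" using C0 d_nonneg d_le_1[OF x(1,2)] by (auto simp: t_def mult_left_le)
  have GG: "G i x \<le> exp t * G i x'" "G i x' \<le> exp t * G i x" unfolding t_def by (rule G_distortion[OF x])+
  have e: "1 - t \<le> exp (-t)" using exp_ge_add_one_self[of "-t"] by simp
  then have "exp t - 1 \<le> t * exp t"
    using mult_right_mono[OF e, of "exp t"] by (simp add: algebra_simps flip: exp_add)
  also have "\<dots> \<le> t * exp C\<^sub>0" using t by (intro mult_left_mono) auto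
  finally have "(exp t - 1) * G i x \<le> t * exp C\<^sub>0 * G i x" using G_nonneg by (intro mult_right_mono)
  then have 1: "G i x' - G i x \<le> t * exp C\<^sub>0 * G i x" using GG by (simp add: algebra_simps)
  have "exp (-t) * G i x \<le> G i x'"
    using mult_left_mono[OF GG(1), of "exp (-t)"] by (simp add: mult.assoc [symmetric] flip: exp_add)
  then have "G i x - G i x' \<le> t * G i x"
    using mult_right_mono[OF e G_nonneg[of i x]] by (simp add: algebra_simps)
  also have "\<dots> \<le> (t * exp C\<^sub>0) * G i x"
    using t C0 G_nonneg by (intro mult_right_mono) (auto simp: mult_le_cancel_left1)
  finally show ?thesis using 1 by (simp add: C\<^sub>L_def t_def mult_ac abs_le_iff)
qed

text \<open>
By distortion the weight is constant on the image up to the factor \<open>exp C\<^sub>0\<close>; it integrates to the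
mass of the cell, and the image has mass at least \<open>c\<^sub>0\<close>.
\<close>

lemma G_le: "G i x \<le> C\<^sub>G * m i"
proof (cases "x \<in> F ` cell i")
  case True
  have xD: "branch i x \<in> D" "\<kappa> (branch i x) = i" using branch_in_cell[OF True] by (auto simp: cell_def)
  have low: "exp (- C\<^sub>0) * G i x \<le> g (branch i x')" if x': "x' \<in> F ` cell i" for x'
  proof -
    have "branch i x' \<in> D" "\<kappa> (branch i x') = i" using branch_in_cell[OF x'] by (auto simp: cell_def)
    then have "\<bar>ln (g (branch i x')) - ln (g (branch i x))\<bar> \<le> C\<^sub>0 * d x' x"
      using distortion[of "branch i x'" "branch i x"] xD F_branch[OF x'] F_branch[OF True] by simp
    moreover have "C\<^sub>0 * d x' x \<le> C\<^sub>0 * 1"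
      using d_le_1[of x' x] C0 x' True image_subset[of i] by (intro mult_left_mono) auto
    ultimately have "\<bar>ln (g (branch i x')) - ln (g (branch i x))\<bar> \<le> C\<^sub>0" by simp
    then have "- C\<^sub>0 + ln (g (branch i x)) \<le> ln (g (branch i x'))" by linarith
    then have "exp (- C\<^sub>0 + ln (g (branch i x))) \<le> exp (ln (g (branch i x')))" by simp
    then show ?thesis using g_pos[OF \<open>branch i x' \<in> D\<close>] g_pos[OF xD(1)] True by (simp add: exp_diff exp_minus G_def field_simps)
  qed
  have "ennreal (exp (- C\<^sub>0) * G i x * c\<^sub>0) \<le> ennreal (exp (- C\<^sub>0) * G i x) * emeasure M (F ` cell i)"
    using big_images[OF xD(1)] xD(2) G_nonneg[of i x] c0
    by (simp add: ennreal_mult' emeasure_eq_measure cell_def mult_left_mono)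
  also have "\<dots> = (\<integral>\<^sup>+x'. ennreal (exp (- C\<^sub>0) * G i x) * indicator (F ` cell i) x' \<partial>M)"
    by (rule nn_integral_cmult_indicator[symmetric]) (rule image_cell_sets, auto)
  also have "\<dots> \<le> (\<integral>\<^sup>+x'. ennreal (g (branch i x')) * indicator (F ` cell i) x' \<partial>M)"
    using low by (intro nn_integral_mono) (auto simp: indicator_def intro!: ennreal_leI)
  also have "\<dots> = emeasure M (cell i)"
    using jacobian[of "cell i" i] by (simp add: cell_def branch_def)
  finally have "exp (- C\<^sub>0) * G i x * c\<^sub>0 \<le> m i"
    by (simp add: m_def emeasure_eq_measure)
  then have "exp C\<^sub>0 * (exp (- C\<^sub>0) * G i x * c\<^sub>0) \<le> exp C\<^sub>0 * m i" by (intro mult_left_mono) auto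
  then show ?thesis using c0 by (simp add: C\<^sub>G_def field_simps exp_minus)
next
  case False
  then show ?thesis using C\<^sub>G_nonneg by (simp add: G_def m_def)
qed

lemma measure_cells: "(\<lambda>i. if P i then m i else 0) sums measure M {x \<in> D. P (\<kappa> x)}"
proof -
  define A where "A i = (if P i then cell i else {})" for i
  have dis: "disjoint_family A" by (auto simp: disjoint_family_on_def A_def cell_def)
  have "(\<lambda>i. measure M (A i)) sums measure M (\<Union>i. A i)"
    by (intro finite_measure_UNION dis) (simp add: A_def image_subset_iff)
  moreover have "(\<Union>i. A i) = {x \<in> D. P (\<kappa> x)}" by (auto simp: A_def cell_def split: if_splits)
  moreover have "(\<lambda>i. measure M (A i)) = (\<lambda>i. if P i then m i else 0)" by (auto simp: A_def m_def)
  ultimately show ?thesis by simp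
qed

lemma measure_D: "measure M D = 1"
  using D_full by (simp add: prob_eq_1)

lemma m_sums: "m sums 1"
  using measure_cells[of "\<lambda>_. True"] measure_D by simp

lemma summable_m: "summable m"
  using m_sums by (rule sums_summable)

lemma summable_G_le:
  assumes "\<And>i. norm (f i :: 'b::banach) \<le> B * G i x" 
  shows "summable (\<lambda>i. norm (f i))" "summable f"
proof -
  have "norm (f i) \<le> (\<bar>B\<bar> * C\<^sub>G) * m i" for i
  proof -
    have "norm (f i) \<le> \<bar>B\<bar> * G i x" using assms[of i] mult_right_mono[OF abs_ge_self[of B] G_nonneg[of i x]] by linarith
    also have "\<dots> \<le> \<bar>B\<bar> * (C\<^sub>G * m i)" using G_le by (intro mult_left_mono) auto
    finally show ?thesis by (simp add: mult.assoc)
  qed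
  then show "summable (\<lambda>i. norm (f i))"
    by (intro summable_comparison_test'[OF summable_mult[OF summable_m]]) auto
  then show "summable f" by (rule summable_norm_cancel)
qed

lemma summable_G: "summable (\<lambda>i. G i x)"
  by (rule summable_G_le[where B = 1 and x = x]) (simp add: G_nonneg)

text \<open>
The inverse branch, made total and measurable by the identity off the image.
\<close>

definition branch' :: "nat \<Rightarrow> 'x \<Rightarrow> 'x" where
  "branch' i x = (if x \<in> F ` cell i then branch i x else x)"

lemma branch'_vimage:
  assumes "A \<in> sets M"
  shows "branch' i -` A \<inter> space M = F ` (A \<inter> cell i) \<union> (A - F ` cell i)"
proof -
  have "x \<in> space M" if "x \<in> F ` cell i" for x using that image_subset D_subset by blast
  moreover have "branch i x \<in> A \<longleftrightarrow> x \<in> F ` (A \<inter> cell i)" if x: "x \<in> F ` cell i" for x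
  proof
    assume "branch i x \<in> A"
    then show "x \<in> F ` (A \<inter> cell i)"
      using branch_in_cell[OF x] F_branch[OF x] by (intro image_eqI[of _ _ "branch i x"]) auto
  qed (auto simp: branch_F)
  ultimately show ?thesis using sets.sets_into_space[OF assms] by (auto simp: branch'_def split: if_splits)
qed

lemma branch'_measurable [measurable]: "branch' i \<in> measurable M M"
proof (rule measurableI)
  fix x assume "x \<in> space M"
  then show "branch' i x \<in> space M"
    using branch_in_cell[of x i] cell_subset[of i] D_subset unfolding branch'_def by auto
next
  fix A assume A: "A \<in> sets M"
  then show "branch' i -` A \<inter> space M \<in> sets M"
    using image_cell_sets[of "A \<inter> cell i" i] by (simp add: branch'_vimage sets.Int sets.Diff)
qed

lemma G_branch': "G i x = indicator (F ` cell i) x * g (branch' i x)"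
  by (simp add: G_def branch'_def)

lemma G_measurable [measurable]: "G i \<in> borel_measurable M"
  unfolding G_branch' by measurable

lemma distr_branch:
  "distr (density M (\<lambda>x. ennreal (G i x))) M (branch' i) = density M (indicator (cell i))"
proof (rule measure_eqI)
  fix A assume "A \<in> sets (distr (density M (\<lambda>x. ennreal (G i x))) M (branch' i))"
  then have A [measurable]: "A \<in> sets M" by simp
  have "emeasure (distr (density M (\<lambda>x. ennreal (G i x))) M (branch' i)) A
      = (\<integral>\<^sup>+x. ennreal (G i x) * indicator (branch' i -` A \<inter> space M) x \<partial>M)"
    by (subst emeasure_distr) (auto simp: emeasure_density intro: measurable_sets)
  also have "\<dots> = (\<integral>\<^sup>+x. ennreal (g (branch i x)) * indicator (F ` (A \<inter> cell i)) x \<partial>M)"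
    unfolding branch'_vimage[OF A] by (intro nn_integral_cong) (auto simp: G_def indicator_def)
  also have "\<dots> = emeasure M (A \<inter> cell i)"
    using jacobian[of "A \<inter> cell i" i] by (auto simp: cell_def branch_def)
  also have "\<dots> = emeasure (density M (indicator (cell i))) A"
    by (simp add: emeasure_density Int_commute flip: indicator_inter_arith)
  finally show "emeasure (distr (density M (\<lambda>x. ennreal (G i x))) M (branch' i)) A = emeasure (density M (indicator (cell i))) A" .
qed simp

lemma
  fixes h :: "'x \<Rightarrow> 'b::{banach, second_countable_topology}"
  assumes h [measurable]: "h \<in> borel_measurable M"
  shows integral_cell: "(\<integral>x. G i x *\<^sub>R h (branch i x) \<partial>M) = (\<integral>x. indicator (cell i) x *\<^sub>R h x \<partial>M)"
    and integrable_cell: "integrable M (\<lambda>x. G i x *\<^sub>R h (branch i x)) \<longleftrightarrow> integrable M (\<lambda>x. indicator (cell i) x *\<^sub>R h x)"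
    and measurable_cell: "(\<lambda>x. G i x *\<^sub>R h (branch i x)) \<in> borel_measurable M"
proof -
  have eq: "(\<lambda>x. G i x *\<^sub>R h (branch i x)) = (\<lambda>x. G i x *\<^sub>R h (branch' i x))"
    by (auto simp: G_def branch'_def)
  have den: "density M (indicator (cell i)) = density M (\<lambda>x. ennreal (indicator (cell i) x))"
    by (simp add: ennreal_indicator)
  show "(\<integral>x. G i x *\<^sub>R h (branch i x) \<partial>M) = (\<integral>x. indicator (cell i) x *\<^sub>R h x \<partial>M)"
    using arg_cong[OF distr_branch[of i], of "\<lambda>N. \<integral>x. h x \<partial>N"] unfolding eq den
    by (simp add: integral_distr integral_density G_nonneg)
  show "integrable M (\<lambda>x. G i x *\<^sub>R h (branch i x)) \<longleftrightarrow> integrable M (\<lambda>x. indicator (cell i) x *\<^sub>R h x)"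
    using arg_cong[OF distr_branch[of i], of "\<lambda>N. integrable N h"] unfolding eq den
    by (simp add: integrable_distr_eq integrable_density G_nonneg)
  show "(\<lambda>x. G i x *\<^sub>R h (branch i x)) \<in> borel_measurable M"
    unfolding eq by measurable
qed

section \<open>The transfer operator\<close>

text \<open>
The argument may depend on the branch. In this way restrictions to some branches and factors
that depend on the return time are treated together.
\<close>

definition transfer :: "(nat \<Rightarrow> 'x \<Rightarrow> 'b) \<Rightarrow> 'x \<Rightarrow> 'b::{banach, second_countable_topology}" where
  "transfer f x = (\<Sum>i. G i x *\<^sub>R f i (branch i x))"

lemma transfer_off: "x \<notin> D \<Longrightarrow> transfer f x = 0"
  by (simp add: transfer_def G_off)

lemma transfer_cong:
  "(\<And>i y. y \<in> cell i \<Longrightarrow> f i y = f' i y) \<Longrightarrow> transfer f x = transfer f' x"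
  unfolding transfer_def by (intro suminf_cong) (auto simp: G_def branch_in_cell)

lemma norm_G_scale_le:
  assumes "\<And>y. y \<in> cell i \<Longrightarrow> norm (h y) \<le> B"
  shows "norm (G i x *\<^sub>R h (branch i x)) \<le> B * G i x"
proof (cases "x \<in> F ` cell i")
  case True
  then show ?thesis using mult_right_mono[OF assms[OF branch_in_cell[OF True]] G_nonneg[of i x]]
    by (simp add: G_nonneg mult.commute[of "G i x"])
qed (simp add: G_def)

lemma summable_transfer:
  fixes f :: "nat \<Rightarrow> 'x \<Rightarrow> 'b::{banach, second_countable_topology}"
  assumes "\<And>i y. y \<in> cell i \<Longrightarrow> norm (f i y) \<le> B"
  shows "summable (\<lambda>i. norm (G i x *\<^sub>R f i (branch i x)))" "summable (\<lambda>i. G i x *\<^sub>R f i (branch i x))"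
  by (rule summable_G_le[of _ B x], rule norm_G_scale_le, rule assms, assumption)+

lemma measurable_transfer:
  fixes f :: "nat \<Rightarrow> 'x \<Rightarrow> 'b::{banach, second_countable_topology}"
  assumes "\<And>i. f i \<in> borel_measurable M" "\<And>i y. y \<in> cell i \<Longrightarrow> norm (f i y) \<le> B"
  shows "transfer f \<in> borel_measurable M"
proof (rule borel_measurable_LIMSEQ_metric)
  show "(\<lambda>x. \<Sum>i<n. G i x *\<^sub>R f i (branch i x)) \<in> borel_measurable M" for n
    by (intro borel_measurable_sum measurable_cell assms)
  show "(\<lambda>n. \<Sum>i<n. G i x *\<^sub>R f i (branch i x)) \<longlonglongrightarrow> transfer f x" for x
    unfolding transfer_def by (rule summable_LIMSEQ[OF summable_transfer(2)[OF assms(2)]])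
qed

lemma suminf_indicator_cell:
  fixes h :: "nat \<Rightarrow> 'b::{banach}"
  shows "(\<lambda>i. indicator (cell i) y *\<^sub>R h i) sums (indicator D y *\<^sub>R h (\<kappa> y))"
proof -
  have "(\<lambda>i. indicator (cell i) y *\<^sub>R h i) = (\<lambda>i. if i = \<kappa> y then indicator D y *\<^sub>R h (\<kappa> y) else 0)"
    by (auto simp: cell_def indicator_def)
  then show ?thesis using sums_single[of "\<kappa> y" "\<lambda>_. indicator D y *\<^sub>R h (\<kappa> y)"] by simp
qed

text \<open>
Branch by branch this is the change of variables \<open>distr_branch\<close>; the branches are summed by dominated
convergence, with the masses of the cells as a majorant.
\<close>

lemma transfer_duality:
  fixes f :: "nat \<Rightarrow> 'x \<Rightarrow> 'b::{real_normed_algebra, banach, second_countable_topology}"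
  assumes f: "\<And>i. f i \<in> borel_measurable M" "\<And>i y. y \<in> cell i \<Longrightarrow> norm (f i y) \<le> B"
    and w [measurable]: "w \<in> borel_measurable M" and W: "\<And>x. x \<in> D \<Longrightarrow> norm (w x) \<le> W"
  shows "(\<integral>x. transfer f x * w x \<partial>M) = (\<integral>y. indicator D y *\<^sub>R (f (\<kappa> y) y * w (F y)) \<partial>M)"
    and "integrable M (\<lambda>x. transfer f x * w x)"
proof -
  note f(1)[measurable]
  define h where "h i y = f i y * w (F y)" for i y
  have h [measurable]: "h i \<in> borel_measurable M" for i unfolding h_def by measurable
  have hb: "norm (h i y) \<le> \<bar>B\<bar> * \<bar>W\<bar>" if "y \<in> cell i" for i y
  proof -
    have "F y \<in> D" using that F_D cell_subset by blast
    then have "norm (f i y) \<le> \<bar>B\<bar>" "norm (w (F y)) \<le> \<bar>W\<bar>"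
      using f(2)[OF that] W[of "F y"] by auto
    then show ?thesis unfolding h_def by (intro order_trans[OF norm_mult_ineq] mult_mono) auto
  qed
  have termeq: "G i x *\<^sub>R (f i (branch i x) * w x) = G i x *\<^sub>R h i (branch i x)" for i x
    by (cases "x \<in> F ` cell i") (auto simp: G_def h_def F_branch)
  have sum: "transfer f x * w x = (\<Sum>i. G i x *\<^sub>R h i (branch i x))" for x
    unfolding transfer_def using summable_transfer(2)[where f = f and x = x, OF f(2)] by (subst suminf_mult2) (auto simp: termeq)
  have int_cell: "integrable M (\<lambda>y. indicator (cell i) y *\<^sub>R h i y)" for i
    by (rule integrable_const_bound[where B = "\<bar>B\<bar> * \<bar>W\<bar>"]) (auto simp: indicator_def hb)
  have int: "integrable M (\<lambda>x. G i x *\<^sub>R h i (branch i x))" for i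
    using int_cell by (subst integrable_cell) auto
  have le: "(\<integral>y. norm (indicator (cell i) y *\<^sub>R h i y) \<partial>M) \<le> \<bar>B\<bar> * \<bar>W\<bar> * m i" for i
  proof -
    have "(\<integral>y. norm (indicator (cell i) y *\<^sub>R h i y) \<partial>M) \<le> (\<integral>y. \<bar>B\<bar> * \<bar>W\<bar> * indicator (cell i) y \<partial>M)"
    proof (intro integral_mono integrable_norm int_cell)
      show "integrable M (\<lambda>y. \<bar>B\<bar> * \<bar>W\<bar> * indicator (cell i) y)"
        by (rule integrable_const_bound[where B = "\<bar>B\<bar> * \<bar>W\<bar>"]) (auto simp: indicator_def)
    qed (auto simp: indicator_def hb)
    then show ?thesis by (simp add: m_def cell_sets)
  qed
  have le': "(\<integral>x. norm (G i x *\<^sub>R h i (branch i x)) \<partial>M) = (\<integral>y. norm (indicator (cell i) y *\<^sub>R h i y) \<partial>M)" for i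
    using integral_cell[of "\<lambda>y. norm (h i y)" i] G_nonneg by simp
  have smb: "summable (\<lambda>i. \<integral>y. norm (indicator (cell i) y *\<^sub>R h i y) \<partial>M)"
    by (rule summable_comparison_test'[OF summable_mult[OF summable_m, of "\<bar>B\<bar> * \<bar>W\<bar>"]]) (use le in auto)
  then have smb': "summable (\<lambda>i. \<integral>x. norm (G i x *\<^sub>R h i (branch i x)) \<partial>M)" by (simp only: le')
  have AE1: "AE x in M. summable (\<lambda>i. norm (G i x *\<^sub>R h i (branch i x)))"
    by (intro AE_I2 summable_transfer(1)[where f = h, OF hb])
  have AE2: "AE y in M. summable (\<lambda>i. norm (indicator (cell i) y *\<^sub>R h i y))"
  proof (rule AE_I2)
    fix y
    have "(\<lambda>i. norm (indicator (cell i) y *\<^sub>R h i y)) = (\<lambda>i. indicator (cell i) y *\<^sub>R norm (h i y))"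
      by (auto simp: indicator_def)
    then show "summable (\<lambda>i. norm (indicator (cell i) y *\<^sub>R h i y))"
      using sums_summable[OF suminf_indicator_cell[of y "\<lambda>i. norm (h i y)"]] by simp
  qed
  have "(\<integral>x. transfer f x * w x \<partial>M) = (\<Sum>i. \<integral>x. G i x *\<^sub>R h i (branch i x) \<partial>M)"
    unfolding sum by (intro integral_suminf int AE1 smb')
  also have "\<dots> = (\<Sum>i. \<integral>y. indicator (cell i) y *\<^sub>R h i y \<partial>M)"
    by (simp add: integral_cell)
  also have "\<dots> = (\<integral>y. (\<Sum>i. indicator (cell i) y *\<^sub>R h i y) \<partial>M)"
    using smb by (intro integral_suminf[symmetric] int_cell AE2)
  also have "\<dots> = (\<integral>y. indicator D y *\<^sub>R (f (\<kappa> y) y * w (F y)) \<partial>M)"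
    by (subst sums_unique[OF suminf_indicator_cell, symmetric]) (simp add: h_def)
  finally show "(\<integral>x. transfer f x * w x \<partial>M) = (\<integral>y. indicator D y *\<^sub>R (f (\<kappa> y) y * w (F y)) \<partial>M)" .
  show "integrable M (\<lambda>x. transfer f x * w x)"
    unfolding sum by (intro integrable_suminf int AE1 smb')
qed

section \<open>Estimates for the transfer operator\<close>

definition mass :: "nat set \<Rightarrow> real" where
  "mass I = measure M {x \<in> D. \<kappa> x \<in> I}"

lemma mass_nonneg: "0 \<le> mass I"
  by (simp add: mass_def)

text \<open>
The transfer operator applied to the indicator of the cells with index in \<open>I\<close>.
\<close>

definition S :: "nat set \<Rightarrow> 'x \<Rightarrow> real" where
  "S I x = (\<Sum>i. if i \<in> I then G i x else 0)"

lemma summable_S: "summable (\<lambda>i. if i \<in> I then G i x else 0)"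
  by (rule summable_G_le[where B = 1 and x = x]) (simp add: G_nonneg)

lemma S_nonneg: "0 \<le> S I x"
  unfolding S_def by (intro suminf_nonneg summable_S) (simp add: G_nonneg)

lemma S_le_mass: "S I x \<le> C\<^sub>G * mass I"
proof -
  have sums: "(\<lambda>i. C\<^sub>G * (if i \<in> I then m i else 0)) sums (C\<^sub>G * mass I)"
    unfolding mass_def by (intro sums_mult measure_cells)
  then show ?thesis
    unfolding S_def sums_unique[OF sums]
    by (intro suminf_le summable_S sums_summable[OF sums]) (auto simp: G_le)
qed

lemma S_mono: "I \<subseteq> J \<Longrightarrow> S I x \<le> S J x"
  unfolding S_def by (intro suminf_le summable_S) (auto simp: G_nonneg)

lemma norm_transfer_le:
  fixes f :: "nat \<Rightarrow> 'x \<Rightarrow> 'b::{banach, second_countable_topology}"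
  assumes B: "\<And>i y. y \<in> cell i \<Longrightarrow> i \<in> I \<Longrightarrow> norm (f i y) \<le> B" and B0: "0 \<le> B"
    and off: "\<And>i y. y \<in> cell i \<Longrightarrow> i \<notin> I \<Longrightarrow> f i y = 0"
  shows "norm (transfer f x) \<le> B * S I x"
proof -
  have b: "norm (G i x *\<^sub>R f i (branch i x)) \<le> B * (if i \<in> I then G i x else 0)" for i
    using norm_G_scale_le[of i "f i" B x] norm_G_scale_le[of i "f i" 0 x] B off by auto
  have s: "summable (\<lambda>i. B * (if i \<in> I then G i x else 0))" by (intro summable_mult summable_S)
  have "norm (transfer f x) \<le> (\<Sum>i. B * (if i \<in> I then G i x else 0))"
    unfolding transfer_def by (rule norm_suminf_le[OF b s])
  then show ?thesis unfolding S_def by (subst (asm) suminf_mult) (auto intro: summable_S)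
qed

text \<open>
The Lasota-Yorke inequality: an inverse branch contracts by \<open>\<theta>\<close>, and the variation of the weights contributes
\<open>C\<^sub>L\<close> times the supremum. Every term is weighted by \<open>S I x\<close>, so that sums over disjoint sets of branches do not
accumulate constants.
\<close>

lemma transfer_lipschitz:
  fixes f :: "nat \<Rightarrow> 'x \<Rightarrow> 'b::{banach, second_countable_topology}"
  assumes B: "\<And>i y. y \<in> cell i \<Longrightarrow> i \<in> I \<Longrightarrow> norm (f i y) \<le> B" and B0: "0 \<le> B"
    and K: "\<And>i y y'. y \<in> cell i \<Longrightarrow> y' \<in> cell i \<Longrightarrow> i \<in> I \<Longrightarrow> norm (f i y - f i y') \<le> K * d y y'" and K0: "0 \<le> K"
    and off: "\<And>i y. y \<in> cell i \<Longrightarrow> i \<notin> I \<Longrightarrow> f i y = 0"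
    and x: "x \<in> D" "x' \<in> D" "\<kappa> x' = \<kappa> x"
  shows "norm (transfer f x - transfer f x') \<le> (\<theta> * K + C\<^sub>L * B) * d x x' * S I x"
proof -
  have B': "norm (f i y) \<le> B" if "y \<in> cell i" for i y
    using B[of y i] off[of y i] that B0 by (cases "i \<in> I") auto
  define c where "c = (\<theta> * K + C\<^sub>L * B) * d x x'"
  have b: "norm (G i x *\<^sub>R f i (branch i x) - G i x' *\<^sub>R f i (branch i x')) \<le> c * (if i \<in> I then G i x else 0)" for i
  proof (cases "i \<in> I \<and> x \<in> F ` cell i")
    case True
    then have i: "i \<in> I" and xi: "x \<in> F ` cell i" and xi': "x' \<in> F ` cell i"
      using image_iff_kappa[OF x, of i] by auto
    note br = branch_in_cell[OF xi] branch_in_cell[OF xi']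
    have "norm (G i x *\<^sub>R (f i (branch i x) - f i (branch i x'))) \<le> G i x * (K * (\<theta> * d x x'))"
      using K[OF br i] d_branch[OF xi xi'] G_nonneg[of i x] by (simp add: mult_left_mono)
    moreover have "norm ((G i x - G i x') *\<^sub>R f i (branch i x')) \<le> (C\<^sub>L * d x x' * G i x) * B"
      using G_diff[OF x, of i] B[OF br(2) i] by (simp add: mult_mono)
    ultimately have "norm (G i x *\<^sub>R (f i (branch i x) - f i (branch i x')) + (G i x - G i x') *\<^sub>R f i (branch i x'))
        \<le> G i x * (K * (\<theta> * d x x')) + (C\<^sub>L * d x x' * G i x) * B"
      by (intro norm_triangle_le add_mono)
    then show ?thesis using i by (simp add: algebra_simps c_def)
  next
    case False
    have c0: "0 \<le> c * G i x"
      using theta K0 B0 C\<^sub>L_nonneg d_nonneg[of x x'] G_nonneg[of i x] by (simp add: c_def)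
    show ?thesis
    proof (cases "x \<in> F ` cell i")
      case True
      then have "x' \<in> F ` cell i" "i \<notin> I" using image_iff_kappa[OF x, of i] False by auto
      then show ?thesis using off[OF branch_in_cell[of x i]] off[OF branch_in_cell[of x' i]] True by simp
    next
      case False
      then show ?thesis using image_iff_kappa[OF x, of i] by (simp add: G_def)
    qed
  qed
  have s: "summable (\<lambda>i. c * (if i \<in> I then G i x else 0))" by (intro summable_mult summable_S)
  have "norm (transfer f x - transfer f x') \<le> (\<Sum>i. c * (if i \<in> I then G i x else 0))"
    unfolding transfer_def
    by (subst suminf_diff) (auto intro!: summable_transfer(2)[OF B'] norm_suminf_le[OF b s])
  then show ?thesis unfolding S_def c_def by (subst (asm) suminf_mult) (auto intro: summable_S)
qed

lemma lip_boundI: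
  assumes off: "\<And>x. x \<notin> D \<Longrightarrow> v x = 0" and B: "\<And>x. x \<in> D \<Longrightarrow> cmod (v x) \<le> B"
    and K: "\<And>x x'. x \<in> D \<Longrightarrow> x' \<in> D \<Longrightarrow> \<kappa> x' = \<kappa> x \<Longrightarrow> cmod (v x - v x') \<le> K * d x x'"
    and L: "0 \<le> L" "2 * B \<le> L" "K \<le> L"
  shows "lip_bound d v L"
  unfolding lip_bound_def
proof safe
  have B': "cmod (v x) \<le> L / 2" for x
    using B[of x] off[of x] L by (cases "x \<in> D") auto
  show "cmod (v x) \<le> L" for x using B'[of x] L by simp
  fix x x'
  have L': "cmod (v x - v x') \<le> L"
    using norm_triangle_ineq4[of "v x" "v x'"] B'[of x] B'[of x'] by simp
  show "cmod (v x - v x') \<le> L * \<bar>d x x'\<bar>"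
  proof (cases "x \<in> D \<and> x' \<in> D")
    case True
    show ?thesis
    proof (cases "\<kappa> x' = \<kappa> x")
      case True2: True
      have "K * d x x' \<le> L * d x x'" using L d_nonneg by (intro mult_right_mono)
      then show ?thesis using K[of x x'] True True2 d_nonneg[of x x'] by auto
    next
      case False
      then show ?thesis using L' True d_distinct[of x x'] by simp
    qed
  next
    case False
    then show ?thesis using L' L d_off[of x x'] by auto
  qed
qed

section \<open>Lipschitz functions are measurable\<close>

definition itinerary :: "nat \<Rightarrow> 'x \<Rightarrow> nat list" where
  "itinerary k x = map (\<lambda>i. \<kappa> ((F ^^ i) x)) [0..<k]"

lemma itinerary_eq_iff: "itinerary k x = itinerary k x' \<longleftrightarrow> (\<forall>i<k. \<kappa> ((F ^^ i) x) = \<kappa> ((F ^^ i) x'))"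
  by (auto simp: itinerary_def)

lemma funpow_D: "x \<in> D \<Longrightarrow> (F ^^ n) x \<in> D"
  by (induction n) (auto intro: F_D)

lemma itinerary_measurable [measurable]: "itinerary k \<in> measurable M (count_space UNIV)"
proof -
  have "itinerary k -` {w} \<inter> space M \<in> sets M" for w
  proof -
    have "itinerary k -` {w} \<inter> space M = {x \<in> space M. length w = k \<and> (\<forall>i<k. \<kappa> ((F ^^ i) x) = w ! i)}"
    proof -
      have "itinerary k x = w \<longleftrightarrow> length w = k \<and> (\<forall>i<k. \<kappa> ((F ^^ i) x) = w ! i)" for x
        unfolding itinerary_def by (subst list_eq_iff_nth_eq) auto
      then show ?thesis by blast
    qed
    also have "\<dots> \<in> sets M"
      by measurable
    finally show ?thesis .
  qed
  then show ?thesis by (subst measurable_count_space_eq_countable) (auto intro: countableI_type)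
qed

lemma d_itinerary:
  "x \<in> D \<Longrightarrow> x' \<in> D \<Longrightarrow> itinerary k x = itinerary k x' \<Longrightarrow> d x x' \<le> \<theta> ^ k"
proof (induction k arbitrary: x x')
  case 0
  then show ?case using d_le_1 by simp
next
  case (Suc k)
  have eq: "\<kappa> ((F ^^ i) x) = \<kappa> ((F ^^ i) x')" if "i < Suc k" for i
    using Suc.prems(3) that by (simp only: itinerary_eq_iff)
  then have k: "\<kappa> x' = \<kappa> x" using eq[of 0] by simp
  have "itinerary k (F x) = itinerary k (F x')"
    unfolding itinerary_eq_iff
  proof safe
    fix i assume "i < k"
    then show "\<kappa> ((F ^^ i) (F x)) = \<kappa> ((F ^^ i) (F x'))"
      using eq[of "Suc i"] by (simp add: funpow_swap1)
  qed
  then have "d (F x) (F x') \<le> \<theta> ^ k" using Suc F_D by blast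
  then show ?case using d_shift[OF Suc.prems(1,2) k] theta by simp
qed

lemma lipschitz_measurable:
  fixes v :: "'x \<Rightarrow> 'b::{real_normed_vector, second_countable_topology}"
  assumes off: "\<And>x. x \<notin> D \<Longrightarrow> v x = 0"
    and K: "\<And>x x'. x \<in> D \<Longrightarrow> x' \<in> D \<Longrightarrow> \<kappa> x' = \<kappa> x \<Longrightarrow> norm (v x - v x') \<le> K * d x x'"
  shows "v \<in> borel_measurable M"
proof (rule measurable_of_itineraries[where it = "\<lambda>k. itinerary (Suc k)" and C = D and \<epsilon> = "\<lambda>k. \<bar>K\<bar> * \<theta> ^ Suc k"])
  show "v x = 0" if "x \<notin> D" for x using off that .
  show "norm (v x - v x') \<le> \<bar>K\<bar> * \<theta> ^ Suc k"
    if x: "x \<in> D" "x' \<in> D" "itinerary (Suc k) x = itinerary (Suc k) x'" for k x x'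
  proof -
    have "\<forall>i<Suc k. \<kappa> ((F ^^ i) x) = \<kappa> ((F ^^ i) x')" using x(3) by (simp only: itinerary_eq_iff)
    from this[rule_format, of 0] have "\<kappa> x' = \<kappa> x" by simp
    then have "norm (v x - v x') \<le> K * d x x'" by (rule K[OF x(1,2)])
    also have "\<dots> \<le> \<bar>K\<bar> * \<theta> ^ Suc k"
      using d_itinerary[OF x] d_nonneg by (intro mult_mono) auto
    finally show ?thesis .
  qed
  show "(\<lambda>k. \<bar>K\<bar> * \<theta> ^ Suc k) \<longlonglongrightarrow> 0"
    using theta by (intro tendsto_mult_right_zero LIMSEQ_Suc LIMSEQ_power_zero) simp
qed (rule itinerary_measurable D_sets)+

lemma lip_bound_measurable:
  assumes "lip_bound d v K"
  shows "(\<lambda>x. indicator D x * v x) \<in> borel_measurable M"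
  by (rule lipschitz_measurable[where K = K])
    (use assms d_nonneg in \<open>auto simp: lip_bound_def abs_of_nonneg\<close>)

text \<open>
Every point of \<open>D\<close> is approximated by points of its cylinders at which the almost everywhere identity holds.
\<close>

lemma eq_on_D:
  fixes v w :: "'x \<Rightarrow> 'b::real_normed_vector"
  assumes v: "\<And>x x'. x \<in> D \<Longrightarrow> x' \<in> D \<Longrightarrow> \<kappa> x' = \<kappa> x \<Longrightarrow> norm (v x - v x') \<le> K * d x x'"
    and w: "\<And>x x'. x \<in> D \<Longrightarrow> x' \<in> D \<Longrightarrow> \<kappa> x' = \<kappa> x \<Longrightarrow> norm (w x - w x') \<le> L * d x x'"
    and ae: "AE x in M. v x = w x" and x: "x \<in> D"
  shows "v x = w x"
proof -
  have "norm (v x - w x) \<le> (\<bar>K\<bar> + \<bar>L\<bar>) * \<theta> ^ Suc k" for k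
  proof -
    obtain y where y: "y \<in> D" "v y = w y" "\<forall>i<Suc k. \<kappa> ((F ^^ i) y) = \<kappa> ((F ^^ i) x)"
      using support[OF x ae, of "Suc k"] by blast
    then have k: "\<kappa> y = \<kappa> x" by (metis funpow_0 zero_less_Suc)
    have dxy: "d x y \<le> \<theta> ^ Suc k"
      using y by (intro d_itinerary x) (auto simp: itinerary_eq_iff simp del: upt_Suc)
    have "norm (v x - w x) = norm ((v x - v y) - (w x - w y))" using y by simp
    also have "\<dots> \<le> norm (v x - v y) + norm (w x - w y)" by (rule norm_triangle_ineq4)
    also have "\<dots> \<le> K * d x y + L * d x y" using v[OF x y(1) k] w[OF x y(1) k] by simp
    also have "\<dots> \<le> (\<bar>K\<bar> + \<bar>L\<bar>) * d x y" using d_nonneg[of x y] by (simp add: distrib_right add_mono mult_right_mono)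
    also have "\<dots> \<le> (\<bar>K\<bar> + \<bar>L\<bar>) * \<theta> ^ Suc k" using dxy by (intro mult_left_mono) auto
    finally show ?thesis .
  qed
  moreover have "(\<lambda>k. (\<bar>K\<bar> + \<bar>L\<bar>) * \<theta> ^ Suc k) \<longlonglongrightarrow> (\<bar>K\<bar> + \<bar>L\<bar>) * 0"
    using theta by (intro tendsto_intros LIMSEQ_Suc LIMSEQ_power_zero) auto
  ultimately have "norm (v x - w x) \<le> 0"
    by (intro tendsto_lowerbound[of "\<lambda>k. (\<bar>K\<bar> + \<bar>L\<bar>) * \<theta> ^ Suc k"]) auto
  then show ?thesis by simp
qed

text \<open>
Invariance of the measure gives \<open>R 1 = 1\<close> almost everywhere; both sides are Lipschitz, hence equal on \<open>D\<close>.
\<close>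

lemma S_UNIV: 
  assumes "x \<in> D"
  shows "S UNIV x = 1"
proof -
  define f :: "nat \<Rightarrow> 'x \<Rightarrow> real" where "f i y = 1" for i y
  have tf: "transfer f x = S UNIV x" for x by (simp add: transfer_def S_def f_def)
  have fm: "f i \<in> borel_measurable M" for i unfolding f_def by simp
  have "transfer f \<in> borel_measurable M"
    by (rule measurable_transfer[where B = 1]) (auto simp: fm f_def)
  moreover have "transfer f = S UNIV" by (rule ext) (rule tf)
  ultimately have tm [measurable]: "S UNIV \<in> borel_measurable M" by simp
  have int: "integrable M (S UNIV)"
    by (rule integrable_const_bound[where B = "C\<^sub>G * mass UNIV"]) (auto simp: S_le_mass S_nonneg)
  have "AE x in M. S UNIV x = 1"
  proof (rule density_unique_real)
    fix A assume A [measurable]: "A \<in> sets M"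
    have "(\<integral>x. transfer f x * indicator A x \<partial>M) = (\<integral>y. indicator D y *\<^sub>R (f (\<kappa> y) y * indicator A (F y)) \<partial>M)"
      by (rule transfer_duality(1)[where B = 1 and W = 1]) (auto simp: fm f_def)
    also have "\<dots> = (\<integral>y. indicator A (F y) \<partial>M)"
      using D_full by (intro integral_cong_AE) (auto simp: f_def)
    also have "\<dots> = (\<integral>y. indicator A y \<partial>(distr M M F))"
      by (rule integral_distr[symmetric]) simp_all
    finally show "(\<integral>x\<in>A. S UNIV x \<partial>M) = (\<integral>x\<in>A. 1 \<partial>M)"
      by (simp add: tf F_invariant set_lebesgue_integral_def mult.commute)
  qed (use int in auto)
  then show ?thesis
  proof (rule eq_on_D[rotated 2])
    fix x x' assume *: "x \<in> D" "x' \<in> D" "\<kappa> x' = \<kappa> x"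
    have "norm (transfer f x - transfer f x') \<le> (\<theta> * 0 + C\<^sub>L * 1) * d x x' * S UNIV x"
      by (rule transfer_lipschitz) (use * in \<open>auto simp: f_def\<close>)
    also have "\<dots> \<le> (\<theta> * 0 + C\<^sub>L * 1) * d x x' * (C\<^sub>G * mass UNIV)"
      using S_le_mass C\<^sub>L_nonneg d_nonneg by (intro mult_left_mono) auto
    finally show "norm (S UNIV x - S UNIV x') \<le> (C\<^sub>L * (C\<^sub>G * mass UNIV)) * d x x'"
      by (simp add: tf mult_ac)
    show "norm (1 - 1 :: real) \<le> 0 * d x x'" by simp
  qed (use assms in auto)
qed

lemma S_le_1: "S I x \<le> 1"
proof (cases "x \<in> D")
  case True
  then show ?thesis using S_mono[of I UNIV x] S_UNIV by simp
qed (simp add: S_def G_off cong: if_cong)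

end

context gibbs_markov_map
begin

section \<open>The fixed functions of the transfer operator\<close>

definition ruelle :: "('x \<Rightarrow> 'b) \<Rightarrow> 'x \<Rightarrow> 'b::{banach, second_countable_topology}" where
  "ruelle h = transfer (\<lambda>_. h)"

lemma norm_ruelle_le:
  fixes h :: "'x \<Rightarrow> 'b::{banach, second_countable_topology}"
  assumes "\<And>x. x \<in> D \<Longrightarrow> norm (h x) \<le> B" "0 \<le> B"
  shows "norm (ruelle h x) \<le> B"
proof -
  have "norm (ruelle h x) \<le> B * S UNIV x"
    unfolding ruelle_def by (rule norm_transfer_le) (use assms cell_subset in auto)
  also have "\<dots> \<le> B * 1" using assms S_le_1 by (intro mult_left_mono) auto
  finally show ?thesis by simp
qed

lemma ruelle_measurable:
  fixes h :: "'x \<Rightarrow> 'b::{banach, second_countable_topology}"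
  assumes "h \<in> borel_measurable M" "\<And>x. x \<in> D \<Longrightarrow> norm (h x) \<le> B"
  shows "ruelle h \<in> borel_measurable M"
  unfolding ruelle_def by (rule measurable_transfer[where B = B]) (use assms cell_subset in auto)

lemma ruelle_duality:
  fixes h :: "'x \<Rightarrow> 'b::{real_normed_algebra, banach, second_countable_topology}"
  assumes h: "h \<in> borel_measurable M" "\<And>x. x \<in> D \<Longrightarrow> norm (h x) \<le> B"
    and w: "w \<in> borel_measurable M" "\<And>x. x \<in> D \<Longrightarrow> norm (w x) \<le> W"
  shows "(\<integral>x. ruelle h x * w x \<partial>M) = (\<integral>y. h y * w (F y) \<partial>M)"
proof -
  have "(\<integral>x. ruelle h x * w x \<partial>M) = (\<integral>y. indicator D y *\<^sub>R (h y * w (F y)) \<partial>M)"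
    unfolding ruelle_def by (rule transfer_duality(1)[where B = B and W = W]) (use assms cell_subset in auto)
  also have "\<dots> = (\<integral>y. h y * w (F y) \<partial>M)"
    using D_full assms(1,3) by (intro integral_cong_AE) auto
  finally show ?thesis .
qed

lemma integral_ruelle:
  fixes h :: "'x \<Rightarrow> 'b::{real_normed_algebra_1, banach, second_countable_topology}"
  assumes "h \<in> borel_measurable M" "\<And>x. x \<in> D \<Longrightarrow> norm (h x) \<le> B"
  shows "(\<integral>x. ruelle h x \<partial>M) = (\<integral>y. h y \<partial>M)"
  using ruelle_duality[of h B "\<lambda>_. 1" 1] assms by simp

lemma ruelle_diff:
  fixes h :: "'x \<Rightarrow> 'b::{banach, second_countable_topology}"
  assumes "\<And>x. x \<in> D \<Longrightarrow> norm (h x) \<le> B" "\<And>x. x \<in> D \<Longrightarrow> norm (h' x) \<le> B'"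
  shows "ruelle (\<lambda>x. h x - h' x) x = ruelle h x - ruelle h' x"
proof -
  have s: "summable (\<lambda>i. G i x *\<^sub>R h (branch i x))" "summable (\<lambda>i. G i x *\<^sub>R h' (branch i x))"
    using summable_transfer(2)[where f = "\<lambda>_. h" and B = B] summable_transfer(2)[where f = "\<lambda>_. h'" and B = B']
      assms cell_subset by blast+
  show ?thesis unfolding ruelle_def transfer_def by (subst suminf_diff[OF s]) (simp add: algebra_simps)
qed

lemma norm_ruelle_le_ruelle:
  fixes v :: "'x \<Rightarrow> 'b::{banach, second_countable_topology}" and h :: "'x \<Rightarrow> real"
  assumes vh: "\<And>x. x \<in> D \<Longrightarrow> norm (v x) \<le> h x" and B: "\<And>x. x \<in> D \<Longrightarrow> h x \<le> B"
  shows "norm (ruelle v x) \<le> ruelle h x"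
proof -
  have nn: "norm (h y) \<le> B" if "y \<in> D" for y using vh[OF that] B[OF that] norm_ge_zero[of "v y"] unfolding real_norm_def by linarith
  have s: "summable (\<lambda>i. G i x *\<^sub>R h (branch i x))"
    by (rule summable_transfer(2)[where f = "\<lambda>_. h" and B = B]) (use nn cell_subset in auto)
  have b: "norm (G i x *\<^sub>R v (branch i x)) \<le> G i x *\<^sub>R h (branch i x)" for i
  proof (cases "x \<in> F ` cell i")
    case True
    then have "branch i x \<in> D" using branch_in_cell cell_subset by blast
    then show ?thesis using vh G_nonneg[of i x] by (simp add: mult_left_mono)
  qed (simp add: G_def)
  show ?thesis unfolding ruelle_def transfer_def by (rule norm_suminf_le[OF b s])
qed

lemma ruelle_lipschitz:
  fixes h :: "'x \<Rightarrow> 'b::{banach, second_countable_topology}"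
  assumes B: "\<And>x. x \<in> D \<Longrightarrow> norm (h x) \<le> B" "0 \<le> B"
    and K: "\<And>x x'. x \<in> D \<Longrightarrow> x' \<in> D \<Longrightarrow> \<kappa> x' = \<kappa> x \<Longrightarrow> norm (h x - h x') \<le> K * d x x'" "0 \<le> K"
    and x: "x \<in> D" "x' \<in> D" "\<kappa> x' = \<kappa> x"
  shows "norm (ruelle h x - ruelle h x') \<le> (\<theta> * K + C\<^sub>L * B) * d x x'"
proof -
  have "norm (ruelle h x - ruelle h x') \<le> (\<theta> * K + C\<^sub>L * B) * d x x' * S UNIV x"
    unfolding ruelle_def by (rule transfer_lipschitz) (use assms in \<open>auto simp: cell_def\<close>)
  also have "\<dots> \<le> (\<theta> * K + C\<^sub>L * B) * d x x' * 1"
    using S_le_1 theta K B C\<^sub>L_nonneg d_nonneg by (intro mult_left_mono) auto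
  finally show ?thesis by simp
qed

text \<open>
The cone of nonnegative functions with Lipschitz logarithm, stated so that zeros are allowed.
It is mapped into itself with a smaller constant, and on it the supremum after one step is controlled by
the integral.
\<close>

definition log_lip :: "real \<Rightarrow> ('x \<Rightarrow> real) \<Rightarrow> bool" where
  "log_lip c h \<longleftrightarrow> (\<forall>x\<in>D. 0 \<le> h x) \<and>
     (\<forall>x\<in>D. \<forall>x'\<in>D. \<kappa> x' = \<kappa> x \<longrightarrow> h x \<le> exp (c * d x x') * h x')"

lemma log_lip_ruelle:
  assumes h: "log_lip c h" and B: "\<And>x. x \<in> D \<Longrightarrow> h x \<le> B"
  shows "log_lip (\<theta> * c + C\<^sub>0) (ruelle h)"
  unfolding log_lip_def
proof safe
  have s: "summable (\<lambda>i. G i x *\<^sub>R h (branch i x))" for x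
    by (rule summable_transfer(2)[where f = "\<lambda>_. h" and B = B])
      (use B h cell_subset in \<open>force simp: log_lip_def\<close>)
  have nn: "0 \<le> G i x *\<^sub>R h (branch i x)" for i x
  proof (cases "x \<in> F ` cell i")
    case True
    then have "branch i x \<in> D" using branch_in_cell cell_subset by blast
    then show ?thesis using h G_nonneg[of i x] by (simp add: log_lip_def)
  qed (simp add: G_def)
  fix x assume x: "x \<in> D"
  show "0 \<le> ruelle h x" unfolding ruelle_def transfer_def by (intro suminf_nonneg s nn)
  fix x' assume x': "x' \<in> D" "\<kappa> x' = \<kappa> x"
  have "G i x *\<^sub>R h (branch i x) \<le> exp ((\<theta> * c + C\<^sub>0) * d x x') * (G i x' *\<^sub>R h (branch i x'))" for i
  proof (cases "x \<in> F ` cell i")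
    case True
    then have True': "x' \<in> F ` cell i" using image_iff_kappa[OF x x', of i] by simp
    have b: "branch i x \<in> D" "branch i x' \<in> D" "\<kappa> (branch i x') = \<kappa> (branch i x)"
      using branch_in_cell[OF True] branch_in_cell[OF True'] by (auto simp: cell_def)
    then have "h (branch i x) \<le> exp (c * (\<theta> * d x x')) * h (branch i x')"
      using h d_branch[OF True True'] unfolding log_lip_def by fastforce
    moreover have "0 \<le> h (branch i x)" using h b by (simp add: log_lip_def)
    ultimately have "G i x * h (branch i x) \<le> (exp (C\<^sub>0 * d x x') * G i x') * (exp (c * (\<theta> * d x x')) * h (branch i x'))"
      using G_distortion(1)[OF x x', of i] G_nonneg by (intro mult_mono) auto
    also have "\<dots> = exp (C\<^sub>0 * d x x' + c * (\<theta> * d x x')) * (G i x' * h (branch i x'))"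
      by (simp only: exp_add mult_ac)
    finally show ?thesis by (simp add: algebra_simps)
  next
    case False
    then show ?thesis using image_iff_kappa[OF x x', of i] by (simp add: G_def)
  qed
  then have "ruelle h x \<le> (\<Sum>i. exp ((\<theta> * c + C\<^sub>0) * d x x') * (G i x' *\<^sub>R h (branch i x')))"
    unfolding ruelle_def transfer_def by (intro suminf_le summable_mult s)
  also have "\<dots> = exp ((\<theta> * c + C\<^sub>0) * d x x') * ruelle h x'"
    unfolding ruelle_def transfer_def by (rule suminf_mult[OF s])
  finally show "ruelle h x \<le> exp ((\<theta> * c + C\<^sub>0) * d x x') * ruelle h x'" .
qed

lemma ruelle_le_integral:
  assumes h: "log_lip c h" and hm [measurable]: "h \<in> borel_measurable M" and B: "\<And>x. x \<in> D \<Longrightarrow> h x \<le> B" and c: "0 \<le> c"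
  shows "ruelle h x \<le> C\<^sub>G * exp c * (\<integral>x. h x \<partial>M)"
proof -
  have hB: "0 \<le> h x" "h x \<le> B" if "x \<in> D" for x using h B that by (auto simp: log_lip_def)
  have s: "summable (\<lambda>i. G i x *\<^sub>R h (branch i x))" for x
    by (rule summable_transfer(2)[where f = "\<lambda>_. h" and B = B]) (use hB cell_subset in force)
  have int: "integrable M h"
    by (rule integrable_const_bound[where B = B]) (use D_full hB in auto)
  have ic: "integrable M (\<lambda>y. indicator (cell i) y * h y)" for i
    by (rule Bochner_Integration.integrable_bound[OF int]) (auto simp: indicator_def)
  have term1: "m i * h y \<le> exp c * (\<integral>y. indicator (cell i) y * h y \<partial>M)" if y: "y \<in> cell i" for i y
  proof -
    have "m i * h y = (\<integral>z. indicator (cell i) z * h y \<partial>M)" by (simp add: m_def)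
    also have "\<dots> \<le> (\<integral>z. exp c * (indicator (cell i) z * h z) \<partial>M)"
    proof (intro integral_mono integrable_mult_right ic)
      show "integrable M (\<lambda>z. indicator (cell i) z * h y)" by (simp add: emeasure_eq_measure)
      fix z
      have "h y \<le> exp c * h z" if "z \<in> cell i"
      proof -
        have "h y \<le> exp (c * d y z) * h z" using h y that by (auto simp: log_lip_def cell_def)
        also have "\<dots> \<le> exp c * h z"
          using c d_le_1[of y z] y that hB(1)[of z] by (intro mult_right_mono) (auto simp: cell_def mult_left_le)
        finally show ?thesis .
      qed
      then show "indicator (cell i) z * h y \<le> exp c * (indicator (cell i) z * h z)" by (auto simp: indicator_def)
    qed
    finally show ?thesis by simp
  qed
  have term2: "G i x *\<^sub>R h (branch i x) \<le> C\<^sub>G * exp c * (\<integral>y. indicator (cell i) y * h y \<partial>M)" for i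
  proof (cases "x \<in> F ` cell i")
    case True
    then have b: "branch i x \<in> cell i" by (rule branch_in_cell)
    have "G i x * h (branch i x) \<le> C\<^sub>G * m i * h (branch i x)"
      using G_le[of i x] hB(1)[of "branch i x"] b by (intro mult_right_mono) (auto simp: cell_def)
    also have "\<dots> \<le> C\<^sub>G * (exp c * (\<integral>y. indicator (cell i) y * h y \<partial>M))"
      using term1[OF b] C\<^sub>G_nonneg by (simp add: mult.assoc mult_left_mono)
    finally show ?thesis by (simp add: mult.assoc)
  next
    case False
    have "0 \<le> (\<integral>y. indicator (cell i) y * h y \<partial>M)"
      using hB(1) by (intro integral_nonneg_AE AE_I2) (auto simp: indicator_def cell_def)
    then show ?thesis using False C\<^sub>G_nonneg by (simp add: G_def)
  qed
  have "(\<Sum>i<n. G i x *\<^sub>R h (branch i x)) \<le> C\<^sub>G * exp c * (\<integral>x. h x \<partial>M)" for n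
  proof -
    have "(\<Sum>i<n. G i x *\<^sub>R h (branch i x)) \<le> (\<Sum>i<n. C\<^sub>G * exp c * (\<integral>y. indicator (cell i) y * h y \<partial>M))"
      by (intro sum_mono term2)
    also have "\<dots> = C\<^sub>G * exp c * (\<integral>y. (\<Sum>i<n. indicator (cell i) y * h y) \<partial>M)"
      by (subst Bochner_Integration.integral_sum) (auto simp: ic sum_distrib_left)
    also have "\<dots> \<le> C\<^sub>G * exp c * (\<integral>x. h x \<partial>M)"
    proof (intro mult_left_mono integral_mono_AE int)
      show "integrable M (\<lambda>y. \<Sum>i<n. indicator (cell i) y * h y)" by (intro Bochner_Integration.integrable_sum ic)
      show "AE y in M. (\<Sum>i<n. indicator (cell i) y * h y) \<le> h y"
        using D_full
      proof eventually_elim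
        case (elim y)
        have "(\<Sum>i<n. indicator (cell i) y * h y) = (\<Sum>i<n. if i = \<kappa> y then h y else 0)"
          using elim by (intro sum.cong) (auto simp: cell_def indicator_def)
        then show ?case using hB(1)[OF elim] by simp
      qed
    qed (use C\<^sub>G_nonneg in auto)
    finally show ?thesis .
  qed
  then show ?thesis unfolding ruelle_def transfer_def by (intro suminf_le_const s)
qed

text \<open>
This bounds the supremum of an iterate by the \<open>L\<^sup>1\<close> norm. Adding \<open>\<theta>\<^sup>k\<close> to \<open>\<bar>v\<bar>\<close> gives a function in the cone with constant of
order \<open>\<theta>\<^sup>-\<^sup>k\<close>, which \<open>k\<close> applications of the operator reduce to a constant independent of \<open>k\<close>; then
\<open>ruelle_le_integral\<close> applies.
\<close>

lemma ruelle_iterate_sup: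
  fixes v :: "'x \<Rightarrow> complex"
  assumes v: "lip_bound d v 1" and off: "\<And>x. x \<notin> D \<Longrightarrow> v x = 0"
  shows "cmod ((ruelle ^^ Suc k) v x) \<le> C\<^sub>G * exp (1 + C\<^sub>0 / (1 - \<theta>)) * ((\<integral>x. cmod (v x) \<partial>M) + \<theta> ^ k)"
proof -
  define h where "h j = (ruelle ^^ j) (\<lambda>x. cmod (v x) + \<theta> ^ k)" for j
  have vm [measurable]: "v \<in> borel_measurable M"
  proof -
    have "(\<lambda>x. indicator D x * v x) = v" by (rule ext) (use off in \<open>auto simp: indicator_def\<close>)
    then show ?thesis using lip_bound_measurable[OF v] by simp
  qed
  have v1: "cmod (v x) \<le> 1" for x using v by (simp add: lip_bound_def)
  have tk: "0 < \<theta> ^ k" "\<theta> ^ k \<le> 1" using theta by (auto simp: power_le_one)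
  have c1: "\<theta> * (C\<^sub>0 / (1 - \<theta>)) + C\<^sub>0 = C\<^sub>0 / (1 - \<theta>)" using theta by (simp add: field_simps)
  have inv: "log_lip (\<theta> ^ j / \<theta> ^ k + C\<^sub>0 / (1 - \<theta>)) (h j) \<and> h j \<in> borel_measurable M \<and>
      (\<forall>x\<in>D. h j x \<le> 2) \<and> (\<integral>x. h j x \<partial>M) = (\<integral>x. cmod (v x) \<partial>M) + \<theta> ^ k \<and>
      (\<forall>x\<in>D. cmod ((ruelle ^^ j) v x) \<le> h j x)" for j
  proof (induction j)
    case 0
    have "log_lip (1 / \<theta> ^ k + C\<^sub>0 / (1 - \<theta>)) (h 0)"
      unfolding log_lip_def h_def
    proof safe
      fix x x' assume x: "x \<in> D" "x' \<in> D" "\<kappa> x' = \<kappa> x"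
      have "cmod (v x - v x') \<le> 1 * \<bar>d x x'\<bar>" using v by (simp only: lip_bound_def)
      then have "cmod (v x) \<le> cmod (v x') + d x x'" using norm_triangle_ineq2[of "v x" "v x'"] d_nonneg[of x x'] by linarith
      also have "d x x' = (d x x' / \<theta> ^ k) * \<theta> ^ k" using theta by simp
      also have "\<dots> \<le> (d x x' / \<theta> ^ k) * (cmod (v x') + \<theta> ^ k)"
        using d_nonneg tk by (intro mult_left_mono) auto
      finally have "cmod (v x) + \<theta> ^ k \<le> (1 + d x x' / \<theta> ^ k) * (cmod (v x') + \<theta> ^ k)"
        by (simp add: algebra_simps)
      also have "1 + d x x' / \<theta> ^ k \<le> exp (d x x' / \<theta> ^ k)" by (rule exp_ge_add_one_self)
      also have "\<dots> \<le> exp ((1 / \<theta> ^ k + C\<^sub>0 / (1 - \<theta>)) * d x x')"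
        using C0 theta d_nonneg[of x x'] by (simp add: algebra_simps)
      finally show "(ruelle ^^ 0) (\<lambda>x. cmod (v x) + \<theta> ^ k) x
          \<le> exp ((1 / \<theta> ^ k + C\<^sub>0 / (1 - \<theta>)) * d x x') * (ruelle ^^ 0) (\<lambda>x. cmod (v x) + \<theta> ^ k) x'"
        using tk by (simp add: mult_right_mono)
    qed (use tk in auto)
    moreover have "h 0 x \<le> 2" for x using v1[of x] tk by (simp add: h_def)
    moreover have "integrable M (\<lambda>x. cmod (v x))" by (rule integrable_const_bound[where B = 1]) (auto simp: v1)
    then have "(\<integral>x. h 0 x \<partial>M) = (\<integral>x. cmod (v x) \<partial>M) + \<theta> ^ k"
      by (simp add: h_def prob_space)
    ultimately show ?case using tk by (simp add: h_def)
  next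
    case (Suc j)
    then have IH: "log_lip (\<theta> ^ j / \<theta> ^ k + C\<^sub>0 / (1 - \<theta>)) (h j)" "h j \<in> borel_measurable M"
      "\<And>x. x \<in> D \<Longrightarrow> h j x \<le> 2" "(\<integral>x. h j x \<partial>M) = (\<integral>x. cmod (v x) \<partial>M) + \<theta> ^ k"
      "\<And>x. x \<in> D \<Longrightarrow> cmod ((ruelle ^^ j) v x) \<le> h j x" by auto
    have hS: "h (Suc j) = ruelle (h j)" by (simp add: h_def)
    have hb: "norm (h j x) \<le> 2" if "x \<in> D" for x using IH(1,3) that by (auto simp: log_lip_def)
    have "log_lip (\<theta> * (\<theta> ^ j / \<theta> ^ k + C\<^sub>0 / (1 - \<theta>)) + C\<^sub>0) (h (Suc j))"
      unfolding hS by (rule log_lip_ruelle[OF IH(1,3)])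
    moreover have "\<theta> * (\<theta> ^ j / \<theta> ^ k + C\<^sub>0 / (1 - \<theta>)) + C\<^sub>0 = \<theta> ^ Suc j / \<theta> ^ k + C\<^sub>0 / (1 - \<theta>)"
      using c1 by (simp add: distrib_left)
    moreover have "h (Suc j) \<in> borel_measurable M" unfolding hS by (rule ruelle_measurable[OF IH(2) hb])
    moreover have "h (Suc j) x \<le> 2" for x
      using norm_ruelle_le[of "h j" 2 x] hb by (simp add: hS abs_le_iff)
    moreover have "(\<integral>x. h (Suc j) x \<partial>M) = (\<integral>x. cmod (v x) \<partial>M) + \<theta> ^ k"
      unfolding hS IH(4)[symmetric] by (rule integral_ruelle[OF IH(2) hb])
    moreover have "cmod ((ruelle ^^ Suc j) v x) \<le> h (Suc j) x" for x
      using norm_ruelle_le_ruelle[of "(ruelle ^^ j) v" "h j" 2 x] IH(3,5) by (simp add: hS)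
    ultimately show ?case by simp
  qed
  have "cmod ((ruelle ^^ Suc k) v x) \<le> ruelle (h k) x"
    using norm_ruelle_le_ruelle[of "(ruelle ^^ k) v" "h k" 2 x] inv[of k] by simp
  also have "\<dots> \<le> C\<^sub>G * exp (1 + C\<^sub>0 / (1 - \<theta>)) * (\<integral>x. h k x \<partial>M)"
    by (rule ruelle_le_integral) (use inv[of k] tk C0 theta in auto)
  finally show ?thesis using inv[of k] by simp
qed

text \<open>
Since \<open>\<integral> u u \<circ> F = \<integral> (R u) u = \<integral> u\<^sup>2 = \<integral> (u \<circ> F)\<^sup>2\<close>, the function \<open>u \<circ> F - u\<close> vanishes in \<open>L\<^sup>2\<close>, hence on \<open>D\<close>.
By ergodicity \<open>u\<close> has constant sign, and its integral is zero.
\<close>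

lemma fixed_point_real_zero:
  fixes u :: "'x \<Rightarrow> real"
  assumes off: "\<And>x. x \<notin> D \<Longrightarrow> u x = 0" and B: "\<And>x. \<bar>u x\<bar> \<le> B"
    and K: "\<And>x x'. x \<in> D \<Longrightarrow> x' \<in> D \<Longrightarrow> \<bar>u x - u x'\<bar> \<le> K * d x x'"
    and fixp: "\<And>x. x \<in> D \<Longrightarrow> ruelle u x = u x" and mean: "(\<integral>x. u x \<partial>M) = 0"
    and x: "x \<in> D"
  shows "u x = 0"
proof -
  have um [measurable]: "u \<in> borel_measurable M" by (rule lipschitz_measurable[where K = K]) (use off K in auto)
  have ib: "integrable M f" if "f \<in> borel_measurable M" "\<And>x. \<bar>f x\<bar> \<le> c" for f :: "'x \<Rightarrow> real" and c
    using that by (intro integrable_const_bound[where B = c]) auto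
  have B0: "0 \<le> B" using B[of x] by linarith
  have uu: "\<bar>u x * u y\<bar> \<le> B * B" for x y unfolding abs_mult using B B0 by (intro mult_mono) auto
  have int: "integrable M (\<lambda>x. u x * u x)" "integrable M (\<lambda>x. u (F x) * u (F x))" "integrable M (\<lambda>x. u x * u (F x))"
    by (rule ib[OF _ uu]; simp)+
  have "(\<integral>x. u x * u (F x) \<partial>M) = (\<integral>x. ruelle u x * u x \<partial>M)"
    by (rule ruelle_duality[where B = B and W = B, symmetric]) (auto simp: B)
  also have "\<dots> = (\<integral>x. u x * u x \<partial>M)"
  proof (rule Bochner_Integration.integral_cong)
    fix x show "ruelle u x * u x = u x * u x" using fixp[of x] off[of x] by (cases "x \<in> D") auto
  qed simp
  finally have 1: "(\<integral>x. u x * u (F x) \<partial>M) = (\<integral>x. u x * u x \<partial>M)" .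
  have 2: "(\<integral>x. u (F x) * u (F x) \<partial>M) = (\<integral>x. u x * u x \<partial>M)"
    using integral_distr[of F M M "\<lambda>x. u x * u x"] by (simp add: F_invariant)
  have "(\<integral>x. (u (F x) - u x)\<^sup>2 \<partial>M) = (\<integral>x. u (F x) * u (F x) - 2 * (u x * u (F x)) + u x * u x \<partial>M)"
    by (intro Bochner_Integration.integral_cong) (auto simp: power2_eq_square algebra_simps)
  also have "\<dots> = 0" using int 1 2 by simp
  finally have "(\<integral>x. (u (F x) - u x)\<^sup>2 \<partial>M) = 0" .
  moreover have "integrable M (\<lambda>x. (u (F x) - u x)\<^sup>2)"
  proof (rule ib)
    fix x have "\<bar>u (F x) - u x\<bar> \<le> 2 * B" using B[of x] B[of "F x"] by linarith
    then show "\<bar>(u (F x) - u x)\<^sup>2\<bar> \<le> (2 * B)\<^sup>2" using abs_le_square_iff[of "u (F x) - u x" "2 * B"] B0 by simp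
  qed simp
  ultimately have "AE x in M. (u (F x) - u x)\<^sup>2 = 0"
    by (subst (asm) integral_nonneg_eq_0_iff_AE) auto
  then have ae: "AE x in M. u (F x) = u x" by eventually_elim simp
  have invar: "u (F y) = u y" if y: "y \<in> D" for y
  proof (rule eq_on_D[OF _ _ ae y, of "K / \<theta>" K])
    fix x x' assume *: "x \<in> D" "x' \<in> D" "\<kappa> x' = \<kappa> x"
    show "norm (u (F x) - u (F x')) \<le> K / \<theta> * d x x'"
      using K[OF F_D[OF *(1)] F_D[OF *(2)]] d_shift[OF *] theta by simp
    show "norm (u x - u x') \<le> K * d x x'" using K[OF *(1,2)] by simp
  qed
  have invn: "u ((F ^^ n) y) = u y" if "y \<in> D" for n y
    using that by (induction n) (auto simp: invar funpow_D)
  define A where "A = {y \<in> space M. \<exists>n. (F ^^ n) y \<in> D \<and> u ((F ^^ n) y) < 0}"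
  have "A \<in> sets M" unfolding A_def by measurable
  moreover have "F -` A \<inter> space M = A"
  proof (rule set_eqI)
    fix y
    have "(\<exists>n. (F ^^ n) (F y) \<in> D \<and> u ((F ^^ n) (F y)) < 0) \<longleftrightarrow> (\<exists>n. (F ^^ n) y \<in> D \<and> u ((F ^^ n) y) < 0)" (is "?l \<longleftrightarrow> ?r")
    proof
      assume ?l
      then obtain n where "(F ^^ Suc n) y \<in> D \<and> u ((F ^^ Suc n) y) < 0" by (auto simp: funpow_swap1)
      then show ?r by blast
    next
      assume ?r
      then obtain n where n: "(F ^^ n) y \<in> D" "u ((F ^^ n) y) < 0" by blast
      then have "F ((F ^^ n) y) \<in> D" "u (F ((F ^^ n) y)) < 0" using F_D invar by auto
      then show ?l by (auto simp: funpow_swap1)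
    qed
    moreover have "y \<in> space M \<Longrightarrow> F y \<in> space M" using F_measurable by (rule measurable_space)
    ultimately show "y \<in> F -` A \<inter> space M \<longleftrightarrow> y \<in> A" by (auto simp: A_def)
  qed
  ultimately have "emeasure M A = 0 \<or> emeasure M A = 1" by (rule F_ergodic)
  then have "AE x in M. u x = 0"
  proof
    assume "emeasure M A = 0"
    then have "AE y in M. y \<notin> A" using \<open>A \<in> sets M\<close> by (intro AE_not_in) auto
    then have "AE y in M. 0 \<le> u y" using D_full AE_space
    proof eventually_elim
      case (elim y)
      then show ?case unfolding A_def by (smt (verit) funpow_0 mem_Collect_eq)
    qed
    then show ?thesis using mean ib[OF um B] by (subst (asm) integral_nonneg_eq_0_iff_AE) auto
  next
    assume "emeasure M A = 1"
    then have "AE y in M. y \<in> A" using \<open>A \<in> sets M\<close> by (simp add: emeasure_eq_measure prob_eq_1)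
    then have "AE y in M. 0 \<le> - u y" using D_full
      by eventually_elim (use invn in \<open>force simp: A_def\<close>)
    moreover have "(\<integral>x. - u x \<partial>M) = 0" using mean by simp
    ultimately have "AE y in M. - u y = 0" using ib[OF um B] by (subst (asm) integral_nonneg_eq_0_iff_AE) auto
    then show ?thesis by eventually_elim simp
  qed
  then show ?thesis
    by (rule eq_on_D[where K = K and L = 0 and w = "\<lambda>_. 0", rotated 2]) (use K x in auto)
qed

lemma fixed_point_zero:
  fixes v :: "'x \<Rightarrow> complex"
  assumes off: "\<And>x. x \<notin> D \<Longrightarrow> v x = 0" and v: "lip_bound d v K"
    and fixp: "\<And>x. x \<in> D \<Longrightarrow> ruelle v x = v x" and mean: "(\<integral>x. v x \<partial>M) = 0"
  shows "v x = 0"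
proof (cases "x \<in> D")
  case True
  have vm [measurable]: "v \<in> borel_measurable M"
    by (rule lipschitz_measurable[where K = K]) (use off v d_nonneg in \<open>auto simp: lip_bound_def\<close>)
  have vB: "cmod (v x) \<le> K" for x using v by (simp add: lip_bound_def)
  have vK: "cmod (v x - v y) \<le> K * d x y" for x y using v d_nonneg by (simp add: lip_bound_def)
  have int: "integrable M v" by (rule integrable_const_bound[where B = K]) (auto simp: vB)
  have s: "summable (\<lambda>i. G i x *\<^sub>R v (branch i x))" for x
    by (rule summable_transfer(2)[where f = "\<lambda>_. v" and B = K]) (use vB in auto)
  have "Re (v x) = 0"
  proof (rule fixed_point_real_zero[where B = K and K = K])
    show "ruelle (\<lambda>x. Re (v x)) x = Re (v x)" if "x \<in> D" for x
      using fixp[OF that] bounded_linear.suminf[OF bounded_linear_Re s[of x]]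
      by (simp add: ruelle_def transfer_def)
    show "\<bar>Re (v x) - Re (v y)\<bar> \<le> K * d x y" for x y
      using vK[of x y] abs_Re_le_cmod[of "v x - v y"] by simp
    show "\<bar>Re (v x)\<bar> \<le> K" for x using vB[of x] abs_Re_le_cmod[of "v x"] by simp
    show "(\<integral>x. Re (v x) \<partial>M) = 0" using mean int by simp
  qed (use off True in auto)
  moreover have "Im (v x) = 0"
  proof (rule fixed_point_real_zero[where B = K and K = K])
    show "ruelle (\<lambda>x. Im (v x)) x = Im (v x)" if "x \<in> D" for x
      using fixp[OF that] bounded_linear.suminf[OF bounded_linear_Im s[of x]]
      by (simp add: ruelle_def transfer_def)
    show "\<bar>Im (v x) - Im (v y)\<bar> \<le> K * d x y" for x y
      using vK[of x y] abs_Im_le_cmod[of "v x - v y"] by simp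
    show "\<bar>Im (v x)\<bar> \<le> K" for x using vB[of x] abs_Im_le_cmod[of "v x"] by simp
    show "(\<integral>x. Im (v x) \<partial>M) = 0" using mean int by simp
  qed (use off True in auto)
  ultimately show ?thesis by (simp add: complex_eq_iff)
qed (rule off)

definition word_point :: "nat list \<Rightarrow> 'x" where
  "word_point w = (SOME y. y \<in> D \<and> itinerary (length w) y = w)"

lemma word_point:
  assumes "x \<in> D"
  shows "word_point (itinerary k x) \<in> D" "itinerary k (word_point (itinerary k x)) = itinerary k x"
  using someI[of "\<lambda>y. y \<in> D \<and> itinerary (length (itinerary k x)) y = itinerary k x" x] assms
  unfolding word_point_def by (auto simp: itinerary_def)

text \<open>
The functions are determined up to \<open>\<theta>\<^sup>k\<close> by countably many values, one for each word of length \<open>k\<close>, so a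
diagonal argument applies. No compactness of the space is available, and convergence is only pointwise.
\<close>

lemma lipschitz_convergent_subsequence:
  fixes V :: "nat \<Rightarrow> 'x \<Rightarrow> complex"
  assumes V: "\<And>n. lip_bound d (V n) 1" and off: "\<And>n x. x \<notin> D \<Longrightarrow> V n x = 0"
  obtains r v where "strict_mono (r :: nat \<Rightarrow> nat)" "\<And>x. (\<lambda>n. V (r n) x) \<longlonglongrightarrow> v x"
proof -
  have "countable (range word_point)" by (intro countable_image countableI_type)
  moreover have "cmod (V n x) \<le> 1" for n x using V[of n] by (simp add: lip_bound_def)
  ultimately obtain r :: "nat \<Rightarrow> nat" where r: "strict_mono r"
    and conv: "\<And>x. x \<in> range word_point \<Longrightarrow> \<exists>l. (\<lambda>n. V (r n) x) \<longlonglongrightarrow> l"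
    using function_convergent_subsequence[of "range word_point" V 1] by blast
  have "\<exists>l. (\<lambda>n. V (r n) x) \<longlonglongrightarrow> l" for x
  proof (cases "x \<in> D")
    case True
    have "Cauchy (\<lambda>n. V (r n) x)"
    proof (rule metric_CauchyI)
      fix e :: real assume e: "0 < e"
      then obtain k where k: "\<theta> ^ k < e / 3" using theta real_arch_pow_inv[of "e / 3" \<theta>] by auto
      define y where "y = word_point (itinerary k x)"
      have "d x y \<le> \<theta> ^ k" unfolding y_def using word_point[OF True, of k] True by (intro d_itinerary) auto
      then have dxy: "\<bar>d x y\<bar> < e / 3" using k d_nonneg[of x y] by simp
      have near: "cmod (V n x - V n y) < e / 3" for n
        using V[of n] dxy unfolding lip_bound_def by (metis le_less_trans mult_1)
      have "Cauchy (\<lambda>n. V (r n) y)" using conv[of y] unfolding y_def by (auto intro: LIMSEQ_imp_Cauchy)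
      then obtain N where N: "\<And>m n. m \<ge> N \<Longrightarrow> n \<ge> N \<Longrightarrow> cmod (V (r m) y - V (r n) y) < e / 3"
        using e unfolding Cauchy_def dist_norm by (meson divide_pos_pos zero_less_numeral)
      have "cmod (V (r m) x - V (r n) x) < e" if "m \<ge> N" "n \<ge> N" for m n
      proof -
        have "V (r m) x - V (r n) x = (V (r m) x - V (r m) y) + (V (r m) y - V (r n) y) - (V (r n) x - V (r n) y)" by simp
        also have "cmod \<dots> \<le> cmod (V (r m) x - V (r m) y) + cmod (V (r m) y - V (r n) y) + cmod (V (r n) x - V (r n) y)"
          by (intro order_trans[OF norm_triangle_ineq4] add_mono norm_triangle_ineq order_refl)
        also have "\<dots> < e / 3 + e / 3 + e / 3" by (intro add_strict_mono near N that)
        finally show ?thesis by simp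
      qed
      then show "\<exists>N. \<forall>m\<ge>N. \<forall>n\<ge>N. dist (V (r m) x) (V (r n) x) < e" by (auto simp: dist_norm)
    qed
    then show ?thesis by (simp add: Cauchy_convergent_iff convergent_def)
  next
    case False
    then show ?thesis using off by auto
  qed
  then obtain v where "\<And>x. (\<lambda>n. V (r n) x) \<longlonglongrightarrow> v x" by metis
  then show ?thesis using that r by blast
qed

lemma ruelle_tendsto:
  fixes V :: "nat \<Rightarrow> 'x \<Rightarrow> complex"
  assumes V: "\<And>n x. cmod (V n x) \<le> 1" and lim: "\<And>x. (\<lambda>n. V n x) \<longlonglongrightarrow> v x"
  shows "(\<lambda>n. ruelle (V n) x) \<longlonglongrightarrow> ruelle v x"
  unfolding ruelle_def transfer_def
proof (rule tannerys_theorem[where M = "\<lambda>i. G i x", THEN conjunct2, THEN conjunct2])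
  show "\<forall>\<^sub>F (i, n) in at_top \<times>\<^sub>F sequentially. norm (G i x *\<^sub>R V n (branch i x)) \<le> G i x"
  proof (rule always_eventually, safe)
    fix i n show "norm (G i x *\<^sub>R V n (branch i x)) \<le> G i x"
      using norm_G_scale_le[of i "V n" 1 x] V by simp
  qed
  show "summable (\<lambda>i. G i x)" by (rule summable_G)
qed (auto intro!: tendsto_intros lim)

text \<open>
This replaces quasi-compactness. If the bound failed, there would be functions \<open>V\<^sub>n\<close> of norm one and mean zero with
\<open>V\<^sub>n - R V\<^sub>n\<close> tending to zero in norm. A pointwise limit of a subsequence is a fixed function of mean zero, hence
zero, so \<open>V\<^sub>n\<close> tends to zero in \<open>L\<^sup>1\<close>. Iterating, \<open>ruelle_iterate_sup\<close> makes the supremum small and the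
Lasota-Yorke inequality the Lipschitz constant, which contradicts the normalisation.
\<close>

lemma mean_zero_bounded_below:
  "\<exists>C\<ge>0. \<forall>v K L. (\<forall>x. x \<notin> D \<longrightarrow> v x = 0) \<longrightarrow> lip_bound d v K \<longrightarrow> (\<integral>x. v x \<partial>M) = 0 \<longrightarrow>
     lip_bound d (\<lambda>x. v x - ruelle v x) L \<longrightarrow> lip_bound d v (C * L)"
proof (rule ccontr)
  assume "\<not> ?thesis"
  then have "\<forall>C\<ge>0. \<exists>v K L. (\<forall>x. x \<notin> D \<longrightarrow> v x = 0) \<and> lip_bound d v K \<and> (\<integral>x. v x \<partial>M) = 0 \<and>
     lip_bound d (\<lambda>x. v x - ruelle v x) L \<and> \<not> lip_bound d v (C * L)" by blast
  then have bad: "\<exists>v K L. (\<forall>x. x \<notin> D \<longrightarrow> v x = 0) \<and> lip_bound d v K \<and> (\<integral>x. v x \<partial>M) = 0 \<and>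
     lip_bound d (\<lambda>x. v x - ruelle v x) L \<and> \<not> lip_bound d v (real (Suc n) * L)" for n
    using of_nat_0_le_iff[of "Suc n"] by blast
  have normalise: "\<exists>w. (\<forall>x. x \<notin> D \<longrightarrow> w x = 0) \<and> lip_bound d w 1 \<and> (\<integral>x. w x \<partial>M) = 0 \<and>
     lip_bound d (\<lambda>x. w x - ruelle w x) (1 / real (Suc n)) \<and> (\<forall>K<1. \<not> lip_bound d w K)"
    if off: "\<forall>x. x \<notin> D \<longrightarrow> v x = 0" and v: "lip_bound d v K" and mean: "(\<integral>x. v x \<partial>M) = 0"
      and L: "lip_bound d (\<lambda>x. v x - ruelle v x) L" and not: "\<not> lip_bound d v (real (Suc n) * L)" for v K L and n :: nat
  proof -
    define N where "N = norm (embed d v)"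
    have N: "lip_bound d v N" using lip_bound_norm[of d "embed d v"] component_embed[OF v, of d] by (simp add: N_def)
    have least: "N \<le> K" if "lip_bound d v K" for K using norm_embed_le[OF that] by (simp add: N_def)
    have L0: "0 \<le> L" using lip_bound_nonneg[OF L] .
    have big: "real (Suc n) * L < N" using not lip_bound_mono[OF N] by (meson not_le)
    then have N0: "0 < N" using L0 by (smt (verit) mult_nonneg_nonneg of_nat_0_le_iff)
    define c where "c = complex_of_real (1 / N)"
    have c: "cmod c = 1 / N" unfolding c_def norm_of_real using N0 by simp
    define w where "w x = c * v x" for x
    have R: "ruelle w x = c * ruelle v x" for x
    proof -
      have "summable (\<lambda>i. G i x *\<^sub>R v (branch i x))"
        by (rule summable_transfer(2)[where f = "\<lambda>_. v" and B = N]) (use N in \<open>auto simp: lip_bound_def\<close>)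
      from suminf_mult[OF this, of c] show ?thesis by (simp add: ruelle_def transfer_def w_def mult.left_commute flip: scaleR_conv_of_real)
    qed
    have weq: "w = (\<lambda>x. c * v x)" by (simp add: w_def fun_eq_iff)
    have "lip_bound d w 1" using lip_bound_mult[OF N, of c] N0 by (simp add: c weq)
    moreover have "(\<integral>x. w x \<partial>M) = 0" using mean by (simp add: w_def)
    moreover have "lip_bound d (\<lambda>x. w x - ruelle w x) (1 / real (Suc n))"
    proof (rule lip_bound_mono)
      show "lip_bound d (\<lambda>x. w x - ruelle w x) (cmod c * L)"
        using lip_bound_mult[OF L, of c] by (simp add: R w_def right_diff_distrib)
      show "cmod c * L \<le> 1 / real (Suc n)" using big N0 by (simp add: c field_simps)
    qed
    moreover have "\<not> lip_bound d w K" if "K < 1" for K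
    proof
      assume "lip_bound d w K"
      from lip_bound_mult[OF this, of "complex_of_real N"] have "lip_bound d v (N * K)"
        using N0 by (simp add: w_def c_def)
      then have "N \<le> N * K" by (rule least)
      then show False using N0 that by simp
    qed
    ultimately show ?thesis using off by (intro exI[of _ w]) (simp add: w_def)
  qed
  have "\<exists>w. (\<forall>x. x \<notin> D \<longrightarrow> w x = 0) \<and> lip_bound d w 1 \<and> (\<integral>x. w x \<partial>M) = 0 \<and>
     lip_bound d (\<lambda>x. w x - ruelle w x) (1 / real (Suc n)) \<and> (\<forall>K<1. \<not> lip_bound d w K)" for n
  proof -
    obtain v K L where "\<forall>x. x \<notin> D \<longrightarrow> v x = 0" "lip_bound d v K" "(\<integral>x. v x \<partial>M) = 0"
      "lip_bound d (\<lambda>x. v x - ruelle v x) L" "\<not> lip_bound d v (real (Suc n) * L)"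
      using bad[of n] by blast
    then show ?thesis by (rule normalise)
  qed
  then obtain V where V: "\<And>n x. x \<notin> D \<Longrightarrow> V n x = 0" "\<And>n. lip_bound d (V n) 1" "\<And>n. (\<integral>x. V n x \<partial>M) = 0"
      "\<And>n. lip_bound d (\<lambda>x. V n x - ruelle (V n) x) (1 / real (Suc n))" "\<And>n K. K < 1 \<Longrightarrow> \<not> lip_bound d (V n) K"
    by metis
  obtain r v where r: "strict_mono (r :: nat \<Rightarrow> nat)" and lim: "\<And>x. (\<lambda>n. V (r n) x) \<longlonglongrightarrow> v x"
    using lipschitz_convergent_subsequence[of V] V(1,2) by blast
  have V1: "cmod (V n x) \<le> 1" for n x using V(2)[of n] by (simp add: lip_bound_def)
  have vm [measurable]: "V n \<in> borel_measurable M" for n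
    by (rule lipschitz_measurable[where K = 1]) (use V(1,2) d_nonneg in \<open>auto simp: lip_bound_def\<close>)
  have v1: "lip_bound d v 1" using lim by (rule lip_bound_limit) (simp add: V(2))
  have voff: "v x = 0" if "x \<notin> D" for x using lim[of x] V(1)[OF that] by (simp add: LIMSEQ_const_iff)
  have vmeas [measurable]: "v \<in> borel_measurable M"
    by (rule lipschitz_measurable[where K = 1]) (use voff v1 d_nonneg in \<open>auto simp: lip_bound_def\<close>)
  have d0: "(\<lambda>n. 1 / real (Suc (r n))) \<longlonglongrightarrow> 0"
    using LIMSEQ_subseq_LIMSEQ[OF LIMSEQ_Suc[OF lim_1_over_n[where 'a = real]] r] by (simp add: o_def)
  have "v x = 0" for x
  proof (rule fixed_point_zero[OF voff v1])
    fix x assume "x \<in> D"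
    have "(\<lambda>n. V (r n) x - ruelle (V (r n)) x) \<longlonglongrightarrow> v x - ruelle v x"
      by (intro tendsto_intros lim ruelle_tendsto V1)
    moreover have "(\<lambda>n. V (r n) x - ruelle (V (r n)) x) \<longlonglongrightarrow> 0"
      by (rule Lim_null_comparison[OF _ d0]) (use V(4) in \<open>auto simp: lip_bound_def\<close>)
    ultimately show "ruelle v x = v x" using LIMSEQ_unique by fastforce
  next
    have "(\<lambda>n. \<integral>x. V (r n) x \<partial>M) \<longlonglongrightarrow> (\<integral>x. v x \<partial>M)"
      by (rule integral_dominated_convergence[where w = "\<lambda>_. 1"]) (auto simp: lim V1)
    then show "(\<integral>x. v x \<partial>M) = 0" by (simp add: V(3) LIMSEQ_const_iff)
  qed
  then have lim0: "(\<lambda>n. cmod (V (r n) x)) \<longlonglongrightarrow> 0" for x using tendsto_norm[OF lim[of x]] by simp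
  have I0: "(\<lambda>n. \<integral>x. cmod (V (r n) x) \<partial>M) \<longlonglongrightarrow> (\<integral>x. 0 \<partial>M)"
    by (rule integral_dominated_convergence[where w = "\<lambda>_. 1"]) (auto simp: lim0 V1)
  define C where "C = C\<^sub>G * exp (1 + C\<^sub>0 / (1 - \<theta>))"
  have C0': "0 \<le> C" using C\<^sub>G_nonneg by (simp add: C_def)
  have iter: "cmod (V n x - (ruelle ^^ k) (V n) x) \<le> real k * (1 / real (Suc n))" for n k x
  proof (induction k arbitrary: x)
    case (Suc k)
    have b: "cmod ((ruelle ^^ k) (V n) y) \<le> 1" for k y
    proof (induction k arbitrary: y)
      case (Suc k)
      show ?case using norm_ruelle_le[of "(ruelle ^^ k) (V n)" 1 y] Suc by simp
    qed (simp add: V1)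
    have "ruelle (\<lambda>x. V n x - (ruelle ^^ k) (V n) x) x = ruelle (V n) x - ruelle ((ruelle ^^ k) (V n)) x"
      by (rule ruelle_diff[where B = 1 and B' = 1]) (auto simp: V1 b)
    then have "cmod (ruelle (V n) x - ruelle ((ruelle ^^ k) (V n)) x) \<le> real k * (1 / real (Suc n))"
      using norm_ruelle_le[of "\<lambda>x. V n x - (ruelle ^^ k) (V n) x" "real k * (1 / real (Suc n))" x] Suc by simp
    moreover have "cmod (V n x - ruelle (V n) x) \<le> 1 / real (Suc n)" using V(4)[of n] by (simp add: lip_bound_def)
    ultimately have "cmod ((V n x - ruelle (V n) x) + (ruelle (V n) x - ruelle ((ruelle ^^ k) (V n)) x))
        \<le> 1 / real (Suc n) + real k * (1 / real (Suc n))" by (intro norm_triangle_le add_mono)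
    then show ?case by (simp add: algebra_simps add_divide_distrib)
  qed simp
  define \<epsilon> where "\<epsilon> = (1 - \<theta>) / (4 * (1 + C\<^sub>L))"
  have \<epsilon>: "0 < \<epsilon>" "C\<^sub>L * \<epsilon> \<le> (1 - \<theta>) / 4" "\<epsilon> \<le> (1 - \<theta>) / 4"
    using theta C\<^sub>L_nonneg by (auto simp: \<epsilon>_def field_simps mult_left_le_one_le)
  obtain k where k: "C * \<theta> ^ k \<le> \<epsilon> / 3"
  proof -
    have "(\<lambda>k. C * \<theta> ^ k) \<longlonglongrightarrow> C * 0" using theta by (intro tendsto_intros LIMSEQ_power_zero) auto
    then have "\<forall>\<^sub>F k in sequentially. C * \<theta> ^ k < \<epsilon> / 3" using \<epsilon> by (intro order_tendstoD) auto
    then show ?thesis using that by (auto simp: eventually_sequentially intro: less_imp_le)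
  qed
  have "(\<lambda>n. C * (\<integral>x. cmod (V (r n) x) \<partial>M)) \<longlonglongrightarrow> C * 0" using I0 by (intro tendsto_intros) simp
  then have e1: "\<forall>\<^sub>F n in sequentially. C * (\<integral>x. cmod (V (r n) x) \<partial>M) < \<epsilon> / 3"
    using \<epsilon> by (intro order_tendstoD) auto
  have "(\<lambda>n. real (Suc k) * (1 / real (Suc (r n)))) \<longlonglongrightarrow> real (Suc k) * 0" by (intro tendsto_intros d0)
  then have e2: "\<forall>\<^sub>F n in sequentially. real (Suc k) * (1 / real (Suc (r n))) < \<epsilon> / 3"
    using \<epsilon> by (intro order_tendstoD) auto
  obtain n where n: "C * (\<integral>x. cmod (V n x) \<partial>M) < \<epsilon> / 3" "real (Suc k) * (1 / real (Suc n)) < \<epsilon> / 3"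
    using eventually_conj[OF e1 e2] by (auto simp: eventually_sequentially)
  have small: "cmod (V n x) \<le> \<epsilon>" for x
  proof -
    have "cmod ((ruelle ^^ Suc k) (V n) x) \<le> C * ((\<integral>x. cmod (V n x) \<partial>M) + \<theta> ^ k)"
      unfolding C_def using V(1,2) by (intro ruelle_iterate_sup)
    also have "\<dots> \<le> \<epsilon> / 3 + \<epsilon> / 3" using n(1) k by (simp add: distrib_left)
    finally have "cmod ((ruelle ^^ Suc k) (V n) x) \<le> \<epsilon> / 3 + \<epsilon> / 3" .
    moreover have "cmod (V n x - (ruelle ^^ Suc k) (V n) x) \<le> \<epsilon> / 3" using iter[of n x "Suc k"] n(2) by linarith
    ultimately show ?thesis using norm_triangle_sub[of "V n x" "(ruelle ^^ Suc k) (V n) x"] by linarith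
  qed
  have dn: "1 / real (Suc n) \<le> (1 - \<theta>) / 4"
  proof -
    have "1 * (1 / real (Suc n)) \<le> real (Suc k) * (1 / real (Suc n))" by (intro mult_right_mono) auto
    then show ?thesis using n(2) \<epsilon> by linarith
  qed
  have arith: "\<theta> + a + b \<le> (1 + \<theta>) / 2" if "a \<le> (1 - \<theta>) / 4" "b \<le> (1 - \<theta>) / 4" for a b
    using that by (simp add: field_simps)
  have "lip_bound d (V n) ((1 + \<theta>) / 2)"
  proof (rule lip_boundI[where B = \<epsilon> and K = "(1 + \<theta>) / 2"])
    fix x x' assume x: "x \<in> D" "x' \<in> D" "\<kappa> x' = \<kappa> x"
    have "cmod (ruelle (V n) x - ruelle (V n) x') \<le> (\<theta> * 1 + C\<^sub>L * \<epsilon>) * d x x'"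
      by (rule ruelle_lipschitz) (use x small \<epsilon> V(2)[of n] d_nonneg in \<open>auto simp: lip_bound_def\<close>)
    moreover have "cmod ((V n x - ruelle (V n) x) - (V n x' - ruelle (V n) x')) \<le> (1 / real (Suc n)) * d x x'"
      using V(4)[of n] unfolding lip_bound_def abs_of_nonneg[OF d_nonneg] by blast
    ultimately have "cmod ((ruelle (V n) x - ruelle (V n) x') + ((V n x - ruelle (V n) x) - (V n x' - ruelle (V n) x')))
        \<le> (\<theta> * 1 + C\<^sub>L * \<epsilon>) * d x x' + (1 / real (Suc n)) * d x x'"
      by (intro norm_triangle_le add_mono)
    also have "\<dots> = (\<theta> + C\<^sub>L * \<epsilon> + 1 / real (Suc n)) * d x x'" by (simp add: algebra_simps)
    also have "\<dots> \<le> (1 + \<theta>) / 2 * d x x'"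
    proof (rule mult_right_mono[OF _ d_nonneg])
      show "\<theta> + C\<^sub>L * \<epsilon> + 1 / real (Suc n) \<le> (1 + \<theta>) / 2"
        using arith[OF \<epsilon>(2) dn] .
    qed
    finally show "cmod (V n x - V n x') \<le> (1 + \<theta>) / 2 * d x x'" by simp
  qed (use V(1) small theta \<epsilon> in auto)
  then show False using V(5)[of "(1 + \<theta>) / 2" n] theta by simp
qed

end

section \<open>Tails, and bounds from below on the disc\<close>

lemma sum_powr_le:
  assumes s: "-1 < s"
  shows "\<exists>C\<ge>0. \<forall>k. (\<Sum>n<k. wt s n) \<le> C * wt (s + 1) k"
proof (cases "0 \<le> s")
  case True
  have "(\<Sum>n<k. wt s n) \<le> 1 * wt (s + 1) k" for k
  proof -
    have "(\<Sum>n<k. wt s n) \<le> (\<Sum>n<k. wt s k)" using True by (intro sum_mono wt_mono) auto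
    also have "\<dots> = real k * wt s k" by simp
    also have "\<dots> \<le> real (Suc k) * wt s k" by (intro mult_right_mono) auto
    also have "\<dots> = wt (s + 1) k" by (simp add: wt_def powr_add)
    finally show ?thesis by simp
  qed
  then show ?thesis by (intro exI[of _ 1]) auto
next
  case False
  have le1: "(\<Sum>n<k. wt s n) \<le> 1 / (s + 1) * real k powr (s + 1)" for k
  proof (induction k)
    case (Suc k)
    have "wt s k * (s + 1) \<le> real (Suc k) powr (s + 1) - real k powr (s + 1)"
    proof (cases "k = 0")
      case True
      then show ?thesis using False s by (simp add: wt_def)
    next
      case k: False
      have "\<exists>z. real k < z \<and> z < real (Suc k) \<and>
          real (Suc k) powr (s + 1) - real k powr (s + 1) = (real (Suc k) - real k) * ((s + 1) * z powr s)"
      proof (rule MVT2)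
        fix x assume "real k \<le> x" "x \<le> real (Suc k)"
        then have "0 < x" using k by simp
        then show "((\<lambda>x. x powr (s + 1)) has_real_derivative (s + 1) * x powr s) (at x)"
          using has_real_derivative_powr[of x "s + 1"] by simp
      qed simp
      then obtain z where z: "real k < z" "z < real (Suc k)"
        "real (Suc k) powr (s + 1) - real k powr (s + 1) = (s + 1) * z powr s" by auto
      have "wt s k \<le> z powr s" unfolding wt_def using z False k by (intro powr_mono2') auto
      then show ?thesis using z s by (simp add: mult.commute[of _ "s + 1"])
    qed
    then have "wt s k \<le> 1 / (s + 1) * (real (Suc k) powr (s + 1) - real k powr (s + 1))"
      using s by (simp add: field_simps)
    then show ?case using Suc by (simp add: right_diff_distrib)
  qed simp
  have le2: "real k powr (s + 1) \<le> wt (s + 1) k" for k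
    unfolding wt_def using s by (intro powr_mono2) auto
  have "0 \<le> 1 / (s + 1)" using s by simp
  then have "(\<Sum>n<k. wt s n) \<le> 1 / (s + 1) * wt (s + 1) k" for k
    by (rule order_trans[OF le1 mult_left_mono[OF le2]])
  then show ?thesis using s by (intro exI[of _ "1 / (s + 1)"]) auto
qed

text \<open>
Passing to tail sums costs one power of the weight: exchange the order of summation.
\<close>

lemma summable_tail_weighted:
  fixes x :: "nat \<Rightarrow> real"
  assumes s: "-1 < s" and x: "\<And>k. 0 \<le> x k" and sum: "summable (\<lambda>k. wt (s + 1) k * x k)"
  shows "summable x" and "summable (\<lambda>n. wt s n * (\<Sum>k. x (k + Suc n)))"
proof -
  have "x k \<le> wt (s + 1) k * x k" for k
    using mult_right_mono[OF wt_ge_1[of "s + 1" k] x[of k]] s by simp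
  then show sx: "summable x" by (intro summable_comparison_test'[OF sum]) (auto simp: x)
  obtain C where C: "0 \<le> C" "\<And>k. (\<Sum>n<k. wt s n) \<le> C * wt (s + 1) k" using sum_powr_le[OF s] by blast
  have sx': "summable (\<lambda>k. x (k + m))" for m using sx by (simp add: summable_iff_shift)
  show "summable (\<lambda>n. wt s n * (\<Sum>k. x (k + Suc n)))"
  proof (rule bounded_imp_summable)
    fix N
    define T where "T = C * (\<Sum>k. wt (s + 1) k * x k)"
    have tl: "(\<Sum>n\<le>N. wt s n * (\<Sum>k<m. x (k + Suc n))) \<le> T" for m
    proof -
      have "(\<Sum>n\<le>N. wt s n * (\<Sum>k<m. x (k + Suc n))) = (\<Sum>(n,k)\<in>{..N} \<times> {..<m}. wt s n * x (k + Suc n))"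
        by (simp add: sum_distrib_left sum.cartesian_product)
      also have "\<dots> = (\<Sum>(j,n)\<in>(\<lambda>(n,k). (k + Suc n, n)) ` ({..N} \<times> {..<m}). wt s n * x j)"
        by (subst sum.reindex) (auto simp: inj_on_def case_prod_beta)
      also have "\<dots> \<le> (\<Sum>(j,n)\<in>Sigma {..<N + m + 2} (\<lambda>j. {..<j}). wt s n * x j)"
        by (intro sum_mono2) (auto simp: x)
      also have "\<dots> = (\<Sum>j<N + m + 2. (\<Sum>n<j. wt s n) * x j)"
        by (subst sum.Sigma[symmetric]) (auto simp: sum_distrib_right)
      also have "\<dots> \<le> (\<Sum>j<N + m + 2. (C * wt (s + 1) j) * x j)"
        by (intro sum_mono mult_right_mono C x)
      also have "\<dots> = C * (\<Sum>j<N + m + 2. wt (s + 1) j * x j)" by (simp only: sum_distrib_left mult.assoc)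
      also have "\<dots> \<le> T" unfolding T_def using C by (intro mult_left_mono sum_le_suminf sum) (auto simp: x)
      finally show ?thesis .
    qed
    have "(\<lambda>m. \<Sum>n\<le>N. wt s n * (\<Sum>k<m. x (k + Suc n))) \<longlonglongrightarrow> (\<Sum>n\<le>N. wt s n * (\<Sum>k. x (k + Suc n)))"
      by (intro tendsto_intros summable_LIMSEQ sx')
    then show "(\<Sum>n\<le>N. wt s n * (\<Sum>k. x (k + Suc n))) \<le> T"
      by (rule LIMSEQ_le_const2) (use tl in auto)
  qed (auto intro!: mult_nonneg_nonneg suminf_nonneg[OF sx'] x simp del: add_Suc_right)
qed

text \<open>
If the bound were not uniform, the points \<open>z\<close> violating it would accumulate somewhere in the closed disc, and the bound at the
limit point persists nearby because evaluation is continuous in norm.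
\<close>

lemma bounded_below_uniform:
  fixes A :: "'x lipop fps"
  assumes A: "wfin 0 A" and below: "\<And>z. cmod z \<le> 1 \<Longrightarrow> \<exists>C. \<forall>u. norm u \<le> C * norm (app (lipop.ev A z) u)"
  shows "\<exists>C\<ge>0. \<forall>z u. cmod z \<le> 1 \<longrightarrow> norm u \<le> C * norm (app (lipop.ev A z) u)"
proof (rule ccontr)
  assume "\<not> ?thesis"
  then have "\<forall>n::nat. \<exists>z u. cmod z \<le> 1 \<and> real n * norm (app (lipop.ev A z) u) < norm u"
    by (meson not_le of_nat_0_le_iff)
  then obtain Z U where Z: "\<And>n. cmod (Z n) \<le> 1" and U: "\<And>n. real n * norm (app (lipop.ev A (Z n)) (U n)) < norm (U n)"
    by metis
  have "compact (cball (0::complex) 1)" by simp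
  then obtain z r where z: "z \<in> cball 0 1" and r: "strict_mono (r :: nat \<Rightarrow> nat)" and lim: "(Z \<circ> r) \<longlonglongrightarrow> z"
    using Z unfolding compact_def by (metis mem_cball_0)
  obtain C where C: "\<And>u. norm u \<le> C * norm (app (lipop.ev A z) u)" using below[of z] z by auto
  define D where "D = \<bar>C\<bar> + 1"
  have D: "norm u \<le> D * norm (app (lipop.ev A z) u)" for u
  proof (rule order_trans[OF C mult_right_mono])
    show "C \<le> D" by (simp add: D_def)
  qed simp
  have "(\<lambda>n. lipop.ev A (Z (r n))) \<longlonglongrightarrow> lipop.ev A z"
    using lipop.ev_continuous[OF A, of z "Z \<circ> r"] z Z lim by (simp add: o_def)
  then have "\<forall>\<^sub>F n in sequentially. dist (lipop.ev A (Z (r n))) (lipop.ev A z) < 1 / (2 * D)"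
    by (rule tendstoD) (simp add: D_def)
  moreover have "\<forall>\<^sub>F n in sequentially. real n > 2 * D" 
    using filterlim_real_sequentially unfolding filterlim_at_top_dense by blast
  ultimately have "\<forall>\<^sub>F n in sequentially. False"
  proof eventually_elim
    case (elim n)
    define u where "u = U (r n)"
    define a where "a = norm (app (lipop.ev A (Z (r n))) u)"
    have u: "real (r n) * a < norm u" unfolding u_def a_def by (rule U)
    have a0: "0 \<le> a" by (simp add: a_def)
    have "n \<le> r n" using r by (rule seq_suble)
    then have "real n * a \<le> real (r n) * a" using a0 by (intro mult_right_mono) auto
    moreover have "2 * D * a \<le> real n * a" using elim(2) a0 by (intro mult_right_mono) auto
    ultimately have 1: "2 * D * a < norm u" using u by linarith
    have "app (lipop.ev A z) u = app (lipop.ev A (Z (r n))) u - app (lipop.ev A (Z (r n)) - lipop.ev A z) u" by simp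
    then have "norm (app (lipop.ev A z) u) \<le> a + norm (app (lipop.ev A (Z (r n)) - lipop.ev A z) u)"
      unfolding a_def by (metis norm_triangle_ineq4)
    also have "\<dots> \<le> a + 1 / (2 * D) * norm u"
      using elim(1) norm_app_le[of "lipop.ev A (Z (r n)) - lipop.ev A z" u]
        mult_right_mono[of "norm (lipop.ev A (Z (r n)) - lipop.ev A z)" "1 / (2 * D)" "norm u"]
      by (simp add: dist_norm)
    finally have "D * norm (app (lipop.ev A z) u) \<le> D * (a + 1 / (2 * D) * norm u)"
      by (intro mult_left_mono) (auto simp: D_def)
    then have "norm u \<le> D * (a + 1 / (2 * D) * norm u)" using D[of u] by linarith
    also have "\<dots> = D * a + norm u / 2" by (simp add: D_def field_simps)
    finally show False using 1 by linarith
  qed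
  then show False by simp
qed

section \<open>The renewal operators\<close>

text \<open>
The return time is a function of the cell. Aperiodicity is stated as a bound from below for \<open>1 - R(z)\<close> with the
functions as the data, which is how a condition on the spectrum enters the estimates.
\<close>

locale gibbs_markov_return = gibbs_markov_map M F D \<kappa> g d \<theta> C\<^sub>0 c\<^sub>0
  for M :: "'x measure" and F D \<kappa> g d \<theta> C\<^sub>0 c\<^sub>0 +
  fixes ph :: "nat \<Rightarrow> nat" and q :: real
  assumes ph_pos: "x \<in> D \<Longrightarrow> 0 < ph (\<kappa> x)"
    and q: "0 < q"
    and moment: "integrable M (\<lambda>x. indicator D x * real (ph (\<kappa> x)) powr (q + 1))"
    and aperiodic: "cmod z \<le> 1 \<Longrightarrow> z \<noteq> 1 \<Longrightarrow> \<exists>C\<ge>0. \<forall>v K L. (\<forall>x. x \<notin> D \<longrightarrow> v x = 0) \<longrightarrow> lip_bound d v K \<longrightarrow>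
      lip_bound d (\<lambda>x. v x - (\<Sum>n. z ^ n * transfer (\<lambda>i y. if ph i = n then v y else 0) x)) L \<longrightarrow> lip_bound d v (C * L)"
begin

lemma cell_D: "y \<in> cell i \<Longrightarrow> y \<in> D"
  using cell_subset by blast

definition C\<^sub>R :: real where
  "C\<^sub>R = C\<^sub>G * (2 + C\<^sub>L)"

text \<open>
The transfer operator restricted to the cells with index in \<open>I\<close>, on the component of \<open>d\<close>.
\<close>

definition op :: "nat set \<Rightarrow> 'x lipop" where
  "op I = component_op d (\<lambda>v. transfer (\<lambda>i y. if i \<in> I then v y else 0))"

text \<open>
The unit of the corner of the operator algebra in which the other operators live.
\<close>

definition onD :: "'x lipop" where
  "onD = component_op d (\<lambda>v x. indicator D x * v x)"

definition mean :: "'x lipop" where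
  "mean = component_op d (\<lambda>v x. indicator D x * (\<integral>y. indicator D y * v y \<partial>M))"

lemma C\<^sub>R_nonneg: "0 \<le> C\<^sub>R"
  using C\<^sub>G_nonneg C\<^sub>L_nonneg by (simp add: C\<^sub>R_def)

lemma transfer_add:
  fixes f h :: "nat \<Rightarrow> 'x \<Rightarrow> 'b::{banach, second_countable_topology}"
  assumes "\<And>i y. y \<in> cell i \<Longrightarrow> norm (f i y) \<le> B" "\<And>i y. y \<in> cell i \<Longrightarrow> norm (h i y) \<le> B'"
  shows "transfer (\<lambda>i y. f i y + h i y) x = transfer f x + transfer h x"
  unfolding transfer_def
  by (subst suminf_add)
    (auto simp: scaleR_add_right intro!: summable_transfer(2)[where B = B and f = f] summable_transfer(2)[where B = B' and f = h] assms)

lemma transfer_mult: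
  fixes f :: "nat \<Rightarrow> 'x \<Rightarrow> complex"
  assumes "\<And>i y. y \<in> cell i \<Longrightarrow> norm (f i y) \<le> B"
  shows "transfer (\<lambda>i y. c * f i y) x = c * transfer f x"
  unfolding transfer_def
  by (subst suminf_mult[symmetric]) (auto simp: mult_ac intro!: summable_transfer(2)[where B = B and f = f] assms)

lemma lip_op_transfer: "lip_op d (\<lambda>v. transfer (\<lambda>i y. if i \<in> I then v y else 0)) (C\<^sub>R * mass I)"
  unfolding lip_op_def
proof (intro conjI allI impI)
  show "0 \<le> C\<^sub>R * mass I" using C\<^sub>R_nonneg mass_nonneg by simp
  fix v :: "'x \<Rightarrow> complex" and K assume v: "lip_bound d v K"
  have K0: "0 \<le> K" using lip_bound_nonneg[OF v] .
  have vb: "cmod (v x) \<le> K" "cmod (v x - v y) \<le> K * d x y" for x y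
    using v d_nonneg by (auto simp: lip_bound_def abs_of_nonneg)
  let ?f = "\<lambda>i y. if i \<in> I then v y else 0"
  show "lip_bound d (transfer ?f) (C\<^sub>R * mass I * K)"
  proof (rule lip_boundI[where B = "K * (C\<^sub>G * mass I)" and K = "(\<theta> * K + C\<^sub>L * K) * (C\<^sub>G * mass I)"])
    show "cmod (transfer ?f x) \<le> K * (C\<^sub>G * mass I)" for x
    proof -
      have "cmod (transfer ?f x) \<le> K * S I x" by (rule norm_transfer_le) (use vb K0 in auto)
      also have "\<dots> \<le> K * (C\<^sub>G * mass I)" using K0 S_le_mass by (intro mult_left_mono)
      finally show ?thesis .
    qed
    fix x x' assume x: "x \<in> D" "x' \<in> D" "\<kappa> x' = \<kappa> x"
    have "cmod (transfer ?f x - transfer ?f x') \<le> (\<theta> * K + C\<^sub>L * K) * d x x' * S I x"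
      by (rule transfer_lipschitz) (use vb K0 x in auto)
    also have "\<dots> \<le> (\<theta> * K + C\<^sub>L * K) * d x x' * (C\<^sub>G * mass I)"
      using K0 S_le_mass theta C\<^sub>L_nonneg d_nonneg by (intro mult_left_mono) auto
    finally show "cmod (transfer ?f x - transfer ?f x') \<le> (\<theta> * K + C\<^sub>L * K) * (C\<^sub>G * mass I) * d x x'"
      by (simp add: mult_ac)
  next
    have *: "0 \<le> C\<^sub>G * mass I * K" using C\<^sub>G_nonneg mass_nonneg K0 by simp
    show "0 \<le> C\<^sub>R * mass I * K" using C\<^sub>R_nonneg mass_nonneg K0 by simp
    have "2 * (C\<^sub>G * mass I * K) \<le> (2 + C\<^sub>L) * (C\<^sub>G * mass I * K)"
      using * C\<^sub>L_nonneg by (intro mult_right_mono) auto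
    then show "2 * (K * (C\<^sub>G * mass I)) \<le> C\<^sub>R * mass I * K" by (simp add: C\<^sub>R_def mult_ac)
    have "(\<theta> + C\<^sub>L) * (C\<^sub>G * mass I * K) \<le> (2 + C\<^sub>L) * (C\<^sub>G * mass I * K)"
      using * theta by (intro mult_right_mono) auto
    then show "(\<theta> * K + C\<^sub>L * K) * (C\<^sub>G * mass I) \<le> C\<^sub>R * mass I * K"
      by (simp add: C\<^sub>R_def algebra_simps)
  qed (simp add: transfer_off)
next
  fix v w :: "'x \<Rightarrow> complex" and K assume "lip_bound d v K" "lip_bound d w K"
  then have b: "cmod (v y) \<le> \<bar>K\<bar>" "cmod (w y) \<le> \<bar>K\<bar>" for y
    by (meson lip_bound_def abs_ge_self order_trans)+
  show "transfer (\<lambda>i y. if i \<in> I then v y + w y else 0)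
      = (\<lambda>x. transfer (\<lambda>i y. if i \<in> I then v y else 0) x + transfer (\<lambda>i y. if i \<in> I then w y else 0) x)"
    by (rule ext, subst transfer_add[where B = "\<bar>K\<bar>" and B' = "\<bar>K\<bar>", symmetric])
      (auto simp: b intro!: transfer_cong)
next
  fix v :: "'x \<Rightarrow> complex" and K c assume "lip_bound d v K"
  then have b: "cmod (v y) \<le> \<bar>K\<bar>" for y
    by (meson lip_bound_def abs_ge_self order_trans)
  show "transfer (\<lambda>i y. if i \<in> I then c * v y else 0) = (\<lambda>x. c * transfer (\<lambda>i y. if i \<in> I then v y else 0) x)"
    by (rule ext, subst transfer_mult[where B = "\<bar>K\<bar>", symmetric]) (auto simp: b intro!: transfer_cong)
qed

lemma component_op_apply:
  "component (app (op I) u) d' x = (if d' = d then transfer (\<lambda>i y. if i \<in> I then component u d y else 0) x else 0)"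
  unfolding op_def by (simp add: component_component_op[OF lip_op_transfer])

lemma norm_op: "norm (op I) \<le> C\<^sub>R * mass I"
  unfolding op_def by (rule norm_component_op[OF lip_op_transfer])

lemma lip_op_onD: "lip_op d (\<lambda>v x. indicator D x * v x) 2"
  unfolding lip_op_def
proof (intro conjI allI impI)
  fix v :: "'x \<Rightarrow> complex" and K assume v: "lip_bound d v K"
  show "lip_bound d (\<lambda>x. indicator D x * v x) (2 * K)"
    by (rule lip_boundI[where B = K and K = K])
      (use v lip_bound_nonneg[OF v] d_nonneg in \<open>auto simp: lip_bound_def abs_of_nonneg\<close>)
qed (auto simp: algebra_simps)

lemma component_onD: "component (app onD u) d' x = (if d' = d then indicator D x * component u d x else 0)"
  unfolding onD_def by (simp add: component_component_op[OF lip_op_onD])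

definition mn :: "('x \<Rightarrow> complex) \<Rightarrow> complex" where
  "mn v = (\<integral>y. indicator D y * v y \<partial>M)"

lemma
  assumes v: "lip_bound d v K"
  shows integrable_mn: "integrable M (\<lambda>y. indicator D y * v y)" and mn_le: "cmod (mn v) \<le> K"
proof -
  have "cmod (indicator D y * v y) \<le> K" for y
    using v lip_bound_nonneg[OF v] by (auto simp: lip_bound_def indicator_def)
  then show 1: "integrable M (\<lambda>y. indicator D y * v y)"
    by (intro integrable_const_bound[where B = K] AE_I2 lip_bound_measurable[OF v])
  have "cmod (mn v) \<le> (\<integral>y. cmod (indicator D y * v y) \<partial>M)" unfolding mn_def by (rule integral_norm_bound)
  also have "\<dots> \<le> (\<integral>y. K \<partial>M)"
    using 1 v lip_bound_nonneg[OF v] by (intro integral_mono) (auto simp: lip_bound_def indicator_def)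
  finally show "cmod (mn v) \<le> K" by (simp add: prob_space)
qed

lemma lip_op_mean: "lip_op d (\<lambda>v x. indicator D x * (\<integral>y. indicator D y * v y \<partial>M)) 2"
  unfolding lip_op_def mn_def[symmetric]
proof (intro conjI allI impI)
  fix v :: "'x \<Rightarrow> complex" and K assume v: "lip_bound d v K"
  show "lip_bound d (\<lambda>x. indicator D x * mn v) (2 * K)"
    by (rule lip_boundI[where B = K and K = 0])
      (use mn_le[OF v] lip_bound_nonneg[OF v] in auto)
next
  fix v w :: "'x \<Rightarrow> complex" and K assume "lip_bound d v K" "lip_bound d w K"
  then show "(\<lambda>x. indicator D x * mn (\<lambda>x. v x + w x)) = (\<lambda>x. indicator D x * mn v + indicator D x * mn w)"
    using integrable_mn[of v K] integrable_mn[of w K] by (simp add: mn_def distrib_left)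
next
  fix v :: "'x \<Rightarrow> complex" and c
  show "(\<lambda>x. indicator D x * mn (\<lambda>x. c * v x)) = (\<lambda>x. c * (indicator D x * mn v))"
    by (simp add: mn_def mult.left_commute[of _ c])
qed auto

lemma component_mean: "component (app mean u) d' x = (if d' = d then indicator D x * mn (component u d) else 0)"
  unfolding mean_def by (simp add: component_component_op[OF lip_op_mean] mn_def)

lemma onD_op [simp]: "onD * op I = op I"
  by (intro lipop_eqI lipfam_eqI) (auto simp: component_onD component_op_apply indicator_def transfer_off)

lemma op_onD [simp]: "op I * onD = op I"
  by (intro lipop_eqI lipfam_eqI) (auto simp: component_onD component_op_apply indicator_def cell_D intro!: transfer_cong)

lemma mn_onD: "mn (\<lambda>x. indicator D x * v x) = mn v"
proof -
  have "(\<lambda>x. indicator D x * (indicator D x * v x)) = (\<lambda>x. indicator D x * v x)" by (auto simp: indicator_def)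
  then show ?thesis by (simp add: mn_def)
qed

lemma mn_const: "mn (\<lambda>x. c) = c" "mn (\<lambda>x. indicator D x * c) = c"
proof -
  have "mn (\<lambda>x. c) = (\<integral>y. c \<partial>M)"
    unfolding mn_def
  proof (rule integral_cong_AE)
    show "AE y in M. indicator D y * c = c" using D_full by eventually_elim simp
  qed simp_all
  then show "mn (\<lambda>x. c) = c" by (simp add: prob_space)
  then show "mn (\<lambda>x. indicator D x * c) = c" by (simp add: mn_onD)
qed

lemma component_eta: "component (app onD u) d = (\<lambda>x. indicator D x * component u d x)"
  "component (app mean u) d = (\<lambda>x. indicator D x * mn (component u d))"
  by (auto simp: component_onD component_mean)

lemma mean_mean [simp]: "mean * mean = mean"
  by (intro lipop_eqI lipfam_eqI) (simp add: component_mean component_eta mn_const)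

lemma mn_transfer:
  assumes v: "lip_bound d v K"
  shows "mn (transfer (\<lambda>i y. if i \<in> I then v y else 0)) = (\<integral>y. indicator {x \<in> D. \<kappa> x \<in> I} y * v y \<partial>M)"
proof -
  define v' where "v' y = indicator D y * v y" for y
  have v' [measurable]: "v' \<in> borel_measurable M" unfolding v'_def by (rule lip_bound_measurable[OF v])
  have "transfer (\<lambda>i y. if i \<in> I then v y else 0) x = transfer (\<lambda>i y. if i \<in> I then v' y else 0) x" for x
    by (intro transfer_cong) (auto simp: v'_def cell_D)
  then have "mn (transfer (\<lambda>i y. if i \<in> I then v y else 0)) = (\<integral>x. transfer (\<lambda>i y. if i \<in> I then v' y else 0) x * indicator D x \<partial>M)"
    by (simp add: mn_def mult.commute)
  also have "\<dots> = (\<integral>y. indicator D y *\<^sub>R ((if \<kappa> y \<in> I then v' y else 0) * indicator D (F y)) \<partial>M)"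
    by (rule transfer_duality(1)[where B = K and W = 1])
      (use v lip_bound_nonneg[OF v] in \<open>auto simp: lip_bound_def v'_def indicator_def\<close>)
  also have "\<dots> = (\<integral>y. indicator {x \<in> D. \<kappa> x \<in> I} y * v y \<partial>M)"
    by (intro Bochner_Integration.integral_cong) (auto simp: indicator_def v'_def F_D)
  finally show ?thesis .
qed

lemma mean_op_UNIV [simp]: "mean * op UNIV = mean"
proof (intro lipop_eqI lipfam_eqI)
  fix u d' x
  have "component (app (op UNIV) u) d = transfer (\<lambda>i y. if i \<in> UNIV then component u d y else 0)"
    by (auto simp: component_op_apply)
  then have "mn (component (app (op UNIV) u) d) = mn (component u d)"
    using mn_transfer[OF lip_bound_norm[of d u], of UNIV] by (simp add: mn_def)
  then show "component (app (mean * op UNIV) u) d' x = component (app mean u) d' x"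
    by (simp add: component_mean)
qed

lemma op_UNIV_mean [simp]: "op UNIV * mean = mean"
proof (intro lipop_eqI lipfam_eqI)
  fix u d' x
  define c where "c = mn (component u d)"
  have "transfer (\<lambda>i y. if i \<in> UNIV then indicator D y * c else 0) x = transfer (\<lambda>i y. c * 1) x"
    by (intro transfer_cong) (auto simp: cell_D)
  also have "\<dots> = c * transfer (\<lambda>i y. 1) x" by (rule transfer_mult[where B = 1]) simp
  also have "transfer (\<lambda>i y. 1::complex) x = of_real (S UNIV x)"
  proof -
    have "summable (\<lambda>i. G i x)" by (rule summable_G)
    from bounded_linear.suminf[OF bounded_linear_of_real[where 'a = complex] this] show ?thesis
      by (simp add: transfer_def S_def scaleR_conv_of_real)
  qed
  also have "c * of_real (S UNIV x) = indicator D x * c"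
    using S_UNIV[of x] by (cases "x \<in> D") (auto simp: S_def G_off)
  finally show "component (app (op UNIV * mean) u) d' x = component (app mean u) d' x"
    by (simp add: component_op_apply component_eta component_mean c_def)
qed

lemma mean_op_mean: "mean * op I * mean = mass I *\<^sub>R mean"
proof (intro lipop_eqI lipfam_eqI)
  fix u d' x
  define c where "c = mn (component u d)"
  have lb: "lip_bound d (\<lambda>y. indicator D y * c) (2 * norm u)"
    using lip_op_mean lip_bound_norm[of d u] by (auto simp: lip_op_def c_def mn_def)
  have "component (app (op I * mean) u) d = transfer (\<lambda>i y. if i \<in> I then indicator D y * c else 0)"
    by (rule ext) (simp add: component_op_apply component_eta c_def cong: if_cong)
  then have "mn (component (app (op I * mean) u) d) = (\<integral>y. indicator {x \<in> D. \<kappa> x \<in> I} y * (indicator D y * c) \<partial>M)"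
    using mn_transfer[OF lb] by simp
  also have "\<dots> = (\<integral>y. indicator {x \<in> D. \<kappa> x \<in> I} y *\<^sub>R c \<partial>M)"
    by (intro Bochner_Integration.integral_cong) (auto simp: indicator_def)
  also have "\<dots> = mass I *\<^sub>R c"
  proof -
    have "{x \<in> D. \<kappa> x \<in> I} = D \<inter> (\<kappa> -` I \<inter> space M)" using D_subset by auto
    then have "{x \<in> D. \<kappa> x \<in> I} \<in> sets M" by simp
    then have "integrable M (indicator {x \<in> D. \<kappa> x \<in> I} :: 'x \<Rightarrow> real)" "{x \<in> D. \<kappa> x \<in> I} \<inter> space M = {x \<in> D. \<kappa> x \<in> I}"
      using sets.sets_into_space by (auto simp: emeasure_eq_measure)
    then show ?thesis by (subst integral_scaleR_left) (auto simp: mass_def)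
  qed
  finally show "component (app (mean * op I * mean) u) d' x = component (app (mass I *\<^sub>R mean) u) d' x"
    by (simp add: component_mean c_def scaleR_conv_of_real[where 'a = complex] mult.assoc)
qed

lemma op_union:
  assumes "I \<inter> J = {}"
  shows "op (I \<union> J) = op I + op J"
proof (intro lipop_eqI lipfam_eqI)
  fix u d' x
  have b: "cmod (component u d y) \<le> norm u" for y using norm_component_le .
  have "transfer (\<lambda>i y. if i \<in> I \<union> J then component u d y else 0) x
      = transfer (\<lambda>i y. (if i \<in> I then component u d y else 0) + (if i \<in> J then component u d y else 0)) x"
    using assms by (intro transfer_cong) auto
  also have "\<dots> = transfer (\<lambda>i y. if i \<in> I then component u d y else 0) x + transfer (\<lambda>i y. if i \<in> J then component u d y else 0) x"
    by (rule transfer_add[where B = "norm u" and B' = "norm u"]) (auto simp: b)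
  finally show "component (app (op (I \<union> J)) u) d' x = component (app (op I + op J) u) d' x"
    by (simp add: component_op_apply)
qed

lemma op_null: "mass I = 0 \<Longrightarrow> op I = 0"
  using norm_op[of I] by simp

text \<open>
The series \<open>R(z)\<close> of the transfer operators restricted to the levels of the return time.
\<close>

definition RR :: "'x lipop fps" where
  "RR = Abs_fps (\<lambda>n. op {i. ph i = n})"

lemma RR_nth: "fps_nth RR n = op {i. ph i = n}"
  by (simp add: RR_def)

lemma RR_0 [simp]: "fps_nth RR 0 = 0"
proof -
  have "{x \<in> D. \<kappa> x \<in> {i. ph i = 0}} = {}" using ph_pos by fastforce
  then have "mass {i. ph i = 0} = 0" by (simp only: mass_def measure_empty)
  then show ?thesis unfolding RR_nth by (rule op_null)
qed

lemma op_atMost: "op {i. ph i \<le> n} = (\<Sum>k\<le>n. op {i. ph i = k})"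
proof (induction n)
  case (Suc n)
  have "{i. ph i \<le> Suc n} = {i. ph i \<le> n} \<union> {i. ph i = Suc n}" by auto
  then show ?case using Suc op_union[of "{i. ph i \<le> n}" "{i. ph i = Suc n}"] by (simp add: disjoint_iff)
qed simp

lemma op_split: "op UNIV = (\<Sum>k\<le>n. op {i. ph i = k}) + op {i. n < ph i}"
proof -
  have "UNIV = {i. ph i \<le> n} \<union> {i. n < ph i}" by auto
  then show ?thesis using op_union[of "{i. ph i \<le> n}" "{i. n < ph i}"] by (simp add: op_atMost disjoint_iff)
qed

text \<open>
The renewal operators \<open>(1 - R(z))\<^sup>-\<^sup>1\<close>. The series is formal at this stage; since the constant coefficient of \<open>R(z)\<close>
is zero, the inverse exists.
\<close>

definition TT :: "'x lipop fps" where
  "TT = fps_right_inverse (1 - RR) 1"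

lemma TT_right: "(1 - RR) * TT = 1"
  unfolding TT_def by (rule fps_right_inverse) simp

lemma TT_left: "TT * (1 - RR) = 1"
proof -
  have "fps_left_inverse (1 - RR) 1 = TT"
    unfolding TT_def by (rule fps_left_inverse_eq_fps_right_inverse) simp_all
  moreover have "fps_left_inverse (1 - RR) 1 * (1 - RR) = 1"
    by (rule fps_left_inverse) simp
  ultimately show ?thesis by simp
qed

lemma TT_0: "fps_nth TT 0 = 1"
  by (simp add: TT_def)

lemma TT_rec: "0 < n \<Longrightarrow> fps_nth TT n = (\<Sum>j\<le>n. op {i. ph i = j} * fps_nth TT (n - j))"
proof -
  assume "0 < n"
  have "TT = 1 + RR * TT" using TT_right by (simp add: left_diff_distrib algebra_simps)
  then have "fps_nth TT n = fps_nth (1 + RR * TT) n" by simp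
  then show ?thesis using \<open>0 < n\<close> by (simp add: fps_mult_nth RR_nth atMost_atLeast0)
qed

lemma transfer_sum:
  fixes f :: "nat \<Rightarrow> nat \<Rightarrow> 'x \<Rightarrow> complex"
  assumes "finite J" "\<And>j i y. j \<in> J \<Longrightarrow> y \<in> cell i \<Longrightarrow> norm (f j i y) \<le> B"
  shows "(\<Sum>j\<in>J. transfer (f j) x) = transfer (\<lambda>i y. \<Sum>j\<in>J. f j i y) x"
  using assms
proof (induction J rule: finite_induct)
  case (insert j J)
  have "transfer (\<lambda>i y. f j i y + (\<Sum>j\<in>J. f j i y)) x = transfer (f j) x + transfer (\<lambda>i y. \<Sum>j\<in>J. f j i y) x"
  proof (rule transfer_add[where B = B and B' = "real (card J) * B"])
    show "norm (\<Sum>j\<in>J. f j i y) \<le> real (card J) * B" if "y \<in> cell i" for i y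
      using insert.prems that by (intro sum_norm_bound) auto
  qed (use insert.prems in auto)
  then show ?case using insert by simp
qed (simp add: transfer_def)

text \<open>
The renewal recursion writes \<open>T\<^sub>n u\<close> as a transfer operator applied to the earlier \<open>T\<^bsub>n-k\<^esub> u\<close>, where the branch
determines \<open>k\<close>. As the weights of the branches have total mass at most \<open>1\<close>, the supremum does not grow, and a Lipschitz constant
\<open>K\<close> with \<open>\<theta> K + C\<^sub>L \<le> K\<close> is reproduced.
\<close>

lemma TT_bounded: "\<exists>C. \<forall>n. norm (fps_nth TT n) \<le> C"
proof -
  \<comment> \<open>the fixed point of the recursion for the Lipschitz constant, raised to be at least \<open>1\<close>\<close>
  define K where "K = 1 + C\<^sub>L / (1 - \<theta>)"
  have K: "1 \<le> K" "\<theta> * K + C\<^sub>L \<le> K"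
  proof -
    have "0 \<le> C\<^sub>L / (1 - \<theta>)" using C\<^sub>L_nonneg theta by simp
    then show "1 \<le> K" by (simp add: K_def)
    have "(1 - \<theta>) * K = (1 - \<theta>) + C\<^sub>L" using theta by (simp add: K_def distrib_left)
    then have "C\<^sub>L \<le> (1 - \<theta>) * K" using theta by simp
    then show "\<theta> * K + C\<^sub>L \<le> K" by (simp add: algebra_simps)
  qed
  define v where "v n u = component (app (fps_nth TT n) u) d" for n u
  have v_rec: "v n u x = transfer (\<lambda>i y. if i \<in> {i. ph i \<le> n} then v (n - ph i) u y else 0) x" if n: "0 < n" for n u x
  proof -
    define B where "B = (\<Sum>j\<le>n. norm (app (fps_nth TT (n - j)) u))"
    have bj: "cmod (component (app (fps_nth TT (n - j)) u) d y) \<le> B" if "j \<le> n" for j y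
      using norm_component_le[of "app (fps_nth TT (n - j)) u" d y] that
        member_le_sum[of j "{..n}" "\<lambda>j. norm (app (fps_nth TT (n - j)) u)"] by (simp add: B_def)
    have B0: "0 \<le> B" unfolding B_def by (intro sum_nonneg) auto
    have app_sum: "app (\<Sum>j\<in>J. A j) u = (\<Sum>j\<in>J. app (A j) u)" for A :: "nat \<Rightarrow> 'x lipop" and J
      by (induction J rule: infinite_finite_induct) auto
    have comp_sum: "component (\<Sum>j\<in>J. w j) d x = (\<Sum>j\<in>J. component (w j) d x)" for w :: "nat \<Rightarrow> 'x lipfam" and J
      by (induction J rule: infinite_finite_induct) auto
    have "v n u x = (\<Sum>j\<le>n. transfer (\<lambda>i y. if ph i = j then v (n - j) u y else 0) x)"
      unfolding v_def TT_rec[OF n] app_sum comp_sum by (simp add: component_op_apply)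
    also have "\<dots> = transfer (\<lambda>i y. \<Sum>j\<le>n. if ph i = j then v (n - j) u y else 0) x"
      by (rule transfer_sum[where B = B]) (auto simp: v_def bj B0)
    also have "\<dots> = transfer (\<lambda>i y. if i \<in> {i. ph i \<le> n} then v (n - ph i) u y else 0) x"
      by (intro transfer_cong) auto
    finally show ?thesis .
  qed
  have off: "component (app (fps_nth TT n) u) d' x = 0" if n: "0 < n" and *: "d' \<noteq> d \<or> x \<notin> D" for n u d' x
  proof -
    have app_sum: "app (\<Sum>j\<in>J. A j) u = (\<Sum>j\<in>J. app (A j) u)" for A :: "nat \<Rightarrow> 'x lipop" and J
      by (induction J rule: infinite_finite_induct) auto
    have comp_sum: "component (\<Sum>j\<in>J. w j) d' x = (\<Sum>j\<in>J. component (w j) d' x)" for w :: "nat \<Rightarrow> 'x lipfam" and J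
      by (induction J rule: infinite_finite_induct) auto
    show ?thesis
      unfolding TT_rec[OF n] app_sum comp_sum using * by (cases "d' = d") (auto simp: component_op_apply transfer_off)
  qed
  have bounds: "(\<forall>x\<in>D. cmod (v n u x) \<le> norm u) \<and>
      (\<forall>x\<in>D. \<forall>x'\<in>D. \<kappa> x' = \<kappa> x \<longrightarrow> cmod (v n u x - v n u x') \<le> K * norm u * d x x')" for n u
  proof (induction n rule: less_induct)
    case (less n)
    show ?case
    proof (cases "n = 0")
      case True
      have "cmod (component u d x - component u d x') \<le> K * norm u * d x x'" for x x'
      proof -
        have "cmod (component u d x - component u d x') \<le> norm u * d x x'"
          using lip_bound_norm[of d u] unfolding lip_bound_def abs_of_nonneg[OF d_nonneg] by blast
        also have "\<dots> \<le> K * norm u * d x x'" using K d_nonneg[of x x'] by (intro mult_right_mono) (auto simp: mult_le_cancel_right1)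
        finally show ?thesis .
      qed
      then show ?thesis using True by (simp add: v_def TT_0 norm_component_le)
    next
      case False
      then have n: "0 < n" by simp
      let ?f = "\<lambda>i y. if i \<in> {i. ph i \<le> n} then v (n - ph i) u y else 0"
      have IH: "cmod (v (n - ph i) u y) \<le> norm u" "y' \<in> D \<Longrightarrow> \<kappa> y' = \<kappa> y \<Longrightarrow> cmod (v (n - ph i) u y - v (n - ph i) u y') \<le> K * norm u * d y y'"
        if "y \<in> cell i" "ph i \<le> n" for i y y'
      proof -
        have "y \<in> D" "0 < ph i" using that ph_pos[of y] by (auto simp: cell_def)
        then have "n - ph i < n" using n by simp
        from less[OF this] \<open>y \<in> D\<close>
        show "cmod (v (n - ph i) u y) \<le> norm u" "y' \<in> D \<Longrightarrow> \<kappa> y' = \<kappa> y \<Longrightarrow> cmod (v (n - ph i) u y - v (n - ph i) u y') \<le> K * norm u * d y y'"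
          by auto
      qed
      have s1: "cmod (v n u x) \<le> norm u" for x
      proof -
        have "cmod (v n u x) \<le> norm u * S {i. ph i \<le> n} x"
          unfolding v_rec[OF n] by (rule norm_transfer_le) (use IH(1) in auto)
        also have "\<dots> \<le> norm u * 1" using S_le_1 by (intro mult_left_mono) auto
        finally show ?thesis by simp
      qed
      moreover have "cmod (v n u x - v n u x') \<le> K * norm u * d x x'" if x: "x \<in> D" "x' \<in> D" "\<kappa> x' = \<kappa> x" for x x'
      proof -
        have "cmod (v n u x - v n u x') \<le> (\<theta> * (K * norm u) + C\<^sub>L * norm u) * d x x' * S {i. ph i \<le> n} x"
          unfolding v_rec[OF n, of u x] v_rec[OF n, of u x']
          by (rule transfer_lipschitz) (use IH K x in \<open>auto simp: cell_def\<close>)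
        also have "\<dots> \<le> (\<theta> * (K * norm u) + C\<^sub>L * norm u) * d x x' * 1"
          using S_le_1 theta K C\<^sub>L_nonneg d_nonneg by (intro mult_left_mono) auto
        also have "\<dots> = (\<theta> * K + C\<^sub>L) * (norm u * d x x')" by (simp add: algebra_simps)
        also have "\<dots> \<le> K * (norm u * d x x')" using K d_nonneg by (intro mult_right_mono) auto
        finally show ?thesis by (simp add: mult.assoc)
      qed
      ultimately show ?thesis by blast
    qed
  qed
  have "norm (fps_nth TT n) \<le> 2 + K" for n
  proof (cases "n = 0")
    case True
    then show ?thesis using K by (simp add: TT_0)
  next
    case False
    then have n: "0 < n" by simp
    show ?thesis
    proof (rule norm_lipop_le)
      fix u
      have "lip_bound d' (component (app (fps_nth TT n) u) d') ((2 + K) * norm u)" for d'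
      proof (cases "d' = d")
        case True
        have "lip_bound d (v n u) ((2 + K) * norm u)"
        proof (rule lip_boundI[where B = "norm u" and K = "K * norm u"])
          show "v n u x = 0" if "x \<notin> D" for x using off[OF n, of d x u] that by (simp add: v_def)
        qed (use bounds[of n u] K in \<open>auto simp: distrib_right\<close>)
        then show ?thesis using True by (simp add: v_def)
      next
        case False
        then have "component (app (fps_nth TT n) u) d' = (\<lambda>_. 0)" using off[OF n] by auto
        then show ?thesis using K by simp
      qed
      then show "norm (app (fps_nth TT n) u) \<le> (2 + K) * norm u" by (rule norm_lipfam_le)
    qed (use K in simp)
  qed
  then show ?thesis by blast
qed

text \<open>
Outside the component of \<open>d\<close> and outside \<open>D\<close> the operator \<open>1 - X\<close> is the identity, so a bound from below
for functions on \<open>D\<close> gives one on the whole space.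
\<close>

lemma bounded_below_lift:
  assumes X: "onD * X = X" "X * onD = X" and C: "0 \<le> C"
    and low: "\<And>L. lip_bound d (\<lambda>x. component (app onD u) d x - component (app X (app onD u)) d x) L \<Longrightarrow>
      lip_bound d (component (app onD u) d) (C * L)"
  shows "norm u \<le> (C * norm (onD :: 'x lipop) + norm (1 - onD :: 'x lipop)) * norm (app (1 - X) u)"
proof -
  define w where "w = app (1 - X) u"
  have Xu: "app X (app onD u) = app X u" "app onD (app X u) = app X u"
    using X by (metis app_simps(6))+
  have "app onD w = app onD u - app X (app onD u)" by (simp add: w_def Xu)
  then have "component (app onD w) d = (\<lambda>x. component (app onD u) d x - component (app X (app onD u)) d x)" by auto
  then have "lip_bound d (component (app onD u) d) (C * norm (app onD w))"
    using low[of "norm (app onD w)"] lip_bound_norm[of d "app onD w"] by simp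
  then have 1: "norm (app onD u) \<le> C * norm (app onD w)"
  proof (intro norm_lipfam_le)
    fix d' assume *: "lip_bound d (component (app onD u) d) (C * norm (app onD w))"
    show "lip_bound d' (component (app onD u) d') (C * norm (app onD w))"
    proof (cases "d' = d")
      case False
      then have "component (app onD u) d' = (\<lambda>_. 0)" by (auto simp: component_onD)
      then show ?thesis using C by simp
    qed (use * in simp)
  qed
  have "app (1 - onD) w = app (1 - onD) u" by (simp add: w_def Xu)
  then have "u = app onD u + app (1 - onD) w" by simp
  then have "norm u \<le> norm (app onD u) + norm (app (1 - onD) w)" by (metis norm_triangle_ineq)
  also have "\<dots> \<le> C * (norm (onD :: 'x lipop) * norm w) + norm (1 - onD :: 'x lipop) * norm w"
    using 1 C norm_app_le[of onD w] by (intro add_mono norm_app_le) (meson mult_left_mono order_trans)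
  finally show ?thesis by (simp add: w_def algebra_simps)
qed

lemma wfin_RR: 
  assumes "summable (\<lambda>n. wt s n * mass {i. ph i = n})"
  shows "wfin s RR"
  unfolding wfin_def RR_nth
proof (rule summable_comparison_test'[OF summable_mult[OF assms, of C\<^sub>R]])
  fix n
  show "norm (wt s n * norm (op {i. ph i = n})) \<le> C\<^sub>R * (wt s n * mass {i. ph i = n})"
    using mult_left_mono[OF norm_op[of "{i. ph i = n}"], of "wt s n"] by (simp add: mult_ac)
qed

lemma component_bounded_linear: "bounded_linear (\<lambda>u. component u d' x)"
  by (rule bounded_linear_intro[where K = 1]) (auto simp: norm_component_le scaleR_conv_of_real)

lemma component_ev:
  assumes "wfin 0 f" "cmod z \<le> 1"
  shows "component (app (lipop.ev f z) u) d' x = (\<Sum>n. z ^ n * component (app (fps_nth f n) u) d' x)"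
proof -
  have bl: "bounded_linear (\<lambda>A. component (app A u) d' x)"
    by (rule bounded_linear_compose[OF component_bounded_linear bounded_linear_app_left])
  show ?thesis
    unfolding lipop.ev_def using bounded_linear.suminf[OF bl lipop.summable_ev[OF assms]] by simp
qed

end

section \<open>The pole at one and the decay of the renewal operators\<close>

definition geom :: "'b::ring_1 fps" where
  "geom = Abs_fps (\<lambda>_. 1)"

lemma geom_nth [simp]: "fps_nth geom n = 1"
  by (simp add: geom_def)

lemma mult_geom_nth: "fps_nth (f * geom) n = (\<Sum>i\<le>n. fps_nth f i)"
  by (simp add: fps_mult_nth atMost_atLeast0)

lemma geom_const_commute: "geom * fps_const c = fps_const c * geom"
  by (rule fps_ext) simp

lemma geom_inverse: "(1 - fps_X) * geom = (1 :: 'b::ring_1 fps)"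
  by (rule fps_ext) (simp add: left_diff_distrib)

context gibbs_markov_return
begin

text \<open>
Here \<open>p\<close> is the distribution of the return time and \<open>tl\<close> its tail; the tails sum to the mean return time \<open>phibar\<close>.
\<close>

definition p :: "nat \<Rightarrow> real" where
  "p n = mass {i. ph i = n}"

definition tl :: "nat \<Rightarrow> real" where
  "tl n = mass {i. n < ph i}"

definition phibar :: real where
  "phibar = (\<Sum>n. tl n)"

lemma p_nonneg: "0 \<le> p n" and tl_nonneg: "0 \<le> tl n"
  by (simp_all add: p_def tl_def mass_nonneg)

lemma mass_sets: "{x \<in> D. \<kappa> x \<in> I} \<in> sets M"
proof -
  have "{x \<in> D. \<kappa> x \<in> I} = D \<inter> (\<kappa> -` I \<inter> space M)" using D_subset by auto
  then show ?thesis by simp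
qed

lemma mass_disjoint_sums:
  assumes "disjoint_family I"
  shows "(\<lambda>n. mass (I n)) sums mass (\<Union>n. I n)"
proof -
  have "(\<lambda>n. measure M {x \<in> D. \<kappa> x \<in> I n}) sums measure M (\<Union>n. {x \<in> D. \<kappa> x \<in> I n})"
    by (intro finite_measure_UNION) (use assms mass_sets in \<open>auto simp: disjoint_family_on_def\<close>)
  moreover have "(\<Union>n. {x \<in> D. \<kappa> x \<in> I n}) = {x \<in> D. \<kappa> x \<in> (\<Union>n. I n)}" by auto
  ultimately show ?thesis by (simp add: mass_def)
qed

lemma tl_eq: "tl n = (\<Sum>k. p (k + Suc n))"
proof -
  have "disjoint_family (\<lambda>k. {i. ph i = k + Suc n})" by (auto simp: disjoint_family_on_def)
  from mass_disjoint_sums[OF this] have "(\<lambda>k. p (k + Suc n)) sums mass (\<Union>k. {i. ph i = k + Suc n})" by (simp add: p_def)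
  moreover have "(\<Union>k. {i. ph i = k + Suc n}) = {i. n < ph i}"
    by (auto simp: less_iff_Suc_add add.commute)
  ultimately show ?thesis by (simp add: tl_def sums_iff)
qed

lemma p_moment: "summable (\<lambda>n. wt (q + 1) n * p n)"
proof -
  define f where "f x = indicator D x * real (ph (\<kappa> x)) powr (q + 1)" for x
  have "(\<Sum>n\<le>N. wt (q + 1) n * p n) \<le> 2 powr (q + 1) * (\<integral>x. f x \<partial>M)" for N
  proof -
    have int: "integrable M (\<lambda>x. wt (q + 1) n * indicator {x \<in> D. \<kappa> x \<in> {i. ph i = n}} x)" for n
      using mass_sets[of "{i. ph i = n}"] by (intro integrable_mult_right) (simp add: emeasure_eq_measure)
    have "(\<Sum>n\<le>N. wt (q + 1) n * p n) = (\<Sum>n\<le>N. \<integral>x. wt (q + 1) n * indicator {x \<in> D. \<kappa> x \<in> {i. ph i = n}} x \<partial>M)"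
      using mass_sets[of "{i. ph i = _}"] sets.sets_into_space[OF mass_sets[of "{i. ph i = _}"]]
      by (intro sum.cong) (auto simp: p_def mass_def Int_absorb2)
    also have "\<dots> = (\<integral>x. (\<Sum>n\<le>N. wt (q + 1) n * indicator {x \<in> D. \<kappa> x \<in> {i. ph i = n}} x) \<partial>M)"
      by (rule Bochner_Integration.integral_sum[symmetric]) (rule int)
    also have "\<dots> \<le> (\<integral>x. 2 powr (q + 1) * f x \<partial>M)"
    proof (intro integral_mono Bochner_Integration.integrable_sum int)
      show "integrable M (\<lambda>x. 2 powr (q + 1) * f x)" using moment unfolding f_def by simp
      fix x
      have "(\<Sum>n\<le>N. wt (q + 1) n * indicator {x \<in> D. \<kappa> x \<in> {i. ph i = n}} x)
          = (\<Sum>n\<le>N. if n = ph (\<kappa> x) then wt (q + 1) n * indicator D x else 0)"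
        by (intro sum.cong) (auto simp: indicator_def)
      also have "\<dots> \<le> wt (q + 1) (ph (\<kappa> x)) * indicator D x"
        by simp
      also have "\<dots> \<le> 2 powr (q + 1) * f x"
      proof (cases "x \<in> D")
        case True
        then have "real (Suc (ph (\<kappa> x))) \<le> 2 * real (ph (\<kappa> x))" using ph_pos[OF True] by simp
        then have "real (Suc (ph (\<kappa> x))) powr (q + 1) \<le> (2 * real (ph (\<kappa> x))) powr (q + 1)"
          using q by (intro powr_mono2) auto
        then show ?thesis using True by (simp add: wt_def f_def powr_mult)
      qed (simp add: f_def)
      finally show "(\<Sum>n\<le>N. wt (q + 1) n * indicator {x \<in> D. \<kappa> x \<in> {i. ph i = n}} x) \<le> 2 powr (q + 1) * f x" .
    qed
    finally show ?thesis by simp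
  qed
  then show ?thesis by (intro bounded_imp_summable) (auto simp: p_nonneg)
qed

lemma tl_summable: "summable (\<lambda>n. wt q n * tl n)"
  using summable_tail_weighted(2)[of q p] q p_moment p_nonneg by (simp add: tl_eq)

lemma tl_summable0: "summable tl"
proof (rule summable_comparison_test'[OF tl_summable])
  show "norm (tl n) \<le> wt q n * tl n" for n
    using mult_right_mono[OF wt_ge_1[of q n] tl_nonneg[of n]] q tl_nonneg[of n] by simp
qed

lemma phibar_ge_1: "1 \<le> phibar"
proof -
  have "{x \<in> D. \<kappa> x \<in> {i. 0 < ph i}} = D" using ph_pos by auto
  then have "tl 0 = 1" using measure_D by (simp only: tl_def mass_def)
  moreover have "(\<Sum>n<1. tl n) \<le> phibar" unfolding phibar_def by (intro sum_le_suminf tl_summable0) (auto simp: tl_nonneg)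
  ultimately show ?thesis by simp
qed

lemma wfin_RR_q: "wfin q RR"
proof (rule wfin_RR)
  show "summable (\<lambda>n. wt q n * mass {i. ph i = n})"
    by (rule summable_comparison_test'[OF p_moment])
      (auto simp: p_def mass_nonneg intro!: mult_right_mono wt_mono_exponent)
qed

lemma wfin_RR_0: "wfin 0 RR"
  using wfin_mono_exponent[OF wfin_RR_q] q by simp

lemma op_UNIV_eq: "lipop.ev RR 1 = op UNIV"
proof -
  have "(\<lambda>n. C\<^sub>R * tl n) \<longlonglongrightarrow> C\<^sub>R * 0" by (intro tendsto_intros summable_LIMSEQ_zero tl_summable0)
  then have l0: "(\<lambda>n. C\<^sub>R * tl n) \<longlonglongrightarrow> 0" by simp
  have "(\<lambda>n. (\<Sum>k\<le>n. fps_nth RR k) - op UNIV) \<longlonglongrightarrow> 0"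
  proof (rule Lim_null_comparison[OF always_eventually l0], rule allI)
    fix n
    have "(\<Sum>k\<le>n. fps_nth RR k) - op UNIV = - op {i. n < ph i}" by (simp add: RR_nth op_split[of n])
    then show "norm ((\<Sum>k\<le>n. fps_nth RR k) - op UNIV) \<le> C\<^sub>R * tl n" by (simp add: tl_def norm_op)
  qed
  then have "(\<lambda>n. \<Sum>k\<le>n. fps_nth RR k) \<longlonglongrightarrow> op UNIV" by (rule LIM_zero_cancel)
  moreover have "(\<lambda>n. \<Sum>k\<le>n. fps_nth RR k) \<longlonglongrightarrow> lipop.ev RR 1"
    using summable_LIMSEQ'[OF lipop.summable_ev[OF wfin_RR_0, of 1]] by (simp add: lipop.ev_def)
  ultimately show ?thesis using LIMSEQ_unique by blast
qed

text \<open>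
In closed form \<open>E = (1 - P) + P / (1 - z)\<close> with \<open>P\<close> the projection \<open>mean\<close>, and \<open>E'\<close> is its inverse
\<open>(1 - P) + P (1 - z)\<close>. Multiplication by \<open>E\<close> turns the zero of \<open>1 - R(z)\<close> at \<open>z = 1\<close> into the invertible value
\<open>A(1)\<close>; here \<open>A\<close> is \<open>AA\<close>, and \<open>BB\<close> is its inverse.
\<close>

definition E :: "'x lipop fps" where
  "E = fps_const (1 - mean) + fps_const mean * geom"

definition E' :: "'x lipop fps" where
  "E' = fps_const (1 - mean) + fps_const mean * (1 - fps_X)"

definition AA :: "'x lipop fps" where
  "AA = (1 - RR) * E"

definition BB :: "'x lipop fps" where
  "BB = E' * TT"

lemma const_mult: "fps_const a * (fps_const b * f) = fps_const (a * b) * (f :: 'b::ring_1 fps)"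
  by (simp add: mult.assoc[symmetric])

lemma mean_cancel [simp]: "mean * (1 - mean) = 0" "(1 - mean) * mean = 0"
  by (simp_all add: algebra_simps)

lemma compl_idem: "(1 - mean) * (1 - mean) = 1 - mean"
  by (simp add: algebra_simps)

lemma X_geom: "geom * (1 - fps_X) = (1 :: 'b::ring_1 fps)"
proof (rule fps_ext)
  fix n show "fps_nth (geom * (1 - fps_X)) n = fps_nth (1 :: 'b fps) n"
    by (cases n) (simp_all add: right_diff_distrib fps_X_mult_right_nth)
qed

lemma X_const_commute: "(1 - fps_X) * fps_const c = fps_const c * (1 - fps_X :: 'b::ring_1 fps)"
  by (rule fps_ext) (simp add: left_diff_distrib right_diff_distrib)

lemma E_E': "E * E' = 1"
proof -
  have "E * E' = fps_const (1 - mean) * fps_const (1 - mean) + fps_const (1 - mean) * (fps_const mean * (1 - fps_X))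
     + fps_const mean * (geom * fps_const (1 - mean)) + fps_const mean * (geom * fps_const mean) * (1 - fps_X)"
    by (simp only: E_def E'_def distrib_left distrib_right mult.assoc add_ac)
  also have "\<dots> = fps_const (1 - mean) + fps_const mean * (geom * (1 - fps_X))"
    unfolding geom_const_commute by (simp add: const_mult compl_idem mult.assoc)
  finally show ?thesis by (simp add: X_geom)
qed

lemma E'_E: "E' * E = 1"
proof -
  have "E' * E = fps_const (1 - mean) * fps_const (1 - mean) + fps_const (1 - mean) * (fps_const mean * geom)
     + fps_const mean * ((1 - fps_X) * fps_const (1 - mean)) + fps_const mean * ((1 - fps_X) * fps_const mean) * geom"
    by (simp only: E_def E'_def distrib_left distrib_right mult.assoc add_ac)
  also have "\<dots> = fps_const (1 - mean) + fps_const mean * ((1 - fps_X) * geom)"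
    unfolding X_const_commute by (simp add: const_mult compl_idem mult.assoc)
  finally show ?thesis by (simp add: geom_inverse)
qed

lemma AA_BB: "AA * BB = 1"
proof -
  have "AA * BB = (1 - RR) * (E * E') * TT" by (simp only: AA_def BB_def mult.assoc)
  then show ?thesis by (simp add: E_E' TT_right)
qed

lemma BB_AA: "BB * AA = 1"
proof -
  have "BB * AA = E' * (TT * (1 - RR)) * E" by (simp only: AA_def BB_def mult.assoc)
  then show ?thesis by (simp add: E'_E TT_left)
qed

lemma TT_eq: "TT = E * BB"
  by (simp add: BB_def E_E' mult.assoc[symmetric])

lemma AA_E': "AA * E' = 1 - RR"
  by (simp add: AA_def mult.assoc E_E')

definition CC :: "'x lipop fps" where
  "CC = Abs_fps (\<lambda>n. op {i. n < ph i} * mean)"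

text \<open>
Since \<open>R(1) P = P\<close>, the partial sums of \<open>(1 - R(z)) P\<close> are the operators of the tails \<open>{\<phi> > n}\<close> applied to \<open>P\<close>.
\<close>

lemma CC_eq: "(1 - RR) * (fps_const mean * geom) = CC"
proof (rule fps_ext)
  fix n
  have "fps_nth ((1 - RR) * (fps_const mean * geom)) n = (\<Sum>i\<le>n. fps_nth ((1 - RR) * fps_const mean) i)"
    by (simp only: mult.assoc[symmetric] mult_geom_nth)
  also have "\<dots> = (\<Sum>i\<le>n. (if i = 0 then mean else 0) - op {j. ph j = i} * mean)"
    by (intro sum.cong) (auto simp: left_diff_distrib RR_nth)
  also have "\<dots> = mean - (\<Sum>i\<le>n. op {j. ph j = i}) * mean"
    by (simp add: sum_subtractf sum_distrib_right)
  also have "\<dots> = op {i. n < ph i} * mean"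
  proof -
    have "(\<Sum>i\<le>n. op {j. ph j = i}) = op UNIV - op {i. n < ph i}" by (simp add: op_split[of n])
    then show ?thesis by (simp add: left_diff_distrib)
  qed
  finally show "fps_nth ((1 - RR) * (fps_const mean * geom)) n = fps_nth CC n" by (simp add: CC_def)
qed

lemma AA_eq: "AA = (1 - RR) * fps_const (1 - mean) + CC"
  by (simp add: AA_def E_def distrib_left CC_eq)

lemma wfin_CC: "wfin q CC"
  unfolding wfin_def
proof (rule summable_comparison_test'[OF summable_mult[OF tl_summable, of "C\<^sub>R * norm (mean :: 'x lipop)"]])
  fix n
  have "norm (fps_nth CC n) \<le> (C\<^sub>R * tl n) * norm (mean :: 'x lipop)"
    using norm_mult_ineq[of "op {i. n < ph i}" mean] mult_right_mono[OF norm_op[of "{i. n < ph i}"], of "norm mean"]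
    by (simp add: CC_def tl_def)
  then show "norm (wt q n * norm (fps_nth CC n)) \<le> C\<^sub>R * norm (mean :: 'x lipop) * (wt q n * tl n)"
    using mult_left_mono[of "norm (fps_nth CC n)" "(C\<^sub>R * tl n) * norm (mean :: 'x lipop)" "wt q n"] by (simp add: mult_ac)
qed

lemma wfin_AA: "wfin q AA"
  unfolding AA_eq using q by (intro wfin_add wfin_CC wfin_mult wfin_diff wfin_RR_q wfin_1 wfin_const) auto

lemma wfin_AA_0: "wfin 0 AA"
  using wfin_mono_exponent[OF wfin_AA] q by simp

lemma wfin_CC_0: "wfin 0 CC"
  using wfin_mono_exponent[OF wfin_CC] q by simp

lemma wfin_X: "wfin s (fps_X :: 'b::real_normed_algebra_1 fps)"
  unfolding wfin_def by (rule summable_finite[of "{0..1}"]) auto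

lemma wfin_E': "wfin 0 E'"
  unfolding E'_def by (intro wfin_add wfin_mult wfin_diff wfin_X wfin_const wfin_1) auto

lemma ev_X: "lipop.ev fps_X z = (scalar_lipop z :: 'x lipop)"
proof -
  have "(\<Sum>n. scalar_lipop (z ^ n) * fps_nth fps_X n) = (\<Sum>n\<in>{1}. scalar_lipop (z ^ n) * fps_nth fps_X n :: 'x lipop)"
    by (rule suminf_finite) auto
  then show ?thesis by (simp add: lipop.ev_def)
qed

lemma mult_onD_ev:
  assumes "wfin 0 f" "cmod z \<le> 1" "\<And>n. onD * fps_nth f n = fps_nth f n" "\<And>n. fps_nth f n * onD = fps_nth f n"
  shows "onD * lipop.ev f z = lipop.ev f z" "lipop.ev f z * onD = lipop.ev f z"
proof -
  have "fps_const onD * f = f" by (rule fps_ext) (simp add: assms(3))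
  moreover have "f * fps_const onD = f" by (rule fps_ext) (simp add: assms(4))
  ultimately have *: "lipop.ev (fps_const onD * f) z = lipop.ev f z" "lipop.ev (f * fps_const onD) z = lipop.ev f z"
    by simp_all
  then show "onD * lipop.ev f z = lipop.ev f z" "lipop.ev f z * onD = lipop.ev f z"
    using * assms(1,2) by (simp_all add: lipop.ev_mult)
qed

lemma onD_RR: "onD * fps_nth RR n = fps_nth RR n" "fps_nth RR n * onD = fps_nth RR n"
  by (simp_all add: RR_nth)

lemma resolvent_bounded_below:
  assumes z: "cmod z \<le> 1" "z \<noteq> 1"
  shows "\<exists>C\<ge>0. \<forall>u. norm u \<le> C * norm (app (1 - lipop.ev RR z) u)"
proof -
  obtain C where C: "0 \<le> C" and low0: "\<forall>v K L. (\<forall>x. x \<notin> D \<longrightarrow> v x = 0) \<longrightarrow> lip_bound d v K \<longrightarrow>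
      lip_bound d (\<lambda>x. v x - (\<Sum>n. z ^ n * transfer (\<lambda>i y. if ph i = n then v y else 0) x)) L \<longrightarrow> lip_bound d v (C * L)"
    using aperiodic[OF z] by blast
  note low = low0[rule_format]
  have "norm u \<le> (C * norm (onD :: 'x lipop) + norm (1 - onD :: 'x lipop)) * norm (app (1 - lipop.ev RR z) u)" for u
  proof (rule bounded_below_lift[OF mult_onD_ev[OF wfin_RR_0 z(1) onD_RR] C])
    fix L assume L: "lip_bound d (\<lambda>x. component (app onD u) d x - component (app (lipop.ev RR z) (app onD u)) d x) L"
    show "lip_bound d (component (app onD u) d) (C * L)"
    proof (rule low)
      show "component (app onD u) d x = 0" if "x \<notin> D" for x using that by (simp add: component_onD)
      show "lip_bound d (component (app onD u) d) (norm (app onD u))" by (rule lip_bound_norm)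
      show "lip_bound d (\<lambda>x. component (app onD u) d x
          - (\<Sum>n. z ^ n * transfer (\<lambda>i y. if ph i = n then component (app onD u) d y else 0) x)) L"
        using L by (simp add: component_ev[OF wfin_RR_0 z(1)] RR_nth component_op_apply)
    qed
  qed
  then show ?thesis using C by (intro exI[of _ "C * norm (onD :: 'x lipop) + norm (1 - onD :: 'x lipop)"]) auto
qed

lemma mean_zero_bounded_below_op:
  "\<exists>C\<ge>0. \<forall>u. app mean u = 0 \<longrightarrow> norm u \<le> C * norm (app (1 - op UNIV) u)"
proof -
  obtain C where C: "0 \<le> C" and low0: "\<forall>v K L. (\<forall>x. x \<notin> D \<longrightarrow> v x = 0) \<longrightarrow> lip_bound d v K \<longrightarrow> (\<integral>x. v x \<partial>M) = 0 \<longrightarrow>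
     lip_bound d (\<lambda>x. v x - ruelle v x) L \<longrightarrow> lip_bound d v (C * L)"
    using mean_zero_bounded_below by blast
  note low = low0[rule_format]
  have "norm u \<le> (C * norm (onD :: 'x lipop) + norm (1 - onD :: 'x lipop)) * norm (app (1 - op UNIV) u)"
    if u: "app mean u = 0" for u
  proof (rule bounded_below_lift[OF onD_op op_onD C])
    fix L assume L: "lip_bound d (\<lambda>x. component (app onD u) d x - component (app (op UNIV) (app onD u)) d x) L"
    show "lip_bound d (component (app onD u) d) (C * L)"
    proof (rule low)
      show "component (app onD u) d x = 0" if "x \<notin> D" for x using that by (simp add: component_onD)
      show "lip_bound d (component (app onD u) d) (norm (app onD u))" by (rule lip_bound_norm)
      obtain x where "x \<in> D" using measure_D by fastforce
      then have "mn (component u d) = 0" using arg_cong[OF u, of "\<lambda>w. component w d x"] by (simp add: component_mean)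
      then show "(\<integral>x. component (app onD u) d x \<partial>M) = 0" by (simp add: component_onD mn_def)
      show "lip_bound d (\<lambda>x. component (app onD u) d x - ruelle (component (app onD u) d) x) L"
        using L by (simp add: component_op_apply ruelle_def)
    qed
  qed
  then show ?thesis using C by (intro exI[of _ "C * norm (onD :: 'x lipop) + norm (1 - onD :: 'x lipop)"]) auto
qed

text \<open>
This is where the mean return time enters: \<open>P R\<^sub>I P\<close> is \<open>P\<close> times the mass of the cells in \<open>I\<close>, and the tails sum to \<open>phibar\<close>.
\<close>

lemma mean_ev_CC: "mean * lipop.ev CC 1 = phibar *\<^sub>R mean"
proof -
  have "fps_nth (fps_const mean * CC) n = tl n *\<^sub>R mean" for n
    by (simp add: CC_def mult.assoc[symmetric] mean_op_mean tl_def)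
  then have "lipop.ev (fps_const mean * CC) 1 = (\<Sum>n. tl n *\<^sub>R mean)" by (simp add: lipop.ev_def)
  also have "\<dots> = phibar *\<^sub>R mean"
    unfolding phibar_def by (rule bounded_linear.suminf[OF bounded_linear_scaleR_left tl_summable0, symmetric])
  finally show ?thesis using lipop.ev_mult[of "fps_const mean" CC 1] wfin_CC_0 by simp
qed

lemma ev_AA_1: "lipop.ev AA 1 = (1 - op UNIV) * (1 - mean) + lipop.ev CC 1"
  unfolding AA_eq using wfin_CC_0 wfin_RR_0
  by (simp add: lipop.ev_add lipop.ev_mult lipop.ev_diff wfin_mult wfin_diff op_UNIV_eq)

lemma mean_ev_AA_1: "mean * lipop.ev AA 1 = phibar *\<^sub>R mean"
proof -
  have "mean * (1 - op UNIV) = 0" by (simp add: right_diff_distrib)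
  then have "mean * ((1 - op UNIV) * (1 - mean)) = 0" by (simp only: mult.assoc[symmetric] mult_zero_left)
  then show ?thesis by (simp add: ev_AA_1 distrib_left mean_ev_CC)
qed

text \<open>
The part \<open>P u\<close> is recovered from \<open>P A(1) u = phibar P u\<close>, and the part of mean zero from
\<open>mean_zero_bounded_below_op\<close> after subtraction of the contribution of \<open>P u\<close>.
\<close>

lemma AA_bounded_below_1: "\<exists>C. \<forall>u. norm u \<le> C * norm (app (lipop.ev AA 1) u)"
proof -
  obtain C where C: "0 \<le> C" and low: "\<And>u. app mean u = 0 \<Longrightarrow> norm u \<le> C * norm (app (1 - op UNIV) u)"
    using mean_zero_bounded_below_op by blast
  define P where "P = norm (mean :: 'x lipop)"
  define N where "N = norm (lipop.ev CC 1)"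
  have CCm: "lipop.ev CC 1 = lipop.ev CC 1 * mean"
  proof -
    have "CC * fps_const mean = CC" by (rule fps_ext) (simp add: CC_def mult.assoc)
    then show ?thesis using lipop.ev_mult[of CC "fps_const mean" 1] wfin_CC_0 by simp
  qed
  have "norm u \<le> (P + C * (1 + N * P)) * norm (app (lipop.ev AA 1) u)" for u
  proof -
    define w where "w = app (lipop.ev AA 1) u"
    have "app mean w = phibar *\<^sub>R app mean u" unfolding w_def by (simp flip: app_simps(6) add: mean_ev_AA_1)
    then have "norm (app mean w) = phibar * norm (app mean u)" using phibar_ge_1 by simp
    then have "norm (app mean u) \<le> norm (app mean w)"
      using mult_right_mono[OF phibar_ge_1, of "norm (app mean u)"] by simp
    also have "\<dots> \<le> P * norm w" unfolding P_def by (rule norm_app_le)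
    finally have mu: "norm (app mean u) \<le> P * norm w" .
    define u' where "u' = app (1 - mean) u"
    have "app mean u' = 0" unfolding u'_def by (simp flip: app_simps(6))
    then have "norm u' \<le> C * norm (app (1 - op UNIV) u')" by (rule low)
    also have "app (1 - op UNIV) u' = w - app (lipop.ev CC 1) (app mean u)"
      unfolding w_def u'_def ev_AA_1 by (subst CCm) simp
    also have "norm \<dots> \<le> norm w + N * (P * norm w)"
      using norm_app_le[of "lipop.ev CC 1" "app mean u"] mult_left_mono[OF mu, of N]
      by (intro order_trans[OF norm_triangle_ineq4]) (auto simp: N_def)
    finally have "norm u' \<le> C * (norm w + N * (P * norm w))" using C by (meson mult_left_mono order_trans order_refl)
    moreover have "norm u \<le> norm (app mean u) + norm u'"
      using norm_triangle_ineq[of "app mean u" u'] by (simp add: u'_def)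
    ultimately have "norm u \<le> P * norm w + C * (norm w + N * (P * norm w))" using mu by linarith
    then show ?thesis by (simp add: w_def algebra_simps)
  qed
  then show ?thesis by blast
qed

lemma AA_bounded_below:
  assumes z: "cmod z \<le> 1"
  shows "\<exists>C. \<forall>u. norm u \<le> C * norm (app (lipop.ev AA z) u)"
proof (cases "z = 1")
  case True
  then show ?thesis using AA_bounded_below_1 by simp
next
  case False
  obtain C where C: "0 \<le> C" and low: "\<And>u. norm u \<le> C * norm (app (1 - lipop.ev RR z) u)"
    using resolvent_bounded_below[OF z False] by blast
  define e where "e = lipop.ev E' z"
  define c where "c = z / (1 - z)"
  define e' where "e' = 1 + scalar_lipop c * (mean :: 'x lipop)"
  have "lipop.ev E' z = (1 - mean) + mean * (1 - scalar_lipop z)"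
    unfolding E'_def using z by (simp add: lipop.ev_add lipop.ev_mult lipop.ev_diff ev_X wfin_mult wfin_diff wfin_X)
  then have e: "e = 1 - scalar_lipop z * mean"
    by (simp add: e_def right_diff_distrib lipop.cs_commute[of z mean])
  have "e * e' = 1 + scalar_lipop (c - z - z * c) * mean"
  proof -
    have "e * e' = 1 + scalar_lipop c * mean - scalar_lipop z * mean - scalar_lipop z * (mean * scalar_lipop c) * mean"
      unfolding e e'_def by (simp add: algebra_simps)
    also have "mean * scalar_lipop c = scalar_lipop c * (mean :: 'x lipop)" by (rule lipop.cs_commute[symmetric])
    also have "scalar_lipop z * (scalar_lipop c * mean) * mean = scalar_lipop (z * c) * (mean :: 'x lipop)"
      by (simp add: lipop.cs_mult mult.assoc)
    also have "1 + scalar_lipop c * mean - scalar_lipop z * mean - scalar_lipop (z * c) * mean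
        = 1 + (scalar_lipop c - scalar_lipop z - scalar_lipop (z * c)) * (mean :: 'x lipop)" by (simp add: algebra_simps)
    also have "scalar_lipop c - scalar_lipop z - scalar_lipop (z * c) = (scalar_lipop (c - z - z * c) :: 'x lipop)"
      by (intro lipop_eqI lipfam_eqI) (simp add: algebra_simps)
    finally show ?thesis .
  qed
  moreover have "c - z - z * c = 0" using False by (simp add: c_def field_simps)
  ultimately have ee': "e * e' = 1" by simp
  have Ae: "lipop.ev AA z * e = 1 - lipop.ev RR z"
  proof -
    have "lipop.ev AA z * e = lipop.ev (AA * E') z" unfolding e_def using z wfin_AA_0 wfin_E' by (simp add: lipop.ev_mult)
    then show ?thesis using z wfin_RR_0 by (simp add: AA_E' lipop.ev_diff)
  qed
  have "norm u \<le> norm e * C * norm (app (lipop.ev AA z) u)" for u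
  proof -
    define u' where "u' = app e' u"
    have u: "u = app e u'" unfolding u'_def by (simp flip: app_simps(6) add: ee')
    have "norm u \<le> norm e * norm u'" by (subst u) (rule norm_app_le)
    also have "\<dots> \<le> norm e * (C * norm (app (1 - lipop.ev RR z) u'))" by (intro mult_left_mono low) auto
    also have "app (1 - lipop.ev RR z) u' = app (lipop.ev AA z) u" unfolding Ae[symmetric] by (simp flip: u)
    finally show ?thesis by (simp add: mult.assoc)
  qed
  then show ?thesis by blast
qed

text \<open>
The factor \<open>1 - z\<close> in \<open>E'\<close> only takes differences of consecutive renewal operators, which are bounded.
\<close>

lemma BB_bounded: "\<exists>C. \<forall>n. norm (fps_nth BB n) \<le> C"
proof -
  obtain C where C: "\<And>n. norm (fps_nth TT n) \<le> C" using TT_bounded by blast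
  define B where "B = norm (1 - mean :: 'x lipop) + 2 * norm (mean :: 'x lipop)"
  have C0: "0 \<le> C" using order_trans[OF norm_ge_zero C[of 0]] .
  have "norm (fps_nth BB n) \<le> B * C" for n
  proof -
    define f where "f = (1 - fps_X) * TT"
    have f: "norm (fps_nth f n) \<le> 2 * C"
    proof (cases n)
      case 0
      then show ?thesis using C[of 0] C0 by (simp add: f_def left_diff_distrib)
    next
      case (Suc k)
      have "norm (fps_nth TT (Suc k) - fps_nth TT k) \<le> C + C"
        by (intro order_trans[OF norm_triangle_ineq4] add_mono C)
      then show ?thesis using Suc by (simp add: f_def left_diff_distrib)
    qed
    have "fps_nth BB n = (1 - mean) * fps_nth TT n + mean * fps_nth f n"
      by (simp add: BB_def E'_def f_def distrib_right mult.assoc)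
    also have "norm \<dots> \<le> norm (1 - mean :: 'x lipop) * C + norm (mean :: 'x lipop) * (2 * C)"
      by (intro norm_triangle_le add_mono order_trans[OF norm_mult_ineq] mult_left_mono C f) auto
    finally show ?thesis by (simp add: B_def algebra_simps)
  qed
  then show ?thesis by blast
qed

text \<open>
The hypotheses of the Wiener lemma are met: on the open disc \<open>B(z)\<close> is the inverse of \<open>A(z)\<close>, which is uniformly
bounded from below.
\<close>

theorem wfin_BB: "wfin q BB"
proof -
  obtain C where C: "\<And>n. norm (fps_nth BB n) \<le> C" using BB_bounded by blast
  obtain K where K: "0 \<le> K" and low: "\<And>z u. cmod z \<le> 1 \<Longrightarrow> norm u \<le> K * norm (app (lipop.ev AA z) u)"
    using bounded_below_uniform[OF wfin_AA_0 AA_bounded_below] by metis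
  show ?thesis
  proof (rule lipop.weighted_wiener[OF q wfin_AA AA_BB BB_AA C])
    fix z :: complex assume z: "cmod z < 1"
    define r where "r = (1 + cmod z) / 2"
    have r: "0 < r" "r < 1" "cmod z < r" using z by (auto simp: r_def add_pos_nonneg)
    define y where "y = z / of_real r"
    have y: "cmod y \<le> 1" "of_real r * y = z" using r by (auto simp: y_def norm_divide)
    have dB: "wfin 0 (dilate r BB)" using r C by (intro wfin_dilate_bounded) auto
    have dA: "wfin 0 (dilate r AA)" using r wfin_AA_0 by (intro wfin_dilate) auto
    have "lipop.ev AA z * lipop.ev BB z = lipop.ev (dilate r (AA * BB)) y"
      using dA dB y by (simp add: dilate_mult lipop.ev_mult lipop.ev_dilate)
    then have inv: "lipop.ev AA z * lipop.ev BB z = 1" by (simp add: AA_BB)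
    show "norm (lipop.ev BB z) \<le> K"
    proof (rule norm_lipop_le[OF _ K])
      fix u
      have "norm (app (lipop.ev BB z) u) \<le> K * norm (app (lipop.ev AA z) (app (lipop.ev BB z) u))" using z by (intro low) auto
      then show "norm (app (lipop.ev BB z) u) \<le> K * norm u" by (simp flip: app_simps(6) add: inv)
    qed
  qed
qed

definition SS :: "'x lipop fps" where
  "SS = TT - fps_const ((1 / phibar) *\<^sub>R mean) * geom"

text \<open>
As \<open>T = E B\<close>, the \<open>n\<close>-th coefficient of \<open>P T\<close> is the \<open>n\<close>-th partial sum of \<open>P B\<close>. The full sum is
\<open>P B(1) = P / phibar\<close>, by \<open>P A(1) = phibar P\<close>, so the difference is a tail of a sequence summable with
weight \<open>n\<^sup>q\<close>.
\<close>

theorem wfin_SS: "wfin (q - 1) SS"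
proof -
  have B0: "wfin 0 BB" using wfin_mono_exponent[OF wfin_BB] q by simp
  have bs: "summable (\<lambda>n. norm (fps_nth BB n))" using wfin_norm_summable[OF B0] .
  have "lipop.ev AA 1 * lipop.ev BB 1 = 1" using lipop.ev_mult[of AA BB 1] wfin_AA_0 B0 by (simp add: AA_BB)
  then have "mean = mean * lipop.ev AA 1 * lipop.ev BB 1" by (simp add: mult.assoc)
  also have "\<dots> = phibar *\<^sub>R (mean * lipop.ev BB 1)" by (simp add: mean_ev_AA_1)
  finally have "(1 / phibar) *\<^sub>R mean = (1 / phibar) *\<^sub>R (phibar *\<^sub>R (mean * lipop.ev BB 1))" by simp
  then have pB: "(1 / phibar) *\<^sub>R mean = mean * lipop.ev BB 1" using phibar_ge_1 by simp
  have evB: "lipop.ev BB 1 = (\<Sum>n. fps_nth BB n)" by (simp add: lipop.ev_def)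
  define t where "t n = (\<Sum>k. norm (fps_nth BB (k + Suc n)))" for n
  have SSn: "norm (fps_nth SS n) \<le> norm (1 - mean :: 'x lipop) * norm (fps_nth BB n) + norm (mean :: 'x lipop) * t n" for n
  proof -
    have "fps_nth TT n = (1 - mean) * fps_nth BB n + mean * (\<Sum>i\<le>n. fps_nth BB i)"
    proof -
      have "TT = fps_const (1 - mean) * BB + fps_const mean * (geom * BB)"
        by (simp add: TT_eq E_def distrib_right mult.assoc)
      moreover have "fps_nth (geom * BB) n = (\<Sum>i\<le>n. fps_nth BB i)"
        unfolding fps_mult_nth
        by (rule sum.reindex_bij_witness[of _ "\<lambda>i. n - i" "\<lambda>i. n - i"]) auto
      ultimately show ?thesis by simp
    qed
    moreover have "(\<Sum>n. fps_nth BB n) = (\<Sum>k. fps_nth BB (k + Suc n)) + (\<Sum>i\<le>n. fps_nth BB i)"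
      using suminf_split_initial_segment[OF summable_norm_cancel[OF bs], of "Suc n"] by (simp add: lessThan_Suc_atMost)
    ultimately have "fps_nth SS n = (1 - mean) * fps_nth BB n - mean * (\<Sum>k. fps_nth BB (k + Suc n))"
      by (simp add: SS_def pB evB algebra_simps)
    also have "norm \<dots> \<le> norm (1 - mean :: 'x lipop) * norm (fps_nth BB n) + norm (mean :: 'x lipop) * t n"
    proof (intro order_trans[OF norm_triangle_ineq4] add_mono norm_mult_ineq order_trans[OF norm_mult_ineq] mult_left_mono)
      show "norm (\<Sum>k. fps_nth BB (k + Suc n)) \<le> t n"
        unfolding t_def using summable_ignore_initial_segment[OF bs, of "Suc n"] by (rule summable_norm)
    qed auto
    finally show ?thesis .
  qed
  have "summable (\<lambda>n. wt (q - 1) n * t n)"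
    unfolding t_def using q wfin_BB by (intro summable_tail_weighted(2)) (auto simp: wfin_def)
  then have s2: "summable (\<lambda>n. norm (mean :: 'x lipop) * (wt (q - 1) n * t n))" by (rule summable_mult)
  have "summable (\<lambda>n. wt (q - 1) n * norm (fps_nth BB n))"
    using wfin_mono_exponent[OF wfin_BB, of "q - 1"] by (simp add: wfin_def)
  then have s1: "summable (\<lambda>n. norm (1 - mean :: 'x lipop) * (wt (q - 1) n * norm (fps_nth BB n)))" by (rule summable_mult)
  show ?thesis
    unfolding wfin_def
  proof (rule summable_comparison_test'[OF summable_add[OF s1 s2]])
    fix n
    show "norm (wt (q - 1) n * norm (fps_nth SS n)) \<le> norm (1 - mean :: 'x lipop) * (wt (q - 1) n * norm (fps_nth BB n))
        + norm (mean :: 'x lipop) * (wt (q - 1) n * t n)"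
      using mult_left_mono[OF SSn[of n], of "wt (q - 1) n"] by (simp add: algebra_simps)
  qed
qed

end

section \<open>Correlations in terms of return times\<close>

text \<open>
The exponent \<open>q - 1\<close> may be negative, in which case the weight is decreasing and not submultiplicative; the extra power in the
other factor compensates.
\<close>

lemma wt_shifted_submult:
  assumes q: "0 < q"
  shows "wt (q - 1) (i + j) \<le> wt q i * wt (q - 1) j"
proof (cases "1 \<le> q")
  case True
  have "wt (q - 1) (i + j) \<le> wt (q - 1) i * wt (q - 1) j" using True by (intro wt_submult) auto
  also have "\<dots> \<le> wt q i * wt (q - 1) j" by (intro mult_right_mono wt_mono_exponent) auto
  finally show ?thesis .
next
  case False
  have "wt (q - 1) (i + j) \<le> 1 * wt (q - 1) j"
    unfolding wt_def using False by (simp add: powr_mono2')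
  also have "\<dots> \<le> wt q i * wt (q - 1) j" using q by (intro mult_right_mono wt_ge_1) auto
  finally show ?thesis .
qed

lemma wfin_shifted_mult:
  fixes f g :: "'b::real_normed_algebra_1 fps"
  assumes q: "0 < q" and f: "wfin q f" and g: "wfin (q - 1) g"
  shows "wfin (q - 1) (f * g)" and "wfin (q - 1) (g * f)"
proof -
  have *: "wfin (q - 1) h" if h: "\<And>n. norm (fps_nth h n) \<le> (\<Sum>i\<le>n. norm (fps_nth f i) * norm (fps_nth g (n - i)))"
    for h :: "'b fps"
  proof (rule wfinI)
    fix N
    have "wsum (q - 1) h N \<le> (\<Sum>n<N. \<Sum>i\<le>n. (wt q i * norm (fps_nth f i)) * (wt (q - 1) (n - i) * norm (fps_nth g (n - i))))"
      unfolding wsum_def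
    proof (rule sum_mono)
      fix n
      have "wt (q - 1) n * norm (fps_nth h n) \<le> wt (q - 1) n * (\<Sum>i\<le>n. norm (fps_nth f i) * norm (fps_nth g (n - i)))"
        by (intro mult_left_mono h) auto
      also have "\<dots> = (\<Sum>i\<le>n. wt (q - 1) (i + (n - i)) * (norm (fps_nth f i) * norm (fps_nth g (n - i))))"
        by (simp add: sum_distrib_left)
      also have "\<dots> \<le> (\<Sum>i\<le>n. (wt q i * wt (q - 1) (n - i)) * (norm (fps_nth f i) * norm (fps_nth g (n - i))))"
        by (intro sum_mono mult_right_mono wt_shifted_submult q) auto
      finally show "wt (q - 1) n * norm (fps_nth h n)
          \<le> (\<Sum>i\<le>n. (wt q i * norm (fps_nth f i)) * (wt (q - 1) (n - i) * norm (fps_nth g (n - i))))"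
        by (simp add: mult_ac)
    qed
    also have "\<dots> \<le> wsum q f N * wsum (q - 1) g N"
      unfolding wsum_def by (rule sum_convolution_le) auto
    also have "\<dots> \<le> wnorm q f * wnorm (q - 1) g"
      using f g by (intro mult_mono wsum_le_wnorm wsum_nonneg wnorm_nonneg)
    finally show "wsum (q - 1) h N \<le> wnorm q f * wnorm (q - 1) g" .
  qed
  show "wfin (q - 1) (f * g)" by (rule *) (rule norm_fps_nth_mult_le)
  show "wfin (q - 1) (g * f)"
  proof (rule *)
    fix n
    have "norm (fps_nth (g * f) n) \<le> (\<Sum>i\<le>n. norm (fps_nth g i) * norm (fps_nth f (n - i)))" by (rule norm_fps_nth_mult_le)
    also have "\<dots> = (\<Sum>i\<le>n. norm (fps_nth f i) * norm (fps_nth g (n - i)))"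
      by (rule sum.reindex_bij_witness[of _ "\<lambda>i. n - i" "\<lambda>i. n - i"]) (auto simp: mult.commute)
    finally show "norm (fps_nth (g * f) n) \<le> (\<Sum>i\<le>n. norm (fps_nth f i) * norm (fps_nth g (n - i)))" .
  qed
qed

lemma wfin_leI:
  assumes "summable (\<lambda>n. wt s n * x n)" "\<And>n. norm (fps_nth f n) \<le> C * x n"
  shows "wfin s f"
  unfolding wfin_def
proof (rule summable_comparison_test'[OF summable_mult[OF assms(1), of C]])
  fix n show "norm (wt s n * norm (fps_nth f n)) \<le> C * (wt s n * x n)"
    using mult_left_mono[OF assms(2)[of n], of "wt s n"] by (simp add: mult_ac)
qed

lemma app_sum: "app (\<Sum>j\<in>J. A j) u = (\<Sum>j\<in>J. app (A j) u)"
  by (induction J rule: infinite_finite_induct) auto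

lemma component_sum: "component (\<Sum>j\<in>J. w j) d x = (\<Sum>j\<in>J. component (w j) d x)"
  by (induction J rule: infinite_finite_induct) auto

context gibbs_markov_return
begin

text \<open>
Functionals \<open>v \<mapsto> \<integral> h v\<close> are realised as operators with constant values, so that sequences of them are power series in the
same algebra as the renewal operators.
\<close>

definition pairing :: "('x \<Rightarrow> complex) \<Rightarrow> ('x \<Rightarrow> complex) \<Rightarrow> complex" where
  "pairing h v = (\<integral>y. indicator D y * (h y * v y) \<partial>M)"

lemma
  assumes h [measurable]: "h \<in> borel_measurable M" and v: "lip_bound d v K" and H: "0 \<le> H"
    and hH: "\<And>y. y \<in> D \<Longrightarrow> cmod (h y) \<le> H * indicator {x \<in> D. \<kappa> x \<in> I} y"
  shows integrable_pairing: "integrable M (\<lambda>y. indicator D y * (h y * v y))"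
    and pairing_le: "cmod (pairing h v) \<le> H * mass I * K"
proof -
  have K: "0 \<le> K" "cmod (v y) \<le> K" for y using v lip_bound_nonneg[OF v] by (auto simp: lip_bound_def)
  have eq: "(\<lambda>y. indicator D y * (h y * v y)) = (\<lambda>y. h y * (indicator D y * v y))" by (auto simp: indicator_def)
  have m: "(\<lambda>y. indicator D y * (h y * v y)) \<in> borel_measurable M"
    unfolding eq using lip_bound_measurable[OF v] by measurable
  have le: "cmod (indicator D y * (h y * v y)) \<le> H * K * indicator {x \<in> D. \<kappa> x \<in> I} y" for y
  proof (cases "y \<in> D")
    case True
    have "cmod (h y) * cmod (v y) \<le> (H * indicator {x \<in> D. \<kappa> x \<in> I} y) * K"
      using hH[OF True] K H by (intro mult_mono) auto
    then show ?thesis using True by (simp add: norm_mult mult_ac)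
  qed (use H K in auto)
  have iI: "integrable M (\<lambda>y. H * K * indicator {x \<in> D. \<kappa> x \<in> I} y)"
    using mass_sets[of I] by (intro integrable_mult_right) (simp add: emeasure_eq_measure)
  show 1: "integrable M (\<lambda>y. indicator D y * (h y * v y))"
    by (rule Bochner_Integration.integrable_bound[OF iI m]) (use le H K in auto)
  have "cmod (pairing h v) \<le> (\<integral>y. cmod (indicator D y * (h y * v y)) \<partial>M)"
    unfolding pairing_def by (rule integral_norm_bound)
  also have "\<dots> \<le> (\<integral>y. H * K * indicator {x \<in> D. \<kappa> x \<in> I} y \<partial>M)"
    by (intro integral_mono integrable_norm 1 iI le)
  also have "\<dots> = H * mass I * K"
    using mass_sets[of I] sets.sets_into_space[OF mass_sets[of I]] by (simp add: mass_def Int_absorb2)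
  finally show "cmod (pairing h v) \<le> H * mass I * K" .
qed

definition pair_op :: "('x \<Rightarrow> complex) \<Rightarrow> 'x lipop" where
  "pair_op h = component_op d (\<lambda>v x. indicator D x * pairing h v)"

lemma lip_op_pairing:
  assumes h: "h \<in> borel_measurable M" and H: "0 \<le> H"
    and hH: "\<And>y. y \<in> D \<Longrightarrow> cmod (h y) \<le> H * indicator {x \<in> D. \<kappa> x \<in> I} y"
  shows "lip_op d (\<lambda>v x. indicator D x * pairing h v) (2 * (H * mass I))"
  unfolding lip_op_def
proof (intro conjI allI impI)
  show "0 \<le> 2 * (H * mass I)" using H mass_nonneg by simp
  fix v :: "'x \<Rightarrow> complex" and K assume v: "lip_bound d v K"
  have *: "0 \<le> H * mass I * K" using H mass_nonneg lip_bound_nonneg[OF v] by simp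
  show "lip_bound d (\<lambda>x. indicator D x * pairing h v) (2 * (H * mass I) * K)"
    by (rule lip_boundI[where B = "H * mass I * K" and K = 0])
      (use pairing_le[OF h v H hH] * in \<open>auto simp: mult_ac\<close>)
next
  fix v w :: "'x \<Rightarrow> complex" and K assume "lip_bound d v K" "lip_bound d w K"
  then have "integrable M (\<lambda>y. indicator D y * (h y * v y))" "integrable M (\<lambda>y. indicator D y * (h y * w y))"
    using integrable_pairing[OF h _ H hH] by auto
  then show "(\<lambda>x. indicator D x * pairing h (\<lambda>x. v x + w x)) = (\<lambda>x. indicator D x * pairing h v + indicator D x * pairing h w)"
    by (simp add: pairing_def distrib_left)
next
  fix v :: "'x \<Rightarrow> complex" and c
  have "pairing h (\<lambda>x. c * v x) = c * pairing h v"
    unfolding pairing_def by (subst integral_mult_right_zero[symmetric]) (simp add: mult_ac)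
  then show "(\<lambda>x. indicator D x * pairing h (\<lambda>x. c * v x)) = (\<lambda>x. c * (indicator D x * pairing h v))"
    by (simp add: mult_ac)
qed

text \<open>
Here \<open>V k\<close> is the observable seen \<open>k\<close> steps before the return, \<open>W n\<close> the other observable seen \<open>n\<close> steps after
the base, and \<open>W_rec\<close> says that after a return the orbit starts afresh. Cutting the integral of \<open>W n\<close> against a
density at the first return gives the renewal equation \<open>W = E + W R\<close> for the functionals, where \<open>E\<close> only involves the orbits
that have not yet returned; hence \<open>W = E T\<close>. The sum in question is therefore a coefficient of \<open>E T V\<close>. Replacing \<open>T\<close> by its
limit \<open>P / phibar\<close> produces partial sums of the convolution of the moments of \<open>E\<close> and \<open>V\<close>, which converge to
\<open>a b\<close> up to a tail; the difference \<open>T - P / phibar\<close> has weight \<open>n\<^sup>q\<^sup>-\<^sup>1\<close>, and the outer factors have weight \<open>n\<^sup>q\<close>.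
\<close>

theorem return_correlation_decay:
  fixes W V :: "nat \<Rightarrow> 'x \<Rightarrow> complex"
  assumes W [measurable]: "\<And>n. W n \<in> borel_measurable M" and Wb: "\<And>n y. y \<in> D \<Longrightarrow> cmod (W n y) \<le> Wb"
    and W_rec: "\<And>n y. y \<in> D \<Longrightarrow> ph (\<kappa> y) \<le> n \<Longrightarrow> W n y = W (n - ph (\<kappa> y)) (F y)"
    and V_off: "\<And>k y. y \<notin> D \<Longrightarrow> V k y = 0" "\<And>k y. y \<in> D \<Longrightarrow> ph (\<kappa> y) < k \<Longrightarrow> V k y = 0"
    and Vb: "\<And>k y. y \<in> D \<Longrightarrow> cmod (V k y) \<le> Vb"
    and V_lip: "\<And>k y y'. y \<in> D \<Longrightarrow> y' \<in> D \<Longrightarrow> \<kappa> y' = \<kappa> y \<Longrightarrow> cmod (V k y - V k y') \<le> Vb * d y y'"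
  defines "a \<equiv> (\<Sum>i. \<integral>y. indicator {x \<in> D. i < ph (\<kappa> x)} y * W i y \<partial>M)"
    and "b \<equiv> (\<Sum>k. \<integral>y. V k y \<partial>M)"
  shows "summable (\<lambda>n. wt (q - 1) n * cmod ((\<Sum>k\<le>n. \<integral>y. V k y * W (n - k) (F y) \<partial>M) - a * b / of_real phibar))"
proof -
  obtain x0 where x0: "x0 \<in> D" using measure_D by fastforce
  have Wb0: "0 \<le> Wb" using order_trans[OF norm_ge_zero Wb[OF x0]] .
  have Vb0: "0 \<le> Vb" using order_trans[OF norm_ge_zero Vb[OF x0]] .
  have V_bound: "lip_bound d (V k) (2 * Vb)" for k
    by (rule lip_boundI[where B = Vb and K = Vb]) (use V_off Vb V_lip Vb0 in auto)
  have Vm [measurable]: "V k \<in> borel_measurable M" for k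
    by (rule lipschitz_measurable[where K = Vb]) (use V_off V_lip in auto)

  define eW where "eW i y = indicator {x \<in> D. \<kappa> x \<in> {j. i < ph j}} y * W i y" for i y
  have eWm [measurable]: "eW i \<in> borel_measurable M" for i
    unfolding eW_def using mass_sets[of "{j. i < ph j}"] by measurable
  have eWb: "cmod (eW i y) \<le> Wb * indicator {x \<in> D. \<kappa> x \<in> {j. i < ph j}} y" if "y \<in> D" for i y
    using Wb[OF that] Wb0 by (auto simp: eW_def indicator_def)
  have Wb': "cmod (W i y) \<le> Wb * indicator {x \<in> D. \<kappa> x \<in> UNIV} y" if "y \<in> D" for i y
    using Wb[OF that] that by simp
  note opE = lip_op_pairing[OF eWm Wb0 eWb]
  note opW = lip_op_pairing[OF W Wb0 Wb']

  define Eh where "Eh = Abs_fps (\<lambda>i. pair_op (eW i))"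
  define Wh where "Wh = Abs_fps (\<lambda>i. pair_op (W i))"
  have cE: "component (app (fps_nth Eh i) u) d' x = (if d' = d then indicator D x * pairing (eW i) (component u d) else 0)" for i u d' x
    unfolding Eh_def pair_op_def by (simp add: component_component_op[OF opE])
  have cW: "component (app (fps_nth Wh i) u) d' x = (if d' = d then indicator D x * pairing (W i) (component u d) else 0)" for i u d' x
    unfolding Wh_def pair_op_def by (simp add: component_component_op[OF opW])

  \<comment> \<open>On the cells with return time \<open>j\<close> the function \<open>W n\<close> is \<open>W (n - j) \<circ> F\<close>, and duality moves it past the transfer operator.\<close>
  have renew: "Wh = Eh + Wh * RR"
  proof (rule fps_ext, rule lipop_eqI, rule lipfam_eqI)
    fix n u d' x
    define v where "v = component u d"
    have v: "lip_bound d v (norm u)" unfolding v_def by (rule lip_bound_norm)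
    have vm: "(\<lambda>y. indicator D y * v y) \<in> borel_measurable M" by (rule lip_bound_measurable[OF v])
    have vb: "cmod (v y) \<le> norm u" for y using v by (simp add: lip_bound_def)
    have pr: "pairing (W (n - j)) (component (app (op {i. ph i = j}) u) d)
        = (\<integral>y. indicator {x \<in> D. ph (\<kappa> x) = j} y * (W n y * v y) \<partial>M)" if "j \<le> n" for j
    proof -
      let ?f = "\<lambda>i y. if i \<in> {i. ph i = j} then indicator D y * v y else 0"
      have "component (app (op {i. ph i = j}) u) d y = transfer ?f y" for y
        unfolding component_op_apply by (auto simp: v_def cell_D intro!: transfer_cong)
      then have "pairing (W (n - j)) (component (app (op {i. ph i = j}) u) d)
          = (\<integral>y. transfer ?f y * (indicator D y * W (n - j) y) \<partial>M)"
        unfolding pairing_def by (intro Bochner_Integration.integral_cong) (auto simp: mult_ac)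
      also have "\<dots> = (\<integral>y. indicator D y *\<^sub>R (?f (\<kappa> y) y * (indicator D (F y) * W (n - j) (F y))) \<partial>M)"
      proof (rule transfer_duality(1)[where B = "norm u" and W = Wb])
        show "?f i \<in> borel_measurable M" for i using vm by simp
        show "norm (?f i y) \<le> norm u" for i y using vb[of y] by (auto simp: indicator_def)
        show "norm (indicator D y * W (n - j) y) \<le> Wb" if "y \<in> D" for y using Wb[OF that] that by simp
      qed simp
      also have "\<dots> = (\<integral>y. indicator {x \<in> D. ph (\<kappa> x) = j} y * (W n y * v y) \<partial>M)"
      proof (intro Bochner_Integration.integral_cong refl)
        fix y show "indicator D y *\<^sub>R (?f (\<kappa> y) y * (indicator D (F y) * W (n - j) (F y)))
            = indicator {x \<in> D. ph (\<kappa> x) = j} y * (W n y * v y)"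
          using W_rec[of y n] F_D[of y] that by (auto simp: indicator_def)
      qed
      finally show ?thesis .
    qed
    have int: "integrable M (\<lambda>y. indicator {x \<in> D. \<kappa> x \<in> I} y * (W n y * v y))" for I
    proof -
      have "integrable M (\<lambda>y. indicator {x \<in> D. \<kappa> x \<in> I} y *\<^sub>R (indicator D y * (W n y * v y)))"
        using mass_sets[of I] integrable_pairing[OF W v Wb0 Wb'] by (intro integrable_mult_indicator)
      then show ?thesis by (rule back_subst[where P = "integrable M"]) (auto simp: indicator_def)
    qed
    have eqs: "{x \<in> D. ph (\<kappa> x) = j} = {x \<in> D. \<kappa> x \<in> {i. ph i = j}}" for j by auto
    have "pairing (W n) v = (\<integral>y. indicator {x \<in> D. \<kappa> x \<in> {j. n < ph j}} y * (W n y * v y)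
        + (\<Sum>j\<le>n. indicator {x \<in> D. ph (\<kappa> x) = j} y * (W n y * v y)) \<partial>M)"
      unfolding pairing_def
    proof (intro Bochner_Integration.integral_cong refl)
      fix y
      have "(\<Sum>j\<le>n. indicator {x \<in> D. ph (\<kappa> x) = j} y * (W n y * v y))
          = (\<Sum>j\<le>n. if j = ph (\<kappa> y) then indicator D y * (W n y * v y) else 0)"
        by (intro sum.cong) (auto simp: indicator_def)
      then show "indicator D y * (W n y * v y) = indicator {x \<in> D. \<kappa> x \<in> {j. n < ph j}} y * (W n y * v y)
        + (\<Sum>j\<le>n. indicator {x \<in> D. ph (\<kappa> x) = j} y * (W n y * v y))"
        by (simp add: indicator_def)
    qed
    also have "\<dots> = (\<integral>y. indicator {x \<in> D. \<kappa> x \<in> {j. n < ph j}} y * (W n y * v y) \<partial>M)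
        + (\<Sum>j\<le>n. \<integral>y. indicator {x \<in> D. ph (\<kappa> x) = j} y * (W n y * v y) \<partial>M)"
      unfolding eqs
    proof (subst Bochner_Integration.integral_add)
      show "integrable M (\<lambda>y. \<Sum>j\<le>n. indicator {x \<in> D. \<kappa> x \<in> {i. ph i = j}} y * (W n y * v y))"
        by (intro Bochner_Integration.integrable_sum int)
      show "(\<integral>y. indicator {x \<in> D. \<kappa> x \<in> {j. n < ph j}} y * (W n y * v y) \<partial>M)
          + (\<integral>y. (\<Sum>j\<le>n. indicator {x \<in> D. \<kappa> x \<in> {i. ph i = j}} y * (W n y * v y)) \<partial>M)
        = (\<integral>y. indicator {x \<in> D. \<kappa> x \<in> {j. n < ph j}} y * (W n y * v y) \<partial>M)
          + (\<Sum>j\<le>n. \<integral>y. indicator {x \<in> D. \<kappa> x \<in> {i. ph i = j}} y * (W n y * v y) \<partial>M)"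
        by (subst Bochner_Integration.integral_sum) (rule int, rule refl)
    qed (rule int)
    also have "(\<integral>y. indicator {x \<in> D. \<kappa> x \<in> {j. n < ph j}} y * (W n y * v y) \<partial>M) = pairing (eW n) v"
      unfolding pairing_def eW_def by (intro Bochner_Integration.integral_cong) (auto simp: indicator_def)
    also have "(\<Sum>j\<le>n. \<integral>y. indicator {x \<in> D. ph (\<kappa> x) = j} y * (W n y * v y) \<partial>M)
        = (\<Sum>j\<le>n. pairing (W (n - j)) (component (app (op {i. ph i = j}) u) d))"
      by (intro sum.cong) (auto simp: pr)
    also have "\<dots> = (\<Sum>i\<le>n. pairing (W i) (component (app (op {j. ph j = n - i}) u) d))"
      by (rule sum.reindex_bij_witness[of _ "\<lambda>i. n - i" "\<lambda>i. n - i"]) auto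
    finally have key: "pairing (W n) v = pairing (eW n) v + (\<Sum>i\<le>n. pairing (W i) (component (app (op {j. ph j = n - i}) u) d))" .
    show "component (app (fps_nth Wh n) u) d' x = component (app (fps_nth (Eh + Wh * RR) n) u) d' x"
      using key by (simp add: fps_mult_nth app_sum component_sum cW cE RR_nth v_def atMost_atLeast0
          distrib_left sum_distrib_left)
  qed
  have "Wh * (1 - RR) = Eh" using renew by (simp add: right_diff_distrib algebra_simps)
  then have Wh_eq: "Wh = Eh * TT" by (metis TT_right mult.assoc mult.right_neutral)

  define V' where "V' k = transfer (\<lambda>i y. if i \<in> {i. k \<le> ph i} then V k y else 0)" for k
  have V'_eq: "V' k x = transfer (\<lambda>_. V k) x" for k x
    unfolding V'_def using V_off(2) by (intro transfer_cong) (auto simp: cell_def not_le)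
  have V'b: "lip_bound d (V' k) (2 * C\<^sub>R * Vb * mass {i. k \<le> ph i})" for k
  proof -
    have "lip_bound d (V' k) (C\<^sub>R * mass {i. k \<le> ph i} * (2 * Vb))"
      using lip_op_transfer[of "{i. k \<le> ph i}"] V_bound[of k] unfolding lip_op_def V'_def by blast
    then show ?thesis by (simp add: mult_ac)
  qed
  define CV where "CV = 2 * C\<^sub>R * Vb"
  have CV0: "0 \<le> CV" using C\<^sub>R_nonneg Vb0 by (simp add: CV_def)
  have opV: "lip_op d (\<lambda>v x. mn v * V' k x) (CV * mass {i. k \<le> ph i})" for k
    unfolding lip_op_def
  proof (intro conjI allI impI)
    show "0 \<le> CV * mass {i. k \<le> ph i}" using CV0 mass_nonneg by simp
    fix v :: "'x \<Rightarrow> complex" and K assume v: "lip_bound d v K"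
    show "lip_bound d (\<lambda>x. mn v * V' k x) (CV * mass {i. k \<le> ph i} * K)"
    proof (rule lip_bound_mono[OF lip_bound_mult[OF V'b]])
      have "0 \<le> CV * mass {i. k \<le> ph i}" using CV0 mass_nonneg by simp
      then show "cmod (mn v) * (2 * C\<^sub>R * Vb * mass {i. k \<le> ph i}) \<le> CV * mass {i. k \<le> ph i} * K"
        using mult_right_mono[OF mn_le[OF v], of "CV * mass {i. k \<le> ph i}"] by (simp add: CV_def mult_ac)
    qed
  next
    fix v w :: "'x \<Rightarrow> complex" and K assume "lip_bound d v K" "lip_bound d w K"
    then show "(\<lambda>x. mn (\<lambda>x. v x + w x) * V' k x) = (\<lambda>x. mn v * V' k x + mn w * V' k x)"
      using integrable_mn[of v K] integrable_mn[of w K] by (simp add: mn_def distrib_left distrib_right)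
  next
    fix v :: "'x \<Rightarrow> complex" and c
    have "mn (\<lambda>x. c * v x) = c * mn v"
      unfolding mn_def by (subst integral_mult_right_zero[symmetric]) (simp add: mult_ac)
    then show "(\<lambda>x. mn (\<lambda>x. c * v x) * V' k x) = (\<lambda>x. c * (mn v * V' k x))" by (simp add: mult.assoc)
  qed
  define Vh where "Vh = Abs_fps (\<lambda>k. component_op d (\<lambda>v x. mn v * V' k x))"
  have cV: "component (app (fps_nth Vh k) u) d' x = (if d' = d then mn (component u d) * V' k x else 0)" for k u d' x
    unfolding Vh_def by (simp add: component_component_op[OF opV])

  define e where "e = Abs_fps (\<lambda>i. pairing (eW i) (\<lambda>_. 1))"
  define bb where "bb = Abs_fps (\<lambda>k. mn (V k))"
  define Mn where "Mn n = (\<Sum>k\<le>n. \<integral>y. V k y * W (n - k) (F y) \<partial>M)" for n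

  \<comment> \<open>All outer sequences are dominated by the distribution of the return time or its tail.\<close>
  have mass_ge: "mass {i. k \<le> ph i} = tl k + p k" for k
  proof -
    have "{x \<in> D. \<kappa> x \<in> {i. k \<le> ph i}} = {x \<in> D. \<kappa> x \<in> {i. k < ph i}} \<union> {x \<in> D. \<kappa> x \<in> {i. ph i = k}}" by auto
    then show ?thesis unfolding mass_def tl_def p_def
      using mass_sets[of "{i. k < ph i}"] mass_sets[of "{i. ph i = k}"]
      by (subst finite_measure_Union[symmetric]) auto
  qed
  have sp: "summable (\<lambda>k. wt q k * p k)"
    by (rule summable_comparison_test'[OF p_moment]) (auto simp: p_nonneg intro!: mult_right_mono wt_mono_exponent)
  have sge: "summable (\<lambda>k. wt q k * mass {i. k \<le> ph i})"
    unfolding mass_ge distrib_left by (intro summable_add tl_summable sp)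
  have wE: "wfin q Eh"
    by (rule wfin_leI[OF tl_summable, of _ "2 * Wb"])
      (use norm_component_op[OF opE] in \<open>simp add: Eh_def pair_op_def tl_def mult.assoc\<close>)
  have wV: "wfin q Vh"
    by (rule wfin_leI[OF sge, of _ CV]) (use norm_component_op[OF opV] in \<open>simp add: Vh_def\<close>)
  have one: "lip_bound d (\<lambda>x. indicator D x) 2"
    by (rule lip_boundI[where B = 1 and K = 0]) auto
  have pair1: "pairing h (\<lambda>_. 1) = pairing h (indicator D)" for h
    unfolding pairing_def by (intro Bochner_Integration.integral_cong) (auto simp: indicator_def)
  have we: "wfin q e"
    by (rule wfin_leI[OF tl_summable, of _ "Wb * 2"])
      (use pairing_le[OF eWm one Wb0 eWb] in \<open>simp add: e_def tl_def pair1 mult_ac\<close>)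
  have wb: "wfin q bb"
  proof (rule wfin_leI[OF sge, of _ "2 * Vb"])
    fix k
    have hH: "cmod (V k y) \<le> Vb * indicator {x \<in> D. \<kappa> x \<in> {i. k \<le> ph i}} y" if "y \<in> D" for y
      using Vb[OF that, of k] V_off(2)[OF that, of k] that by (auto simp: indicator_def)
    have "mn (V k) = pairing (V k) (indicator D)"
      unfolding mn_def pairing_def by (intro Bochner_Integration.integral_cong) (auto simp: indicator_def)
    then show "norm (fps_nth bb k) \<le> 2 * Vb * mass {i. k \<le> ph i}"
      using pairing_le[OF Vm one Vb0 hH] by (simp add: bb_def mult_ac)
  qed

  \<comment> \<open>The product \<open>W V\<close> has the sums in question as coefficients, up to the factor \<open>mn u\<close>.\<close>
  have lhs: "component (app (fps_nth (Wh * Vh) n) u) d x = indicator D x * (mn (component u d) * Mn n)" for n u x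
  proof -
    have pv: "pairing (W (n - k)) (\<lambda>x. c * V' k x) = c * (\<integral>y. V k y * W (n - k) (F y) \<partial>M)" for k c
    proof -
      have "(\<integral>y. V k y * (indicator D (F y) * W (n - k) (F y)) \<partial>M) = (\<integral>y. transfer (\<lambda>_. V k) y * (indicator D y * W (n - k) y) \<partial>M)"
      proof (rule ruelle_duality[unfolded ruelle_def, symmetric])
        show "norm (V k x) \<le> Vb" if "x \<in> D" for x using Vb[OF that] .
        show "norm (indicator D x * W (n - k) x) \<le> Wb" if "x \<in> D" for x using Wb[OF that] that by simp
      qed simp_all
      also have "\<dots> = pairing (W (n - k)) (V' k)"
        unfolding pairing_def V'_eq by (intro Bochner_Integration.integral_cong) (auto simp: mult_ac)
      also have "(\<integral>y. V k y * (indicator D (F y) * W (n - k) (F y)) \<partial>M) = (\<integral>y. V k y * W (n - k) (F y) \<partial>M)"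
        by (intro Bochner_Integration.integral_cong refl) (use V_off(1) F_D in \<open>auto simp: indicator_def\<close>)
      finally have "(\<integral>y. V k y * W (n - k) (F y) \<partial>M) = pairing (W (n - k)) (V' k)" .
      moreover have "pairing (W (n - k)) (\<lambda>x. c * V' k x) = c * pairing (W (n - k)) (V' k)"
        unfolding pairing_def by (subst integral_mult_right_zero[symmetric]) (simp add: mult_ac)
      ultimately show ?thesis by simp
    qed
    have eta: "component (app (fps_nth Vh k) u) d = (\<lambda>x. mn (component u d) * V' k x)" for k by (auto simp: cV)
    have "component (app (fps_nth (Wh * Vh) n) u) d x = (\<Sum>i\<le>n. indicator D x * pairing (W i) (\<lambda>x. mn (component u d) * V' (n - i) x))"
      by (simp add: fps_mult_nth app_sum component_sum cW eta atMost_atLeast0)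
    also have "\<dots> = (\<Sum>k\<le>n. indicator D x * pairing (W (n - k)) (\<lambda>x. mn (component u d) * V' k x))"
      by (rule sum.reindex_bij_witness[of _ "\<lambda>i. n - i" "\<lambda>i. n - i"]) auto
    finally show ?thesis by (simp add: pv Mn_def sum_distrib_left)
  qed
  have rank1: "fps_nth Eh i * mean * fps_nth Vh k = scalar_lipop (fps_nth e i * fps_nth bb k) * mean" for i k
  proof (rule lipop_eqI, rule lipfam_eqI)
    fix u d' x
    define c where "c = mn (component u d)"
    have "component (app (mean * fps_nth Vh k) u) d = (\<lambda>x. indicator D x * mn (component (app (fps_nth Vh k) u) d))"
      by (simp add: component_eta)
    also have "component (app (fps_nth Vh k) u) d = (\<lambda>x. c * V' k x)" by (auto simp: cV c_def)
    also have "mn (\<lambda>x. c * V' k x) = c * mn (V k)"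
    proof -
      have "mn (V' k) = (\<integral>x. ruelle (V k) x \<partial>M)"
        unfolding mn_def ruelle_def V'_eq
        by (intro Bochner_Integration.integral_cong refl) (auto simp: indicator_def transfer_off)
      also have "\<dots> = (\<integral>x. V k x \<partial>M)" by (rule integral_ruelle[where B = Vb]) (auto simp: Vb)
      also have "\<dots> = mn (V k)" unfolding mn_def
        by (intro Bochner_Integration.integral_cong refl) (auto simp: indicator_def V_off(1))
      finally have "mn (V' k) = mn (V k)" .
      moreover have "mn (\<lambda>x. c * V' k x) = c * mn (V' k)"
        unfolding mn_def by (subst integral_mult_right_zero[symmetric]) (simp add: mult_ac)
      ultimately show ?thesis by simp
    qed
    finally have "component (app (mean * fps_nth Vh k) u) d = (\<lambda>x. indicator D x * (c * mn (V k)))" .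
    moreover have "pairing (eW i) (\<lambda>x. indicator D x * (c * mn (V k))) = c * mn (V k) * pairing (eW i) (\<lambda>_. 1)"
      unfolding pairing_def
      by (subst integral_mult_right_zero[symmetric], intro Bochner_Integration.integral_cong) (auto simp: indicator_def)
    ultimately show "component (app (fps_nth Eh i * mean * fps_nth Vh k) u) d' x = component (app (scalar_lipop (fps_nth e i * fps_nth bb k) * mean) u) d' x"
      by (simp add: mult.assoc cE component_mean e_def bb_def c_def)
  qed
  define c where "c = e * bb"
  have geo: "fps_nth (Eh * (fps_const mean * geom) * Vh) n = scalar_lipop (\<Sum>j\<le>n. fps_nth c j) * mean" for n
  proof -
    have "Eh * (fps_const mean * geom) * Vh = (Eh * fps_const mean * Vh) * geom"
    proof -
      have "geom * Vh = Vh * geom"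
      proof (rule fps_ext)
        fix n
        show "fps_nth (geom * Vh) n = fps_nth (Vh * geom) n"
          unfolding fps_mult_nth
          by (rule sum.reindex_bij_witness[of _ "\<lambda>i. n - i" "\<lambda>i. n - i"]) auto
      qed
      then show ?thesis by (simp add: mult.assoc)
    qed
    moreover have "fps_nth (Eh * fps_const mean * Vh) j = scalar_lipop (fps_nth c j) * mean" for j
    proof -
      have "fps_nth (Eh * fps_const mean * Vh) j = (\<Sum>i=0..j. fps_nth Eh i * mean * fps_nth Vh (j - i))"
        by (subst fps_mult_nth) simp
      then show ?thesis by (simp add: rank1 c_def fps_mult_nth lipop.cs_sum sum_distrib_right)
    qed
    ultimately show ?thesis by (simp add: mult_geom_nth lipop.cs_sum sum_distrib_right)
  qed
  define u1 where "u1 = embed d (indicator D :: 'x \<Rightarrow> complex)"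
  have cu1: "component u1 d = indicator D" unfolding u1_def by (simp add: component_embed[OF one])
  have mu1: "mn (component u1 d) = 1" using mn_const(2)[of 1] by (simp add: cu1)
  have nu1: "norm u1 \<le> 2" unfolding u1_def by (rule norm_embed_le[OF one])
  have Mn_eq: "Mn n = (\<Sum>j\<le>n. fps_nth c j) / of_real phibar + component (app (fps_nth (Eh * SS * Vh) n) u1) d x0" for n
  proof -
    have "Wh * Vh = Eh * (fps_const ((1 / phibar) *\<^sub>R mean) * geom) * Vh + Eh * SS * Vh"
      unfolding Wh_eq SS_def by (simp add: algebra_simps)
    moreover have "fps_const ((1 / phibar) *\<^sub>R mean) * geom = fps_const (of_real (1 / phibar)) * (fps_const mean * geom :: 'x lipop fps)"
      by (rule fps_ext) (simp add: scaleR_conv_of_real)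
    moreover have "Eh * (fps_const (of_real (1 / phibar)) * f) = fps_const (of_real (1 / phibar)) * (Eh * f)" for f :: "'x lipop fps"
    proof (rule fps_ext)
      fix n
      have comm: "x * (of_real r * y) = of_real r * (x * y)" for x y :: "'x lipop" and r
        by (simp flip: scaleR_conv_of_real)
      have "fps_nth (Eh * (fps_const (of_real (1 / phibar)) * f)) n = (\<Sum>i=0..n. fps_nth Eh i * (of_real (1 / phibar) * fps_nth f (n - i)))"
        by (subst fps_mult_nth) simp
      also have "\<dots> = of_real (1 / phibar) * fps_nth (Eh * f) n"
        by (simp only: comm fps_mult_nth sum_distrib_left)
      finally show "fps_nth (Eh * (fps_const (of_real (1 / phibar)) * f)) n = fps_nth (fps_const (of_real (1 / phibar)) * (Eh * f)) n"
        by simp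
    qed
    ultimately have eq: "fps_nth (Wh * Vh) n = (1 / phibar) *\<^sub>R fps_nth (Eh * (fps_const mean * geom) * Vh) n + fps_nth (Eh * SS * Vh) n"
      by (simp add: mult.assoc of_real_def)
    have "component (app (fps_nth (Wh * Vh) n) u1) d x0 = Mn n" using x0 by (simp add: lhs mu1)
    then show ?thesis
      unfolding eq geo using x0 by (simp add: component_mean mu1 divide_inverse mult.commute)
  qed
  have wc: "wfin q c" unfolding c_def using q we wb by (intro wfin_mult) auto
  have sc: "summable (\<lambda>n. norm (fps_nth c n))" "summable (\<lambda>n. norm (fps_nth e n))" "summable (\<lambda>n. norm (fps_nth bb n))"
    using wc we wb q by (auto intro!: wfin_norm_summable elim: wfin_mono_exponent)
  have ab: "a * b = (\<Sum>n. fps_nth c n)"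
  proof -
    have "a = (\<Sum>n. fps_nth e n)"
      unfolding a_def e_def pairing_def eW_def
      by (intro suminf_cong) (auto intro!: Bochner_Integration.integral_cong simp: indicator_def)
    moreover have "b = (\<Sum>n. fps_nth bb n)"
      unfolding b_def bb_def mn_def
      by (intro suminf_cong) (auto intro!: Bochner_Integration.integral_cong simp: indicator_def V_off(1))
    ultimately show ?thesis
      using Cauchy_product[OF sc(2,3)] by (simp add: c_def fps_mult_nth atMost_atLeast0)
  qed
  have w3: "wfin (q - 1) (Eh * SS * Vh)"
    by (intro wfin_shifted_mult q wE wV wfin_SS)
  have st: "summable (\<lambda>n. wt (q - 1) n * (\<Sum>k. norm (fps_nth c (k + Suc n))))"
    using wc q by (intro summable_tail_weighted(2)) (auto simp: wfin_def)
  have bound: "wt (q - 1) n * cmod (Mn n - a * b / of_real phibar)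
      \<le> wt (q - 1) n * (\<Sum>k. norm (fps_nth c (k + Suc n))) + 2 * (wt (q - 1) n * norm (fps_nth (Eh * SS * Vh) n))" for n
  proof -
    have "(\<Sum>n. fps_nth c n) = (\<Sum>k. fps_nth c (k + Suc n)) + (\<Sum>i\<le>n. fps_nth c i)"
      using suminf_split_initial_segment[OF summable_norm_cancel[OF sc(1)], of "Suc n"] by (simp add: lessThan_Suc_atMost)
    then have "Mn n - a * b / of_real phibar
        = component (app (fps_nth (Eh * SS * Vh) n) u1) d x0 - (\<Sum>k. fps_nth c (k + Suc n)) / of_real phibar"
      by (simp add: Mn_eq ab add_divide_distrib)
    also have "cmod \<dots> \<le> cmod (component (app (fps_nth (Eh * SS * Vh) n) u1) d x0) + cmod ((\<Sum>k. fps_nth c (k + Suc n)) / of_real phibar)"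
      by (rule norm_triangle_ineq4)
    also have "\<dots> \<le> norm (fps_nth (Eh * SS * Vh) n) * 2 + (\<Sum>k. norm (fps_nth c (k + Suc n)))"
    proof (rule add_mono)
      show "cmod (component (app (fps_nth (Eh * SS * Vh) n) u1) d x0) \<le> norm (fps_nth (Eh * SS * Vh) n) * 2"
        by (rule order_trans[OF norm_component_le order_trans[OF norm_app_le mult_left_mono[OF nu1]]]) simp
      have "cmod (\<Sum>k. fps_nth c (k + Suc n)) \<le> (\<Sum>k. norm (fps_nth c (k + Suc n)))"
        using summable_ignore_initial_segment[OF sc(1), of "Suc n"] by (rule summable_norm)
      moreover have "cmod ((\<Sum>k. fps_nth c (k + Suc n)) / of_real phibar) \<le> cmod (\<Sum>k. fps_nth c (k + Suc n)) / 1"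
        unfolding norm_divide using phibar_ge_1 by (intro divide_left_mono) auto
      ultimately show "cmod ((\<Sum>k. fps_nth c (k + Suc n)) / of_real phibar) \<le> (\<Sum>k. norm (fps_nth c (k + Suc n)))" by simp
    qed
    finally show ?thesis
      using mult_left_mono[of "cmod (Mn n - a * b / of_real phibar)" _ "wt (q - 1) n"] by (fastforce simp: algebra_simps)
  qed
  show ?thesis
    unfolding Mn_def[symmetric]
  proof (rule summable_comparison_test')
    show "summable (\<lambda>n. wt (q - 1) n * (\<Sum>k. norm (fps_nth c (k + Suc n))) + 2 * (wt (q - 1) n * norm (fps_nth (Eh * SS * Vh) n)))"
      using w3 by (intro summable_add st summable_mult) (simp add: wfin_def)
  qed (use bound in auto)
qed

end

section \<open>From a Young tower to a pointwise Gibbs-Markov map\<close>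

locale young_tower_data = young_tower X T M \<phi> \<alpha> \<theta>
  for X :: "'x measure" and T M \<phi> \<alpha> \<theta> +
  fixes N :: "'x set" and g :: "'x \<Rightarrow> real" and C\<^sub>0 :: real
  assumes N_null: "N \<in> null_sets M" and markov_N: "markov N"
    and g_meas [measurable]: "g \<in> borel_measurable M" and g_positive: "y \<in> space M \<Longrightarrow> 0 < g y"
    and g_density: "density (mu_F N) (\<lambda>y. ennreal (g y)) = M"
    and g_distortion: "a \<in> \<alpha> \<Longrightarrow> y \<in> a \<inter> core \<Longrightarrow> y' \<in> a \<inter> core \<Longrightarrow> \<bar>ln (g y) - ln (g y')\<bar> \<le> C\<^sub>0 * dtheta (F y) (F y')"
begin

sublocale prob_space M
  by (rule prob_M)

lemma partition: "countable \<alpha>" "a \<in> \<alpha> \<Longrightarrow> a \<in> sets M" "a \<in> \<alpha> \<Longrightarrow> 0 < emeasure M a"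
  "a \<in> \<alpha> \<Longrightarrow> b \<in> \<alpha> \<Longrightarrow> a \<noteq> b \<Longrightarrow> a \<inter> b \<in> null_sets M" "space M - \<Union>\<alpha> \<in> null_sets M"
  using gibbs_markov by (auto simp: gibbs_markov_def partition_mod_null_def)

lemma funpow_T_measurable: "(T ^^ n) \<in> measurable M X"
proof -
  have "T ^^ n \<in> measurable X X" by (induction n) (auto simp: o_def intro: measurable_compose[OF _ T_measurable])
  then have "T ^^ n \<in> measurable (restrict_space X (space M)) X" by (rule measurable_restrict_space1)
  then show ?thesis unfolding measurable_cong_sets[OF sets_M refl] .
qed

lemma F_measurable [measurable]: "F \<in> measurable M M"
proof -
  have "(\<lambda>y. (T ^^ \<phi> y) y) \<in> measurable M X"
    by (rule measurable_compose_countable[OF funpow_T_measurable phi_measurable])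
  then have "F \<in> measurable M X" by (simp add: F_def[abs_def])
  then have "F \<in> measurable M (restrict_space X (space M))"
    by (rule measurable_restrict_space2[rotated]) (auto simp: F_maps_to)
  then show ?thesis unfolding measurable_cong_sets[OF refl sets_M, symmetric] .
qed

lemma funpow_F_space: "y \<in> space M \<Longrightarrow> (F ^^ n) y \<in> space M"
  by (induction n) (auto intro: F_maps_to)

lemma AE_F: "AE y in M. P y \<Longrightarrow> AE y in M. P (F y)"
  using AE_distrD[OF F_measurable, of P] unfolding F_invariant .

lemma AE_funpow_F: "AE y in M. P y \<Longrightarrow> AE y in M. P ((F ^^ n) y)"
proof (induction n)
  case (Suc n)
  then show ?case using AE_F[of "\<lambda>y. P ((F ^^ n) y)"] by (simp add: funpow_swap1)
qed simp

definition inside :: "'x set" where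
  "inside = {y \<in> space M. \<exists>!a. a \<in> \<alpha> \<and> y \<in> a}"

definition cell_of :: "'x \<Rightarrow> 'x set" where
  "cell_of y = (THE a. a \<in> \<alpha> \<and> y \<in> a)"

definition index :: "'x \<Rightarrow> nat" where
  "index y = (if y \<in> inside then to_nat_on \<alpha> (cell_of y) else 0)"

lemma cell_of: "y \<in> inside \<Longrightarrow> cell_of y \<in> \<alpha>" "y \<in> inside \<Longrightarrow> y \<in> cell_of y"
  "y \<in> inside \<Longrightarrow> a \<in> \<alpha> \<Longrightarrow> y \<in> a \<Longrightarrow> cell_of y = a"
proof -
  assume "y \<in> inside"
  then have ex: "\<exists>!a. a \<in> \<alpha> \<and> y \<in> a" by (simp add: inside_def)
  show "cell_of y \<in> \<alpha>" "y \<in> cell_of y" using theI'[OF ex] by (simp_all add: cell_of_def)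
  show "cell_of y = a" if "a \<in> \<alpha>" "y \<in> a" unfolding cell_of_def using the1_equality[OF ex] that by simp
qed

lemma index_eq_iff: "y \<in> inside \<Longrightarrow> y' \<in> inside \<Longrightarrow> index y = index y' \<longleftrightarrow> cell_of y = cell_of y'"
  using cell_of(1)[of y] cell_of(1)[of y'] partition(1) by (simp add: index_def)

lemma inside_sets [measurable]: "inside \<in> sets M"
proof -
  have "inside = (\<Union>a\<in>\<alpha>. a - (\<Union>b\<in>\<alpha> - {a}. b))"
  proof (intro set_eqI iffI)
    fix y assume "y \<in> inside"
    then obtain a where "a \<in> \<alpha>" "y \<in> a" "\<And>b. b \<in> \<alpha> \<Longrightarrow> y \<in> b \<Longrightarrow> b = a" unfolding inside_def by blast
    then show "y \<in> (\<Union>a\<in>\<alpha>. a - (\<Union>b\<in>\<alpha> - {a}. b))" by blast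
  next
    fix y assume "y \<in> (\<Union>a\<in>\<alpha>. a - (\<Union>b\<in>\<alpha> - {a}. b))"
    then obtain a where a: "a \<in> \<alpha>" "y \<in> a" "\<And>b. b \<in> \<alpha> \<Longrightarrow> y \<in> b \<Longrightarrow> b = a" by blast
    then have "y \<in> space M" using sets.sets_into_space[OF partition(2)[OF a(1)]] by blast
    then show "y \<in> inside" using a unfolding inside_def by blast
  qed
  moreover have "countable (\<alpha> - {a})" for a using partition(1) by (rule countable_subset[rotated]) auto
  ultimately show ?thesis using partition(1,2) by (auto intro!: sets.countable_UN' sets.Diff)
qed

lemma AE_inside: "AE y in M. y \<in> inside"
proof -
  have "(\<Union>a\<in>\<alpha>. \<Union>b\<in>\<alpha> - {a}. a \<inter> b) \<in> null_sets M"
    using partition(1,4) by (intro null_sets_UN') (auto intro: countable_subset)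
  then have "AE y in M. y \<notin> (\<Union>a\<in>\<alpha>. \<Union>b\<in>\<alpha> - {a}. a \<inter> b)" by (rule AE_not_in)
  moreover have "AE y in M. y \<notin> space M - \<Union>\<alpha>" using partition(5) by (rule AE_not_in)
  ultimately show ?thesis
    using AE_space by eventually_elim (auto simp: inside_def)
qed

lemma core_eq: "core = {y \<in> space M. \<forall>n. (F ^^ n) y \<in> inside}"
  unfolding core_def inside_def by (intro Collect_cong conj_cong refl) (simp add: funpow_F_space)

lemma core_sets [measurable]: "core \<in> sets M"
  unfolding core_eq by measurable

lemma AE_core: "AE y in M. y \<in> core"
proof -
  have "AE y in M. \<forall>n. (F ^^ n) y \<in> inside"
    by (subst AE_all_countable) (intro allI AE_funpow_F AE_inside)
  then show ?thesis using AE_space by eventually_elim (simp add: core_eq)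
qed

lemma core_inside: "y \<in> core \<Longrightarrow> (F ^^ n) y \<in> inside" and core_inside': "y \<in> core \<Longrightarrow> y \<in> inside"
  and core_F: "y \<in> core \<Longrightarrow> F y \<in> core" and core_space: "core \<subseteq> space M"
proof -
  show "y \<in> core \<Longrightarrow> (F ^^ n) y \<in> inside" for n by (simp add: core_eq)
  from this[of 0] show "y \<in> core \<Longrightarrow> y \<in> inside" by simp
  show "F y \<in> core" if y: "y \<in> core"
  proof -
    have "(F ^^ Suc n) y \<in> inside" for n using y unfolding core_eq by blast
    then have "(F ^^ n) (F y) \<in> inside" for n by (simp only: funpow_Suc_right o_apply)
    moreover have "F y \<in> space M" using y by (simp add: core_eq F_maps_to)
    ultimately show ?thesis by (simp add: core_eq)
  qed
  show "core \<subseteq> space M" by (auto simp: core_eq)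
qed

lemma index_measurable [measurable]: "index \<in> measurable M (count_space UNIV)"
proof -
  have "index -` {i} \<inter> space M \<in> sets M" for i
  proof -
    have "index -` {i} \<inter> space M = (\<Union>a\<in>{a \<in> \<alpha>. to_nat_on \<alpha> a = i}. a \<inter> inside) \<union> (if i = 0 then space M - inside else {})"
    proof (intro set_eqI iffI)
      fix y assume y: "y \<in> index -` {i} \<inter> space M"
      show "y \<in> (\<Union>a\<in>{a \<in> \<alpha>. to_nat_on \<alpha> a = i}. a \<inter> inside) \<union> (if i = 0 then space M - inside else {})"
      proof (cases "y \<in> inside")
        case True
        then show ?thesis using y cell_of(1,2)[OF True] by (intro UnI1 UN_I[of "cell_of y"]) (simp_all add: index_def)
      qed (use y in \<open>auto simp: index_def\<close>)
    next
      fix y assume "y \<in> (\<Union>a\<in>{a \<in> \<alpha>. to_nat_on \<alpha> a = i}. a \<inter> inside) \<union> (if i = 0 then space M - inside else {})"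
      then consider a where "a \<in> \<alpha>" "to_nat_on \<alpha> a = i" "y \<in> a" "y \<in> inside" | "i = 0" "y \<in> space M" "y \<notin> inside"
        by (auto split: if_splits)
      then show "y \<in> index -` {i} \<inter> space M"
      proof cases
        case 1
        then have "cell_of y = a" "y \<in> space M" using cell_of(3)[of y a] by (auto simp: inside_def)
        then show ?thesis using 1 by (simp add: index_def)
      qed (simp add: index_def)
    qed
    also have "\<dots> \<in> sets M"
      using partition(1,2) by (intro sets.Un sets.countable_UN') (auto intro: countable_subset)
    finally show ?thesis .
  qed
  then show ?thesis by (subst measurable_count_space_eq_countable) (auto intro: countableI_type)
qed

text \<open>
On the core the separation time is the least element of this set.
\<close>

definition differ :: "'x \<Rightarrow> 'x \<Rightarrow> nat set" where
  "differ y y' = {n. index ((F ^^ n) y) \<noteq> index ((F ^^ n) y')}"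

lemma dtheta_core:
  assumes y: "y \<in> core" "y' \<in> core"
  shows "dtheta y y' = (if differ y y' = {} then 0 else \<theta> ^ (LEAST n. n \<in> differ y y'))"
proof -
  have eq: "{n. \<exists>a\<in>\<alpha>. \<exists>b\<in>\<alpha>. a \<noteq> b \<and> (F ^^ n) y \<in> a \<and> (F ^^ n) y' \<in> b} = differ y y'"
  proof (intro set_eqI)
    fix n
    have i: "(F ^^ n) y \<in> inside" "(F ^^ n) y' \<in> inside" using y core_inside by auto
    show "n \<in> {n. \<exists>a\<in>\<alpha>. \<exists>b\<in>\<alpha>. a \<noteq> b \<and> (F ^^ n) y \<in> a \<and> (F ^^ n) y' \<in> b} \<longleftrightarrow> n \<in> differ y y'"
    proof
      assume "n \<in> {n. \<exists>a\<in>\<alpha>. \<exists>b\<in>\<alpha>. a \<noteq> b \<and> (F ^^ n) y \<in> a \<and> (F ^^ n) y' \<in> b}"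
      then obtain a b where ab: "a \<in> \<alpha>" "b \<in> \<alpha>" "a \<noteq> b" "(F ^^ n) y \<in> a" "(F ^^ n) y' \<in> b" by blast
      then have "cell_of ((F ^^ n) y) = a" "cell_of ((F ^^ n) y') = b" using cell_of(3) i by blast+
      then show "n \<in> differ y y'" using ab(3) index_eq_iff[OF i] by (simp add: differ_def)
    next
      assume "n \<in> differ y y'"
      then have "cell_of ((F ^^ n) y) \<noteq> cell_of ((F ^^ n) y')" using index_eq_iff[OF i] by (simp add: differ_def)
      then show "n \<in> {n. \<exists>a\<in>\<alpha>. \<exists>b\<in>\<alpha>. a \<noteq> b \<and> (F ^^ n) y \<in> a \<and> (F ^^ n) y' \<in> b}"
        using cell_of(1,2)[OF i(1)] cell_of(1,2)[OF i(2)] by blast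
    qed
  qed
  show ?thesis
  proof (cases "differ y y' = {}")
    case True
    then have "sep y y' = \<infinity>" unfolding sep_def eq by (simp add: top_enat_def)
    then show ?thesis using True by (simp add: dtheta_def)
  next
    case False
    then obtain k where "k \<in> differ y y'" by blast
    then have L: "(LEAST n. n \<in> differ y y') \<in> differ y y'" by (rule LeastI)
    have "sep y y' = enat (LEAST n. n \<in> differ y y')"
      unfolding sep_def eq
      by (intro antisym INF_greatest INF_lower L) (auto intro: Least_le)
    then show ?thesis using False by (simp add: dtheta_def)
  qed
qed

lemma dtheta_nonneg: "0 \<le> dtheta y y'"
  using theta by (auto simp: dtheta_def split: enat.splits)

lemma dtheta_le_1: "dtheta y y' \<le> 1"
  using theta by (auto simp: dtheta_def power_le_one split: enat.splits)

lemma dtheta_distinct: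
  assumes y: "y \<in> core" "y' \<in> core" "index y' \<noteq> index y"
  shows "dtheta y y' = 1"
proof -
  have "0 \<in> differ y y'" using y(3) by (auto simp: differ_def)
  moreover from this have "(LEAST n. n \<in> differ y y') = 0" by (rule Least_eq_0)
  ultimately show ?thesis using dtheta_core[OF y(1,2)] by auto
qed

lemma dtheta_shift:
  assumes y: "y \<in> core" "y' \<in> core" "index y' = index y"
  shows "dtheta y y' = \<theta> * dtheta (F y) (F y')"
proof -
  have S: "Suc n \<in> differ y y' \<longleftrightarrow> n \<in> differ (F y) (F y')" for n
    by (simp add: differ_def funpow_swap1)
  have 0: "0 \<notin> differ y y'" using y(3) by (simp add: differ_def)
  show ?thesis
  proof (cases "differ y y' = {}")
    case True
    then have "differ (F y) (F y') = {}" using S by auto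
    then show ?thesis using True dtheta_core[OF y(1,2)] dtheta_core[of "F y" "F y'"] core_F y by simp
  next
    case False
    then obtain n where n: "n \<in> differ y y'" by blast
    then have ne: "differ (F y) (F y') \<noteq> {}" using S 0 by (cases n) auto
    have "(LEAST n. n \<in> differ y y') = Suc (LEAST m. Suc m \<in> differ y y')"
      by (rule Least_Suc[OF n 0])
    then show ?thesis
      using False ne dtheta_core[OF y(1,2)] dtheta_core[of "F y" "F y'"] core_F y by (simp add: S)
  qed
qed

lemma dtheta_sym: "y \<in> core \<Longrightarrow> y' \<in> core \<Longrightarrow> dtheta y y' = dtheta y' y"
proof -
  have "differ y y' = differ y' y" by (auto simp: differ_def)
  then show "y \<in> core \<Longrightarrow> y' \<in> core \<Longrightarrow> dtheta y y' = dtheta y' y" by (simp add: dtheta_core)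
qed

lemma dtheta_triangle:
  assumes y: "x \<in> core" "y \<in> core" "z \<in> core"
  shows "dtheta x z \<le> dtheta x y + dtheta y z"
proof (cases "differ x z = {}")
  case True
  then show ?thesis using y dtheta_nonneg by (simp add: dtheta_core[of x z] add_nonneg_nonneg)
next
  case False
  define n where "n = (LEAST n. n \<in> differ x z)"
  have "n \<in> differ x z" using False unfolding n_def by (auto intro: LeastI)
  then consider "n \<in> differ x y" | "n \<in> differ y z" unfolding differ_def mem_Collect_eq by metis
  then have "\<theta> ^ n \<le> dtheta x y \<or> \<theta> ^ n \<le> dtheta y z"
  proof cases
    case 1
    then have "(LEAST n. n \<in> differ x y) \<le> n" by (rule Least_le)
    then show ?thesis using 1 y theta by (auto simp: dtheta_core intro!: power_decreasing)
  next
    case 2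
    then have "(LEAST n. n \<in> differ y z) \<le> n" by (rule Least_le)
    then show ?thesis using 2 y theta by (auto simp: dtheta_core intro!: power_decreasing)
  qed
  moreover have "dtheta x z = \<theta> ^ n" using False y by (simp add: dtheta_core n_def)
  ultimately show ?thesis using dtheta_nonneg[of x y] dtheta_nonneg[of y z] by linarith
qed

lemma dtheta_pos: "y \<in> core \<Longrightarrow> y' \<in> core \<Longrightarrow> y \<noteq> y' \<Longrightarrow> 0 < dtheta y y'"
proof -
  assume y: "y \<in> core" "y' \<in> core" "y \<noteq> y'"
  then have "sep y y' < \<infinity>" using gibbs_markov by (auto simp: gibbs_markov_def)
  then show "0 < dtheta y y'" using theta by (auto simp: dtheta_def split: enat.splits)
qed

definition word :: "nat \<Rightarrow> 'x \<Rightarrow> nat list" where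
  "word k y = map (\<lambda>i. index ((F ^^ i) y)) [0..<k]"

lemma word_eq_iff: "word k y = word k y' \<longleftrightarrow> (\<forall>i<k. index ((F ^^ i) y) = index ((F ^^ i) y'))"
  by (auto simp: word_def)

lemma word_measurable [measurable]: "word k \<in> measurable M (count_space UNIV)"
proof -
  have "word k -` {w} \<inter> space M \<in> sets M" for w
  proof -
    have "word k y = w \<longleftrightarrow> length w = k \<and> (\<forall>i<k. index ((F ^^ i) y) = w ! i)" for y
      unfolding word_def by (subst list_eq_iff_nth_eq) auto
    then have "word k -` {w} \<inter> space M = {y \<in> space M. length w = k \<and> (\<forall>i<k. index ((F ^^ i) y) = w ! i)}" by blast
    also have "\<dots> \<in> sets M" by measurable
    finally show ?thesis .
  qed
  then show ?thesis by (subst measurable_count_space_eq_countable) (auto intro: countableI_type)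
qed

lemma dtheta_word:
  assumes y: "y \<in> core" "y' \<in> core" "word k y = word k y'"
  shows "dtheta y y' \<le> \<theta> ^ k"
proof (cases "differ y y' = {}")
  case True
  then show ?thesis using y theta by (simp add: dtheta_core)
next
  case False
  have "n \<in> differ y y' \<Longrightarrow> k \<le> n" for n using y(3) by (auto simp: word_eq_iff differ_def not_less [symmetric])
  then have "k \<le> (LEAST n. n \<in> differ y y')" using False by (metis LeastI ex_in_conv)
  then show ?thesis using False y theta by (auto simp: dtheta_core intro!: power_decreasing)
qed

text \<open>
A null set off which the image of \<open>a\<close> is a union of elements of the partition.
\<close>

definition defect :: "'x set \<Rightarrow> 'x set" where
  "defect a = (SOME E. \<exists>\<beta>\<subseteq>\<alpha>. E = (F ` (a - N) - \<Union>\<beta>) \<union> (\<Union>\<beta> - F ` (a - N)) \<and> E \<in> null_sets M)"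

lemma defect:
  assumes "a \<in> \<alpha>"
  shows "defect a \<in> null_sets M"
    and "\<exists>\<beta>\<subseteq>\<alpha>. defect a = (F ` (a - N) - \<Union>\<beta>) \<union> (\<Union>\<beta> - F ` (a - N))"
proof -
  have "\<exists>\<beta>\<subseteq>\<alpha>. (F ` (a - N) - \<Union>\<beta>) \<union> (\<Union>\<beta> - F ` (a - N)) \<in> null_sets M"
    using markov_N assms by (simp add: markov_def)
  then have "\<exists>E. \<exists>\<beta>\<subseteq>\<alpha>. E = (F ` (a - N) - \<Union>\<beta>) \<union> (\<Union>\<beta> - F ` (a - N)) \<and> E \<in> null_sets M" by blast
  from someI_ex[OF this] show "defect a \<in> null_sets M"
    and "\<exists>\<beta>\<subseteq>\<alpha>. defect a = (F ` (a - N) - \<Union>\<beta>) \<union> (\<Union>\<beta> - F ` (a - N))"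
    unfolding defect_def by blast+
qed

lemma markov_image:
  assumes "a \<in> \<alpha>" "A \<in> sets M" "A \<subseteq> a - N"
  shows "F ` A \<in> sets M" "emeasure M (F ` A) = 0 \<longleftrightarrow> emeasure M A = 0"
  using markov_N assms by (simp_all add: markov_def)

lemma markov_inj: "a \<in> \<alpha> \<Longrightarrow> inj_on F (a - N)"
  using markov_N by (simp add: markov_def)

text \<open>
The points at which one of the almost sure properties fails, or which lie in a cylinder of measure zero.
\<close>

definition bad0 :: "'x set" where
  "bad0 = N \<union> (space M - core) \<union> (\<Union>a\<in>\<alpha>. defect a)
     \<union> (\<Union>w\<in>{w. {y \<in> space M. word (length w) y = w} \<in> null_sets M}. {y \<in> space M. word (length w) y = w})"

lemma bad0_null: "bad0 \<in> null_sets M"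
proof -
  have "space M - core \<in> null_sets M"
  proof (subst AE_iff_null_sets)
    show "AE y in M. y \<notin> space M - core" using AE_core by eventually_elim simp
  qed simp
  moreover have "(\<Union>a\<in>\<alpha>. defect a) \<in> null_sets M"
    using partition(1) defect(1) by (rule null_sets_UN')
  moreover have "(\<Union>w\<in>{w. {y \<in> space M. word (length w) y = w} \<in> null_sets M}. {y \<in> space M. word (length w) y = w}) \<in> null_sets M"
    by (rule null_sets_UN') auto
  ultimately show ?thesis unfolding bad0_def using N_null by (intro null_sets.Un)
qed

text \<open>
A null set stays a null set when preimages and images under the branches are added; images are
harmless because the branches are nonsingular. The limit of this process is invariant in both directions, so that on its complement
\<open>D\<close> images of cells are exact unions of cells.
\<close>

definition spread :: "'x set \<Rightarrow> 'x set" where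
  "spread Z = Z \<union> {y \<in> space M. F y \<in> Z} \<union> (\<Union>a\<in>\<alpha>. F ` (Z \<inter> a - N))"

lemma spread_null:
  assumes Z: "Z \<in> null_sets M"
  shows "spread Z \<in> null_sets M"
proof -
  have "AE y in M. y \<notin> Z" using Z by (rule AE_not_in)
  then have ae: "AE y in M. F y \<notin> Z" by (rule AE_F)
  have "F -` Z \<inter> space M \<in> sets M" using Z by (intro measurable_sets[OF F_measurable]) auto
  moreover have "{y \<in> space M. F y \<in> Z} = F -` Z \<inter> space M" by auto
  ultimately have pre: "{y \<in> space M. F y \<in> Z} \<in> sets M" by simp
  have "AE y in M. y \<notin> {y \<in> space M. F y \<in> Z}" using ae by eventually_elim simp
  then have "{y \<in> space M. F y \<in> Z} \<in> null_sets M" using AE_iff_null_sets[OF pre] by simp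
  moreover have "F ` (Z \<inter> a - N) \<in> null_sets M" if "a \<in> \<alpha>" for a
  proof -
    have A: "Z \<inter> a - N \<in> sets M" using Z N_null partition(2)[OF that] by auto
    have "Z \<inter> a - N \<in> null_sets M" by (rule null_sets_subset[OF Z A]) blast
    then have "emeasure M (Z \<inter> a - N) = 0" by (rule null_setsD1)
    moreover have "Z \<inter> a - N \<subseteq> a - N" by blast
    ultimately show ?thesis using markov_image[OF that A] by (intro null_setsI) simp_all
  qed
  then have "(\<Union>a\<in>\<alpha>. F ` (Z \<inter> a - N)) \<in> null_sets M" using partition(1) by (intro null_sets_UN')
  ultimately show ?thesis unfolding spread_def using Z by (intro null_sets.Un)
qed

definition bad :: "'x set" where
  "bad = (\<Union>n. (spread ^^ n) bad0)"

definition D :: "'x set" where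
  "D = space M - bad"

lemma bad_null: "bad \<in> null_sets M"
proof -
  have "(spread ^^ n) bad0 \<in> null_sets M" for n
    by (induction n) (auto intro: bad0_null spread_null)
  then show ?thesis unfolding bad_def by (intro null_sets_UN) auto
qed

lemma D_sets [measurable]: "D \<in> sets M"
  unfolding D_def using bad_null by auto

lemma AE_D: "AE y in M. y \<in> D"
  using AE_not_in[OF bad_null] AE_space by eventually_elim (simp add: D_def)

lemma D_space: "D \<subseteq> space M" by (auto simp: D_def)

lemma D_bad0: "y \<in> D \<Longrightarrow> y \<notin> bad0"
proof
  assume "y \<in> D" "y \<in> bad0"
  then have "y \<in> (spread ^^ 0) bad0" by simp
  then have "y \<in> bad" unfolding bad_def by blast
  then show False using \<open>y \<in> D\<close> by (simp add: D_def)
qed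

lemma D_core: "y \<in> D \<Longrightarrow> y \<in> core" and D_N: "y \<in> D \<Longrightarrow> y \<notin> N"
  using D_bad0[of y] D_space by (auto simp: bad0_def)

lemma D_inside: "y \<in> D \<Longrightarrow> y \<in> inside"
  using D_core core_inside' by blast

lemma F_D: "y \<in> D \<Longrightarrow> F y \<in> D"
proof -
  assume y: "y \<in> D"
  have "F y \<notin> (spread ^^ n) bad0" for n
  proof
    assume "F y \<in> (spread ^^ n) bad0"
    then have "y \<in> (spread ^^ Suc n) bad0" using y D_space by (auto simp: spread_def)
    then have "y \<in> bad" unfolding bad_def by blast
    then show False using y by (simp add: D_def)
  qed
  moreover have "F y \<in> space M" using y D_space F_maps_to by blast
  ultimately show "F y \<in> D" by (simp add: D_def bad_def)
qed

text \<open>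
This is the reason for adding images: a point of \<open>D\<close> has its preimages in \<open>D\<close>.
\<close>

lemma D_backward: "y \<in> space M \<Longrightarrow> a \<in> \<alpha> \<Longrightarrow> y \<in> a - N \<Longrightarrow> F y \<in> D \<Longrightarrow> y \<in> D"
proof -
  assume y: "y \<in> space M" "a \<in> \<alpha>" "y \<in> a - N" "F y \<in> D"
  have "y \<notin> (spread ^^ n) bad0" for n
  proof
    assume "y \<in> (spread ^^ n) bad0"
    then have "F y \<in> (spread ^^ Suc n) bad0" using y by (auto simp: spread_def)
    then have "F y \<in> bad" unfolding bad_def by blast
    then show False using y by (simp add: D_def)
  qed
  then show "y \<in> D" using y by (simp add: D_def bad_def)
qed

lemma cell_cases:
  obtains "{y \<in> D. index y = i} = {}" | a where "a \<in> \<alpha>" "{y \<in> D. index y = i} = D \<inter> a"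
proof (cases "{y \<in> D. index y = i} = {}")
  case False
  then obtain x where x: "x \<in> D" "index x = i" by blast
  have "{y \<in> D. index y = i} = D \<inter> cell_of x"
  proof (intro set_eqI)
    fix y
    have "index y = i \<longleftrightarrow> y \<in> cell_of x" if y: "y \<in> D"
    proof -
      have "index y = i \<longleftrightarrow> cell_of y = cell_of x"
        using index_eq_iff[OF D_inside[OF y] D_inside[OF x(1)]] x(2) by simp
      also have "\<dots> \<longleftrightarrow> y \<in> cell_of x"
        using cell_of(2)[OF D_inside[OF y]] cell_of(3)[OF D_inside[OF y] cell_of(1)[OF D_inside[OF x(1)]]] by auto
      finally show ?thesis .
    qed
    then show "y \<in> {y \<in> D. index y = i} \<longleftrightarrow> y \<in> D \<inter> cell_of x" by blast
  qed
  then show ?thesis using that cell_of(1)[OF D_inside[OF x(1)]] by blast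
qed (use that in blast)

lemma image_cell:
  assumes x: "x \<in> F ` (D \<inter> a)" and a: "a \<in> \<alpha>" and x': "x' \<in> D" "index x' = index x"
  shows "x' \<in> F ` (D \<inter> a)"
proof -
  obtain y where y: "y \<in> D" "y \<in> a" "x = F y" using x by blast
  have xD: "x \<in> D" using y F_D by blast
  have xa: "x \<in> F ` (a - N)" using y D_N by blast
  obtain \<beta> where \<beta>: "\<beta> \<subseteq> \<alpha>" "defect a = (F ` (a - N) - \<Union>\<beta>) \<union> (\<Union>\<beta> - F ` (a - N))"
    using defect(2)[OF a] by blast
  have nd: "x \<notin> defect a" "x' \<notin> defect a" using D_bad0[OF xD] D_bad0[OF x'(1)] a by (auto simp: bad0_def)
  then obtain b where b: "b \<in> \<beta>" "x \<in> b" using xa \<beta>(2) by blast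
  have "cell_of x = b" using b \<beta>(1) D_inside[OF xD] cell_of(3) by blast
  then have "cell_of x' = b" using index_eq_iff[OF D_inside[OF x'(1)] D_inside[OF xD]] x'(2) by simp
  then have "x' \<in> b" using cell_of(2)[OF D_inside[OF x'(1)]] by simp
  then obtain y' where y': "y' \<in> a - N" "x' = F y'" using nd(2) \<beta>(2) b(1) by blast
  have "y' \<in> space M" using y' sets.sets_into_space[OF partition(2)[OF a]] by blast
  then have "y' \<in> D" using D_backward[OF _ a y'(1)] y'(2) x'(1) by simp
  then show ?thesis using y' by blast
qed

lemma image_sets:
  assumes "A \<in> sets M" "A \<subseteq> {y \<in> D. index y = i}"
  shows "F ` A \<in> sets M"
proof (rule cell_cases[of i])
  assume "{y \<in> D. index y = i} = {}"
  then have "A = {}" using assms(2) by (simp only: subset_empty)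
  then show ?thesis by simp
next
  fix a assume "a \<in> \<alpha>" "{y \<in> D. index y = i} = D \<inter> a"
  then show ?thesis using markov_image(1)[of a A] assms D_N by blast
qed

lemma emeasure_mu_F:
  assumes A: "A \<in> sets M"
  shows "emeasure (mu_F N) A = (\<integral>\<^sup>+a. emeasure M (F ` (A \<inter> a - N)) \<partial>count_space \<alpha>)"
proof -
  have Fs: "F ` (A \<inter> a - N) \<in> sets M" if "A \<in> sets M" "a \<in> \<alpha>" for A a
    using that N_null partition(2)[OF that(2)] by (intro markov_image(1)[OF that(2)]) auto
  show ?thesis
    unfolding mu_F_def
  proof (rule emeasure_measure_of_sigma)
    show "sigma_algebra (space M) (sets M)" by (rule sets.sigma_algebra_axioms)
    show "positive (sets M) (\<lambda>A. \<integral>\<^sup>+a. emeasure M (F ` (A \<inter> a - N)) \<partial>count_space \<alpha>)"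
      by (simp add: positive_def)
    show "countably_additive (sets M) (\<lambda>A. \<integral>\<^sup>+a. emeasure M (F ` (A \<inter> a - N)) \<partial>count_space \<alpha>)"
      unfolding countably_additive_def
    proof (intro allI impI)
      fix A :: "nat \<Rightarrow> 'x set" assume A: "range A \<subseteq> sets M" "disjoint_family A" "\<Union> (range A) \<in> sets M"
      have "(\<Sum>i. \<integral>\<^sup>+a. emeasure M (F ` (A i \<inter> a - N)) \<partial>count_space \<alpha>)
          = (\<integral>\<^sup>+a. (\<Sum>i. emeasure M (F ` (A i \<inter> a - N))) \<partial>count_space \<alpha>)"
        by (rule nn_integral_suminf[symmetric]) simp
      also have "\<dots> = (\<integral>\<^sup>+a. emeasure M (F ` (\<Union> (range A) \<inter> a - N)) \<partial>count_space \<alpha>)"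
      proof (rule nn_integral_cong)
        fix a assume "a \<in> space (count_space \<alpha>)"
        then have a: "a \<in> \<alpha>" by simp
        have "(\<Sum>i. emeasure M (F ` (A i \<inter> a - N))) = emeasure M (\<Union>i. F ` (A i \<inter> a - N))"
        proof (rule suminf_emeasure)
          show "range (\<lambda>i. F ` (A i \<inter> a - N)) \<subseteq> sets M" using A(1) Fs a by auto
          show "disjoint_family (\<lambda>i. F ` (A i \<inter> a - N))"
            using A(2) markov_inj[OF a] unfolding disjoint_family_on_def inj_on_def by blast
        qed
        also have "(\<Union>i. F ` (A i \<inter> a - N)) = F ` (\<Union> (range A) \<inter> a - N)" by auto
        finally show "(\<Sum>i. emeasure M (F ` (A i \<inter> a - N))) = emeasure M (F ` (\<Union> (range A) \<inter> a - N))" .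
      qed
      finally show "(\<Sum>i. \<integral>\<^sup>+a. emeasure M (F ` (A i \<inter> a - N)) \<partial>count_space \<alpha>)
          = (\<integral>\<^sup>+a. emeasure M (F ` (\<Union> (range A) \<inter> a - N)) \<partial>count_space \<alpha>)" .
    qed
  qed (rule A)
qed

lemma sets_mu_F [measurable_cong]: "sets (mu_F N) = sets M"
  by (simp add: mu_F_def sets.sigma_sets_eq)

lemma emeasure_mu_F_cell:
  assumes A: "A \<in> sets M" "A \<subseteq> D \<inter> a" and a: "a \<in> \<alpha>"
  shows "emeasure (mu_F N) A = emeasure M (F ` A)"
proof -
  have "emeasure (mu_F N) A = (\<integral>\<^sup>+b. emeasure M (F ` A) * indicator {a} b \<partial>count_space \<alpha>)"
    unfolding emeasure_mu_F[OF A(1)]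
  proof (rule nn_integral_cong)
    fix b assume "b \<in> space (count_space \<alpha>)"
    then have b: "b \<in> \<alpha>" by simp
    show "emeasure M (F ` (A \<inter> b - N)) = emeasure M (F ` A) * indicator {a} b"
    proof (cases "b = a")
      case True
      then have "A \<inter> b - N = A" using A D_N by blast
      then show ?thesis using True by simp
    next
      case False
      have e: "A \<inter> b - N = {}"
      proof (rule ccontr)
        assume "A \<inter> b - N \<noteq> {}"
        then obtain y where y: "y \<in> A" "y \<in> b" by blast
        then have "y \<in> inside" "y \<in> a" using A D_inside by auto
        then show False using cell_of(3)[of y a] cell_of(3)[of y b] a b y False by simp
      qed
      show ?thesis unfolding e using False by simp
    qed
  qed
  also have "\<dots> = emeasure M (F ` A)"
    using a by (subst nn_integral_cmult_indicator) (auto simp: emeasure_count_space)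
  finally show ?thesis .
qed

text \<open>
The density of \<open>\<mu>\<close> with respect to \<open>\<mu> \<circ> F\<close> is transported to the image of a cell by the map that is the inverse
branch on the image of \<open>A\<close> and the identity elsewhere.
\<close>

lemma jacobian:
  assumes A: "A \<in> sets M" "A \<subseteq> {y \<in> D. index y = i}"
  shows "emeasure M A = (\<integral>\<^sup>+x. ennreal (g (inv_into {y \<in> D. index y = i} F x)) * indicator (F ` A) x \<partial>M)"
proof (rule cell_cases[of i])
  assume "{y \<in> D. index y = i} = {}"
  then have "A = {}" using assms(2) by (simp only: subset_empty)
  then show ?thesis by simp
next
  fix a assume a: "a \<in> \<alpha>" and c: "{y \<in> D. index y = i} = D \<inter> a"
  have inj: "inj_on F (D \<inter> a)" using markov_inj[OF a] D_N by (auto intro: inj_on_subset)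
  have Aa: "A \<subseteq> D \<inter> a" using A c by simp
  have FA: "F ` B \<in> sets M" if "B \<in> sets M" "B \<subseteq> A" for B
  proof (rule image_sets[of B i])
    show "B \<subseteq> {y \<in> D. index y = i}" using that(2) A(2) by (rule subset_trans)
  qed (rule that)
  define \<psi> where "\<psi> x = (if x \<in> F ` A then inv_into (D \<inter> a) F x else x)" for x
  have inv: "inv_into (D \<inter> a) F (F y) = y" if "y \<in> A" for y using inj Aa that by (intro inv_into_f_f) auto
  have vim: "\<psi> -` B \<inter> space M = F ` (A \<inter> B) \<union> (B - F ` A)" if "B \<in> sets M" for B
  proof -
    have "F ` A \<subseteq> space M" using sets.sets_into_space[OF FA[OF A(1) order_refl]] .
    moreover have "B \<subseteq> space M" using sets.sets_into_space[OF that] .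
    moreover have "\<psi> x \<in> B \<longleftrightarrow> x \<in> F ` (A \<inter> B) \<union> (B - F ` A)" for x
    proof (cases "x \<in> F ` A")
      case True
      then obtain y where y: "y \<in> A" "x = F y" by blast
      then have p: "\<psi> x = y" using inv True by (simp add: \<psi>_def)
      have "x \<in> F ` (A \<inter> B) \<longleftrightarrow> y \<in> B"
      proof
        assume "x \<in> F ` (A \<inter> B)"
        then obtain y' where y': "y' \<in> A" "y' \<in> B" "F y' = x" by blast
        have "y' = y" by (rule inj_onD[OF inj y'(3)[unfolded y(2)]]) (use Aa y(1) y'(1) in blast)+
        then show "y \<in> B" using y'(2) by (rule subst)
      next
        assume "y \<in> B"
        then show "x \<in> F ` (A \<inter> B)" unfolding y(2) by (intro imageI IntI y(1))
      qed
      then show ?thesis unfolding p using True by blast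
    qed (auto simp: \<psi>_def)
    ultimately show ?thesis by blast
  qed
  have \<psi> [measurable]: "\<psi> \<in> measurable M M"
  proof (rule measurableI)
    fix x assume "x \<in> space M"
    then show "\<psi> x \<in> space M" using inv sets.sets_into_space[OF A(1)] by (auto simp: \<psi>_def)
  next
    fix B assume "B \<in> sets M"
    then show "\<psi> -` B \<inter> space M \<in> sets M"
      using FA[of "A \<inter> B"] FA[of A] A(1) by (simp add: vim sets.Un sets.Diff)
  qed
  have FAs [measurable]: "F ` A \<in> sets M" using FA A by auto
  note A(1) [measurable]
  have eq: "distr (density M (indicator (F ` A))) M \<psi> = distr (density (mu_F N) (indicator A)) M (\<lambda>x. x)"
  proof (rule measure_eqI)
    fix B assume "B \<in> sets (distr (density M (indicator (F ` A))) M \<psi>)"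
    then have B [measurable]: "B \<in> sets M" by simp
    have "emeasure (distr (density M (indicator (F ` A))) M \<psi>) B = (\<integral>\<^sup>+x. indicator (F ` A) x * indicator (\<psi> -` B \<inter> space M) x \<partial>M)"
      by (subst emeasure_distr) (auto simp: emeasure_density intro: measurable_sets)
    also have "\<dots> = (\<integral>\<^sup>+x. indicator (F ` (A \<inter> B)) x \<partial>M)"
      unfolding vim[OF B] by (intro nn_integral_cong) (auto simp: indicator_def)
    also have "\<dots> = emeasure M (F ` (A \<inter> B))" using FA[of "A \<inter> B"] by simp
    also have "\<dots> = emeasure (mu_F N) (A \<inter> B)"
      using Aa by (intro emeasure_mu_F_cell[symmetric, OF _ _ a]) auto
    also have "\<dots> = emeasure (distr (density (mu_F N) (indicator A)) M (\<lambda>x. x)) B"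
    proof -
      have "(\<lambda>x. x) -` B \<inter> space (mu_F N) = B" using sets.sets_into_space[OF B] by (simp add: mu_F_def Int_absorb2)
      then show ?thesis
        by (subst emeasure_distr) (auto simp: emeasure_density measurable_ident_sets sets_mu_F indicator_inter_arith[symmetric])
    qed
    finally show "emeasure (distr (density M (indicator (F ` A))) M \<psi>) B = emeasure (distr (density (mu_F N) (indicator A)) M (\<lambda>x. x)) B" .
  qed simp
  have "emeasure M A = emeasure (density (mu_F N) (\<lambda>y. ennreal (g y))) A" by (simp add: g_density)
  also have "\<dots> = (\<integral>\<^sup>+y. ennreal (g y) * indicator A y \<partial>mu_F N)"
    by (subst emeasure_density) auto
  also have "\<dots> = (\<integral>\<^sup>+y. ennreal (g y) \<partial>distr (density (mu_F N) (indicator A)) M (\<lambda>x. x))"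
    by (subst nn_integral_distr) (auto simp: nn_integral_density mult.commute measurable_ident_sets sets_mu_F)
  also have "\<dots> = (\<integral>\<^sup>+x. indicator (F ` A) x * ennreal (g (\<psi> x)) \<partial>M)"
    unfolding eq[symmetric] by (simp add: nn_integral_distr nn_integral_density)
  also have "\<dots> = (\<integral>\<^sup>+x. ennreal (g (inv_into {y \<in> D. index y = i} F x)) * indicator (F ` A) x \<partial>M)"
    unfolding c by (intro nn_integral_cong) (auto simp: \<psi>_def indicator_def)
  finally show ?thesis .
qed

definition c\<^sub>0 :: real where
  "c\<^sub>0 = enn2real (INF a\<in>\<alpha>. emeasure M (F ` (a - N)))"

lemma alpha_nonempty: "\<alpha> \<noteq> {}"
proof
  assume "\<alpha> = {}"
  then have "inside = {}" using cell_of(1) by blast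
  moreover have "measure M inside = 1" using AE_inside by (simp add: prob_eq_1)
  ultimately show False by (metis measure_empty zero_neq_one)
qed

lemma INF_image: "0 < (INF a\<in>\<alpha>. emeasure M (F ` (a - N)))" "(INF a\<in>\<alpha>. emeasure M (F ` (a - N))) \<le> 1"
proof -
  show "0 < (INF a\<in>\<alpha>. emeasure M (F ` (a - N)))" using markov_N by (simp add: markov_def)
  obtain a where "a \<in> \<alpha>" using alpha_nonempty by blast
  then have "(INF a\<in>\<alpha>. emeasure M (F ` (a - N))) \<le> emeasure M (F ` (a - N))" by (rule INF_lower)
  also have "\<dots> \<le> 1" by (rule emeasure_le_1)
  finally show "(INF a\<in>\<alpha>. emeasure M (F ` (a - N))) \<le> 1" .
qed

lemma c0_pos: "0 < c\<^sub>0"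
  unfolding c\<^sub>0_def using INF_image by (intro enn2real_positive_iff[THEN iffD2]) (auto intro: le_less_trans)

lemma big_images:
  assumes a: "a \<in> \<alpha>"
  shows "c\<^sub>0 \<le> measure M (F ` (D \<inter> a))"
proof -
  have aM [measurable]: "a \<in> sets M" "N \<in> sets M" using partition(2)[OF a] N_null by auto
  have sub: "D \<inter> a \<subseteq> a - N" using D_N by blast
  have A: "a - N - D \<in> sets M" by measurable
  have "a - N - D \<subseteq> bad" using sets.sets_into_space[OF aM(1)] unfolding D_def by blast
  then have "a - N - D \<in> null_sets M" by (rule null_sets_subset[OF bad_null A])
  then have "emeasure M (a - N - D) = 0" by (rule null_setsD1)
  moreover have "a - N - D \<subseteq> a - N" by blast
  ultimately have n: "F ` (a - N - D) \<in> null_sets M" using markov_image[OF a A] by (intro null_setsI) simp_all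
  have "F ` (a - N) = F ` (D \<inter> a) \<union> F ` (a - N - D)" using sub by auto
  moreover have FD: "F ` (D \<inter> a) \<in> sets M" using sub by (intro markov_image(1)[OF a]) auto
  ultimately have "emeasure M (F ` (a - N)) = emeasure M (F ` (D \<inter> a))"
    using n by (simp add: emeasure_Un_null_set)
  then have "(INF a\<in>\<alpha>. emeasure M (F ` (a - N))) \<le> emeasure M (F ` (D \<inter> a))"
    using INF_lower[OF a, of "\<lambda>a. emeasure M (F ` (a - N))"] by simp
  then have "c\<^sub>0 \<le> enn2real (emeasure M (F ` (D \<inter> a)))"
    unfolding c\<^sub>0_def by (intro enn2real_mono) (auto simp: less_top[symmetric])
  then show ?thesis by (simp add: measure_def)
qed

text \<open>
The value \<open>2\<close> off \<open>D\<close> matches the convention of the abstract setting, where it makes extension by zero Lipschitz.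
\<close>

definition dist_D :: "'x \<Rightarrow> 'x \<Rightarrow> real" where
  "dist_D x x' = (if x \<in> D \<and> x' \<in> D then dtheta x x' else 2)"

lemma support:
  assumes x: "x \<in> D" and P: "AE y in M. P y"
  shows "\<exists>y\<in>D. P y \<and> (\<forall>i<k. index ((F ^^ i) y) = index ((F ^^ i) x))"
proof -
  define C where "C = {y \<in> space M. word k y = word k x}"
  have len: "length (word k x) = k" by (simp add: word_def)
  have "C \<notin> null_sets M"
    using D_bad0[OF x] x D_space unfolding C_def bad0_def by (auto simp: len dest: spec[of _ "word k x"])
  moreover have "C \<in> sets M" unfolding C_def by measurable
  ultimately have "\<not> (AE y in M. y \<notin> C)" by (auto simp: AE_iff_null_sets)
  then have "\<exists>y. y \<in> C \<and> y \<in> D \<and> P y"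
  proof (rule contrapos_np)
    assume "\<nexists>y. y \<in> C \<and> y \<in> D \<and> P y"
    then show "AE y in M. y \<notin> C" using AE_D P by (auto elim!: eventually_elim2)
  qed
  then obtain y where y: "y \<in> C" "y \<in> D" "P y" by blast
  then have "word k y = word k x" by (simp add: C_def)
  then show ?thesis using y by (auto simp: word_eq_iff)
qed

sublocale gm: gibbs_markov_map M F D index g dist_D \<theta> "max 0 C\<^sub>0" c\<^sub>0
proof unfold_locales
  show "D \<in> sets M" "AE x in M. x \<in> D" "F \<in> measurable M M" "index \<in> measurable M (count_space UNIV)"
    "distr M M F = M" "g \<in> borel_measurable M" "0 < \<theta>" "\<theta> < 1" "0 < c\<^sub>0" "0 \<le> max 0 C\<^sub>0"
    using AE_D F_invariant theta c0_pos by simp_all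
  show "F x \<in> D" if "x \<in> D" for x using F_D that .
  show "emeasure M A = 0 \<or> emeasure M A = 1" if "A \<in> sets M" "F -` A \<inter> space M = A" for A
    using F_ergodic that .
  show "inj_on F {x \<in> D. index x = i}" for i
  proof (rule cell_cases[of i])
    fix a assume "a \<in> \<alpha>" "{y \<in> D. index y = i} = D \<inter> a"
    then show ?thesis using markov_inj[of a] D_N by (auto intro: inj_on_subset)
  qed (simp only: inj_on_empty)
  show "F ` A \<in> sets M" if "A \<in> sets M" "A \<subseteq> {x \<in> D. index x = i}" for A i using image_sets that .
  show "x' \<in> F ` {y \<in> D. index y = i}" if "x \<in> F ` {y \<in> D. index y = i}" "x' \<in> D" "index x' = index x" for x x' i
  proof (rule cell_cases[of i])
    fix a assume a: "a \<in> \<alpha>" "{y \<in> D. index y = i} = D \<inter> a"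
    then show ?thesis using image_cell[OF _ a(1) that(2,3)] that(1) by simp
  next
    assume E: "{y \<in> D. index y = i} = {}"
    show ?thesis using that(1) unfolding E by simp
  qed
  show "0 < g x" if "x \<in> D" for x using g_positive that D_space by blast
  show "emeasure M A = (\<integral>\<^sup>+x. ennreal (g (inv_into {x \<in> D. index x = i} F x)) * indicator (F ` A) x \<partial>M)"
    if "A \<in> sets M" "A \<subseteq> {x \<in> D. index x = i}" for A i using jacobian that .
  show "\<bar>ln (g x) - ln (g x')\<bar> \<le> max 0 C\<^sub>0 * dist_D (F x) (F x')" if "x \<in> D" "x' \<in> D" "index x' = index x" for x x'
  proof -
    have "cell_of x' = cell_of x" using that index_eq_iff D_inside by blast
    then have "cell_of x \<in> \<alpha>" "x \<in> cell_of x" "x' \<in> cell_of x"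
      using cell_of(1,2)[OF D_inside[OF that(1)]] cell_of(2)[OF D_inside[OF that(2)]] by simp_all
    then have "\<bar>ln (g x) - ln (g x')\<bar> \<le> C\<^sub>0 * dtheta (F x) (F x')"
      using D_core[OF that(1)] D_core[OF that(2)] by (intro g_distortion[of "cell_of x"]) simp_all
    also have "\<dots> \<le> max 0 C\<^sub>0 * dtheta (F x) (F x')" using dtheta_nonneg by (intro mult_right_mono) auto
    finally show ?thesis using F_D that by (simp add: dist_D_def)
  qed
  show "c\<^sub>0 \<le> measure M (F ` {y \<in> D. index y = index x})" if "x \<in> D" for x
  proof (rule cell_cases[of "index x"])
    fix a assume "a \<in> \<alpha>" "{y \<in> D. index y = index x} = D \<inter> a"
    then show ?thesis using big_images by simp
  qed (use that in blast)
  show "0 \<le> dist_D x x'" for x x' using dtheta_nonneg by (simp add: dist_D_def)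
  show "dist_D x x' \<le> 1" if "x \<in> D" "x' \<in> D" for x x' using dtheta_le_1 that by (simp add: dist_D_def)
  show "dist_D x x' = 1" if "x \<in> D" "x' \<in> D" "index x' \<noteq> index x" for x x'
    using dtheta_distinct D_core that by (simp add: dist_D_def)
  show "dist_D x x' = \<theta> * dist_D (F x) (F x')" if "x \<in> D" "x' \<in> D" "index x' = index x" for x x'
    using dtheta_shift D_core F_D that by (simp add: dist_D_def)
  show "dist_D x x' = 2" if "x \<notin> D \<or> x' \<notin> D" for x x' using that by (auto simp: dist_D_def)
  show "\<exists>y\<in>D. P y \<and> (\<forall>i<k. index ((F ^^ i) y) = index ((F ^^ i) x))" if "x \<in> D" "AE y in M. P y" for x P k
    using support that .
qed

end

section \<open>Aperiodicity as a bound from below\<close>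

lemma suminf_Suc_eq:
  fixes f :: "nat \<Rightarrow> 'a::real_normed_vector"
  assumes "f 0 = 0"
  shows "(\<Sum>n. f (Suc n)) = (\<Sum>n. f n)"
proof -
  have "(sums) (\<lambda>n. f (Suc n)) = (sums) f" using sums_Suc_iff[of f] assms by (intro ext) simp
  then show ?thesis unfolding suminf_def by (rule arg_cong)
qed

lemma wt_le_Suc: "wt s n \<le> 2 powr \<bar>s\<bar> * wt s (Suc n)"
proof (cases "0 \<le> s")
  case True
  have "wt s n \<le> 1 * wt s (Suc n)" using wt_mono[OF True, of n "Suc n"] by simp
  also have "\<dots> \<le> 2 powr \<bar>s\<bar> * wt s (Suc n)" by (intro mult_right_mono ge_one_powr_ge_zero) auto
  finally show ?thesis .
next
  case False
  have "(2 * real (Suc n)) powr s \<le> real (Suc (Suc n)) powr s" using False by (intro powr_mono2') auto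
  then have "2 powr s * wt s n \<le> wt s (Suc n)" unfolding wt_def by (subst (asm) powr_mult) auto
  then have "2 powr (-s) * (2 powr s * wt s n) \<le> 2 powr (-s) * wt s (Suc n)" by (intro mult_left_mono) auto
  then show ?thesis using False by (simp add: mult.assoc[symmetric] flip: powr_add)
qed

context gibbs_markov_map
begin

lemma S_union:
  assumes "I \<inter> J = {}"
  shows "S (I \<union> J) x = S I x + S J x"
  unfolding S_def suminf_add[OF summable_S summable_S]
  by (intro suminf_cong) (use assms in auto)

lemma sum_S_levels:
  fixes ph :: "nat \<Rightarrow> nat"
  shows "(\<Sum>n<k. S {i. ph i = n} x) = S {i. ph i < k} x"
proof (induction k)
  case (Suc k)
  have "{i. ph i < Suc k} = {i. ph i < k} \<union> {i. ph i = k}" by auto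
  then show ?case using Suc S_union[of "{i. ph i < k}" "{i. ph i = k}"] by (simp add: disjoint_iff)
qed (simp add: S_def)

lemma summable_transfer_levels:
  fixes v :: "'x \<Rightarrow> complex"
  assumes v: "\<And>y. y \<in> D \<Longrightarrow> cmod (v y) \<le> B" and z: "cmod z \<le> 1"
  shows "summable (\<lambda>n. z ^ n * transfer (\<lambda>i y. if ph i = n then indicator D y * v y else 0) x)"
proof (rule summable_norm_cancel, rule bounded_imp_summable)
  fix N
  have b: "norm (z ^ n * transfer (\<lambda>i y. if ph i = n then indicator D y * v y else 0) x) \<le> \<bar>B\<bar> * S {i. ph i = n} x" for n
  proof -
    have "cmod (transfer (\<lambda>i y. if ph i = n then indicator D y * v y else 0) x) \<le> \<bar>B\<bar> * S {i. ph i = n} x"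
    proof (rule norm_transfer_le)
      show "cmod (if ph i = n then indicator D y * v y else 0) \<le> \<bar>B\<bar>" for i y
        using v[of y] by (auto simp: indicator_def)
    qed auto
    moreover have "cmod (z ^ n) \<le> 1" using z by (simp add: norm_power power_le_one)
    ultimately show ?thesis
      unfolding norm_mult using mult_mono[of "cmod (z ^ n)" 1 "cmod (transfer (\<lambda>i y. if ph i = n then indicator D y * v y else 0) x)" "\<bar>B\<bar> * S {i. ph i = n} x"] by simp
  qed
  have "(\<Sum>n\<le>N. norm (z ^ n * transfer (\<lambda>i y. if ph i = n then indicator D y * v y else 0) x)) \<le> (\<Sum>n<Suc N. \<bar>B\<bar> * S {i. ph i = n} x)"
    unfolding lessThan_Suc_atMost by (intro sum_mono b)
  also have "\<dots> = \<bar>B\<bar> * S {i. ph i < Suc N} x" by (simp only: sum_distrib_left[symmetric] sum_S_levels)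
  also have "\<dots> \<le> \<bar>B\<bar> * 1" by (intro mult_left_mono S_le_1) auto
  finally show "(\<Sum>n\<le>N. norm (z ^ n * transfer (\<lambda>i y. if ph i = n then indicator D y * v y else 0) x)) \<le> \<bar>B\<bar> * 1" .
qed simp

text \<open>
The pointwise version of \<open>R(z)\<close>.
\<close>

definition twisted :: "(nat \<Rightarrow> nat) \<Rightarrow> complex \<Rightarrow> ('x \<Rightarrow> complex) \<Rightarrow> 'x \<Rightarrow> complex" where
  "twisted ph z v x = (\<Sum>n. z ^ n * transfer (\<lambda>i y. if ph i = n then indicator D y * v y else 0) x)"

lemma twisted_diff:
  assumes v: "\<And>y. y \<in> D \<Longrightarrow> cmod (v y) \<le> B" and w: "\<And>y. y \<in> D \<Longrightarrow> cmod (w y) \<le> B'" and z: "cmod z \<le> 1"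
  shows "twisted ph z (\<lambda>y. v y - w y) x = twisted ph z v x - twisted ph z w x"
proof -
  have "transfer (\<lambda>i y. if ph i = n then indicator D y * (v y - w y) else 0) x
      = transfer (\<lambda>i y. if ph i = n then indicator D y * v y else 0) x - transfer (\<lambda>i y. if ph i = n then indicator D y * w y else 0) x" for n
  proof -
    have s: "summable (\<lambda>i. G i x *\<^sub>R (if ph i = n then indicator D (branch i x) * v (branch i x) else 0))"
      "summable (\<lambda>i. G i x *\<^sub>R (if ph i = n then indicator D (branch i x) * w (branch i x) else 0))"
      by (rule summable_transfer(2)[where f = "\<lambda>i y. if ph i = n then indicator D y * v y else 0" and B = "\<bar>B\<bar>"]
            summable_transfer(2)[where f = "\<lambda>i y. if ph i = n then indicator D y * w y else 0" and B = "\<bar>B'\<bar>"];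
          use v w in \<open>fastforce simp: indicator_def\<close>)+
    show ?thesis unfolding transfer_def suminf_diff[OF s]
      by (intro suminf_cong) (auto simp: algebra_simps)
  qed
  then show ?thesis
    unfolding twisted_def
    using suminf_diff[OF summable_transfer_levels[of v B z ph x, OF v z] summable_transfer_levels[of w B' z ph x, OF w z]]
    by (simp only: right_diff_distrib)
qed

lemma twisted_cong: "(\<And>y. y \<in> D \<Longrightarrow> v y = w y) \<Longrightarrow> twisted ph z v x = twisted ph z w x"
  unfolding twisted_def
  by (intro suminf_cong arg_cong[where f = "\<lambda>t. z ^ _ * t"] transfer_cong) (auto simp: indicator_def)

end

context young_tower_data
begin

lemma D_nonempty: "D \<noteq> {}"
  using gm.measure_D by fastforce

text \<open>
The return time as a function of the symbol; symbols of no point get an arbitrary positive value.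
\<close>

definition return :: "nat \<Rightarrow> nat" where
  "return i = (if \<exists>y\<in>D. index y = i then \<phi> (SOME y. y \<in> D \<and> index y = i) else 1)"

lemma phi_return: "y \<in> D \<Longrightarrow> return (index y) = \<phi> y"
proof -
  assume y: "y \<in> D"
  define z where "z = (SOME z. z \<in> D \<and> index z = index y)"
  have z: "z \<in> D" "index z = index y" using someI[of "\<lambda>z. z \<in> D \<and> index z = index y" y] y unfolding z_def by auto
  then have "cell_of z = cell_of y" using index_eq_iff D_inside y by blast
  then have "\<phi> z = \<phi> y" using phi_constant[of "cell_of y" z y] cell_of(1,2) D_inside y z(1) by metis
  then show ?thesis using y by (auto simp: return_def z_def)
qed

lemma return_pos: "y \<in> D \<Longrightarrow> 0 < return (index y)"
  using phi_return phi_pos D_space by auto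

text \<open>
The operator \<open>R\<close> is a choice among the representatives satisfying the duality, and duality determines
the function almost everywhere.
\<close>

lemma R_eq_ruelle:
  assumes h [measurable]: "h \<in> borel_measurable M" and B: "\<And>y. y \<in> D \<Longrightarrow> cmod (h y) \<le> B"
  shows "AE y in M. R h y = gm.ruelle h y"
proof -
  let ?P = "\<lambda>u. integrable M u \<and> (\<forall>w\<in>Linf M. (\<integral>y. u y * w y \<partial>M) = (\<integral>y. h y * w (F y) \<partial>M))"
  have B': "cmod (h y) \<le> \<bar>B\<bar>" if "y \<in> D" for y using B[OF that] by simp
  have rm [measurable]: "gm.ruelle h \<in> borel_measurable M" using B by (intro gm.ruelle_measurable h)
  have rb: "cmod (gm.ruelle h y) \<le> \<bar>B\<bar>" for y using B' by (intro gm.norm_ruelle_le) auto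
  have int: "integrable M (gm.ruelle h)" by (rule integrable_const_bound[where B = "\<bar>B\<bar>"]) (auto simp: rb)
  have "?P (gm.ruelle h)"
  proof (intro conjI ballI int)
    fix w :: "'x \<Rightarrow> complex" assume "w \<in> Linf M"
    then obtain C where w [measurable]: "w \<in> borel_measurable M" and C: "AE x in M. norm (w x) \<le> C"
      by (auto simp: Linf_def)
    define w' where "w' x = (if norm (w x) \<le> C then w x else 0)" for x
    have w' [measurable]: "w' \<in> borel_measurable M" unfolding w'_def by measurable
    have ae: "AE x in M. w' x = w x" using C by eventually_elim (simp add: w'_def)
    have "(\<integral>y. gm.ruelle h y * w y \<partial>M) = (\<integral>y. gm.ruelle h y * w' y \<partial>M)"
      using ae by (intro integral_cong_AE) auto
    also have "\<dots> = (\<integral>y. h y * w' (F y) \<partial>M)"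
      by (rule gm.ruelle_duality[where B = B and W = "\<bar>C\<bar>"]) (use B in \<open>auto simp: w'_def\<close>)
    also have "\<dots> = (\<integral>y. h y * w (F y) \<partial>M)"
      using AE_F[OF ae] by (intro integral_cong_AE) auto
    finally show "(\<integral>y. gm.ruelle h y * w y \<partial>M) = (\<integral>y. h y * w (F y) \<partial>M)" .
  qed
  then have P: "?P (R h)" unfolding R_def by (rule someI[of ?P])
  show ?thesis
  proof (rule density_unique_banach)
    fix A assume A [measurable]: "A \<in> sets M"
    have wl: "(indicator A :: 'x \<Rightarrow> complex) \<in> Linf M"
      unfolding Linf_def by (auto intro!: exI[of _ 1] simp: indicator_def)
    have "(\<integral>y. R h y * indicator A y \<partial>M) = (\<integral>y. gm.ruelle h y * indicator A y \<partial>M)"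
      using P \<open>?P (gm.ruelle h)\<close> wl by simp
    moreover have "set_lebesgue_integral M A u = (\<integral>y. u y * indicator A y \<partial>M)" for u :: "'x \<Rightarrow> complex"
      unfolding set_lebesgue_integral_def by (intro Bochner_Integration.integral_cong) (auto simp: indicator_def)
    ultimately show "set_lebesgue_integral M A (R h) = set_lebesgue_integral M A (gm.ruelle h)" by simp
  qed (use P int in auto)
qed

lemma Rz_eq_twisted:
  assumes v [measurable]: "v \<in> borel_measurable M" and B: "\<And>y. y \<in> D \<Longrightarrow> cmod (v y) \<le> B"
  shows "AE y in M. Rz z v y = gm.twisted return z v y"
proof -
  have phm [measurable]: "\<phi> \<in> measurable M (count_space UNIV)" by (rule phi_measurable)
  have Rn: "AE y in M. Rn n v y = gm.transfer (\<lambda>i y. if return i = n then indicator D y * v y else 0) y" for n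
  proof -
    have "AE y in M. R (\<lambda>y. indicator {y. \<phi> y = n} y * v y) y = gm.ruelle (\<lambda>y. indicator {y. \<phi> y = n} y * v y) y"
    proof (rule R_eq_ruelle)
      have "(\<lambda>y. (if \<phi> y = n then 1 else 0) * v y) \<in> borel_measurable M" by measurable
      then show "(\<lambda>y. indicator {y. \<phi> y = n} y * v y) \<in> borel_measurable M"
        by (rule back_subst[where P = "\<lambda>f. f \<in> borel_measurable M"]) (auto simp: indicator_def)
      show "cmod (indicator {y. \<phi> y = n} y * v y) \<le> \<bar>B\<bar>" if "y \<in> D" for y using B[OF that] by (auto simp: indicator_def)
    qed
    moreover have "gm.ruelle (\<lambda>y. indicator {y. \<phi> y = n} y * v y) y = gm.transfer (\<lambda>i y. if return i = n then indicator D y * v y else 0) y" for y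
      unfolding gm.ruelle_def using phi_return by (intro gm.transfer_cong) (auto simp: gm.cell_def indicator_def)
    ultimately show ?thesis by (simp add: Rn_def)
  qed
  then have "AE y in M. \<forall>n. Rn n v y = gm.transfer (\<lambda>i y. if return i = n then indicator D y * v y else 0) y"
    by (subst AE_all_countable) blast
  then show ?thesis
  proof eventually_elim
    case (elim y)
    have "gm.transfer (\<lambda>i y. if return i = 0 then indicator D y * v y else 0) y = gm.transfer (\<lambda>_ _. 0) y"
      using return_pos by (intro gm.transfer_cong) (fastforce simp: gm.cell_def)
    then have 0: "gm.transfer (\<lambda>i y. if return i = 0 then indicator D y * v y else 0) y = 0"
      by (simp add: gm.transfer_def)
    show ?case
      unfolding Rz_def gm.twisted_def using elim
        suminf_Suc_eq[of "\<lambda>n. z ^ n * gm.transfer (\<lambda>i y. if return i = n then indicator D y * v y else 0) y"] 0 by simp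
  qed
qed

lemma lip_normI:
  assumes "\<And>y. y \<in> A \<Longrightarrow> norm (v y) \<le> B"
    "\<And>y y'. y \<in> A \<Longrightarrow> y' \<in> A \<Longrightarrow> norm (v y - v y') \<le> K * dtheta y y'" "A \<subseteq> core"
  shows "lip_norm A v \<le> ennreal B + ennreal K"
  unfolding lip_norm_def
proof (intro add_mono SUP_least)
  show "ennreal (norm (v y)) \<le> ennreal B" if "y \<in> A" for y using assms(1)[OF that] by (rule ennreal_leI)
  fix p assume "p \<in> {(y, y'). y \<in> A \<and> y' \<in> A \<and> y \<noteq> y'}"
  then obtain y y' where p: "p = (y, y')" "y \<in> A" "y' \<in> A" "y \<noteq> y'" by auto
  then have "0 < dtheta y y'" using assms(3) by (intro dtheta_pos) auto
  then have "norm (v y - v y') / dtheta y y' \<le> K" using assms(2)[OF p(2,3)] by (simp add: divide_le_eq)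
  then show "(case p of (y, y') \<Rightarrow> ennreal (norm (v y - v y') / dtheta y y')) \<le> ennreal K" by (simp add: p ennreal_leI)
qed

lemma lip_normD:
  assumes "lip_norm A v \<le> ennreal Q" "0 \<le> Q" "A \<subseteq> core"
  shows "y \<in> A \<Longrightarrow> norm (v y) \<le> Q" and "y \<in> A \<Longrightarrow> y' \<in> A \<Longrightarrow> norm (v y - v y') \<le> Q * dtheta y y'"
proof -
  show "norm (v y) \<le> Q" if "y \<in> A"
  proof -
    have "ennreal (norm (v y)) \<le> (SUP y\<in>A. ennreal (norm (v y)))" using that by (rule SUP_upper)
    also have "\<dots> \<le> lip_norm A v" unfolding lip_norm_def by simp
    also have "\<dots> \<le> ennreal Q" by fact
    finally show ?thesis using assms(2) by simp
  qed
  show "norm (v y - v y') \<le> Q * dtheta y y'" if "y \<in> A" "y' \<in> A"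
  proof (cases "y = y'")
    case False
    have pos: "0 < dtheta y y'" using False that assms(3) by (intro dtheta_pos) auto
    have "ennreal (norm (v y - v y') / dtheta y y')
        \<le> (SUP (y, y') \<in> {(y, y'). y \<in> A \<and> y' \<in> A \<and> y \<noteq> y'}. ennreal (norm (v y - v y') / dtheta y y'))"
      by (rule SUP_upper2[of "(y, y')"]) (use that False in auto)
    also have "\<dots> \<le> lip_norm A v" unfolding lip_norm_def by simp
    also have "\<dots> \<le> ennreal Q" by fact
    finally have "norm (v y - v y') / dtheta y y' \<le> Q" using assms(2) by simp
    then show ?thesis using pos by (simp add: divide_le_eq)
  qed (use assms(2) dtheta_nonneg in auto)
qed

lemma dtheta_self: "y \<in> core \<Longrightarrow> dtheta y y = 0"
  by (simp add: dtheta_core differ_def)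

text \<open>
The McShane extension \<open>y \<mapsto> inf (f x + L d(x, y))\<close>. A bound on \<open>D\<close> must be turned into a bound on the larger
core, on which the norm of the space of observables is taken.
\<close>

lemma real_extension:
  fixes f :: "'x \<Rightarrow> real"
  assumes L: "0 \<le> L" "\<And>x. x \<in> D \<Longrightarrow> \<bar>f x\<bar> \<le> L"
    "\<And>x x'. x \<in> D \<Longrightarrow> x' \<in> D \<Longrightarrow> \<bar>f x - f x'\<bar> \<le> L * dtheta x x'"
  obtains e where "\<And>x. x \<in> D \<Longrightarrow> e x = f x" "\<And>y. y \<in> core \<Longrightarrow> \<bar>e y\<bar> \<le> 2 * L"
    "\<And>y y'. y \<in> core \<Longrightarrow> y' \<in> core \<Longrightarrow> \<bar>e y - e y'\<bar> \<le> L * dtheta y y'"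
proof -
  define e where "e y = (INF x\<in>D. f x + L * dtheta x y)" for y
  have lb: "- L \<le> f x + L * dtheta x y" if "x \<in> D" for x y
    using L(2)[OF that] mult_nonneg_nonneg[OF L(1) dtheta_nonneg[of x y]] by linarith
  then have bdd: "bdd_below ((\<lambda>x. f x + L * dtheta x y) ` D)" for y by (intro bdd_belowI2)
  have up: "e y \<le> f x + L * dtheta x y" if "x \<in> D" for x y unfolding e_def by (intro cINF_lower bdd that)
  have low: "c \<le> e y" if "\<And>x. x \<in> D \<Longrightarrow> c \<le> f x + L * dtheta x y" for c y
    unfolding e_def by (intro cINF_greatest D_nonempty that)
  have eq: "e x = f x" if x: "x \<in> D" for x
  proof (rule antisym)
    show "e x \<le> f x" using up[OF x, of x] dtheta_self D_core x by simp
    show "f x \<le> e x"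
    proof (rule low)
      fix x' assume "x' \<in> D"
      then show "f x \<le> f x' + L * dtheta x' x" using L(3)[of x' x] x by (simp add: abs_le_iff)
    qed
  qed
  have bound: "\<bar>e y\<bar> \<le> 2 * L" for y
  proof -
    obtain x where x: "x \<in> D" using D_nonempty by blast
    have "f x + L * dtheta x y \<le> L + L * 1"
      using L(1) L(2)[OF x] dtheta_le_1[of x y] by (intro add_mono mult_left_mono) auto
    then have "e y \<le> 2 * L" using up[OF x, of y] by linarith
    moreover have "- L \<le> e y" by (intro low lb)
    ultimately show ?thesis using L(1) by (simp add: abs_le_iff)
  qed
  have half: "e y \<le> e y' + L * dtheta y y'" if y: "y \<in> core" "y' \<in> core" for y y'
  proof -
    have "e y - L * dtheta y y' \<le> e y'"
    proof (rule low)
      fix x assume x: "x \<in> D"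
      have "dtheta x y \<le> dtheta x y' + dtheta y y'"
        using dtheta_triangle[OF D_core[OF x] y(2,1)] dtheta_sym[OF y] by simp
      then have "L * dtheta x y \<le> L * dtheta x y' + L * dtheta y y'"
        using L(1) by (metis distrib_left mult_left_mono)
      then show "e y - L * dtheta y y' \<le> f x + L * dtheta x y'" using up[OF x, of y] by linarith
    qed
    then show ?thesis by simp
  qed
  have "\<bar>e y - e y'\<bar> \<le> L * dtheta y y'" if "y \<in> core" "y' \<in> core" for y y'
    using half[OF that] half[OF that(2,1)] dtheta_sym[OF that] by (simp add: abs_le_iff)
  then show ?thesis using that eq bound by blast
qed

lemma BY_extension:
  assumes v: "lip_bound dist_D v L"
  obtains v' where "v' \<in> BY" "\<And>x. x \<in> D \<Longrightarrow> v' x = v x" "lip_norm core v' \<le> ennreal (6 * L)"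
proof -
  have L0: "0 \<le> L" using lip_bound_nonneg[OF v] .
  have vb: "cmod (v x) \<le> L" for x using v by (simp add: lip_bound_def)
  have vd: "cmod (v x - v x') \<le> L * dtheta x x'" if "x \<in> D" "x' \<in> D" for x x'
  proof -
    have "cmod (v x - v x') \<le> L * \<bar>dist_D x x'\<bar>" using v unfolding lip_bound_def by blast
    then show ?thesis using that dtheta_nonneg[of x x'] by (simp add: dist_D_def)
  qed
  obtain e1 where e1: "\<And>x. x \<in> D \<Longrightarrow> e1 x = Re (v x)" "\<And>y. y \<in> core \<Longrightarrow> \<bar>e1 y\<bar> \<le> 2 * L"
    "\<And>y y'. y \<in> core \<Longrightarrow> y' \<in> core \<Longrightarrow> \<bar>e1 y - e1 y'\<bar> \<le> L * dtheta y y'"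
  proof (rule real_extension[OF L0, of "\<lambda>x. Re (v x)"])
    show "\<bar>Re (v x)\<bar> \<le> L" for x using vb[of x] abs_Re_le_cmod[of "v x"] by simp
    show "\<bar>Re (v x) - Re (v x')\<bar> \<le> L * dtheta x x'" if "x \<in> D" "x' \<in> D" for x x'
      using vd[OF that] abs_Re_le_cmod[of "v x - v x'"] by simp
  qed (rule that)
  obtain e2 where e2: "\<And>x. x \<in> D \<Longrightarrow> e2 x = Im (v x)" "\<And>y. y \<in> core \<Longrightarrow> \<bar>e2 y\<bar> \<le> 2 * L"
    "\<And>y y'. y \<in> core \<Longrightarrow> y' \<in> core \<Longrightarrow> \<bar>e2 y - e2 y'\<bar> \<le> L * dtheta y y'"
  proof (rule real_extension[OF L0, of "\<lambda>x. Im (v x)"])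
    show "\<bar>Im (v x)\<bar> \<le> L" for x using vb[of x] abs_Im_le_cmod[of "v x"] by simp
    show "\<bar>Im (v x) - Im (v x')\<bar> \<le> L * dtheta x x'" if "x \<in> D" "x' \<in> D" for x x'
      using vd[OF that] abs_Im_le_cmod[of "v x - v x'"] by simp
  qed (rule that)
  define v' where "v' y = (if y \<in> core then Complex (e1 y) (e2 y) else 0)" for y
  have b: "cmod (v' y) \<le> 4 * L" if "y \<in> core" for y
    using cmod_le[of "v' y"] e1(2)[OF that] e2(2)[OF that] that by (simp add: v'_def)
  have k: "cmod (v' y - v' y') \<le> 2 * L * dtheta y y'" if "y \<in> core" "y' \<in> core" for y y'
    using cmod_le[of "v' y - v' y'"] e1(3)[OF that] e2(3)[OF that] that by (simp add: v'_def)
  have m: "v' \<in> borel_measurable M"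
  proof (rule measurable_of_itineraries[OF word_measurable core_sets])
    show "v' x = 0" if "x \<notin> core" for x using that by (simp add: v'_def)
    show "norm (v' x - v' x') \<le> 2 * L * \<theta> ^ n" if "x \<in> core" "x' \<in> core" "word n x = word n x'" for n x x'
      using k[OF that(1,2)] mult_left_mono[OF dtheta_word[OF that], of "2 * L"] L0 by linarith
    have "(\<lambda>n. 2 * L * \<theta> ^ n) \<longlonglongrightarrow> 2 * L * 0" using theta by (intro tendsto_intros LIMSEQ_power_zero) auto
    then show "(\<lambda>n. 2 * L * \<theta> ^ n) \<longlonglongrightarrow> 0" by simp
  qed
  have "lip_norm core v' \<le> ennreal (4 * L) + ennreal (2 * L)" by (rule lip_normI[OF b k order_refl])
  also have "\<dots> = ennreal (6 * L)" using L0 by (simp flip: ennreal_plus)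
  finally have n: "lip_norm core v' \<le> ennreal (6 * L)" .
  then have "v' \<in> BY" using m by (auto simp: BY_def intro: le_less_trans)
  moreover have "v' x = v x" if "x \<in> D" for x using D_core[OF that] e1(1)[OF that] e2(1)[OF that] by (simp add: v'_def)
  ultimately show ?thesis using that n by blast
qed

text \<open>
Surjectivity with bounded inverse provides for \<open>u = v - R(z) v\<close> some solution \<open>v\<^sub>1\<close> of norm at most a multiple of
that of \<open>u\<close>; injectivity identifies \<open>v\<^sub>1\<close> with \<open>v\<close> almost everywhere, and so on \<open>D\<close>.
\<close>

lemma aperiodic_bounded_below:
  assumes z: "cmod z \<le> 1" "z \<noteq> 1"
  shows "\<exists>C\<ge>0. \<forall>v K L. (\<forall>x. x \<notin> D \<longrightarrow> v x = 0) \<longrightarrow> lip_bound dist_D v K \<longrightarrow>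
      lip_bound dist_D (\<lambda>x. v x - (\<Sum>n. z ^ n * gm.transfer (\<lambda>i y. if return i = n then v y else 0) x)) L \<longrightarrow> lip_bound dist_D v (C * L)"
proof -
  have "1 \<notin> spectrum_BY (Rz z)" using aperiodic z by blast
  then have inj: "\<And>v. v \<in> BY \<Longrightarrow> AE y in M. 1 * v y - Rz z v y = 0 \<Longrightarrow> AE y in M. v y = 0"
    and "\<exists>K::real. \<forall>u\<in>BY. \<exists>v\<in>BY. (AE y in M. 1 * v y - Rz z v y = u y) \<and> lip_norm core v \<le> ennreal K * lip_norm core u"
    unfolding spectrum_BY_def by blast+
  then obtain K\<^sub>0 :: real where surj: "\<And>u. u \<in> BY \<Longrightarrow> \<exists>v\<in>BY. (AE y in M. 1 * v y - Rz z v y = u y) \<and> lip_norm core v \<le> ennreal K\<^sub>0 * lip_norm core u"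
    by blast
  have "lip_bound dist_D v (12 * \<bar>K\<^sub>0\<bar> * L)"
    if off: "\<And>x. x \<notin> D \<Longrightarrow> v x = 0" and v: "lip_bound dist_D v K"
      and L: "lip_bound dist_D (\<lambda>x. v x - (\<Sum>n. z ^ n * gm.transfer (\<lambda>i y. if return i = n then v y else 0) x)) L" for v K L
  proof -
    have L0: "0 \<le> L" using lip_bound_nonneg[OF L] .
    have tw: "(\<Sum>n. z ^ n * gm.transfer (\<lambda>i y. if return i = n then v y else 0) x) = gm.twisted return z v x" for x
      unfolding gm.twisted_def
      by (intro suminf_cong arg_cong[where f = "\<lambda>t. z ^ _ * t"] gm.transfer_cong) (auto simp: off indicator_def)
    have L': "lip_bound dist_D (\<lambda>x. v x - gm.twisted return z v x) L" using L by (simp add: tw)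
    obtain u where u: "u \<in> BY" "\<And>x. x \<in> D \<Longrightarrow> u x = v x - gm.twisted return z v x" "lip_norm core u \<le> ennreal (6 * L)"
      using BY_extension[OF L'] by metis
    obtain v1 where v1: "v1 \<in> BY" "AE y in M. 1 * v1 y - Rz z v1 y = u y" "lip_norm core v1 \<le> ennreal K\<^sub>0 * lip_norm core u"
      using surj[OF u(1)] by blast
    define Q where "Q = \<bar>K\<^sub>0\<bar> * (6 * L)"
    have Q0: "0 \<le> Q" using L0 by (simp add: Q_def)
    have "ennreal K\<^sub>0 * lip_norm core u \<le> ennreal \<bar>K\<^sub>0\<bar> * ennreal (6 * L)"
      by (intro mult_mono u(3) ennreal_leI) auto
    then have "lip_norm core v1 \<le> ennreal Q" using v1(3) by (simp add: Q_def ennreal_mult')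
    note v1b = lip_normD[OF this Q0 order_refl]
    obtain v2 where v2: "v2 \<in> BY" "\<And>x. x \<in> D \<Longrightarrow> v2 x = v x" "lip_norm core v2 \<le> ennreal (6 * K)"
      using BY_extension[OF v] by metis
    have K0: "0 \<le> 6 * K" using lip_bound_nonneg[OF v] by simp
    note v2b = lip_normD[OF v2(3) K0 order_refl]
    define w where "w y = v1 y - v2 y" for y
    have wm: "w \<in> borel_measurable M" unfolding w_def using v1(1) v2(1) by (auto simp: BY_def)
    have wb: "cmod (w y) \<le> Q + 6 * K" if "y \<in> core" for y
      unfolding w_def using v1b(1)[OF that] v2b(1)[OF that] norm_triangle_ineq4[of "v1 y" "v2 y"] by linarith
    have "lip_norm core w \<le> ennreal (Q + 6 * K) + ennreal (Q + 6 * K)"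
    proof (rule lip_normI[OF wb _ order_refl])
      fix y y' assume y: "y \<in> core" "y' \<in> core"
      have "cmod (w y - w y') = cmod ((v1 y - v1 y') - (v2 y - v2 y'))" by (simp add: w_def algebra_simps)
      also have "\<dots> \<le> Q * dtheta y y' + 6 * K * dtheta y y'"
        using v1b(2)[OF y] v2b(2)[OF y] norm_triangle_ineq4[of "v1 y - v1 y'" "v2 y - v2 y'"] by linarith
      finally show "cmod (w y - w y') \<le> (Q + 6 * K) * dtheta y y'" by (simp add: distrib_right)
    qed
    then have w: "w \<in> BY" using wm by (auto simp: BY_def intro: le_less_trans)
    have "AE y in M. Rz z w y = gm.twisted return z w y"
      by (rule Rz_eq_twisted[OF wm wb]) (rule D_core)
    moreover have "AE y in M. Rz z v1 y = gm.twisted return z v1 y"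
      using v1(1) by (intro Rz_eq_twisted[where B = Q]) (auto simp: BY_def D_core v1b(1))
    ultimately have "AE y in M. 1 * w y - Rz z w y = 0"
      using v1(2) AE_D
    proof eventually_elim
      case (elim y)
      have "gm.twisted return z w y = gm.twisted return z v1 y - gm.twisted return z v2 y"
        unfolding w_def by (rule gm.twisted_diff[where B = Q and B' = "6 * K"]) (auto simp: D_core v1b(1) v2b(1) z)
      moreover have "gm.twisted return z v2 y = gm.twisted return z v y" by (rule gm.twisted_cong) (rule v2(2))
      ultimately have "1 * w y - Rz z w y = (v1 y - gm.twisted return z v1 y) - (v y - gm.twisted return z v y)"
        using elim(1) v2(2)[OF elim(4)] by (simp add: w_def)
      then show ?case using elim(2,3) u(2)[OF elim(4)] by simp
    qed
    then have "AE y in M. w y = 0" by (rule inj[OF w])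
    then have ae: "AE y in M. v1 y = v y" using AE_D by eventually_elim (simp add: w_def v2(2))
    have veq: "v1 x = v x" if "x \<in> D" for x
    proof (rule gm.eq_on_D[OF _ _ ae that, of Q K])
      fix x x' assume x: "x \<in> D" "x' \<in> D"
      show "cmod (v1 x - v1 x') \<le> Q * dist_D x x'" using v1b(2)[OF D_core[OF x(1)] D_core[OF x(2)]] x by (simp add: dist_D_def)
      show "cmod (v x - v x') \<le> K * dist_D x x'" 
      proof -
        have "cmod (v x - v x') \<le> K * \<bar>dist_D x x'\<bar>" using v unfolding lip_bound_def by blast
        then show ?thesis using gm.d_nonneg[of x x'] by simp
      qed
    qed
    show ?thesis
    proof (rule gm.lip_boundI[where B = Q and K = Q])
      show "cmod (v x) \<le> Q" if "x \<in> D" for x using v1b(1)[OF D_core[OF that]] veq[OF that] by simp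
      show "cmod (v x - v x') \<le> Q * dist_D x x'" if "x \<in> D" "x' \<in> D" for x x'
        using v1b(2)[OF D_core[OF that(1)] D_core[OF that(2)]] veq that by (simp add: dist_D_def)
      show "v x = 0" if "x \<notin> D" for x using off[OF that] .
    qed (use Q0 in \<open>auto simp: Q_def\<close>)
  qed
  then show ?thesis by (intro exI[of _ "12 * \<bar>K\<^sub>0\<bar>"]) auto
qed

end

section \<open>Correlations on the tower\<close>

lemma complex_of_real_measurable: "f \<in> borel_measurable M \<Longrightarrow> (\<lambda>x. complex_of_real (f x)) \<in> borel_measurable M"
  by simp

context gibbs_markov_return
begin

text \<open>
Summation over the levels of a column is exchanged with integration; at level \<open>i\<close> only the points with return
time above \<open>n + i\<close> contribute.
\<close>

lemma level_sum:
  fixes h :: "nat \<Rightarrow> 'x \<Rightarrow> complex"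
  assumes h [measurable]: "\<And>i. h i \<in> borel_measurable M"
    and b: "\<And>i y. cmod (h i y) \<le> B * indicator {x \<in> D. n + i < ph (\<kappa> x)} y" and B: "0 \<le> B"
  shows "integrable M (\<lambda>y. \<Sum>i<ph (\<kappa> y). h i y)"
    and "(\<Sum>i. \<integral>y. h i y \<partial>M) = (\<integral>y. (\<Sum>i<ph (\<kappa> y). h i y) \<partial>M)"
    and "cmod (\<integral>y. (\<Sum>i<ph (\<kappa> y). h i y) \<partial>M) \<le> B * (\<Sum>i. tl (n + i))"
proof -
  have J: "{x \<in> D. n + i < ph (\<kappa> x)} \<in> sets M" for i using mass_sets[of "{j. n + i < ph j}"] by simp
  have tle: "(\<integral>y. B * indicator {x \<in> D. n + i < ph (\<kappa> x)} y \<partial>M) = B * tl (n + i)" for i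
    using J sets.sets_into_space[OF J] by (simp add: tl_def mass_def Int_absorb2)
  have jint: "integrable M (\<lambda>y. B * indicator {x \<in> D. n + i < ph (\<kappa> x)} y)" for i
    using J by (intro integrable_mult_right) (simp add: emeasure_eq_measure)
  have int: "integrable M (h i)" for i
    by (rule Bochner_Integration.integrable_bound[OF jint[of i]]) (use b[of i] B in auto)
  have nb: "(\<integral>y. cmod (h i y) \<partial>M) \<le> B * tl (n + i)" for i
    unfolding tle[symmetric] by (intro integral_mono integrable_norm int jint b)
  have "summable (\<lambda>i. tl (i + n))" by (rule summable_ignore_initial_segment[OF tl_summable0])
  then have st: "summable (\<lambda>i. B * tl (n + i))" by (intro summable_mult) (simp add: add.commute)
  have sn: "summable (\<lambda>i. \<integral>y. cmod (h i y) \<partial>M)"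
    by (rule summable_comparison_test'[OF st]) (use nb in auto)
  have zero: "h i y = 0" if "i \<notin> {..<ph (\<kappa> y)}" for i y using b[of i y] that by simp
  have fin: "(\<Sum>i. h i y) = (\<Sum>i<ph (\<kappa> y). h i y)" for y by (rule suminf_finite) (use zero in auto)
  have as: "AE y in M. summable (\<lambda>i. cmod (h i y))"
    by (intro AE_I2 summable_finite[of "{..<ph (\<kappa> _)}"]) (use zero in auto)
  show "integrable M (\<lambda>y. \<Sum>i<ph (\<kappa> y). h i y)" using integrable_suminf[OF int as sn] by (simp add: fin)
  show eq: "(\<Sum>i. \<integral>y. h i y \<partial>M) = (\<integral>y. (\<Sum>i<ph (\<kappa> y). h i y) \<partial>M)"
    using integral_suminf[OF int as sn] by (simp add: fin)
  have "cmod (\<Sum>i. \<integral>y. h i y \<partial>M) \<le> (\<Sum>i. B * tl (n + i))"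
    by (rule norm_suminf_le[OF order_trans[OF integral_norm_bound nb] st])
  also have "\<dots> = B * (\<Sum>i. tl (n + i))"
    using summable_ignore_initial_segment[OF tl_summable0, of n] by (intro suminf_mult) (simp add: add.commute)
  finally show "cmod (\<integral>y. (\<Sum>i<ph (\<kappa> y). h i y) \<partial>M) \<le> B * (\<Sum>i. tl (n + i))" by (simp add: eq)
qed

lemma tail_sums_summable: "summable (\<lambda>n. wt (q - 1) n * (\<Sum>i. tl (n + i)))"
proof -
  have "summable (\<lambda>n. wt (q - 1) n * tl n + wt (q - 1) n * (\<Sum>k. tl (k + Suc n)))"
  proof (intro summable_add)
    show "summable (\<lambda>n. wt (q - 1) n * tl n)"
      by (rule summable_comparison_test'[OF tl_summable])
        (simp add: abs_mult tl_nonneg mult_right_mono wt_mono_exponent)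
    show "summable (\<lambda>n. wt (q - 1) n * (\<Sum>k. tl (k + Suc n)))"
      using q tl_nonneg tl_summable by (intro summable_tail_weighted(2)) auto
  qed
  moreover have "(\<Sum>i. tl (n + i)) = tl n + (\<Sum>k. tl (k + Suc n))" for n
    using suminf_split_head[OF summable_ignore_initial_segment[OF tl_summable0, of n]] by (simp add: add.commute)
  ultimately show ?thesis by (simp add: distrib_left)
qed

end

context young_tower_data
begin

lemma phi_meas [measurable]: "\<phi> \<in> measurable M (count_space UNIV)"
  by (rule phi_measurable)

definition height :: real where
  "height = (\<integral>y. real (\<phi> y) \<partial>M)"

lemma height_ge_1: "1 \<le> height"
proof -
  have "(\<integral>y. 1 \<partial>M) \<le> height" unfolding height_def
    using phi_pos by (intro integral_mono phi_integrable) (auto simp: Suc_le_eq)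
  then show ?thesis by (simp add: prob_space)
qed

lemma proj_measurable: "proj \<in> measurable mu_tower X"
proof -
  have "(\<lambda>p. (T ^^ snd p) (fst p)) \<in> measurable (M \<Otimes>\<^sub>M count_space UNIV) X"
    by (rule measurable_compose_countable[where f = "\<lambda>l p. (T ^^ l) (fst p)"])
      (use measurable_compose[OF measurable_fst funpow_T_measurable] in auto)
  then have "proj \<in> measurable (restrict_space (M \<Otimes>\<^sub>M count_space UNIV) tower) X"
    unfolding proj_def[abs_def] by (rule measurable_restrict_space1)
  moreover have "measurable mu_tower X = measurable (restrict_space (M \<Otimes>\<^sub>M count_space UNIV) tower) X"
    by (rule measurable_cong_sets) (auto simp: mu_tower_def)
  ultimately show ?thesis by simp
qed

lemma tower_sets: "tower \<in> sets (M \<Otimes>\<^sub>M count_space UNIV)"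
proof -
  have "{y \<in> space M. l < \<phi> y} \<times> {l} \<in> sets (M \<Otimes>\<^sub>M count_space UNIV)" for l
    by (intro pair_measureI) auto
  moreover have "tower = (\<Union>l. {y \<in> space M. l < \<phi> y} \<times> {l})" by (auto simp: tower_def)
  ultimately show ?thesis by auto
qed

lemma comp_T_measurable: "u \<in> borel_measurable X \<Longrightarrow> (\<lambda>y. u ((T ^^ l) y)) \<in> borel_measurable M"
  by (rule measurable_compose[OF funpow_T_measurable])

lemma tower_sum_measurable:
  fixes u :: "'x \<Rightarrow> ennreal"
  assumes "u \<in> borel_measurable X"
  shows "(\<lambda>y. \<Sum>l<\<phi> y. u ((T ^^ l) y)) \<in> borel_measurable M"
proof (rule measurable_compose_countable[where g = \<phi>])
  show "(\<lambda>y. \<Sum>l<i. u ((T ^^ l) y)) \<in> borel_measurable M" for i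
    using assms by (intro borel_measurable_sum comp_T_measurable)
qed measurable

lemma nn_integral_mu_X:
  fixes u :: "'x \<Rightarrow> ennreal"
  assumes u: "u \<in> borel_measurable X"
  shows "(\<integral>\<^sup>+x. u x \<partial>mu_X) = ennreal (1 / height) * (\<integral>\<^sup>+y. (\<Sum>l<\<phi> y. u ((T ^^ l) y)) \<partial>M)"
proof -
  let ?P = "M \<Otimes>\<^sub>M count_space (UNIV :: nat set)"
  have up: "(\<lambda>p. u (proj p)) \<in> borel_measurable (restrict_space ?P tower)"
    using measurable_compose[OF proj_measurable u] by (simp add: mu_tower_def cong: measurable_cong_sets)
  have upt: "(\<lambda>p. u (proj p) * indicator tower p) \<in> borel_measurable ?P"
    using up tower_sets by (subst (asm) borel_measurable_restrict_space_iff_ennreal) (auto simp: sets.sets_into_space Int_absorb2)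
  have "(\<integral>\<^sup>+x. u x \<partial>mu_X) = (\<integral>\<^sup>+p. u (proj p) \<partial>mu_tower)"
    unfolding mu_X_def using u by (intro nn_integral_distr proj_measurable) simp
  also have "\<dots> = ennreal (1 / height) * (\<integral>\<^sup>+p. u (proj p) \<partial>restrict_space ?P tower)"
    unfolding mu_tower_def height_def by (rule nn_integral_scale_measure[OF up])
  also have "(\<integral>\<^sup>+p. u (proj p) \<partial>restrict_space ?P tower) = (\<integral>\<^sup>+p. u (proj p) * indicator tower p \<partial>?P)"
    using tower_sets by (intro nn_integral_restrict_space) auto
  also have "\<dots> = (\<integral>\<^sup>+y. (\<integral>\<^sup>+l. u (proj (y, l)) * indicator tower (y, l) \<partial>count_space UNIV) \<partial>M)"
    by (rule sigma_finite_measure.nn_integral_fst[OF sigma_finite_measure_count_space upt, symmetric])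
  also have "\<dots> = (\<integral>\<^sup>+y. (\<Sum>l<\<phi> y. u ((T ^^ l) y)) \<partial>M)"
  proof (intro nn_integral_cong)
    fix y assume y: "y \<in> space M"
    have "(\<Sum>l. u (proj (y, l)) * indicator tower (y, l)) = (\<Sum>l<\<phi> y. u (proj (y, l)) * indicator tower (y, l))"
      by (rule suminf_finite) (auto simp: tower_def)
    also have "\<dots> = (\<Sum>l<\<phi> y. u ((T ^^ l) y))"
      using y by (intro sum.cong) (auto simp: tower_def proj_def)
    finally show "(\<integral>\<^sup>+l. u (proj (y, l)) * indicator tower (y, l) \<partial>count_space UNIV) = (\<Sum>l<\<phi> y. u ((T ^^ l) y))"
      by (simp add: nn_integral_count_space_nat)
  qed
  finally show ?thesis .
qed

lemma sets_mu_X [measurable_cong]: "sets mu_X = sets X" and space_mu_X: "space mu_X = space X"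
  by (simp_all add: mu_X_def)

lemma AE_mu_X:
  assumes A [measurable]: "A \<in> sets X"
  shows "(AE x in mu_X. x \<notin> A) \<longleftrightarrow> (AE y in M. \<forall>l<\<phi> y. (T ^^ l) y \<notin> A)"
proof -
  have "(AE x in mu_X. x \<notin> A) \<longleftrightarrow> emeasure mu_X A = 0"
    using A by (subst AE_iff_null_sets[symmetric]) (auto simp: null_sets_def)
  also have "emeasure mu_X A = (\<integral>\<^sup>+x. indicator A x \<partial>mu_X)" by simp
  also have "\<dots> = ennreal (1 / height) * (\<integral>\<^sup>+y. (\<Sum>l<\<phi> y. indicator A ((T ^^ l) y)) \<partial>M)"
    by (rule nn_integral_mu_X) simp
  also have "\<dots> = 0 \<longleftrightarrow> (AE y in M. (\<Sum>l<\<phi> y. indicator A ((T ^^ l) y)) = (0 :: ennreal))"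
    using height_ge_1 by (subst nn_integral_0_iff_AE[symmetric]) (auto intro!: tower_sum_measurable simp: ennreal_eq_0_iff)
  also have "\<dots> \<longleftrightarrow> (AE y in M. \<forall>l<\<phi> y. (T ^^ l) y \<notin> A)"
    by (intro AE_cong) (auto simp: indicator_def)
  finally show ?thesis .
qed

text \<open>
Going up one level either stays in the column or arrives at the bottom of the column over \<open>F y\<close>.
\<close>

lemma AE_mu_X_T:
  assumes A [measurable]: "A \<in> sets X" and ae: "AE x in mu_X. x \<notin> A"
  shows "AE x in mu_X. T x \<notin> A"
proof -
  have T: "T -` A \<inter> space X \<in> sets X" using T_measurable A by (rule measurable_sets)
  have 1: "AE y in M. \<forall>l<\<phi> y. (T ^^ l) y \<notin> A" using ae AE_mu_X[OF A] by blast
  have "AE y in M. \<forall>l<\<phi> y. (T ^^ l) y \<notin> T -` A \<inter> space X"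
    using 1 AE_F[OF 1] AE_space
  proof eventually_elim
    case (elim y)
    show ?case
    proof (intro allI impI)
      fix l assume l: "l < \<phi> y"
      have "(T ^^ Suc l) y \<notin> A"
      proof (cases "Suc l < \<phi> y")
        case False
        then have "Suc l = \<phi> y" using l by simp
        then have "(T ^^ Suc l) y = F y" by (simp only: F_def)
        moreover have "(T ^^ 0) (F y) \<notin> A" using elim(2) phi_pos[OF F_maps_to[OF elim(3)]] by blast
        ultimately show ?thesis by simp
      qed (use elim(1) in blast)
      then show "(T ^^ l) y \<notin> T -` A \<inter> space X" by simp
    qed
  qed
  then have "AE x in mu_X. x \<notin> T -` A \<inter> space X" using AE_mu_X[OF T] by blast
  then show ?thesis using AE_space by eventually_elim (auto simp: space_mu_X)
qed

lemma funpow_T_X: "(T ^^ n) \<in> measurable X X"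
proof (induction n)
  case (Suc n)
  show ?case unfolding funpow.simps(2) by (rule measurable_comp[OF Suc T_measurable])
qed simp

lemma AE_mu_X_funpow:
  assumes A: "A \<in> sets X" and ae: "AE x in mu_X. x \<notin> A"
  shows "AE x in mu_X. (T ^^ n) x \<notin> A"
proof (induction n)
  case (Suc n)
  have "(T ^^ n) -` A \<inter> space X \<in> sets X" using funpow_T_X A by (rule measurable_sets)
  moreover have "AE x in mu_X. x \<notin> (T ^^ n) -` A \<inter> space X" using Suc by eventually_elim simp
  ultimately have "AE x in mu_X. T x \<notin> (T ^^ n) -` A \<inter> space X" by (rule AE_mu_X_T)
  then show ?case using AE_space
  proof eventually_elim
    case (elim x)
    have "T x \<in> space X" using elim(2) measurable_space[OF T_measurable] by (simp add: space_mu_X)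
    then show ?case using elim(1) by (simp add: funpow_swap1)
  qed
qed (use ae in simp)

text \<open>
The formula is derived from the one for nonnegative functions by adding a constant.
\<close>

lemma tower_integral:
  assumes u [measurable]: "u \<in> borel_measurable X" and b: "\<And>x. \<bar>u x\<bar> \<le> (C :: real)"
  shows "integrable M (\<lambda>y. \<Sum>l<\<phi> y. u ((T ^^ l) y))"
    and "(\<integral>x. u x \<partial>mu_X) = (\<integral>y. (\<Sum>l<\<phi> y. u ((T ^^ l) y)) \<partial>M) / height"
proof -
  have m: "(\<lambda>y. \<Sum>l<\<phi> y. u ((T ^^ l) y)) \<in> borel_measurable M" if u: "u \<in> borel_measurable X" for u :: "'x \<Rightarrow> real"
  proof (rule measurable_compose_countable[where g = \<phi>])
    show "(\<lambda>y. \<Sum>l<i. u ((T ^^ l) y)) \<in> borel_measurable M" for i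
      using u by (intro borel_measurable_sum comp_T_measurable)
  qed measurable
  have bd: "\<bar>\<Sum>l<\<phi> y. u ((T ^^ l) y)\<bar> \<le> C * real (\<phi> y)" if "\<And>x. \<bar>u x\<bar> \<le> C" for y C and u :: "'x \<Rightarrow> real"
  proof -
    have "\<bar>\<Sum>l<\<phi> y. u ((T ^^ l) y)\<bar> \<le> (\<Sum>l<\<phi> y. \<bar>u ((T ^^ l) y)\<bar>)" by (rule sum_abs)
    also have "\<dots> \<le> of_nat (card {..<\<phi> y}) * C" by (intro sum_bounded_above that)
    finally show ?thesis by (simp add: mult.commute)
  qed
  have i: "integrable M (\<lambda>y. \<Sum>l<\<phi> y. u ((T ^^ l) y))"
    if u: "u \<in> borel_measurable X" and b: "\<And>x. \<bar>u x\<bar> \<le> C" for C and u :: "'x \<Rightarrow> real"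
  proof (rule Bochner_Integration.integrable_bound[OF _ m[OF u]])
    show "integrable M (\<lambda>y. C * real (\<phi> y))" by (intro integrable_mult_right phi_integrable)
    show "AE y in M. norm (\<Sum>l<\<phi> y. u ((T ^^ l) y)) \<le> norm (C * real (\<phi> y))"
      using bd[of u C, OF b] by (intro AE_I2) (simp add: order_trans[OF _ abs_ge_self])
  qed
  show "integrable M (\<lambda>y. \<Sum>l<\<phi> y. u ((T ^^ l) y))" by (rule i[OF u b])
  have nonneg: "(\<integral>x. u x \<partial>mu_X) = (\<integral>y. (\<Sum>l<\<phi> y. u ((T ^^ l) y)) \<partial>M) / height"
    "integrable mu_X u"
    if u [measurable]: "u \<in> borel_measurable X" and b: "\<And>x. 0 \<le> u x" "\<And>x. u x \<le> C" for u :: "'x \<Rightarrow> real" and C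
  proof -
    have I0: "0 \<le> (\<integral>y. (\<Sum>l<\<phi> y. u ((T ^^ l) y)) \<partial>M)"
      by (intro Bochner_Integration.integral_nonneg sum_nonneg b)
    have "(\<integral>\<^sup>+x. ennreal (u x) \<partial>mu_X) = ennreal (1 / height) * (\<integral>\<^sup>+y. (\<Sum>l<\<phi> y. ennreal (u ((T ^^ l) y))) \<partial>M)"
      by (rule nn_integral_mu_X) simp
    also have "\<dots> = ennreal (1 / height) * (\<integral>\<^sup>+y. ennreal (\<Sum>l<\<phi> y. u ((T ^^ l) y)) \<partial>M)"
      using b by (simp add: sum_ennreal)
    also have "(\<integral>\<^sup>+y. ennreal (\<Sum>l<\<phi> y. u ((T ^^ l) y)) \<partial>M) = ennreal (\<integral>y. (\<Sum>l<\<phi> y. u ((T ^^ l) y)) \<partial>M)"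
    proof (intro nn_integral_eq_integral AE_I2 sum_nonneg b)
      have "\<bar>u x\<bar> \<le> C" for x using b[of x] by simp
      then show "integrable M (\<lambda>y. \<Sum>l<\<phi> y. u ((T ^^ l) y))" by (rule i[OF u])
    qed
    also have "ennreal (1 / height) * \<dots> = ennreal ((\<integral>y. (\<Sum>l<\<phi> y. u ((T ^^ l) y)) \<partial>M) / height)"
      using height_ge_1 I0 by (simp add: ennreal_mult'[symmetric])
    finally have e: "(\<integral>\<^sup>+x. ennreal (u x) \<partial>mu_X) = ennreal ((\<integral>y. (\<Sum>l<\<phi> y. u ((T ^^ l) y)) \<partial>M) / height)" .
    have n0: "0 \<le> (\<integral>y. (\<Sum>l<\<phi> y. u ((T ^^ l) y)) \<partial>M) / height"
      using height_ge_1 I0 by simp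
    show "(\<integral>x. u x \<partial>mu_X) = (\<integral>y. (\<Sum>l<\<phi> y. u ((T ^^ l) y)) \<partial>M) / height"
      using b e n0 by (subst integral_eq_nn_integral) auto
    show "integrable mu_X u"
      using b e by (intro integrableI_nonneg) auto
  qed
  have cs: "(\<integral>y. (\<Sum>l<\<phi> y. u ((T ^^ l) y) + C) \<partial>M) = (\<integral>y. (\<Sum>l<\<phi> y. u ((T ^^ l) y)) \<partial>M) + (\<integral>y. (\<Sum>l<\<phi> y. C) \<partial>M)"
    using i[of "\<lambda>_. C" "\<bar>C\<bar>"] i[OF u b] by (simp only: sum.distrib) (intro Bochner_Integration.integral_add; simp)
  have C0: "0 \<le> C" using order_trans[OF abs_ge_zero b] .
  have lo: "0 \<le> u x + C" "u x + C \<le> 2 * C" for x using b[of x] by (auto simp: abs_le_iff)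
  have uC: "(\<lambda>x. u x + C) \<in> borel_measurable X" by measurable
  have cC: "(\<lambda>x. C) \<in> borel_measurable X" by measurable
  have iu: "integrable mu_X (\<lambda>x. u x + C)" by (rule nonneg(2)[OF uC lo])
  have ic: "integrable mu_X (\<lambda>x. C)" by (rule nonneg(2)[OF cC C0 order_refl])
  have "(\<integral>x. u x \<partial>mu_X) = (\<integral>x. (u x + C) - C \<partial>mu_X)" by simp
  also have "\<dots> = (\<integral>x. u x + C \<partial>mu_X) - (\<integral>x. C \<partial>mu_X)" by (rule Bochner_Integration.integral_diff[OF iu ic])
  also have "(\<integral>x. u x + C \<partial>mu_X) = (\<integral>y. (\<Sum>l<\<phi> y. u ((T ^^ l) y) + C) \<partial>M) / height"
    by (rule nonneg(1)[OF uC lo])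
  also have "(\<integral>x. C \<partial>mu_X) = (\<integral>y. (\<Sum>l<\<phi> y. C) \<partial>M) / height"
    by (rule nonneg(1)[OF cC C0 order_refl])
  finally show "(\<integral>x. u x \<partial>mu_X) = (\<integral>y. (\<Sum>l<\<phi> y. u ((T ^^ l) y)) \<partial>M) / height"
    unfolding cs by (simp add: add_divide_distrib)
qed

text \<open>
Almost everywhere equal observables have equal correlations. It permits to truncate both observables to
bounded functions.
\<close>

lemma correlation_cong:
  assumes v: "v \<in> borel_measurable X" "v' \<in> borel_measurable X" "AE x in mu_X. v x = v' x"
    and w: "w \<in> borel_measurable X" "w' \<in> borel_measurable X" "AE x in mu_X. w x = w' x"
  shows "correlation v w n = correlation v' w' n"
proof -
  note Tn = funpow_T_X[of n]
  note m [measurable] = v(1,2) w(1,2) measurable_compose[OF Tn w(1)] measurable_compose[OF Tn w(2)]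
  have A: "{x \<in> space X. w x \<noteq> w' x} \<in> sets X" by measurable
  have "AE x in mu_X. x \<notin> {x \<in> space X. w x \<noteq> w' x}" using w(3) by eventually_elim simp
  from AE_mu_X_funpow[OF A this, of n]
  have ae: "AE x in mu_X. w ((T ^^ n) x) = w' ((T ^^ n) x)" using AE_space
  proof eventually_elim
    case (elim x)
    then have "(T ^^ n) x \<in> space X" using measurable_space[OF Tn] by (simp add: space_mu_X)
    then show ?case using elim(1) by simp
  qed
  have "(\<integral>x. v x * w ((T ^^ n) x) \<partial>mu_X) = (\<integral>x. v' x * w' ((T ^^ n) x) \<partial>mu_X)"
    using v(3) ae by (intro integral_cong_AE) auto
  moreover have "(\<integral>x. v x \<partial>mu_X) = (\<integral>x. v' x \<partial>mu_X)" "(\<integral>x. w x \<partial>mu_X) = (\<integral>x. w' x \<partial>mu_X)"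
    using v(3) w(3) by (auto intro!: integral_cong_AE)
  ultimately show ?thesis by (simp add: correlation_def)
qed

lemma BX_bounds:
  assumes v: "v \<in> BX"
  obtains Q where "0 \<le> Q" "\<And>y l. y \<in> D \<Longrightarrow> l < \<phi> y \<Longrightarrow> \<bar>v ((T ^^ l) y)\<bar> \<le> Q"
    "\<And>y y' l. y \<in> D \<Longrightarrow> y' \<in> D \<Longrightarrow> index y' = index y \<Longrightarrow> l < \<phi> y \<Longrightarrow> \<bar>v ((T ^^ l) y) - v ((T ^^ l) y')\<bar> \<le> Q * dtheta y y'"
proof -
  define Q where "Q = enn2real (norm_BX v)"
  have Q: "norm_BX v = ennreal Q" "0 \<le> Q" using v by (auto simp: Q_def BX_def)
  have n: "lip_norm (cell_of y \<inter> core) (\<lambda>y. v ((T ^^ l) y)) \<le> ennreal Q" if y: "y \<in> D" "l < \<phi> y" for y l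
  proof -
    have c: "cell_of y \<in> \<alpha>" "y \<in> cell_of y" using cell_of D_inside[OF y(1)] by auto
    have l: "l \<in> {l. \<forall>y'\<in>cell_of y. l < \<phi> y'}" using phi_constant[OF c(1) _ c(2)] y(2) by simp
    have "lip_norm (cell_of y \<inter> core) (\<lambda>y. v ((T ^^ l) y)) \<le> (SUP l\<in>{l. \<forall>y'\<in>cell_of y. l < \<phi> y'}. lip_norm (cell_of y \<inter> core) (\<lambda>y. v ((T ^^ l) y)))"
      by (rule SUP_upper[OF l])
    also have "\<dots> \<le> norm_BX v" unfolding norm_BX_def by (rule SUP_upper[OF c(1)])
    finally show ?thesis by (simp only: Q(1))
  qed
  show ?thesis
  proof (rule that[OF Q(2)])
    fix y l assume y: "y \<in> D" "l < \<phi> y"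
    have "y \<in> cell_of y \<inter> core" using cell_of D_inside[OF y(1)] D_core[OF y(1)] by auto
    then show "\<bar>v ((T ^^ l) y)\<bar> \<le> Q" using lip_normD(1)[OF n[OF y] Q(2)] by simp
  next
    fix y y' l assume y: "y \<in> D" "y' \<in> D" "index y' = index y" "l < \<phi> y"
    have "cell_of y' = cell_of y" using index_eq_iff[OF D_inside[OF y(2)] D_inside[OF y(1)]] y(3) by simp
    then have "y \<in> cell_of y \<inter> core" "y' \<in> cell_of y \<inter> core"
      using cell_of(2)[OF D_inside[OF y(1)]] cell_of(2)[OF D_inside[OF y(2)]] D_core y by auto
    then show "\<bar>v ((T ^^ l) y) - v ((T ^^ l) y')\<bar> \<le> Q * dtheta y y'"
      using lip_normD(2)[OF n[OF y(1,4)] Q(2)] by simp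
  qed
qed

end

locale young_tower_moment = young_tower_data X T M \<phi> \<alpha> \<theta> N g C\<^sub>0
  for X :: "'x measure" and T M \<phi> \<alpha> \<theta> N g C\<^sub>0 +
  fixes q :: real
  assumes q_pos: "0 < q" and phi_moment: "integrable M (\<lambda>y. real (\<phi> y) powr (q + 1))"
begin

sublocale gmr: gibbs_markov_return M F D index g dist_D \<theta> "max 0 C\<^sub>0" c\<^sub>0 return q
proof unfold_locales
  show "0 < return (index x)" if "x \<in> D" for x using return_pos that .
  show "0 < q" by (rule q_pos)
  have eq: "indicator D x * real (return (index x)) powr (q + 1) = indicator D x * real (\<phi> x) powr (q + 1)" for x
    using phi_return by (simp add: indicator_def)
  show "integrable M (\<lambda>x. indicator D x * real (return (index x)) powr (q + 1))"
    unfolding eq using integrable_real_mult_indicator[OF D_sets phi_moment] by (simp add: mult.commute)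
qed (rule aperiodic_bounded_below)

lemma level_tower:
  fixes h :: "nat \<Rightarrow> 'x \<Rightarrow> complex" and u :: "'x \<Rightarrow> real"
  assumes h: "\<And>i. h i \<in> borel_measurable M" "\<And>i y. cmod (h i y) \<le> B * indicator {x \<in> D. 0 + i < return (index x)} y" "0 \<le> B"
    and u: "u \<in> borel_measurable X" "\<And>x. \<bar>u x\<bar> \<le> K"
    and hu: "\<And>y. y \<in> D \<Longrightarrow> (\<Sum>i<\<phi> y. h i y) = of_real (\<Sum>l<\<phi> y. u ((T ^^ l) y))"
  shows "(\<Sum>i. \<integral>y. h i y \<partial>M) = of_real (height * (\<integral>x. u x \<partial>mu_X))"
proof -
  note L = gmr.level_sum[of h B 0, OF h]
  have "(\<Sum>i. \<integral>y. h i y \<partial>M) = (\<integral>y. of_real (\<Sum>l<\<phi> y. u ((T ^^ l) y)) \<partial>M)"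
    unfolding L(2)
  proof (rule integral_cong_AE)
    show "AE y in M. (\<Sum>i<return (index y). h i y) = of_real (\<Sum>l<\<phi> y. u ((T ^^ l) y))"
      using AE_D by eventually_elim (simp only: phi_return hu)
    show "(\<lambda>y. \<Sum>i<return (index y). h i y) \<in> borel_measurable M" using L(1) by simp
    show "(\<lambda>y. complex_of_real (\<Sum>l<\<phi> y. u ((T ^^ l) y))) \<in> borel_measurable M"
      using borel_measurable_integrable[OF tower_integral(1)[OF u]] by (rule complex_of_real_measurable)
  qed
  also have "\<dots> = of_real (\<integral>y. (\<Sum>l<\<phi> y. u ((T ^^ l) y)) \<partial>M)" by (rule integral_complex_of_real)
  finally show ?thesis using tower_integral(2)[OF u] height_ge_1 by simp
qed

lemma level_sets: "{x \<in> D. n + i < return (index x)} \<in> sets M"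
  using gmr.mass_sets[of "{j. n + i < return j}"] by simp

lemma phibar_eq: "gmr.phibar = height"
proof -
  have s: "{x \<in> D. i < return (index x)} \<in> sets M" for i using level_sets[of 0 i] by simp
  have "complex_of_real (\<integral>y. indicator {x \<in> D. i < return (index x)} y \<partial>M) = of_real (gmr.tl i)" for i
    using sets.sets_into_space[OF s[of i]] by (simp add: gmr.tl_def gm.mass_def Int_absorb2)
  then have "complex_of_real gmr.phibar = (\<Sum>i. \<integral>y. of_real (indicator {x \<in> D. i < return (index x)} y) \<partial>M)"
    unfolding gmr.phibar_def integral_complex_of_real by (simp add: suminf_of_real gmr.tl_summable0)
  also have "\<dots> = of_real (height * (\<integral>x. 1 \<partial>mu_X))"
  proof (rule level_tower[where B = 1 and K = 1])
    show "(\<lambda>y. complex_of_real (indicator {x \<in> D. i < return (index x)} y)) \<in> borel_measurable M" for i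
      using s by (intro complex_of_real_measurable borel_measurable_indicator)
    show "(\<Sum>i<\<phi> y. complex_of_real (indicator {x \<in> D. i < return (index x)} y)) = of_real (\<Sum>l<\<phi> y. 1)" if "y \<in> D" for y
      using that by (simp add: phi_return indicator_def)
  qed (auto simp: indicator_def)
  also have "(\<integral>x. 1 \<partial>mu_X) = (1 :: real)"
    using tower_integral(2)[of "\<lambda>_. 1" 1] height_ge_1 by (simp add: height_def)
  finally show ?thesis by (simp only: of_real_eq_iff mult_1_right)
qed

text \<open>
Levels \<open>l\<close> from which the orbit is still in the column after \<open>n\<close> steps, and those that return after \<open>k = m - l \<le> n\<close> steps.
\<close>

lemma sum_split_at_return:
  fixes f :: "nat \<Rightarrow> 'b::comm_monoid_add"
  shows "(\<Sum>l<m. f l) = (\<Sum>l<m. if n + l < m then f l else 0) + (\<Sum>k\<le>n. if 1 \<le> k \<and> k \<le> m then f (m - k) else 0)"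
proof -
  have "(\<Sum>l<m. f l) = (\<Sum>l<m. (if n + l < m then f l else 0) + (if m \<le> n + l then f l else 0))"
    by (intro sum.cong) auto
  also have "\<dots> = (\<Sum>l<m. if n + l < m then f l else 0) + (\<Sum>l<m. if m \<le> n + l then f l else 0)"
    by (rule sum.distrib)
  also have "(\<Sum>l<m. if m \<le> n + l then f l else 0) = (\<Sum>l\<in>{l \<in> {..<m}. m \<le> n + l}. f l)"
    by (rule sum.inter_filter[symmetric]) simp
  also have "\<dots> = (\<Sum>k\<in>{k \<in> {..n}. 1 \<le> k \<and> k \<le> m}. f (m - k))"
    by (rule sum.reindex_bij_witness[where i = "\<lambda>k. m - k" and j = "\<lambda>l. m - l"]) auto
  also have "\<dots> = (\<Sum>k\<le>n. if 1 \<le> k \<and> k \<le> m then f (m - k) else 0)"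
    by (rule sum.inter_filter) simp
  finally show ?thesis .
qed

text \<open>
The integral over the tower is split by \<open>sum_split_at_return\<close>. The orbits that stay in their column are
bounded by tail sums of the return time, and the others are treated by \<open>return_correlation_decay\<close>. The product
\<open>a b / phibar\<close> is the product of the two integrals up to the normalisation of the measure on the tower.
\<close>

theorem correlation_decay:
  assumes v: "v \<in> BX" and w: "w \<in> Linf mu_X"
  shows "summable (\<lambda>n. wt (q - 1) n * \<bar>correlation v w n\<bar>)"
proof -
  obtain Q where Q: "0 \<le> Q" "\<And>y l. y \<in> D \<Longrightarrow> l < \<phi> y \<Longrightarrow> \<bar>v ((T ^^ l) y)\<bar> \<le> Q"
    "\<And>y y' l. y \<in> D \<Longrightarrow> y' \<in> D \<Longrightarrow> index y' = index y \<Longrightarrow> l < \<phi> y \<Longrightarrow> \<bar>v ((T ^^ l) y) - v ((T ^^ l) y')\<bar> \<le> Q * dtheta y y'"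
    using BX_bounds[OF v] by blast
  obtain C where "w \<in> borel_measurable mu_X" and C: "AE x in mu_X. \<bar>w x\<bar> \<le> C"
    using w by (auto simp: Linf_def)
  then have wX [measurable]: "w \<in> borel_measurable X" by (simp cong: measurable_cong_sets)
  have vX [measurable]: "v \<in> borel_measurable X" using v by (simp add: BX_def)
  define v' where "v' x = (if \<bar>v x\<bar> \<le> Q then v x else 0)" for x
  define w' where "w' x = (if \<bar>w x\<bar> \<le> C then w x else 0)" for x
  have v'X [measurable]: "v' \<in> borel_measurable X" unfolding v'_def by measurable
  have w'X [measurable]: "w' \<in> borel_measurable X" unfolding w'_def by measurable
  have v'b: "\<bar>v' x\<bar> \<le> Q" for x using Q(1) by (simp add: v'_def)
  have w'b: "\<bar>w' x\<bar> \<le> \<bar>C\<bar>" for x by (simp add: w'_def)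
  have v'v: "v' ((T ^^ l) y) = v ((T ^^ l) y)" if "y \<in> D" "l < \<phi> y" for y l using Q(2)[OF that] by (simp add: v'_def)
  have A: "{x \<in> space X. \<not> \<bar>v x\<bar> \<le> Q} \<in> sets X" by measurable
  have "AE y in M. \<forall>l<\<phi> y. (T ^^ l) y \<notin> {x \<in> space X. \<not> \<bar>v x\<bar> \<le> Q}"
    using AE_D by eventually_elim (use Q(2) in blast)
  then have "AE x in mu_X. x \<notin> {x \<in> space X. \<not> \<bar>v x\<bar> \<le> Q}" using AE_mu_X[OF A] by blast
  then have aev: "AE x in mu_X. v x = v' x"
    using AE_space by eventually_elim (auto simp: space_mu_X v'_def)
  have aew: "AE x in mu_X. w x = w' x" using C by eventually_elim (simp add: w'_def)
  have corr: "correlation v w n = correlation v' w' n" for n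
    by (rule correlation_cong[OF vX v'X aev wX w'X aew])

  define W where "W n y = complex_of_real (w' ((T ^^ n) y))" for n y
  define V where "V k y = (if y \<in> D \<and> 1 \<le> k \<and> k \<le> \<phi> y then complex_of_real (v' ((T ^^ (\<phi> y - k)) y)) else 0)" for k y
  have Wm [measurable]: "W n \<in> borel_measurable M" for n
    unfolding W_def using w'X by (intro complex_of_real_measurable comp_T_measurable)
  have Wb: "cmod (W n y) \<le> \<bar>C\<bar>" for n y using w'b by (simp add: W_def)
  have Vb: "cmod (V k y) \<le> Q" for k y using v'b Q(1) by (simp add: V_def)
  have T_return: "(T ^^ (j + \<phi> y)) y = (T ^^ j) (F y)" for j y by (simp add: funpow_add F_def)
  have W_rec: "W n y = W (n - return (index y)) (F y)" if "y \<in> D" "return (index y) \<le> n" for n y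
    using that T_return[of "n - \<phi> y" y] by (simp add: W_def phi_return)
  have V_off: "V k y = 0" if "y \<notin> D" for k y using that by (simp add: V_def)
  have V_off': "V k y = 0" if "y \<in> D" "return (index y) < k" for k y using that by (simp add: V_def phi_return)
  have V_lip: "cmod (V k y - V k y') \<le> Q * dist_D y y'" if y: "y \<in> D" "y' \<in> D" "index y' = index y" for k y y'
  proof -
    have ph: "\<phi> y' = \<phi> y" using phi_return[OF y(1)] phi_return[OF y(2)] y(3) by simp
    show ?thesis
    proof (cases "1 \<le> k \<and> k \<le> \<phi> y")
      case True
      then have l: "\<phi> y - k < \<phi> y" by simp
      have "V k y - V k y' = of_real (v' ((T ^^ (\<phi> y - k)) y) - v' ((T ^^ (\<phi> y - k)) y'))"
        using True y by (simp add: V_def ph)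
      then have "cmod (V k y - V k y') = \<bar>v ((T ^^ (\<phi> y - k)) y) - v ((T ^^ (\<phi> y - k)) y')\<bar>"
        using v'v[OF y(1) l] v'v[OF y(2), of "\<phi> y - k"] l by (simp only: ph norm_of_real)
      also have "\<dots> \<le> Q * dist_D y y'" using Q(3)[OF y l] y by (simp add: dist_D_def)
      finally show ?thesis .
    next
      case False
      then have "V k y = 0" "V k y' = 0" using ph by (auto simp: V_def)
      then show ?thesis using Q(1) gm.d_nonneg[of y y'] by simp
    qed
  qed
  have Vm [measurable]: "V k \<in> borel_measurable M" for k
    by (rule gm.lipschitz_measurable[where K = Q]) (use V_off V_lip in auto)

  define a where "a = (\<Sum>i. \<integral>y. indicator {x \<in> D. i < return (index x)} y * W i y \<partial>M)"
  define b where "b = (\<Sum>k. \<integral>y. V k y \<partial>M)"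
  define Mn where "Mn n = (\<Sum>k\<le>n. \<integral>y. V k y * W (n - k) (F y) \<partial>M)" for n
  have decay: "summable (\<lambda>n. wt (q - 1) n * cmod (Mn n - a * b / of_real height))"
    unfolding a_def b_def Mn_def phibar_eq[symmetric]
    by (rule gmr.return_correlation_decay[where Wb = "\<bar>C\<bar>" and Vb = Q])
      (use Wm Wb W_rec V_off V_off' Vb V_lip in auto)

  have a: "a = of_real (height * (\<integral>x. w' x \<partial>mu_X))"
    unfolding a_def
  proof (rule level_tower[OF _ _ _ w'X w'b])
    show "(\<lambda>y. indicator {x \<in> D. i < return (index x)} y * W i y) \<in> borel_measurable M" for i
      using level_sets[of 0 i] by (intro borel_measurable_times borel_measurable_indicator Wm) simp
    show "cmod (indicator {x \<in> D. i < return (index x)} y * W i y) \<le> \<bar>C\<bar> * indicator {x \<in> D. 0 + i < return (index x)} y" for i y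
      using Wb by (simp add: indicator_def)
    show "(\<Sum>i<\<phi> y. indicator {x \<in> D. i < return (index x)} y * W i y) = of_real (\<Sum>l<\<phi> y. w' ((T ^^ l) y))" if "y \<in> D" for y
      using that by (simp add: W_def phi_return indicator_def)
  qed simp
  have b: "b = of_real (height * (\<integral>x. v' x \<partial>mu_X))"
  proof -
    have "V 0 = (\<lambda>y. 0)" by (rule ext) (simp add: V_def)
    then have "b = (\<Sum>k. \<integral>y. V (Suc k) y \<partial>M)"
      unfolding b_def by (intro suminf_Suc_eq[symmetric]) simp
    also have "\<dots> = of_real (height * (\<integral>x. v' x \<partial>mu_X))"
    proof (rule level_tower[OF Vm _ Q(1) v'X v'b])
      show "cmod (V (Suc i) y) \<le> Q * indicator {x \<in> D. 0 + i < return (index x)} y" for i y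
        using Vb[of "Suc i" y] by (cases "y \<in> D") (auto simp: V_def phi_return indicator_def)
      show "(\<Sum>i<\<phi> y. V (Suc i) y) = of_real (\<Sum>l<\<phi> y. v' ((T ^^ l) y))" if "y \<in> D" for y
      proof -
        have "(\<Sum>i<\<phi> y. V (Suc i) y) = (\<Sum>i<\<phi> y. complex_of_real (v' ((T ^^ (\<phi> y - Suc i)) y)))"
          using that by (intro sum.cong) (auto simp: V_def)
        also have "\<dots> = (\<Sum>l<\<phi> y. complex_of_real (v' ((T ^^ l) y)))" by (rule sum.nat_diff_reindex)
        finally show ?thesis by simp
      qed
    qed
    finally show ?thesis .
  qed

  define u where "u n x = v' x * w' ((T ^^ n) x)" for n x
  have uX: "u n \<in> borel_measurable X" for n
    unfolding u_def by (intro borel_measurable_times v'X measurable_compose[OF funpow_T_X w'X])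
  have ub: "\<bar>u n x\<bar> \<le> Q * \<bar>C\<bar>" for n x
    unfolding u_def abs_mult by (intro mult_mono v'b w'b Q(1)) auto
  define h where "h n i y = indicator {x \<in> D. n + i < return (index x)} y * complex_of_real (u n ((T ^^ i) y))" for n i y
  have hm: "h n i \<in> borel_measurable M" for n i
    unfolding h_def using level_sets uX
    by (intro borel_measurable_times borel_measurable_indicator complex_of_real_measurable comp_T_measurable)
  have hb: "cmod (h n i y) \<le> (Q * \<bar>C\<bar>) * indicator {x \<in> D. n + i < return (index x)} y" for n i y
    using ub[of n] by (simp add: h_def indicator_def)
  have QC: "0 \<le> Q * \<bar>C\<bar>" using Q(1) by simp
  note L = gmr.level_sum[of "h n" "Q * \<bar>C\<bar>" n for n, OF hm hb QC]
  define col where "col n = (\<integral>y. (\<Sum>i<return (index y). h n i y) \<partial>M)" for n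

  have split: "complex_of_real (\<Sum>l<\<phi> y. u n ((T ^^ l) y))
      = (\<Sum>i<return (index y). h n i y) + (\<Sum>k\<le>n. V k y * W (n - k) (F y))" if y: "y \<in> D" for n y
  proof -
    have "complex_of_real (\<Sum>l<\<phi> y. u n ((T ^^ l) y)) = (\<Sum>l<\<phi> y. complex_of_real (u n ((T ^^ l) y)))" by simp
    also have "\<dots> = (\<Sum>l<\<phi> y. if n + l < \<phi> y then complex_of_real (u n ((T ^^ l) y)) else 0)
        + (\<Sum>k\<le>n. if 1 \<le> k \<and> k \<le> \<phi> y then complex_of_real (u n ((T ^^ (\<phi> y - k)) y)) else 0)"
      by (rule sum_split_at_return)
    also have "(\<Sum>l<\<phi> y. if n + l < \<phi> y then complex_of_real (u n ((T ^^ l) y)) else 0) = (\<Sum>i<return (index y). h n i y)"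
      using y by (intro sum.cong) (auto simp: h_def phi_return)
    also have "(\<Sum>k\<le>n. if 1 \<le> k \<and> k \<le> \<phi> y then complex_of_real (u n ((T ^^ (\<phi> y - k)) y)) else 0) = (\<Sum>k\<le>n. V k y * W (n - k) (F y))"
    proof (intro sum.cong refl)
      fix k assume k: "k \<in> {..n}"
      show "(if 1 \<le> k \<and> k \<le> \<phi> y then complex_of_real (u n ((T ^^ (\<phi> y - k)) y)) else 0) = V k y * W (n - k) (F y)"
      proof (cases "1 \<le> k \<and> k \<le> \<phi> y")
        case True
        then have e: "n + (\<phi> y - k) = (n - k) + \<phi> y" using k by simp
        have "(T ^^ n) ((T ^^ (\<phi> y - k)) y) = (T ^^ (n + (\<phi> y - k))) y"
          by (simp only: funpow_add comp_apply)
        also have "\<dots> = (T ^^ (n - k)) (F y)" unfolding e by (rule T_return)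
        finally show ?thesis using True y by (simp add: u_def V_def W_def)
      next
        case False
        then have "V k y = 0" unfolding V_def by (intro if_not_P) blast
        then show ?thesis using False by (simp only: if_False mult_zero_left)
      qed
    qed
    finally show ?thesis .
  qed
  have VWint: "integrable M (\<lambda>y. V k y * W j (F y))" for k j
  proof (rule integrable_const_bound[where B = "Q * \<bar>C\<bar>"])
    show "AE y in M. cmod (V k y * W j (F y)) \<le> Q * \<bar>C\<bar>"
      unfolding norm_mult by (intro AE_I2 mult_mono Vb Wb Q(1)) auto
    show "(\<lambda>y. V k y * W j (F y)) \<in> borel_measurable M" by measurable
  qed
  have key: "complex_of_real (height * correlation v' w' n) = col n + (Mn n - a * b / of_real height)" for n
  proof -
    have "complex_of_real (\<integral>y. (\<Sum>l<\<phi> y. u n ((T ^^ l) y)) \<partial>M) = (\<integral>y. complex_of_real (\<Sum>l<\<phi> y. u n ((T ^^ l) y)) \<partial>M)"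
      by (rule integral_complex_of_real[symmetric])
    also have "\<dots> = (\<integral>y. (\<Sum>i<return (index y). h n i y) + (\<Sum>k\<le>n. V k y * W (n - k) (F y)) \<partial>M)"
    proof (rule integral_cong_AE)
      show "AE y in M. complex_of_real (\<Sum>l<\<phi> y. u n ((T ^^ l) y)) = (\<Sum>i<return (index y). h n i y) + (\<Sum>k\<le>n. V k y * W (n - k) (F y))"
        using AE_D by eventually_elim (rule split)
      show "(\<lambda>y. complex_of_real (\<Sum>l<\<phi> y. u n ((T ^^ l) y))) \<in> borel_measurable M"
        using borel_measurable_integrable[OF tower_integral(1)[OF uX ub]] by (rule complex_of_real_measurable)
      show "(\<lambda>y. (\<Sum>i<return (index y). h n i y) + (\<Sum>k\<le>n. V k y * W (n - k) (F y))) \<in> borel_measurable M"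
        using borel_measurable_integrable[OF L(1)] borel_measurable_integrable[OF VWint]
        by (intro borel_measurable_add borel_measurable_sum)
    qed
    also have "\<dots> = col n + (\<integral>y. (\<Sum>k\<le>n. V k y * W (n - k) (F y)) \<partial>M)"
      unfolding col_def by (intro Bochner_Integration.integral_add L(1) Bochner_Integration.integrable_sum VWint)
    also have "(\<integral>y. (\<Sum>k\<le>n. V k y * W (n - k) (F y)) \<partial>M) = Mn n"
      unfolding Mn_def by (intro Bochner_Integration.integral_sum VWint)
    also have "(\<integral>y. (\<Sum>l<\<phi> y. u n ((T ^^ l) y)) \<partial>M) = height * (\<integral>x. u n x \<partial>mu_X)"
      using tower_integral(2)[OF uX[of n] ub] height_ge_1 by simp
    finally have "complex_of_real (height * (\<integral>x. u n x \<partial>mu_X)) = col n + Mn n" .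
    moreover have "a * b / of_real height = of_real (height * ((\<integral>x. v' x \<partial>mu_X) * (\<integral>x. w' x \<partial>mu_X)))"
      using height_ge_1 by (simp add: a b)
    moreover have "correlation v' w' n = (\<integral>x. u n x \<partial>mu_X) - (\<integral>x. v' x \<partial>mu_X) * (\<integral>x. w' x \<partial>mu_X)"
      by (simp add: correlation_def u_def)
    ultimately show ?thesis by (simp add: right_diff_distrib)
  qed
  have bound: "\<bar>correlation v w n\<bar> \<le> Q * \<bar>C\<bar> * (\<Sum>i. gmr.tl (n + i)) + cmod (Mn n - a * b / of_real height)" for n
  proof -
    have "\<bar>correlation v w n\<bar> \<le> height * \<bar>correlation v' w' n\<bar>"
      using mult_right_mono[OF height_ge_1 abs_ge_zero[of "correlation v' w' n"]] by (simp add: corr)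
    also have "\<dots> = cmod (complex_of_real (height * correlation v' w' n))"
      using height_ge_1 by (simp only: norm_of_real abs_mult)
    also have "\<dots> \<le> cmod (col n) + cmod (Mn n - a * b / of_real height)"
      unfolding key by (rule norm_triangle_ineq)
    also have "cmod (col n) \<le> Q * \<bar>C\<bar> * (\<Sum>i. gmr.tl (n + i))" unfolding col_def by (rule L(3))
    finally show ?thesis by simp
  qed
  have "summable (\<lambda>n. Q * \<bar>C\<bar> * (wt (q - 1) n * (\<Sum>i. gmr.tl (n + i))) + wt (q - 1) n * cmod (Mn n - a * b / of_real height))"
    by (intro summable_add summable_mult gmr.tail_sums_summable decay)
  then show ?thesis
  proof (rule summable_comparison_test')
    show "norm (wt (q - 1) n * \<bar>correlation v w n\<bar>)
        \<le> Q * \<bar>C\<bar> * (wt (q - 1) n * (\<Sum>i. gmr.tl (n + i))) + wt (q - 1) n * cmod (Mn n - a * b / of_real height)" for n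
      using mult_left_mono[OF bound[of n] wt_nonneg[of "q - 1" n]] by (simp add: abs_mult algebra_simps)
  qed
qed

end

theorem corollary1p3:
  fixes X M :: "'x measure" and T :: "'x \<Rightarrow> 'x" and \<phi> :: "'x \<Rightarrow> nat"
    and \<alpha> :: "'x set set" and \<theta> q :: real and v w :: "'x \<Rightarrow> real"
  assumes "young_tower X T M \<phi> \<alpha> \<theta>"
    and "0 < q"
    and "integrable M (\<lambda>y. real (\<phi> y) powr (q + 1))"
    and "v \<in> tower_data.BX X T M \<phi> \<alpha> \<theta>"
    and "w \<in> Linf (tower_data.mu_X X T M \<phi>)"
  shows "summable (\<lambda>n. real (Suc n) powr (q - 1)
    * \<bar>tower_data.correlation X T M \<phi> v w (Suc n)\<bar>)"
proof -
  interpret young_tower X T M \<phi> \<alpha> \<theta> by fact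
  from gibbs_markov obtain N where N: "N \<in> null_sets M" "markov N" and bd: "bounded_distortion N"
    unfolding gibbs_markov_def by blast
  from bd obtain g C\<^sub>0 where g: "g \<in> borel_measurable M" "\<forall>y\<in>space M. 0 < g y"
    "density (mu_F N) (\<lambda>y. ennreal (g y)) = M"
    "\<forall>a\<in>\<alpha>. \<forall>y\<in>a \<inter> core. \<forall>y'\<in>a \<inter> core. \<bar>ln (g y) - ln (g y')\<bar> \<le> C\<^sub>0 * dtheta (F y) (F y')"
    unfolding bounded_distortion_def by (elim exE conjE) (rule that)
  interpret young_tower_moment X T M \<phi> \<alpha> \<theta> N g C\<^sub>0 q
    by unfold_locales (use N g assms(2,3) in auto)
  have "summable (\<lambda>n. wt (q - 1) (Suc n) * \<bar>correlation v w (Suc n)\<bar>)"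
    using correlation_decay[OF assms(4,5)] by (rule summable_Suc_iff[THEN iffD2])
  then have "summable (\<lambda>n. 2 powr \<bar>q - 1\<bar> * (wt (q - 1) (Suc n) * \<bar>correlation v w (Suc n)\<bar>))"
    by (rule summable_mult)
  then show ?thesis
  proof (rule summable_comparison_test')
    show "norm (real (Suc n) powr (q - 1) * \<bar>correlation v w (Suc n)\<bar>)
        \<le> 2 powr \<bar>q - 1\<bar> * (wt (q - 1) (Suc n) * \<bar>correlation v w (Suc n)\<bar>)" for n
      using mult_right_mono[OF wt_le_Suc[of "q - 1" n] abs_ge_zero[of "correlation v w (Suc n)"]]
      by (simp add: wt_def abs_mult mult.assoc)
  qed
qed

end
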